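(* There exist absolute constants $C_4,C_5>0$ (independent of $n$ and of $\Omega$) such that for every singular integral operator $T$ as described in the context, every $\lambda>0$ and every $f\in L^1(\mathbb{R}^n)$, \[ |\{|Tf|>\lambda\}|\le\left(C_4+C_5\|\Omega\|_{L^1(S^{n-1},\sigma)}\right)\frac{1}{\lambda}\|f\|_{L^1(\mathbb{R}^n)}+2\sup_{\nu}|\{|T\nu|>\lambda\}|, \] where the supremum is taken over measures $\nu=\sum_{k=1}^N a_k\delta_{c_k}$ with $N\in\mathbb{N}$, $c_k\in\mathbb{R}^n$, $a_k\in\mathbb{R}^+$ and $\sum_{k=1}^N a_k\le16\|f\|_{L^1(\mathbb{R}^n)}$.
   Context: $K:\mathbb{R}^n\setminus\{0\}\to\mathbb{C}$ is $K(x)=\Omega(x)/|x|^n$ where (1) $\Omega(\delta x)=\Omega(x)=\Omega(x/|x|)$ for $x\ne0$, $\delta>0$; (2) $\int_{S^{n-1}}\Omega\,d\sigma=0$, $\sigma$ being surface measure on $S^{n-1}$; (3) there is an absolute constant $C>0$ with $\int_{S^{n-1}}|\Omega(\theta-\xi\delta)-\Omega(\theta)|\,d\sigma(\theta)\le Cn\delta\int_{S^{n-1}}|\Omega|\,d\sigma$ for all $\xi\in S^{n-1}$, $0<\delta<1/n$. The operator is $Tf(x)=\mathrm{p.v.}\int K(x-y)f(y)\,dy=\lim_{\varepsilon\to0}\int_{|x-y|\ge\varepsilon}K(x-y)f(y)\,dy$ for $f\in C_c^\infty(\mathbb{R}^n)$, extended to $L^1$ functions, and $T\nu(x)=\mathrm{p.v.}\int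 K(x-y)\,d\nu(y)$ for finite measures $\nu$. $\|\Omega\|_{L^1(S^{n-1},\sigma)}=\int_{S^{n-1}}|\Omega|\,d\sigma$; $|\cdot|$ is Lebesgue measure; $\delta_c$ is the Dirac mass at $c$. *)

theory Defs
  imports "HOL-Analysis.Analysis"
begin

text \<open>Euclidean space R^n with the dimension n as an explicit natural-number
parameter (the constants of the theorem must be independent of n, so n has to
be quantified inside the formula). Points of R^n are the extensional functions
on the index set {..<n}; Lebesgue measure on R^n is the product of n copies of
Lebesgue measure on the line.\<close>

definition Rn :: "nat \<Rightarrow> (nat \<Rightarrow> real) measure" where
  "Rn n = (\<Pi>\<^sub>M i\<in>{..<n}. lborel)"

definition vnorm :: "nat \<Rightarrow> (nat \<Rightarrow> real) \<Rightarrow> real" where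
  "vnorm n x = sqrt (\<Sum>i<n. (x i)\<^sup>2)"

definition vsub :: "nat \<Rightarrow> (nat \<Rightarrow> real) \<Rightarrow> (nat \<Rightarrow> real) \<Rightarrow> (nat \<Rightarrow> real)" where
  "vsub n x y = (\<lambda>i\<in>{..<n}. x i - y i)"

definition vscale :: "nat \<Rightarrow> real \<Rightarrow> (nat \<Rightarrow> real) \<Rightarrow> (nat \<Rightarrow> real)" where
  "vscale n c x = (\<lambda>i\<in>{..<n}. c * x i)"

definition vnormalize :: "nat \<Rightarrow> (nat \<Rightarrow> real) \<Rightarrow> (nat \<Rightarrow> real)" where
  "vnormalize n x = vscale n (1 / vnorm n x) x"

definition unit_sphere :: "nat \<Rightarrow> (nat \<Rightarrow> real) set" where
  "unit_sphere n = {x \<in> space (Rn n). vnorm n x = 1}"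

text \<open>Surface measure on S^{n-1}, via the polar-coordinates (cone) formula
sigma(A) = n * |{x : 0 < |x| \<le> 1, x/|x| \<in> A}|. It is a measure on R^n
concentrated on the unit sphere.\<close>

definition sphere_measure :: "nat \<Rightarrow> (nat \<Rightarrow> real) measure" where
  "sphere_measure n =
     density (distr (restrict_space (Rn n) {x \<in> space (Rn n). 0 < vnorm n x \<and> vnorm n x \<le> 1})
                    (Rn n) (vnormalize n))
             (\<lambda>_. ennreal (real n))"

text \<open>Outer Lebesgue measure on R^n (so that |{|Tf| > lambda}| makes sense even
without a measurability proof; it agrees with Lebesgue measure on measurable sets).\<close>

definition outer_leb :: "nat \<Rightarrow> (nat \<Rightarrow> real) set \<Rightarrow> ennreal" where
  "outer_leb n A = (INF B \<in> {B \<in> sets (Rn n). A \<subseteq> B}. emeasure (Rn n) B)"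

definition kernel :: "nat \<Rightarrow> ((nat \<Rightarrow> real) \<Rightarrow> complex) \<Rightarrow> (nat \<Rightarrow> real) \<Rightarrow> complex" where
  "kernel n \<Omega> x = \<Omega> x / complex_of_real (vnorm n x ^ n)"

definition admissible_Omega :: "real \<Rightarrow> nat \<Rightarrow> ((nat \<Rightarrow> real) \<Rightarrow> complex) \<Rightarrow> bool" where
  "admissible_Omega C n \<Omega> \<longleftrightarrow>
     (\<forall>x\<in>space (Rn n). vnorm n x \<noteq> 0 \<longrightarrow>
        (\<forall>\<delta>>0. \<Omega> (vscale n \<delta> x) = \<Omega> x) \<and> \<Omega> x = \<Omega> (vnormalize n x)) \<and>
     integrable (sphere_measure n) \<Omega> \<and>
     (\<integral>\<theta>. \<Omega> \<theta> \<partial>sphere_measure n) = 0 \<and>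
     (\<forall>\<xi>\<in>unit_sphere n. \<forall>\<delta>. 0 < \<delta> \<and> \<delta> < 1 / real n \<longrightarrow>
        (\<integral>\<^sup>+ \<theta>. ennreal (cmod (\<Omega> (vsub n \<theta> (vscale n \<delta> \<xi>)) - \<Omega> \<theta>)) \<partial>sphere_measure n)
          \<le> ennreal (C * real n * \<delta> * (\<integral>\<theta>. cmod (\<Omega> \<theta>) \<partial>sphere_measure n)))"

definition sio :: "nat \<Rightarrow> ((nat \<Rightarrow> real) \<Rightarrow> complex) \<Rightarrow> ((nat \<Rightarrow> real) \<Rightarrow> complex)
                    \<Rightarrow> (nat \<Rightarrow> real) \<Rightarrow> complex" where
  "sio n \<Omega> f x = Lim (at_right 0)
     (\<lambda>\<epsilon>. \<integral>y. indicator {y. vnorm n (vsub n x y) \<ge> \<epsilon>} y *\<^sub>R (kernel n \<Omega> (vsub n x y) * f y) \<partial>Rn n)"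

text \<open>T nu for nu = sum_k a_k delta_{c_k}, given as a list of pairs (a_k, c_k),
again as a principal value.\<close>

definition sio_dirac :: "nat \<Rightarrow> ((nat \<Rightarrow> real) \<Rightarrow> complex) \<Rightarrow> (real \<times> (nat \<Rightarrow> real)) list
                          \<Rightarrow> (nat \<Rightarrow> real) \<Rightarrow> complex" where
  "sio_dirac n \<Omega> \<nu> x = Lim (at_right 0)
     (\<lambda>\<epsilon>. \<Sum>(a, c)\<leftarrow>\<nu>. (if vnorm n (vsub n x c) \<ge> \<epsilon> then complex_of_real a * kernel n \<Omega> (vsub n x c) else 0))"

end

theory Submission
  imports Defs "HOL-Probability.Probability"
begin

text \<open>Truncate the kernel where it is large: \<open>KM M = K\<close> if \<open>\<bar>K\<bar> \<le> M\<close> and \<open>0\<close> otherwise. For a density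
  \<open>f \<ge> 0\<close>, sums of equal point masses at independent random points distributed according to \<open>f\<close> satisfy
  \<open>T \<nu> x \<approx> (KM M * f) x\<close> with a probability that Chebyshev's inequality controls, because
  \<open>\<integral> min(M, \<bar>K\<bar>\<^sup>2 / M) \<le> 2 \<parallel>\<Omega>\<parallel>\<^sub>1\<close> uniformly in \<open>n\<close> and \<open>M\<close>. By Fubini the assumed bound for point masses
  becomes a weak type bound for \<open>KM M * f\<close>. As \<open>M \<rightarrow> \<infinity>\<close> these convolutions differ from the principal value
  by \<open>f x\<close> times constants \<open>bM M\<close>, which are estimated by testing the same bound on the unit ball. This settles
  functions that are locally constant almost everywhere, which are dense in \<open>L\<^sup>1\<close>. The passage to general \<open>f\<close>
  needs the almost everywhere existence of the principal value, which follows from a maximal inequality proved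
  by the Calderon--Zygmund decomposition and Cotlar's comparison. Finally, the homogeneity of \<open>K\<close> makes the
  supremum at a single level and mass control all levels and masses; the factors \<open>2\<close> and \<open>16\<close> leave
  \<open>32 \<sigma>\<close> of room for the weak type constant \<open>\<sigma>\<close> of point masses, of which \<open>30 \<sigma>\<close> is used.\<close>

subsection \<open>Euclidean structure and invariance of Lebesgue measure\<close>

text \<open>Truncating by size rather than by distance is what makes sampling work: with masses s/M,
  a sample at which |K| > M and a fluctuation of the centred sum beyond M are the two ways to fail,
  and both cost a convolution with the same function min(M, |K|^2/M). The price is twofold. This
  function concentrates at the origin as M grows without losing mass, so the failure probability at
  x retains a multiple of f(x) times the norm of \<Omega>; points where f is large must be removed
  by Chebyshev's inequality, and this is where the norm of \<Omega> enters. Moreover {|K| \<le> M}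
  is not rotation invariant, so the mean zero of \<Omega> no longer cancels the singularity; the
  defect \<open>bM M\<close> is not controlled by the L^1 norm of \<Omega> and has to be bounded
  through the point-mass hypothesis itself. The constants remain free of the dimension because the
  maximal inequality, whose constant depends on n, is applied only to the difference of f and an
  approximation, and the norm of that difference is chosen after the constant.\<close>

lemma space_Rn: "space (Rn n) = extensional {..<n}"
  by (simp add: Rn_def space_PiM PiE_UNIV_domain PiE_def)

lemma sets_Rn: "sets (Rn n) = sets (\<Pi>\<^sub>M i\<in>{..<n}. borel)"
  unfolding Rn_def by (rule sets_PiM_cong) auto

lemma measurable_component_Rn [measurable]:
  "i < n \<Longrightarrow> (\<lambda>x. x i) \<in> borel_measurable (Rn n)"
  unfolding Rn_def by measurable

lemma measurable_into_Rn:
  assumes "\<And>i. i < n \<Longrightarrow> (\<lambda>w. f w i) \<in> borel_measurable M"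
    and "\<And>w. w \<in> space M \<Longrightarrow> f w \<in> extensional {..<n}"
  shows "f \<in> measurable M (Rn n)"
  unfolding Rn_def by (rule measurable_PiM_single') (use assms in \<open>auto simp: space_PiM PiE_def\<close>)

lemma measurable_Rn_component' [measurable (raw)]:
  assumes "f \<in> measurable M (Rn n)" "i < n"
  shows "(\<lambda>w. f w i) \<in> borel_measurable M"
  using measurable_compose[OF assms(1) measurable_component_Rn[OF assms(2)]] .

lemma vnorm_measurable [measurable (raw)]:
  assumes [measurable]: "f \<in> measurable M (Rn n)"
  shows "(\<lambda>w. vnorm n (f w)) \<in> borel_measurable M"
  unfolding vnorm_def by measurable

lemma vsub_measurable [measurable (raw)]:
  assumes [measurable]: "f \<in> measurable M (Rn n)" "g \<in> measurable M (Rn n)"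
  shows "(\<lambda>w. vsub n (f w) (g w)) \<in> measurable M (Rn n)"
  by (rule measurable_into_Rn) (auto simp: vsub_def)

lemma vscale_measurable [measurable (raw)]:
  assumes [measurable]: "c \<in> borel_measurable M" "f \<in> measurable M (Rn n)"
  shows "(\<lambda>w. vscale n (c w) (f w)) \<in> measurable M (Rn n)"
  by (rule measurable_into_Rn) (auto simp: vscale_def)

lemma vnormalize_measurable [measurable (raw)]:
  assumes [measurable]: "f \<in> measurable M (Rn n)"
  shows "(\<lambda>w. vnormalize n (f w)) \<in> measurable M (Rn n)"
  unfolding vnormalize_def by measurable

lemma vsub_space [simp]: "vsub n x y \<in> space (Rn n)"
  by (simp add: vsub_def space_Rn)

lemma vscale_space [simp]: "vscale n c x \<in> space (Rn n)"
  by (simp add: vscale_def space_Rn)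

lemma vnorm_L2_set: "vnorm n x = L2_set x {..<n}"
  by (simp add: vnorm_def L2_set_def)

lemma vnorm_nonneg [simp]: "0 \<le> vnorm n x"
  by (simp add: vnorm_L2_set)

lemma vnorm_vscale: "vnorm n (vscale n c x) = \<bar>c\<bar> * vnorm n x"
proof -
  have "(\<Sum>i<n. (vscale n c x i)\<^sup>2) = c\<^sup>2 * (\<Sum>i<n. (x i)\<^sup>2)"
    by (simp add: vscale_def power_mult_distrib sum_distrib_left)
  then show ?thesis by (simp add: vnorm_def real_sqrt_mult)
qed

lemma vnorm_vsub_commute: "vnorm n (vsub n x y) = vnorm n (vsub n y x)"
  by (simp add: vnorm_def vsub_def power2_commute)

lemma vnorm_vsub_triangle:
  "vnorm n (vsub n x z) \<le> vnorm n (vsub n x y) + vnorm n (vsub n y z)"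
proof -
  have "vnorm n (vsub n x z) = L2_set (\<lambda>i. vsub n x y i + vsub n y z i) {..<n}"
    unfolding vnorm_L2_set by (rule L2_set_cong) (auto simp: vsub_def)
  also have "\<dots> \<le> vnorm n (vsub n x y) + vnorm n (vsub n y z)"
    unfolding vnorm_L2_set by (rule L2_set_triangle_ineq)
  finally show ?thesis .
qed

lemma vnorm_vsub_le: "vnorm n (vsub n x y) \<le> vnorm n x + vnorm n y"
proof -
  have "vnorm n (vsub n x y) = L2_set (\<lambda>i. x i + (- y i)) {..<n}"
    unfolding vnorm_L2_set by (rule L2_set_cong) (auto simp: vsub_def)
  also have "\<dots> \<le> L2_set x {..<n} + L2_set (\<lambda>i. - y i) {..<n}"
    by (rule L2_set_triangle_ineq)
  also have "L2_set (\<lambda>i. - y i) {..<n} = vnorm n y"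
    by (simp add: L2_set_def vnorm_def)
  finally show ?thesis by (simp add: vnorm_L2_set)
qed

lemma vnorm_le_vsub: "vnorm n x \<le> vnorm n (vsub n x y) + vnorm n y"
proof -
  have "vnorm n x = L2_set (\<lambda>i. vsub n x y i + y i) {..<n}"
    unfolding vnorm_L2_set by (rule L2_set_cong) (auto simp: vsub_def)
  also have "\<dots> \<le> vnorm n (vsub n x y) + vnorm n y"
    unfolding vnorm_L2_set by (rule L2_set_triangle_ineq)
  finally show ?thesis .
qed

lemma vsub_vsub: "w \<in> space (Rn n) \<Longrightarrow> vsub n x (vsub n x w) = w"
  by (auto simp: vsub_def space_Rn extensional_def)

lemma component_le_vnorm: "i < n \<Longrightarrow> \<bar>x i\<bar> \<le> vnorm n x"
  using member_le_L2_set[of "{..<n}" i "\<lambda>i. \<bar>x i\<bar>"] by (simp add: vnorm_def L2_set_def)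

lemma vnorm_le_sum: "vnorm n x \<le> (\<Sum>i<n. \<bar>x i\<bar>)"
  unfolding vnorm_L2_set by (rule L2_set_le_sum_abs)

lemma vnorm_eq_0_iff: "x \<in> space (Rn n) \<Longrightarrow> vnorm n x = 0 \<longleftrightarrow> x = (\<lambda>i\<in>{..<n}. 0)"
  by (auto simp: vnorm_def sum_nonneg_eq_0_iff space_Rn extensional_def)

section \<open>Boxes, balls and affine changes of variables\<close>

lemma PiE_sets_Rn: "(\<And>i. i < n \<Longrightarrow> A i \<in> sets borel) \<Longrightarrow> Pi\<^sub>E {..<n} A \<in> sets (Rn n)"
  unfolding Rn_def by (rule sets_PiM_I_finite) auto

lemma emeasure_Rn_PiE:
  "(\<And>i. i < n \<Longrightarrow> A i \<in> sets borel) \<Longrightarrow> emeasure (Rn n) (Pi\<^sub>E {..<n} A) = (\<Prod>i<n. emeasure lborel (A i))"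
proof -
  interpret product_sigma_finite "\<lambda>_::nat. lborel :: real measure" by standard
  show "(\<And>i. i < n \<Longrightarrow> A i \<in> sets borel) \<Longrightarrow> ?thesis"
    unfolding Rn_def by (rule emeasure_PiM) auto
qed

lemma sigma_finite_Rn: "sigma_finite_measure (Rn n)"
proof -
  interpret product_sigma_finite "\<lambda>_::nat. lborel :: real measure" by standard
  interpret finite_product_sigma_finite "\<lambda>_::nat. lborel :: real measure" "{..<n}" by standard auto
  show ?thesis unfolding Rn_def by (rule sigma_finite_measure_axioms)
qed

text \<open>Boxes determine the product measure, and on a box the claim is the one-dimensional
  affine formula in each coordinate, the Jacobian being a product of n factors |c|. The cases c =
  -1, c = 1 and c > 0 yield the reflections, translations and dilations used throughout.\<close>

lemma Rn_affine:
  assumes "c \<noteq> 0"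
  shows "Rn n = density (distr (Rn n) (Rn n) (\<lambda>x. \<lambda>i\<in>{..<n}. t i + c * x i)) (\<lambda>_. ennreal (\<bar>c\<bar> ^ n))"
    (is "_ = density (distr _ _ ?T) _")
proof -
  interpret product_sigma_finite "\<lambda>_::nat. lborel :: real measure" by standard
  have T: "?T \<in> measurable (Rn n) (Rn n)"
    by (rule measurable_into_Rn) auto
  have "density (distr (Rn n) (Rn n) ?T) (\<lambda>_. ennreal (\<bar>c\<bar> ^ n)) = PiM {..<n} (\<lambda>_. lborel)"
  proof (rule PiM_eqI)
    show "finite {..<n}" by simp
    show "sets (density (distr (Rn n) (Rn n) ?T) (\<lambda>_. ennreal (\<bar>c\<bar> ^ n))) = sets (Pi\<^sub>M {..<n} (\<lambda>_. lborel))"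
      by (simp add: Rn_def)
    fix A :: "nat \<Rightarrow> real set" assume "\<And>i. i \<in> {..<n} \<Longrightarrow> A i \<in> sets lborel"
    then have A: "\<And>i. i < n \<Longrightarrow> A i \<in> sets borel" by auto
    have pre: "?T -` Pi\<^sub>E {..<n} A \<inter> space (Rn n) = Pi\<^sub>E {..<n} (\<lambda>i. (\<lambda>y. t i + c * y) -` A i)"
      by (auto simp: space_Rn PiE_def Pi_def)
    have m: "(\<lambda>y. t i + c * y) -` A i \<in> sets borel" if "i < n" for i
    proof -
      have "(\<lambda>y. t i + c * y) \<in> borel_measurable borel" by measurable
      from measurable_sets[OF this A[OF that]] show ?thesis by simp
    qed
    have 1: "emeasure lborel (A i) = ennreal \<bar>c\<bar> * emeasure lborel ((\<lambda>y. t i + c * y) -` A i)" if "i < n" for i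
    proof -
      have "emeasure lborel (A i) = emeasure (density (distr lborel borel (\<lambda>x. t i + c * x)) (\<lambda>_. ennreal (abs c))) (A i)"
        using lborel_real_affine[OF assms, of "t i"] by simp
      also have "\<dots> = ennreal \<bar>c\<bar> * emeasure lborel ((\<lambda>y. t i + c * y) -` A i)"
        using A[OF that] by (simp add: emeasure_density_const emeasure_distr)
      finally show ?thesis .
    qed
    have "emeasure (density (distr (Rn n) (Rn n) ?T) (\<lambda>_. ennreal (\<bar>c\<bar> ^ n))) (Pi\<^sub>E {..<n} A)
        = ennreal (\<bar>c\<bar> ^ n) * emeasure (Rn n) (?T -` Pi\<^sub>E {..<n} A \<inter> space (Rn n))"
      using PiE_sets_Rn[OF A] T by (simp add: emeasure_density_const emeasure_distr)
    also have "\<dots> = (\<Prod>i<n. ennreal \<bar>c\<bar>) * (\<Prod>i<n. emeasure lborel ((\<lambda>y. t i + c * y) -` A i))"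
      unfolding pre by (subst emeasure_Rn_PiE) (use m in \<open>auto simp: prod_ennreal[symmetric] ennreal_power\<close>)
    also have "\<dots> = (\<Prod>i<n. emeasure lborel (A i))"
      unfolding prod.distrib[symmetric] by (rule prod.cong) (use 1 in auto)
    finally show "emeasure (density (distr (Rn n) (Rn n) ?T) (\<lambda>_. ennreal (\<bar>c\<bar> ^ n))) (Pi\<^sub>E {..<n} A)
        = (\<Prod>i\<in>{..<n}. emeasure lborel (A i))" .
  qed
  then show ?thesis by (simp add: Rn_def)
qed

lemma nn_integral_Rn_affine:
  assumes "c \<noteq> 0" and [measurable]: "F \<in> borel_measurable (Rn n)"
  shows "(\<integral>\<^sup>+x. F x \<partial>Rn n) = ennreal (\<bar>c\<bar> ^ n) * (\<integral>\<^sup>+x. F (\<lambda>i\<in>{..<n}. t i + c * x i) \<partial>Rn n)"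
proof -
  have T: "(\<lambda>x. \<lambda>i\<in>{..<n}. t i + c * x i) \<in> measurable (Rn n) (Rn n)"
    by (rule measurable_into_Rn) auto
  show ?thesis
    by (subst Rn_affine[OF assms(1), of n t]) (simp add: nn_integral_density nn_integral_distr nn_integral_cmult T)
qed

lemma distr_vsub_left: "distr (Rn n) (Rn n) (vsub n x) = Rn n"
proof -
  have "vsub n x = (\<lambda>y. \<lambda>i\<in>{..<n}. x i + (-1) * y i)" by (auto simp: vsub_def)
  then show ?thesis using Rn_affine[of "-1" n x] by (simp add: density_1)
qed

lemma distr_vsub_right: "distr (Rn n) (Rn n) (\<lambda>y. vsub n y x) = Rn n"
proof -
  have "(\<lambda>y. vsub n y x) = (\<lambda>y. \<lambda>i\<in>{..<n}. - x i + 1 * y i)" by (auto simp: vsub_def)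
  then show ?thesis using Rn_affine[of 1 n "\<lambda>i. - x i"] by (simp add: density_1)
qed

lemma vsub_left_measurable [measurable]:
  "vsub n x \<in> measurable (Rn n) (Rn n)" "(\<lambda>y. vsub n y x) \<in> measurable (Rn n) (Rn n)"
  by (rule measurable_into_Rn; auto simp: vsub_def)+

lemma nn_integral_vsub_left:
  "F \<in> borel_measurable (Rn n) \<Longrightarrow> (\<integral>\<^sup>+y. F (vsub n x y) \<partial>Rn n) = (\<integral>\<^sup>+y. F y \<partial>Rn n)"
  by (subst (2) distr_vsub_left[of n x, symmetric]) (simp add: nn_integral_distr)

lemma nn_integral_vsub_right:
  "F \<in> borel_measurable (Rn n) \<Longrightarrow> (\<integral>\<^sup>+y. F (vsub n y x) \<partial>Rn n) = (\<integral>\<^sup>+y. F y \<partial>Rn n)"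
  by (subst (2) distr_vsub_right[of n x, symmetric]) (simp add: nn_integral_distr)

lemma integral_vsub_left:
  fixes F :: "(nat \<Rightarrow> real) \<Rightarrow> 'b::{banach, second_countable_topology}"
  shows "F \<in> borel_measurable (Rn n) \<Longrightarrow> (\<integral>y. F (vsub n x y) \<partial>Rn n) = (\<integral>y. F y \<partial>Rn n)"
  by (subst (2) distr_vsub_left[of n x, symmetric]) (simp add: integral_distr)

lemma integrable_vsub_left_iff:
  fixes F :: "(nat \<Rightarrow> real) \<Rightarrow> 'b::{banach, second_countable_topology}"
  shows "F \<in> borel_measurable (Rn n) \<Longrightarrow> integrable (Rn n) (\<lambda>y. F (vsub n x y)) \<longleftrightarrow> integrable (Rn n) F"
  by (subst (2) distr_vsub_left[of n x, symmetric]) (simp add: integrable_distr_eq)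

lemma emeasure_Rn_dilate:
  assumes "c > 0" "A \<in> sets (Rn n)"
  shows "emeasure (Rn n) A = ennreal (c ^ n) * emeasure (Rn n) {x \<in> space (Rn n). vscale n c x \<in> A}"
proof -
  have m: "(\<lambda>x. vscale n c x) \<in> measurable (Rn n) (Rn n)" by measurable
  have "emeasure (Rn n) A = (\<integral>\<^sup>+x. indicator A x \<partial>Rn n)" using assms by simp
  also have "\<dots> = ennreal (c ^ n) * (\<integral>\<^sup>+x. indicator A (vscale n c x) \<partial>Rn n)"
    using assms nn_integral_Rn_affine[of c "indicator A" n "\<lambda>_. 0"] by (simp add: vscale_def)
  also have "(\<integral>\<^sup>+x. indicator A (vscale n c x) \<partial>Rn n) = (\<integral>\<^sup>+x. indicator {x \<in> space (Rn n). vscale n c x \<in> A} x \<partial>Rn n)"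
    by (rule nn_integral_cong) (auto simp: indicator_def)
  also have "\<dots> = emeasure (Rn n) {x \<in> space (Rn n). vscale n c x \<in> A}"
  proof -
    have "(\<lambda>x. vscale n c x) -` A \<inter> space (Rn n) \<in> sets (Rn n)" by (rule measurable_sets[OF m assms(2)])
    also have "(\<lambda>x. vscale n c x) -` A \<inter> space (Rn n) = {x \<in> space (Rn n). vscale n c x \<in> A}" by auto
    finally show ?thesis by simp
  qed
  finally show ?thesis .
qed

lemma emeasure_Rn_cube:
  assumes "r \<ge> 0"
  shows "emeasure (Rn n) (Pi\<^sub>E {..<n} (\<lambda>i. {c i..<c i + r})) = ennreal (r ^ n)"
    "emeasure (Rn n) (Pi\<^sub>E {..<n} (\<lambda>i. {c i - r..c i + r})) = ennreal ((2 * r) ^ n)"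
proof -
  show "emeasure (Rn n) (Pi\<^sub>E {..<n} (\<lambda>i. {c i..<c i + r})) = ennreal (r ^ n)"
    by (subst emeasure_Rn_PiE) (use assms in \<open>auto simp: ennreal_power\<close>)
  have "2 * ennreal r = ennreal (2*r)" by (metis assms ennreal_mult' ennreal_numeral zero_le_numeral)
  then show "emeasure (Rn n) (Pi\<^sub>E {..<n} (\<lambda>i. {c i - r..c i + r})) = ennreal ((2 * r) ^ n)"
    by (subst emeasure_Rn_PiE) (use assms in \<open>auto simp: ennreal_power\<close>)
qed

text \<open>The enclosing cube is precise enough: this bound serves finiteness statements and
  constants that may depend on n.\<close>

lemma emeasure_Rn_ball_le:
  assumes "r \<ge> 0"
  shows "emeasure (Rn n) {y \<in> space (Rn n). vnorm n (vsub n x y) \<le> r} \<le> ennreal ((2 * r) ^ n)"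
proof -
  have "{y \<in> space (Rn n). vnorm n (vsub n x y) \<le> r} \<subseteq> Pi\<^sub>E {..<n} (\<lambda>i. {x i - r..x i + r})"
  proof
    fix y assume y: "y \<in> {y \<in> space (Rn n). vnorm n (vsub n x y) \<le> r}"
    have "y i \<in> {x i - r..x i + r}" if "i < n" for i
      using component_le_vnorm[OF that, of "vsub n x y"] y that by (simp add: vsub_def abs_le_iff)
    then show "y \<in> Pi\<^sub>E {..<n} (\<lambda>i. {x i - r..x i + r})"
      using y by (auto simp: space_Rn PiE_def Pi_def)
  qed
  then have "emeasure (Rn n) {y \<in> space (Rn n). vnorm n (vsub n x y) \<le> r}
      \<le> emeasure (Rn n) (Pi\<^sub>E {..<n} (\<lambda>i. {x i - r..x i + r}))"
    by (rule emeasure_mono) (auto intro!: PiE_sets_Rn)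
  then show ?thesis using emeasure_Rn_cube(2)[OF assms] by simp
qed

lemma null_sets_singleton_Rn:
  assumes "n \<ge> 1" shows "{x \<in> space (Rn n). vnorm n x = 0} \<in> null_sets (Rn n)"
proof -
  have *: "{x \<in> space (Rn n). vnorm n x = 0} = Pi\<^sub>E {..<n} (\<lambda>i. {0})"
    using vnorm_eq_0_iff[of _ n] by (auto simp: space_Rn PiE_def extensional_def vnorm_def)
  have "emeasure (Rn n) (Pi\<^sub>E {..<n} (\<lambda>i. {0})) = 0"
    by (subst emeasure_Rn_PiE) (use assms in auto)
  moreover have "Pi\<^sub>E {..<n} (\<lambda>i. {0}) \<in> sets (Rn n)" by (rule PiE_sets_Rn) auto
  ultimately show ?thesis unfolding * by (simp only: null_sets_def mem_Collect_eq)
qed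

subsection \<open>Polar coordinates\<close>

text \<open>The measure r^(n-1) dr on the positive half-line. Having it as a measure turns polar
  coordinates into an identity with a product measure, so that Tonelli and Fubini apply
  directly.\<close>

definition radial_measure :: "nat \<Rightarrow> real measure" where
  "radial_measure n = density lborel (\<lambda>r. ennreal (indicator {0<..} r * r ^ (n - 1)))"

lemma sets_sphere_measure [simp, measurable_cong]: "sets (sphere_measure n) = sets (Rn n)"
  by (simp add: sphere_measure_def)

lemma space_sphere_measure [simp]: "space (sphere_measure n) = space (Rn n)"
  by (simp add: sphere_measure_def)

lemma sets_radial_measure [simp, measurable_cong]: "sets (radial_measure n) = sets borel"
  by (simp add: radial_measure_def)

lemma vnorm_vnormalize: "vnorm n x \<noteq> 0 \<Longrightarrow> vnorm n (vnormalize n x) = 1"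
  by (simp add: vnormalize_def vnorm_vscale)

lemma vnormalize_vscale: "c > 0 \<Longrightarrow> vnormalize n (vscale n c x) = vnormalize n x"
  by (auto simp: vnormalize_def vnorm_vscale) (auto simp: vscale_def)

lemma vscale_vnormalize: "x \<in> space (Rn n) \<Longrightarrow> vnorm n x \<noteq> 0 \<Longrightarrow> vscale n (vnorm n x) (vnormalize n x) = x"
  by (auto simp: vnormalize_def vscale_def space_Rn extensional_def)

lemma AE_vnorm_pos: "n \<ge> 1 \<Longrightarrow> AE x in Rn n. vnorm n x > 0"
  using AE_not_in[OF null_sets_singleton_Rn[of n]] by (auto elim!: eventually_mono simp: less_le)

lemma emeasure_sphere_measure:
  assumes "n \<ge> 1" and A[measurable]: "A \<in> sets (Rn n)"
  shows "emeasure (sphere_measure n) A = ennreal n * emeasure (Rn n) {x \<in> space (Rn n). vnorm n x \<le> 1 \<and> vnormalize n x \<in> A}"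
proof -
  let ?S = "{x \<in> space (Rn n). 0 < vnorm n x \<and> vnorm n x \<le> 1}"
  have S: "?S \<in> sets (Rn n)" by measurable
  have m: "vnormalize n \<in> measurable (restrict_space (Rn n) ?S) (Rn n)"
    by (rule measurable_restrict_space1) (rule vnormalize_measurable, simp)
  have "emeasure (sphere_measure n) A = ennreal n * emeasure (restrict_space (Rn n) ?S) (vnormalize n -` A \<inter> space (restrict_space (Rn n) ?S))"
    unfolding sphere_measure_def using A m by (simp add: emeasure_density_const emeasure_distr)
  also have "space (restrict_space (Rn n) ?S) = ?S" by (auto simp: space_restrict_space)
  also have "emeasure (restrict_space (Rn n) ?S) (vnormalize n -` A \<inter> ?S) = emeasure (Rn n) (vnormalize n -` A \<inter> ?S)"
    using S by (intro emeasure_restrict_space) auto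
  also have "\<dots> = emeasure (Rn n) {x \<in> space (Rn n). vnorm n x \<le> 1 \<and> vnormalize n x \<in> A}"
  proof (rule emeasure_eq_AE)
    show "AE x in Rn n. (x \<in> vnormalize n -` A \<inter> ?S) = (x \<in> {x \<in> space (Rn n). vnorm n x \<le> 1 \<and> vnormalize n x \<in> A})"
      using AE_vnorm_pos[OF assms(1)] by (auto elim!: eventually_mono)
    have "vnormalize n -` A \<inter> ?S = {x \<in> space (Rn n). 0 < vnorm n x \<and> vnorm n x \<le> 1 \<and> vnormalize n x \<in> A}" by auto
    also have "\<dots> \<in> sets (Rn n)" by measurable
    finally show "vnormalize n -` A \<inter> ?S \<in> sets (Rn n)" .
  qed measurable
  finally show ?thesis .
qed

text \<open>Dilation by b maps the cone in the unit ball onto the cone in the ball of radius b and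
  leaves directions unchanged, so only the factor b^n appears.\<close>

lemma emeasure_cone:
  assumes "n \<ge> 1" "b > 0" and [measurable]: "A \<in> sets (Rn n)"
  shows "emeasure (Rn n) {x \<in> space (Rn n). vnorm n x \<le> b \<and> vnormalize n x \<in> A} = emeasure (sphere_measure n) A * ennreal (b ^ n / n)"
proof -
  have "emeasure (Rn n) {x \<in> space (Rn n). vnorm n x \<le> b \<and> vnormalize n x \<in> A}
     = ennreal (b ^ n) * emeasure (Rn n) {x \<in> space (Rn n). vscale n b x \<in> {x \<in> space (Rn n). vnorm n x \<le> b \<and> vnormalize n x \<in> A}}"
    by (rule emeasure_Rn_dilate) (use assms in auto)
  also have "{x \<in> space (Rn n). vscale n b x \<in> {x \<in> space (Rn n). vnorm n x \<le> b \<and> vnormalize n x \<in> A}}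
     = {x \<in> space (Rn n). vnorm n x \<le> 1 \<and> vnormalize n x \<in> A}"
    using assms by (auto simp: vnorm_vscale vnormalize_vscale)
  finally have "emeasure (Rn n) {x \<in> space (Rn n). vnorm n x \<le> b \<and> vnormalize n x \<in> A} = ennreal (b ^ n) *
      emeasure (Rn n) {x \<in> space (Rn n). vnorm n x \<le> 1 \<and> vnormalize n x \<in> A}" .
  also have "\<dots> = emeasure (sphere_measure n) A * ennreal (b ^ n / n)"
  proof -
    have "ennreal (b ^ n) = ennreal n * ennreal (b ^ n / n)"
      using assms by (simp add: ennreal_mult[symmetric])
    then show ?thesis unfolding emeasure_sphere_measure[OF assms(1,3)] by (simp add: mult_ac)
  qed
  finally show ?thesis .
qed

lemma finite_measure_sphere: 
  assumes "n \<ge> 1" shows "finite_measure (sphere_measure n)"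
proof
  have "emeasure (Rn n) {x \<in> space (Rn n). vnorm n x \<le> 1 \<and> vnormalize n x \<in> space (Rn n)} 
     \<le> emeasure (Rn n) {y \<in> space (Rn n). vnorm n (vsub n (\<lambda>i. 0) y) \<le> 1}"
    by (rule emeasure_mono) (auto simp: vnorm_def vsub_def)
  also have "\<dots> \<le> ennreal ((2 * 1) ^ n)"
    by (rule emeasure_Rn_ball_le) simp
  finally have "emeasure (Rn n) {x \<in> space (Rn n). vnorm n x \<le> 1 \<and> vnormalize n x \<in> space (Rn n)} < \<infinity>"
    by (rule le_less_trans) simp
  then show "emeasure (sphere_measure n) (space (sphere_measure n)) \<noteq> \<infinity>"
    using emeasure_sphere_measure[OF assms sets.top] by (simp add: ennreal_mult_eq_top_iff)
qed

lemma AE_sphere_measure: 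
  assumes "n \<ge> 1" shows "AE x in sphere_measure n. x \<in> space (Rn n) \<and> vnorm n x = 1"
proof (rule AE_I)
  let ?N = "{x \<in> space (Rn n). vnorm n x \<noteq> 1}"
  show "{x \<in> space (sphere_measure n). \<not> (x \<in> space (Rn n) \<and> vnorm n x = 1)} \<subseteq> ?N" by auto
  show "?N \<in> sets (sphere_measure n)" by simp measurable
  have "{x \<in> space (Rn n). vnorm n x \<le> 1 \<and> vnormalize n x \<in> ?N} = {x \<in> space (Rn n). vnorm n x \<le> 1 \<and> vnormalize n x \<in> ?N \<and> vnorm n x = 0}"
    using vnorm_vnormalize by auto
  also have "\<dots> \<subseteq> {x \<in> space (Rn n). vnorm n x = 0}" by auto
  finally have "emeasure (Rn n) {x \<in> space (Rn n). vnorm n x \<le> 1 \<and> vnormalize n x \<in> ?N} \<le> emeasure (Rn n) {x \<in> space (Rn n). vnorm n x = 0}"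
    by (rule emeasure_mono) measurable
  also have "\<dots> = 0" using null_sets_singleton_Rn[OF assms] by auto
  finally show "emeasure (sphere_measure n) ?N = 0"
    by (subst emeasure_sphere_measure[OF assms]) auto
qed

lemma emeasure_radial_atMost:
  assumes "n \<ge> 1"
  shows "emeasure (radial_measure n) {..b} = ennreal (if b > 0 then b ^ n / n else 0)"
proof (cases "b > 0")
  case True
  have "emeasure (radial_measure n) {..b} = (\<integral>\<^sup>+r. ennreal (indicator {0<..} r * r ^ (n - 1)) * indicator {..b} r \<partial>lborel)"
    unfolding radial_measure_def by (subst emeasure_density) auto
  also have "\<dots> = (\<integral>\<^sup>+r. ennreal (r ^ (n - 1)) * indicator {0..b} r \<partial>lborel)"
    by (rule nn_integral_cong_AE) (use AE_lborel_singleton[of 0] in \<open>auto elim!: eventually_mono simp: indicator_def\<close>)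
  also have "\<dots> = ennreal (b ^ n / n - 0 ^ n / n)"
  proof (rule nn_integral_FTC_Icc)
    show "((\<lambda>r. r ^ n / n) has_real_derivative x ^ (n - 1)) (at x)" for x :: real
      using assms by (auto intro!: derivative_eq_intros)
  qed (use True in auto)
  finally show ?thesis using assms True by (simp add: power_0_left)
next
  case False
  have "emeasure (radial_measure n) {..b} = (\<integral>\<^sup>+r. ennreal (indicator {0<..} r * r ^ (n - 1)) * indicator {..b} r \<partial>lborel)"
    unfolding radial_measure_def by (subst emeasure_density) auto
  also have "\<dots> = integral\<^sup>N (lborel :: real measure) (\<lambda>_. 0)" by (rule nn_integral_cong) (use False in \<open>auto simp: indicator_def\<close>)
  finally show ?thesis using False by simp
qed

lemma sigma_finite_radial: "sigma_finite_measure (radial_measure n)"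
  unfolding radial_measure_def
  by (subst sigma_finite_measure.sigma_finite_iff_density_finite) (auto simp: lborel.sigma_finite_measure_axioms)

text \<open>It suffices to compare both sides on rectangles. With the set A of directions fixed,
  both are measures of the radial set, and the half-lines up to b form an intersection-stable
  generator on which the identity is \<open>emeasure_cone\<close>.\<close>

lemma distr_polar:
  assumes n: "n \<ge> 1"
  shows "sphere_measure n \<Otimes>\<^sub>M radial_measure n
    = distr (Rn n) (sphere_measure n \<Otimes>\<^sub>M radial_measure n) (\<lambda>x. (vnormalize n x, vnorm n x))"
proof (rule pair_measure_eqI)
  interpret S: finite_measure "sphere_measure n" by (rule finite_measure_sphere[OF n])
  show "sigma_finite_measure (sphere_measure n)" by (rule S.sigma_finite_measure_axioms)
  show "sigma_finite_measure (radial_measure n)" by (rule sigma_finite_radial)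
  fix A B assume "A \<in> sets (sphere_measure n)" and "B \<in> sets (radial_measure n)"
  then have A[measurable]: "A \<in> sets (Rn n)" and B[measurable]: "B \<in> sets borel" by auto
  \<comment> \<open>The distribution of the norm on the cone over A.\<close>
  let ?N = "distr (density (Rn n) (indicator {x \<in> space (Rn n). vnormalize n x \<in> A})) borel (vnorm n)"
  have vm: "vnorm n \<in> borel_measurable (Rn n)" by measurable
  have N: "emeasure ?N X = emeasure (Rn n) {x \<in> space (Rn n). vnorm n x \<in> X \<and> vnormalize n x \<in> A}" if [measurable]: "X \<in> sets borel" for X
  proof -
    have m: "{x \<in> space (Rn n). vnormalize n x \<in> A} \<in> sets (Rn n)" by measurable
    have "vnorm n -` X \<inter> space (Rn n) \<in> sets (Rn n)" using vm by measurable
    moreover have "{x \<in> space (Rn n). vnormalize n x \<in> A} \<inter> (vnorm n -` X \<inter> space (Rn n)) = {x \<in> space (Rn n). vnorm n x \<in> X \<and> vnormalize n x \<in> A}"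
      by auto
    ultimately show ?thesis using vm m
      by (subst emeasure_distr) (simp_all add: emeasure_density indicator_inter_arith[symmetric])
  qed
  have "scale_measure (emeasure (sphere_measure n) A) (radial_measure n) = ?N"
  proof (rule measure_eqI_generator_eq[where E = "range atMost" and \<Omega> = UNIV and A = "\<lambda>i::nat. {..real i}"])
    show "Int_stable (range (atMost :: real \<Rightarrow> _))"
      by (auto simp: Int_stable_def)
    show "sets (scale_measure (emeasure (sphere_measure n) A) (radial_measure n)) = sigma_sets UNIV (range (atMost :: real \<Rightarrow> _))"
      "sets ?N = sigma_sets UNIV (range (atMost :: real \<Rightarrow> _))"
      by (simp_all add: borel_eq_atMost)
    show "(\<Union>i. {..real i}) = UNIV" using real_arch_simple by auto
    show "emeasure (scale_measure (emeasure (sphere_measure n) A) (radial_measure n)) {..real i} \<noteq> \<infinity>" for i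
      using S.emeasure_finite[of A] by (simp add: emeasure_radial_atMost[OF n] ennreal_mult_eq_top_iff)
    fix X assume "X \<in> range (atMost :: real \<Rightarrow> _)"
    then obtain b where X: "X = {..b}" by auto
    show "emeasure (scale_measure (emeasure (sphere_measure n) A) (radial_measure n)) X = emeasure ?N X"
    proof (cases "b > 0")
      case True
      then show ?thesis unfolding X by (simp add: N emeasure_radial_atMost[OF n] emeasure_cone[OF n])
    next
      \<comment> \<open>For b \<le> 0 the radial side vanishes, and on the other side only the null
        set of the origin can contribute.\<close>
      case False
      have "emeasure ?N X \<le> emeasure (Rn n) {x \<in> space (Rn n). vnorm n x = 0}"
        unfolding X using False vnorm_nonneg[of n] by (subst N) (auto intro!: emeasure_mono simp: order.trans[OF vnorm_nonneg] intro: antisym order.trans)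
      also have "\<dots> = 0" using null_sets_singleton_Rn[OF n] by auto
      finally show ?thesis unfolding X using False by (simp add: emeasure_radial_atMost[OF n])
    qed
  qed auto
  then have "emeasure (sphere_measure n) A * emeasure (radial_measure n) B = emeasure ?N B"
    by (metis emeasure_scale_measure)
  also have "\<dots> = emeasure (distr (Rn n) (sphere_measure n \<Otimes>\<^sub>M radial_measure n) (\<lambda>x. (vnormalize n x, vnorm n x))) (A \<times> B)"
    by (subst N, simp, subst emeasure_distr) (auto intro!: arg_cong[where f="emeasure (Rn n)"])
  finally show "emeasure (sphere_measure n) A * emeasure (radial_measure n) B
    = emeasure (distr (Rn n) (sphere_measure n \<Otimes>\<^sub>M radial_measure n) (\<lambda>x. (vnormalize n x, vnorm n x))) (A \<times> B)" .
qed simp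

lemma polar_aux:
  assumes n: "n \<ge> 1" and [measurable]: "F \<in> borel_measurable (Rn n)"
  shows "AE x in Rn n. (\<lambda>(\<theta>, r). F (vscale n r \<theta>)) (vnormalize n x, vnorm n x) = F x"
  using AE_vnorm_pos[OF n] AE_space[of "Rn n"] by eventually_elim (simp add: vscale_vnormalize)

lemma nn_integral_polar:
  assumes n: "n \<ge> 1" and F[measurable]: "F \<in> borel_measurable (Rn n)"
  shows "(\<integral>\<^sup>+x. F x \<partial>Rn n) = (\<integral>\<^sup>+\<theta>. \<integral>\<^sup>+r. F (vscale n r \<theta>) \<partial>radial_measure n \<partial>sphere_measure n)"
proof -
  interpret R: sigma_finite_measure "radial_measure n" by (rule sigma_finite_radial)
  have "(\<integral>\<^sup>+x. F x \<partial>Rn n) = (\<integral>\<^sup>+x. (\<lambda>(\<theta>, r). F (vscale n r \<theta>)) (vnormalize n x, vnorm n x) \<partial>Rn n)"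
    by (rule nn_integral_cong_AE) (use polar_aux[OF assms] in \<open>auto elim!: eventually_mono\<close>)
  also have "\<dots> = (\<integral>\<^sup>+z. (\<lambda>(\<theta>, r). F (vscale n r \<theta>)) z \<partial>(sphere_measure n \<Otimes>\<^sub>M radial_measure n))"
    by (subst distr_polar[OF n], subst nn_integral_distr) auto
  also have "\<dots> = (\<integral>\<^sup>+\<theta>. \<integral>\<^sup>+r. F (vscale n r \<theta>) \<partial>radial_measure n \<partial>sphere_measure n)"
    by (subst R.nn_integral_fst[symmetric]) auto
  finally show ?thesis .
qed

lemma nn_integral_radial:
  assumes [measurable]: "F \<in> borel_measurable borel"
  shows "(\<integral>\<^sup>+r. F r \<partial>radial_measure n) = (\<integral>\<^sup>+r. ennreal (r ^ (n - 1)) * F r * indicator {0<..} r \<partial>lborel)"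
  unfolding radial_measure_def
  by (subst nn_integral_density) (auto intro!: nn_integral_cong simp: indicator_def)

lemma integral_radial:
  fixes F :: "real \<Rightarrow> 'b::{banach, second_countable_topology}"
  assumes [measurable]: "F \<in> borel_measurable borel"
  shows "(\<integral>r. F r \<partial>radial_measure n) = (\<integral>r. (indicator {0<..} r * r ^ (n - 1)) *\<^sub>R F r \<partial>lborel)"
  unfolding radial_measure_def by (subst integral_density) (auto simp: indicator_def)

lemma integral_polar:
  fixes F :: "(nat \<Rightarrow> real) \<Rightarrow> 'b::{banach, second_countable_topology}"
  assumes n: "n \<ge> 1" and F: "integrable (Rn n) F"
  shows "(\<integral>x. F x \<partial>Rn n) = (\<integral>\<theta>. \<integral>r. F (vscale n r \<theta>) \<partial>radial_measure n \<partial>sphere_measure n)"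
proof -
  interpret R: sigma_finite_measure "radial_measure n" by (rule sigma_finite_radial)
  interpret S: finite_measure "sphere_measure n" by (rule finite_measure_sphere[OF n])
  interpret pair_sigma_finite "sphere_measure n" "radial_measure n" ..
  have Fm[measurable]: "F \<in> borel_measurable (Rn n)" using F by auto
  have 1: "(\<integral>x. F x \<partial>Rn n) = (\<integral>x. (\<lambda>(\<theta>, r). F (vscale n r \<theta>)) (vnormalize n x, vnorm n x) \<partial>Rn n)"
    by (rule integral_cong_AE) (use polar_aux[OF n Fm] in \<open>auto elim!: eventually_mono\<close>)
  have 2: "\<dots> = (\<integral>z. (\<lambda>(\<theta>, r). F (vscale n r \<theta>)) z \<partial>(sphere_measure n \<Otimes>\<^sub>M radial_measure n))"
    by (subst distr_polar[OF n], subst integral_distr) auto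
  have "integrable (Rn n) (\<lambda>x. (\<lambda>(\<theta>, r). F (vscale n r \<theta>)) (vnormalize n x, vnorm n x))"
    by (rule integrable_cong_AE_imp[OF F]) (use polar_aux[OF n Fm] in \<open>auto elim!: eventually_mono\<close>)
  then have "integrable (distr (Rn n) (sphere_measure n \<Otimes>\<^sub>M radial_measure n) (\<lambda>x. (vnormalize n x, vnorm n x))) (\<lambda>(\<theta>, r). F (vscale n r \<theta>))"
    by (subst integrable_distr_eq) auto
  then have 3: "integrable (sphere_measure n \<Otimes>\<^sub>M radial_measure n) (\<lambda>(\<theta>, r). F (vscale n r \<theta>))"
    by (simp only: distr_polar[OF n, symmetric])
  show ?thesis unfolding 1 2 using integral_fst'[OF 3] by simp
qed

subsection \<open>The kernel\<close>

lemma nn_integral_inverse_square: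
  assumes "e > (0::real)"
  shows "(\<integral>\<^sup>+r. ennreal (1 / r\<^sup>2) * indicator {e..} r \<partial>lborel) = ennreal (1 / e)"
proof -
  have "(\<integral>\<^sup>+r. ennreal (1 / r\<^sup>2) * indicator {e..} r \<partial>lborel) = ennreal (0 - (- 1 / e))"
  proof (rule nn_integral_FTC_atLeast)
    show "((\<lambda>r. - 1 / r) has_real_derivative 1 / x\<^sup>2) (at x)" if "e \<le> x" for x :: real
      using that assms by (auto intro!: derivative_eq_intros simp: power2_eq_square)
    show "((\<lambda>r::real. - 1 / r) \<longlongrightarrow> 0) at_top" by real_asymp
  qed auto
  then show ?thesis by simp
qed

text \<open>The singularities at 0 cancel in the difference of the indicators, which leaves the
  signed integral of 1/r between 1 and a; this form treats a < 1 and a \<ge> 1 alike.\<close>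

lemma integral_log_step:
  assumes "a > (0::real)"
  shows "has_bochner_integral lborel (\<lambda>r. (indicator {0<..<a} r - indicator {0<..<1} r) / r) (ln a)"
proof -
  have *: "has_bochner_integral lborel (\<lambda>r. (1 / r) * indicator {b..c} r) (ln c - ln b)" if "0 < b" "b \<le> c" for b c :: real
  proof (rule has_bochner_integral_FTC_Icc_real)
    show "DERIV ln x :> 1 / x" if "b \<le> x" "x \<le> c" for x
      using that \<open>0 < b\<close> by (auto intro!: derivative_eq_intros simp: field_simps)
    show "isCont (\<lambda>x. 1 / x) x" if "b \<le> x" "x \<le> c" for x
      using that \<open>0 < b\<close> by (auto intro!: continuous_intros)
  qed fact
  show ?thesis
  proof (cases "a \<ge> 1")
    case True
    have "AE r in lborel. (1 / r) * indicator {1..a} r = (indicator {0<..<a} r - indicator {0<..<1} r) / r"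
      using AE_lborel_singleton[of a] by eventually_elim (use True in \<open>auto simp: indicator_def\<close>)
    with *[of 1 a] True show ?thesis
      by (subst has_bochner_integral_cong_AE[symmetric, where f="\<lambda>r. (1 / r) * indicator {1..a} r"]) auto
  next
    case False
    have "AE r in lborel. - ((1 / r) * indicator {a..1} r) = (indicator {0<..<a} r - indicator {0<..<1} r) / r"
      using AE_lborel_singleton[of 1] by eventually_elim (use False assms in \<open>auto simp: indicator_def\<close>)
    moreover have "has_bochner_integral lborel (\<lambda>r. - ((1 / r) * indicator {a..1} r)) (- (ln 1 - ln a))"
      by (rule has_bochner_integral_minus) (rule *, use False assms in auto)
    ultimately show ?thesis
      by (subst has_bochner_integral_cong_AE[symmetric, where f="\<lambda>r. - ((1 / r) * indicator {a..1} r)"]) auto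
  qed
qed

lemma inverse_power_diff_le:
  assumes ab: "0 < a" "0 < b" "b \<le> 2 * a" "a \<le> 2 * b"
  shows "\<bar>1 / a ^ n - 1 / b ^ n\<bar> \<le> real n * 4 ^ n * \<bar>a - b\<bar> / a / a ^ n"
proof -
  \<comment> \<open>\<open>norm_power_diff\<close> asks for arguments of norm at most 1; division by
    2 a achieves this for b and turns a into 1/2.\<close>
  have "norm ((b / (2 * a)) ^ n - (1 / 2) ^ n) \<le> real n * norm (b / (2 * a) - 1 / 2)"
    by (rule norm_power_diff) (use ab in auto)
  also have "b / (2 * a) - 1 / 2 = (b - a) / (2 * a)" using ab by (simp add: field_simps)
  finally have "\<bar>(b / (2 * a)) ^ n - (a / (2 * a)) ^ n\<bar> \<le> real n * \<bar>b - a\<bar> / (2 * a)"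
    using ab by (simp add: abs_divide)
  moreover have "(b / (2 * a)) ^ n - (a / (2 * a)) ^ n = (b ^ n - a ^ n) / (2 * a) ^ n"
    by (simp add: power_divide diff_divide_distrib)
  ultimately have 1: "\<bar>b ^ n - a ^ n\<bar> \<le> real n * \<bar>b - a\<bar> / (2 * a) * (2 * a) ^ n"
    using ab by (simp add: abs_divide abs_mult field_simps power_abs)
  have 2: "1 / b ^ n \<le> 2 ^ n / a ^ n"
    using power_mono[OF ab(4), of n] ab by (simp add: field_simps power_mult_distrib)
  have "1 / a ^ n - 1 / b ^ n = (b ^ n - a ^ n) * (1 / a ^ n * (1 / b ^ n))"
    using ab by (simp add: field_simps)
  then have "\<bar>1 / a ^ n - 1 / b ^ n\<bar> = \<bar>b ^ n - a ^ n\<bar> * (1 / a ^ n * (1 / b ^ n))"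
    using ab by (simp add: abs_mult)
  also have "\<dots> \<le> (real n * \<bar>b - a\<bar> / (2 * a) * (2 * a) ^ n) * (1 / a ^ n * (2 ^ n / a ^ n))"
    by (intro mult_mono 1 2) (use ab in auto)
  also have "\<dots> = (real n * 4 ^ n * \<bar>a - b\<bar> / a / a ^ n) / 2"
  proof -
    have "(4::real) ^ n = 2 ^ n * 2 ^ n" by (simp add: power_mult_distrib[symmetric])
    then show ?thesis using ab by (simp add: power_mult_distrib abs_minus_commute[of b a] mult_ac)
  qed
  also have "\<dots> \<le> real n * 4 ^ n * \<bar>a - b\<bar> / a / a ^ n"
    using ab by (simp add: field_simps)
  finally show ?thesis .
qed

locale singular_kernel =
  fixes n :: nat and \<Omega> :: "(nat \<Rightarrow> real) \<Rightarrow> complex" and C :: real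
  assumes n: "n \<ge> 1" and adm: "admissible_Omega C n \<Omega>" and C: "C > 0"
begin

abbreviation "K \<equiv> kernel n \<Omega>"
definition "W = (\<integral>\<theta>. cmod (\<Omega> \<theta>) \<partial>sphere_measure n)"

sublocale S: finite_measure "sphere_measure n" by (rule finite_measure_sphere[OF n])
sublocale R: sigma_finite_measure "Rn n" by (rule sigma_finite_Rn)
sublocale rad: sigma_finite_measure "radial_measure n" by (rule sigma_finite_radial)

section \<open>Homogeneity and integrability of the kernel\<close>

lemma Omega_integrable: "integrable (sphere_measure n) \<Omega>"
  and Omega_mean_zero: "(\<integral>\<theta>. \<Omega> \<theta> \<partial>sphere_measure n) = 0"
  using adm by (auto simp: admissible_Omega_def)

lemma W_nonneg: "W \<ge> 0" unfolding W_def by simp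

lemma nn_integral_Omega: "(\<integral>\<^sup>+\<theta>. ennreal (cmod (\<Omega> \<theta>)) \<partial>sphere_measure n) = ennreal W"
  unfolding W_def by (rule nn_integral_eq_integral) (use Omega_integrable in auto)

lemma Omega_measurable [measurable]: "\<Omega> \<in> borel_measurable (Rn n)"
  using borel_measurable_integrable[OF Omega_integrable] by (simp cong: measurable_cong_sets)

lemma Omega_measurable' [measurable (raw)]:
  "f \<in> measurable M (Rn n) \<Longrightarrow> (\<lambda>w. \<Omega> (f w)) \<in> borel_measurable M"
  by (rule measurable_compose[OF _ Omega_measurable])

lemma K_measurable [measurable (raw)]:
  assumes [measurable]: "f \<in> measurable M (Rn n)"
  shows "(\<lambda>w. K (f w)) \<in> borel_measurable M"
  unfolding kernel_def by measurable

lemma Omega_vscale: "r > 0 \<Longrightarrow> x \<in> space (Rn n) \<Longrightarrow> vnorm n x \<noteq> 0 \<Longrightarrow> \<Omega> (vscale n r x) = \<Omega> x"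
  using adm by (auto simp: admissible_Omega_def)

text \<open>Division by zero: |x|^n is 0 since n \<ge> 1. A point mass therefore contributes nothing
  at its own location, in agreement with its truncated version for every \<epsilon> > 0.\<close>

lemma K_origin: "vnorm n x = 0 \<Longrightarrow> K x = 0"
  using n by (simp add: kernel_def power_0_left)

lemma K_vscale: "c > 0 \<Longrightarrow> x \<in> space (Rn n) \<Longrightarrow> K (vscale n c x) = K x / of_real (c ^ n)"
  by (cases "vnorm n x = 0") (simp_all add: K_origin vnorm_vscale, simp add: kernel_def vnorm_vscale Omega_vscale power_mult_distrib)

lemma K_polar: "r > 0 \<Longrightarrow> x \<in> space (Rn n) \<Longrightarrow> vnorm n x = 1 \<Longrightarrow> K (vscale n r x) = \<Omega> x / of_real (r ^ n)"
  by (simp add: kernel_def vnorm_vscale Omega_vscale)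

text \<open>In polar coordinates the density r^(n-1) meets the homogeneity r^(-n) of the kernel and
  leaves dr/r, while the angular factor integrates to \<open>W\<close>.\<close>

lemma nn_integral_K_radial:
  assumes [measurable]: "\<phi> \<in> borel_measurable borel"
  shows "(\<integral>\<^sup>+w. ennreal (cmod (K w)) * \<phi> (vnorm n w) \<partial>Rn n)
    = ennreal W * (\<integral>\<^sup>+r. ennreal (1 / r) * \<phi> r * indicator {0<..} r \<partial>lborel)"
proof -
  have "(\<integral>\<^sup>+w. ennreal (cmod (K w)) * \<phi> (vnorm n w) \<partial>Rn n)
    = (\<integral>\<^sup>+\<theta>. \<integral>\<^sup>+r. ennreal (cmod (K (vscale n r \<theta>))) * \<phi> (vnorm n (vscale n r \<theta>)) \<partial>radial_measure n \<partial>sphere_measure n)"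
    by (rule nn_integral_polar[OF n]) measurable
  also have "\<dots> = (\<integral>\<^sup>+\<theta>. ennreal (cmod (\<Omega> \<theta>)) * (\<integral>\<^sup>+r. ennreal (1 / r) * \<phi> r * indicator {0<..} r \<partial>lborel) \<partial>sphere_measure n)"
  proof (rule nn_integral_cong_AE, use AE_sphere_measure[OF n] in eventually_elim)
    fix \<theta> assume \<theta>: "\<theta> \<in> space (Rn n) \<and> vnorm n \<theta> = 1"
    then have [measurable]: "\<theta> \<in> space (Rn n)" by simp
    have "(\<integral>\<^sup>+r. ennreal (cmod (K (vscale n r \<theta>))) * \<phi> (vnorm n (vscale n r \<theta>)) \<partial>radial_measure n)
      = (\<integral>\<^sup>+r. ennreal (r ^ (n - 1)) * (ennreal (cmod (K (vscale n r \<theta>))) * \<phi> (vnorm n (vscale n r \<theta>))) * indicator {0<..} r \<partial>lborel)"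
      by (rule nn_integral_radial) measurable
    also have "\<dots> = (\<integral>\<^sup>+r. ennreal (cmod (\<Omega> \<theta>)) * (ennreal (1 / r) * \<phi> r * indicator {0<..} r) \<partial>lborel)"
    proof (rule nn_integral_cong)
      fix r :: real
      show "ennreal (r ^ (n - 1)) * (ennreal (cmod (K (vscale n r \<theta>))) * \<phi> (vnorm n (vscale n r \<theta>))) * indicator {0<..} r
        = ennreal (cmod (\<Omega> \<theta>)) * (ennreal (1 / r) * \<phi> r * indicator {0<..} r)"
      proof (cases "r > 0")
        case True
        have "ennreal (r ^ (n - 1)) * ennreal (cmod (K (vscale n r \<theta>))) = ennreal (r ^ (n - 1) * (cmod (\<Omega> \<theta>) / r ^ n))"
          using \<theta> True by (subst ennreal_mult) (simp_all add: K_polar norm_divide norm_power)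
        also have "r ^ (n - 1) * (cmod (\<Omega> \<theta>) / r ^ n) = cmod (\<Omega> \<theta>) * (1 / r)"
          using n True by (cases n) auto
        finally have "ennreal (r ^ (n - 1)) * ennreal (cmod (K (vscale n r \<theta>))) = ennreal (cmod (\<Omega> \<theta>)) * ennreal (1 / r)"
          using True by (simp add: ennreal_mult[symmetric])
        then show ?thesis using True \<theta> by (simp add: vnorm_vscale mult.assoc[symmetric])
      qed simp
    qed
    finally show "(\<integral>\<^sup>+r. ennreal (cmod (K (vscale n r \<theta>))) * \<phi> (vnorm n (vscale n r \<theta>)) \<partial>radial_measure n)
      = ennreal (cmod (\<Omega> \<theta>)) * (\<integral>\<^sup>+r. ennreal (1 / r) * \<phi> r * indicator {0<..} r \<partial>lborel)"
      by (simp add: nn_integral_cmult)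
  qed
  also have "\<dots> = ennreal W * (\<integral>\<^sup>+r. ennreal (1 / r) * \<phi> r * indicator {0<..} r \<partial>lborel)"
    by (simp add: nn_integral_multc nn_integral_Omega)
  finally show ?thesis .
qed

text \<open>The radial integral is at most that of the constant 1/a; this avoids the logarithm ln (b
  / a) and keeps later arithmetic rational.\<close>

lemma nn_integral_K_annulus:
  assumes "0 < a" "a \<le> b"
  shows "(\<integral>\<^sup>+w. ennreal (cmod (K w)) * indicator {a..b} (vnorm n w) \<partial>Rn n) \<le> ennreal (W * ((b - a) / a))"
proof -
  have "(\<integral>\<^sup>+w. ennreal (cmod (K w)) * indicator {a..b} (vnorm n w) \<partial>Rn n)
    = ennreal W * (\<integral>\<^sup>+r. ennreal (1 / r) * indicator {a..b} r * indicator {0<..} r \<partial>lborel)"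
    by (rule nn_integral_K_radial) simp
  also have "(\<integral>\<^sup>+r. ennreal (1 / r) * indicator {a..b} r * indicator {0<..} r \<partial>lborel)
      \<le> (\<integral>\<^sup>+r. ennreal (1 / a) * indicator {a..b} r \<partial>lborel)"
    by (rule nn_integral_mono) (use assms in \<open>auto simp: indicator_def frac_le\<close>)
  also have "\<dots> = ennreal ((b - a) / a)"
    using assms by (simp add: nn_integral_cmult ennreal_mult[symmetric])
  finally show ?thesis
    using W_nonneg assms by (subst ennreal_mult) (simp_all add: mult_left_mono)
qed

lemma nn_integral_K_tail:
  assumes "0 < e"
  shows "(\<integral>\<^sup>+w. ennreal (cmod (K w) / vnorm n w) * indicator {e..} (vnorm n w) \<partial>Rn n) = ennreal (W / e)"
proof -
  have "(\<integral>\<^sup>+w. ennreal (cmod (K w) / vnorm n w) * indicator {e..} (vnorm n w) \<partial>Rn n)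
    = (\<integral>\<^sup>+w. ennreal (cmod (K w)) * (ennreal (1 / vnorm n w) * indicator {e..} (vnorm n w)) \<partial>Rn n)"
    by (rule nn_integral_cong) (simp add: ennreal_mult[symmetric] mult.assoc[symmetric])
  also have "\<dots> = ennreal W * (\<integral>\<^sup>+r. ennreal (1 / r) * (ennreal (1 / r) * indicator {e..} r) * indicator {0<..} r \<partial>lborel)"
    by (rule nn_integral_K_radial) simp
  also have "(\<integral>\<^sup>+r. ennreal (1 / r) * (ennreal (1 / r) * indicator {e..} r) * indicator {0<..} r \<partial>lborel)
     = (\<integral>\<^sup>+r. ennreal (1 / r\<^sup>2) * indicator {e..} r \<partial>lborel)"
    by (rule nn_integral_cong) (use assms in \<open>auto simp: indicator_def ennreal_mult[symmetric] power2_eq_square\<close>)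
  also have "\<dots> = ennreal (1 / e)" by (rule nn_integral_inverse_square[OF assms])
  finally show ?thesis using W_nonneg assms by (simp add: ennreal_mult[symmetric])
qed

lemma integrable_K_annulus:
  assumes "0 < a" and [measurable]: "\<psi> \<in> borel_measurable (Rn n)" 
    and \<psi>: "\<And>w. w \<in> space (Rn n) \<Longrightarrow> cmod (\<psi> w) \<le> B * indicator {a..b} (vnorm n w)" and B: "B \<ge> 0"
  shows "integrable (Rn n) (\<lambda>w. K w * \<psi> w)"
proof (rule integrableI_bounded)
  let ?b = "max a b"
  have "(\<integral>\<^sup>+w. ennreal (norm (K w * \<psi> w)) \<partial>Rn n) \<le> (\<integral>\<^sup>+w. ennreal B * (ennreal (cmod (K w)) * indicator {a..?b} (vnorm n w)) \<partial>Rn n)"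
  proof (rule nn_integral_mono)
    fix w assume w: "w \<in> space (Rn n)"
    have "norm (K w * \<psi> w) \<le> cmod (K w) * (B * indicator {a..b} (vnorm n w))"
      using \<psi>[OF w] by (simp add: norm_mult mult_left_mono)
    also have "\<dots> \<le> B * (cmod (K w) * indicator {a..?b} (vnorm n w))"
      using B by (auto simp: indicator_def)
    finally have "ennreal (norm (K w * \<psi> w)) \<le> ennreal (B * (cmod (K w) * indicator {a..?b} (vnorm n w)))"
      by (rule ennreal_leI)
    also have "\<dots> = ennreal B * (ennreal (cmod (K w)) * indicator {a..?b} (vnorm n w))"
      using B by (auto simp: indicator_def ennreal_mult)
    finally show "ennreal (norm (K w * \<psi> w)) \<le> ennreal B * (ennreal (cmod (K w)) * indicator {a..?b} (vnorm n w))" .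
  qed
  also have "\<dots> \<le> ennreal B * ennreal (W * ((?b - a) / a))"
    using nn_integral_K_annulus[OF assms(1), of ?b] by (subst nn_integral_cmult) (auto intro: mult_left_mono)
  also have "\<dots> < \<infinity>" by (simp add: ennreal_mult_less_top)
  finally show "(\<integral>\<^sup>+w. ennreal (norm (K w * \<psi> w)) \<partial>Rn n) < \<infinity>" .
qed measurable

text \<open>Polar coordinates factor the integral into \<Omega>(\<theta>) times the radial integral
  of \<psi>(r \<theta>) dr/r. Once the latter is the same in all directions, the mean zero of
  \<Omega> annihilates the whole.\<close>

lemma integral_K_mult_eq_0:
  fixes \<psi> :: "(nat \<Rightarrow> real) \<Rightarrow> real"
  assumes [measurable]: "\<psi> \<in> borel_measurable (Rn n)" and int: "integrable (Rn n) (\<lambda>w. K w * of_real (\<psi> w))"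
    and c: "\<And>\<theta>. \<theta> \<in> space (Rn n) \<Longrightarrow> vnorm n \<theta> = 1 \<Longrightarrow> (\<integral>r. indicator {0<..} r * \<psi> (vscale n r \<theta>) / r \<partial>lborel) = c"
  shows "(\<integral>w. K w * of_real (\<psi> w) \<partial>Rn n) = 0"
proof -
  have "(\<integral>w. K w * of_real (\<psi> w) \<partial>Rn n)
    = (\<integral>\<theta>. \<integral>r. K (vscale n r \<theta>) * of_real (\<psi> (vscale n r \<theta>)) \<partial>radial_measure n \<partial>sphere_measure n)"
    by (rule integral_polar[OF n int])
  also have "\<dots> = (\<integral>\<theta>. \<Omega> \<theta> * of_real c \<partial>sphere_measure n)"
  proof (rule integral_cong_AE)
    show "AE \<theta> in sphere_measure n. (\<integral>r. K (vscale n r \<theta>) * of_real (\<psi> (vscale n r \<theta>)) \<partial>radial_measure n) = \<Omega> \<theta> * of_real c"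
      using AE_sphere_measure[OF n]
    proof eventually_elim
      fix \<theta> assume \<theta>: "\<theta> \<in> space (Rn n) \<and> vnorm n \<theta> = 1"
      then have [measurable]: "\<theta> \<in> space (Rn n)" by simp
      have "(\<integral>r. K (vscale n r \<theta>) * of_real (\<psi> (vscale n r \<theta>)) \<partial>radial_measure n)
         = (\<integral>r. (indicator {0<..} r * r ^ (n - 1)) *\<^sub>R (K (vscale n r \<theta>) * of_real (\<psi> (vscale n r \<theta>))) \<partial>lborel)"
        by (rule integral_radial) measurable
      also have "\<dots> = (\<integral>r. \<Omega> \<theta> * of_real (indicator {0<..} r * \<psi> (vscale n r \<theta>) / r) \<partial>lborel)"
      proof (rule Bochner_Integration.integral_cong[OF refl])
        fix r :: real
        show "(indicator {0<..} r * r ^ (n - 1)) *\<^sub>R (K (vscale n r \<theta>) * of_real (\<psi> (vscale n r \<theta>)))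
          = \<Omega> \<theta> * of_real (indicator {0<..} r * \<psi> (vscale n r \<theta>) / r)"
        proof (cases "r > 0")
          case True
          then have "complex_of_real (r ^ (n - 1)) * (\<Omega> \<theta> / of_real (r ^ n)) = \<Omega> \<theta> / of_real r"
            using n by (cases n) auto
          then have "complex_of_real (r ^ (n - 1)) * (\<Omega> \<theta> / of_real (r ^ n) * of_real (\<psi> (vscale n r \<theta>)))
             = \<Omega> \<theta> / of_real r * of_real (\<psi> (vscale n r \<theta>))"
            by (simp only: mult.assoc[symmetric])
          then show ?thesis using True \<theta> by (simp add: K_polar scaleR_conv_of_real)
        qed simp
      qed
      also have "\<dots> = \<Omega> \<theta> * of_real (\<integral>r. indicator {0<..} r * \<psi> (vscale n r \<theta>) / r \<partial>lborel)"
        by (simp only: integral_mult_right_zero integral_complex_of_real)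
      finally show "(\<integral>r. K (vscale n r \<theta>) * of_real (\<psi> (vscale n r \<theta>)) \<partial>radial_measure n) = \<Omega> \<theta> * of_real c"
        using c \<theta> by simp
    qed
    show "(\<lambda>\<theta>. \<integral>r. K (vscale n r \<theta>) * of_real (\<psi> (vscale n r \<theta>)) \<partial>radial_measure n) \<in> borel_measurable (sphere_measure n)"
      by measurable
  qed measurable
  also have "\<dots> = 0" by (simp only: integral_mult_left_zero Omega_mean_zero mult_zero_left)
  finally show ?thesis .
qed

section \<open>Cancellation on annuli and along chords\<close>

lemma integral_K_annulus:
  assumes "0 < a"
  shows "(\<integral>w. K w * of_real (indicator {a..<b} (vnorm n w)) \<partial>Rn n) = 0"
proof (rule integral_K_mult_eq_0)
  show "integrable (Rn n) (\<lambda>w. K w * of_real (indicator {a..<b} (vnorm n w)))"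
    by (rule integrable_K_annulus[where a=a and b=b and B=1]) (use assms in \<open>auto simp: indicator_def\<close>)
  fix \<theta> :: "nat \<Rightarrow> real" assume "vnorm n \<theta> = 1"
  then show "(\<integral>r. indicator {0<..} r * indicator {a..<b} (vnorm n (vscale n r \<theta>)) / r \<partial>lborel)
     = (\<integral>r. indicator {0<..} r * indicator {a..<b} r / r \<partial>lborel)"
    by (intro Bochner_Integration.integral_cong) (auto simp: vnorm_vscale indicator_def)
qed measurable

text \<open>The condition |r \<theta> - x|^2 < 1 is quadratic in r. As x lies inside the ball, the
  product -(1 - |x|^2) of the roots is negative, so for r > 0 only the positive root
  matters.\<close>

lemma vnorm_vsub_ray:
  assumes "vnorm n \<theta> = 1" "r > 0" "vnorm n x < 1"
  shows "vnorm n (vsub n (vscale n r \<theta>) x) < 1 \<longleftrightarrow> r < (\<Sum>i<n. \<theta> i * x i) + sqrt ((\<Sum>i<n. \<theta> i * x i)\<^sup>2 + (1 - (vnorm n x)\<^sup>2))"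
proof -
  define p where "p = (\<Sum>i<n. \<theta> i * x i)"
  define q where "q = 1 - (vnorm n x)\<^sup>2"
  have q: "q > 0" using assms(3) abs_square_less_1[of "vnorm n x"] by (simp add: q_def)
  have "(vnorm n (vsub n (vscale n r \<theta>) x))\<^sup>2 = (\<Sum>i<n. (r * \<theta> i - x i)\<^sup>2)"
    by (simp add: vnorm_def vsub_def vscale_def sum_nonneg)
  also have "\<dots> = (\<Sum>i<n. r\<^sup>2 * (\<theta> i)\<^sup>2 - 2 * r * (\<theta> i * x i) + (x i)\<^sup>2)"
    by (rule sum.cong) (auto simp: power2_eq_square algebra_simps)
  also have "\<dots> = r\<^sup>2 * (\<Sum>i<n. (\<theta> i)\<^sup>2) - 2 * r * p + (\<Sum>i<n. (x i)\<^sup>2)"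
    by (simp add: sum.distrib sum_subtractf sum_distrib_left p_def)
  also have "(\<Sum>i<n. (\<theta> i)\<^sup>2) = 1"
    using assms(1) by (simp add: vnorm_def)
  also have "(\<Sum>i<n. (x i)\<^sup>2) = 1 - q" by (simp add: q_def vnorm_def sum_nonneg)
  finally have *: "(vnorm n (vsub n (vscale n r \<theta>) x))\<^sup>2 = (r - p)\<^sup>2 - (p\<^sup>2 + q) + 1"
    by (simp add: power2_eq_square algebra_simps)
  have "vnorm n (vsub n (vscale n r \<theta>) x) < 1 \<longleftrightarrow> (vnorm n (vsub n (vscale n r \<theta>) x))\<^sup>2 < 1"
    using abs_square_less_1[of "vnorm n (vsub n (vscale n r \<theta>) x)"] by simp
  also have "\<dots> \<longleftrightarrow> \<bar>r - p\<bar> < sqrt (p\<^sup>2 + q)"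
    unfolding * using real_less_rsqrt real_sqrt_less_mono[of "(r-p)\<^sup>2" "p\<^sup>2 + q"] by (auto simp: real_less_rsqrt power2_abs) (metis power2_abs real_less_lsqrt real_sqrt_less_iff real_sqrt_abs)
  also have "\<dots> \<longleftrightarrow> r < p + sqrt (p\<^sup>2 + q)"
  proof -
    have "\<bar>p\<bar> < sqrt (p\<^sup>2 + q)" using q by (intro real_less_rsqrt) (simp add: power2_abs)
    then show ?thesis using assms(2) by auto
  qed
  finally show ?thesis by (simp add: p_def q_def)
qed

text \<open>The two chords of the unit ball through an interior point in the directions
  \<open>\<theta>\<close> and \<open>-\<theta>\<close> have lengths whose product is independent of \<open>\<theta>\<close> (power of the point).\<close>

lemma integral_K_chords:
  assumes x: "vnorm n x < 1"
  defines "\<psi> \<equiv> \<lambda>w. indicator {..<1::real} (vnorm n (vsub n w x)) + indicator {..<1} (vnorm n (vsub n w (vscale n (-1) x)))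
     - 2 * indicator {..<1} (vnorm n w) :: real"
  shows "integrable (Rn n) (\<lambda>w. K w * of_real (\<psi> w))" "(\<integral>w. K w * of_real (\<psi> w) \<partial>Rn n) = 0"
proof -
  have [measurable]: "\<psi> \<in> borel_measurable (Rn n)" unfolding \<psi>_def by measurable
  \<comment> \<open>Close to the origin all three balls contain w and the weights 1 + 1 - 2 cancel;
    far away all three indicators vanish. Hence \<psi> lives on an annulus away from the
    singularity.\<close>
  have supp: "\<bar>\<psi> w\<bar> \<le> 2 * indicator {1 - vnorm n x..1 + vnorm n x} (vnorm n w)" for w
  proof -
    have "vnorm n (vsub n w x) \<le> vnorm n w + vnorm n x" by (rule vnorm_vsub_le)
    moreover have "vnorm n (vsub n w (vscale n (-1) x)) \<le> vnorm n w + vnorm n x"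
      using vnorm_vsub_le[of n w "vscale n (-1) x"] by (simp add: vnorm_vscale)
    moreover have "vnorm n w \<le> vnorm n (vsub n w x) + vnorm n x" by (rule vnorm_le_vsub)
    moreover have "vnorm n w \<le> vnorm n (vsub n w (vscale n (-1) x)) + vnorm n x"
      using vnorm_le_vsub[of n w "vscale n (-1) x"] by (simp add: vnorm_vscale)
    ultimately show ?thesis using vnorm_nonneg[of n x] by (auto simp: \<psi>_def indicator_def)
  qed
  show int: "integrable (Rn n) (\<lambda>w. K w * of_real (\<psi> w))"
    by (rule integrable_K_annulus[where a="1 - vnorm n x" and b="1 + vnorm n x" and B=2]) (use x supp in auto)
  show "(\<integral>w. K w * of_real (\<psi> w) \<partial>Rn n) = 0"
  proof (rule integral_K_mult_eq_0[OF _ int])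
    fix \<theta> :: "nat \<Rightarrow> real" assume \<theta>: "vnorm n \<theta> = 1"
    define p where "p = (\<Sum>i<n. \<theta> i * x i)"
    define q where "q = 1 - (vnorm n x)\<^sup>2"
    have q: "q > 0" using x abs_square_less_1[of "vnorm n x"] by (simp add: q_def)
    have s: "\<bar>p\<bar> < sqrt (p\<^sup>2 + q)" using q by (intro real_less_rsqrt) (simp add: power2_abs)
    let ?a = "p + sqrt (p\<^sup>2 + q)" and ?b = "- p + sqrt (p\<^sup>2 + q)"
    have ab: "?a > 0" "?b > 0" using s by auto
    have "?a * ?b = (sqrt (p\<^sup>2 + q))\<^sup>2 - p\<^sup>2" by (simp add: algebra_simps power2_eq_square)
    also have "\<dots> = q" using q by simp
    finally have prod: "?a * ?b = q" .
    have sum_neg: "(\<Sum>i<n. \<theta> i * vscale n (-1) x i) = - p"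
      by (simp add: p_def vscale_def sum_negf)
    have "indicator {0<..} r * \<psi> (vscale n r \<theta>) / r
      = (indicator {0<..<?a} r - indicator {0<..<1} r) / r + (indicator {0<..<?b} r - indicator {0<..<1} r) / r" for r :: real
    proof (cases "r > 0")
      case True
      have 1: "vnorm n (vsub n (vscale n r \<theta>) x) < 1 \<longleftrightarrow> r < ?a"
        using vnorm_vsub_ray[OF \<theta> True x] by (simp add: p_def q_def)
      have 2: "vnorm n (vsub n (vscale n r \<theta>) (vscale n (-1) x)) < 1 \<longleftrightarrow> r < ?b"
        using vnorm_vsub_ray[OF \<theta> True, of "vscale n (-1) x"] x unfolding sum_neg by (simp add: vnorm_vscale q_def)
      show ?thesis unfolding \<psi>_def using True \<theta> 1 2 by (auto simp: indicator_def vnorm_vscale field_simps)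
    qed simp
    then have "(\<integral>r. indicator {0<..} r * \<psi> (vscale n r \<theta>) / r \<partial>lborel)
      = (\<integral>r. (indicator {0<..<?a} r - indicator {0<..<1} r) / r + (indicator {0<..<?b} r - indicator {0<..<1} r) / r \<partial>lborel)"
      by (intro Bochner_Integration.integral_cong) auto
    also have "\<dots> = ln ?a + ln ?b"
      by (rule has_bochner_integral_integral_eq) (intro has_bochner_integral_add integral_log_step ab)
    also have "\<dots> = ln (?a * ?b)" using ab by (rule ln_mult_pos[symmetric])
    also have "\<dots> = ln q" by (rule arg_cong[OF prod])
    finally show "(\<integral>r. indicator {0<..} r * \<psi> (vscale n r \<theta>) / r \<partial>lborel) = ln (1 - (vnorm n x)\<^sup>2)"
      by (simp add: q_def)
  qed measurable
qed

text \<open>Dominates, at the scale \<open>M\<close>, both the probability of drawing a point where \<open>\<bar>K\<bar> > M\<close> and the variance of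
  the truncated kernel.\<close>

definition vM :: "real \<Rightarrow> (nat \<Rightarrow> real) \<Rightarrow> real" where
  "vM M w = (if cmod (K w) > M then M else (cmod (K w))\<^sup>2 / M)"

lemma vM_measurable [measurable (raw)]:
  assumes [measurable]: "f \<in> measurable N (Rn n)"
  shows "(\<lambda>w. vM M (f w)) \<in> borel_measurable N"
  unfolding vM_def by measurable

lemma vM_nonneg: "M > 0 \<Longrightarrow> vM M w \<ge> 0"
  by (simp add: vM_def)

text \<open>Provides the dominating function for limits in M away from the singularity.\<close>

lemma vM_le: "M > 0 \<Longrightarrow> vM M w \<le> cmod (K w)"
  by (auto simp: vM_def power2_eq_square field_simps intro: mult_right_mono)

text \<open>With \<open>u = r\<^sup>n M / \<bar>\<Omega>\<bar>\<close> one has \<open>min 1 (1/u\<^sup>2) \<le> 4/(1+u)\<^sup>2\<close>, which has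
  an elementary antiderivative.\<close>

lemma nn_integral_vM:
  assumes M: "M > 0"
  shows "(\<integral>\<^sup>+w. ennreal (vM M w) \<partial>Rn n) \<le> ennreal (4 * W)"
proof -
  have "(\<integral>\<^sup>+w. ennreal (vM M w) \<partial>Rn n)
    = (\<integral>\<^sup>+\<theta>. \<integral>\<^sup>+r. ennreal (vM M (vscale n r \<theta>)) \<partial>radial_measure n \<partial>sphere_measure n)"
    by (rule nn_integral_polar[OF n]) measurable
  also have "\<dots> \<le> (\<integral>\<^sup>+\<theta>. ennreal 4 * ennreal (cmod (\<Omega> \<theta>)) \<partial>sphere_measure n)"
  proof (rule nn_integral_mono_AE, use AE_sphere_measure[OF n] in eventually_elim)
    fix \<theta> assume \<theta>: "\<theta> \<in> space (Rn n) \<and> vnorm n \<theta> = 1"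
    then have [measurable]: "\<theta> \<in> space (Rn n)" by simp
    define A where "A = cmod (\<Omega> \<theta>)"
    have A0: "A \<ge> 0" by (simp add: A_def)
    have Kr: "cmod (K (vscale n r \<theta>)) = A / r ^ n" if "r > 0" for r
      using \<theta> that by (simp add: K_polar norm_divide norm_power A_def)
    have 1: "(\<integral>\<^sup>+r. ennreal (vM M (vscale n r \<theta>)) \<partial>radial_measure n)
      = (\<integral>\<^sup>+r. ennreal (r ^ (n - 1)) * ennreal (vM M (vscale n r \<theta>)) * indicator {0<..} r \<partial>lborel)"
      by (rule nn_integral_radial) measurable
    show "(\<integral>\<^sup>+r. ennreal (vM M (vscale n r \<theta>)) \<partial>radial_measure n) \<le> ennreal 4 * ennreal (cmod (\<Omega> \<theta>))"
    proof (cases "A = 0")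
      case True
      have "(\<integral>\<^sup>+r. ennreal (r ^ (n - 1)) * ennreal (vM M (vscale n r \<theta>)) * indicator {0<..} r \<partial>lborel) 
          = integral\<^sup>N (lborel :: real measure) (\<lambda>_. 0)"
        by (rule nn_integral_cong) (use Kr True M in \<open>auto simp: indicator_def vM_def\<close>)
      then show ?thesis unfolding 1 by simp
    next
      case False
      with A0 have A: "A > 0" by simp
      \<comment> \<open>The antiderivative of the majorant; it tends to 0 at infinity and its value
        at 0 is -4 A / n.\<close>
      define F where "F r = - (4 * A / n) / (1 + r ^ n * M / A)" for r
      have pos: "1 + r ^ n * M / A > 0" if "r \<ge> 0" for r
        using that A M by (intro add_pos_nonneg) auto
      have "(\<integral>\<^sup>+r. ennreal (r ^ (n - 1)) * ennreal (vM M (vscale n r \<theta>)) * indicator {0<..} r \<partial>lborel)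
         \<le> (\<integral>\<^sup>+r. ennreal (r ^ (n - 1) * (4 * M / (1 + r ^ n * M / A)\<^sup>2)) * indicator {0..} r \<partial>lborel)"
      proof (rule nn_integral_mono)
        fix r :: real
        show "ennreal (r ^ (n - 1)) * ennreal (vM M (vscale n r \<theta>)) * indicator {0<..} r
          \<le> ennreal (r ^ (n - 1) * (4 * M / (1 + r ^ n * M / A)\<^sup>2)) * indicator {0..} r"
        proof (cases "r > 0")
          case True
          define u where "u = r ^ n * M / A"
          have u: "u > 0" using True A M by (simp add: u_def)
          have "vM M (vscale n r \<theta>) \<le> 4 * M / (1 + u)\<^sup>2"
          proof (cases "A / r ^ n > M")
            case t: True
            then have "u < 1" using True A by (simp add: u_def field_simps)
            then have "(1 + u)\<^sup>2 \<le> 2\<^sup>2" using u by (intro power_mono) auto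
            then have "M * (1 + u)\<^sup>2 \<le> M * 2\<^sup>2" using M by (intro mult_left_mono) auto
            then show ?thesis using t Kr[OF True] u by (simp add: vM_def field_simps)
          next
            case f: False
            then have u1: "u \<ge> 1" using True A by (simp add: u_def field_simps)
            then have "(1 + u)\<^sup>2 \<le> (2 * u)\<^sup>2" using u by (intro power_mono) auto
            then have "M * (1 + u)\<^sup>2 \<le> M * (4 * u\<^sup>2)" using M by (intro mult_left_mono) (auto simp: power_mult_distrib)
            then have "M / u\<^sup>2 \<le> 4 * M / (1 + u)\<^sup>2" using u by (simp add: field_simps)
            moreover have "(A / r ^ n)\<^sup>2 / M = M / u\<^sup>2"
              using True A M by (simp add: u_def field_simps power2_eq_square)
            ultimately show ?thesis using f Kr[OF True] by (simp add: vM_def)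
          qed
          then have "r ^ (n - 1) * vM M (vscale n r \<theta>) \<le> r ^ (n - 1) * (4 * M / (1 + u)\<^sup>2)"
            using True by (intro mult_left_mono) auto
          then show ?thesis using True vM_nonneg[OF M]
            by (auto simp: u_def ennreal_mult[symmetric] intro!: ennreal_leI)
        qed simp
      qed
      also have "\<dots> = ennreal (0 - F 0)"
      proof (rule nn_integral_FTC_atLeast)
        show "DERIV F x :> x ^ (n - 1) * (4 * M / (1 + x ^ n * M / A)\<^sup>2)" if "0 \<le> x" for x
        proof -
          have ne: "1 + x ^ n * M / A \<noteq> 0" using pos[OF that] by simp
          have "DERIV F x :> (4 * A / n) * (n * x ^ (n - 1) * M / A) / (1 + x ^ n * M / A)\<^sup>2"
            unfolding F_def by (auto intro!: derivative_eq_intros simp: ne power2_eq_square)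
          moreover have "(4 * A / n) * (n * x ^ (n - 1) * M / A) / (1 + x ^ n * M / A)\<^sup>2 = x ^ (n - 1) * (4 * M / (1 + x ^ n * M / A)\<^sup>2)"
            using A n by simp
          ultimately show ?thesis by simp
        qed
        show "0 \<le> x ^ (n - 1) * (4 * M / (1 + x ^ n * M / A)\<^sup>2)" if "0 \<le> x" for x
          using that M by simp
        have "filterlim (\<lambda>r. 1 + r ^ n * M / A) at_top at_top"
          using n A M by (intro filterlim_tendsto_add_at_top[OF tendsto_const] filterlim_at_top_mult_tendsto_pos[where c="M / A", OF tendsto_const, simplified]
             filterlim_pow_at_top filterlim_ident) auto
        then show "(F \<longlongrightarrow> 0) at_top"
          unfolding F_def by (intro tendsto_divide_0[OF tendsto_const] filterlim_at_top_imp_at_infinity)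
      qed measurable
      also have "0 - F 0 = 4 * A / n" using n by (simp add: F_def power_0_left)
      also have "ennreal (4 * A / n) \<le> ennreal (4 * A)"
        using n A by (intro ennreal_leI) (simp add: field_simps)
      also have "\<dots> = ennreal 4 * ennreal (cmod (\<Omega> \<theta>))" by (simp add: A_def ennreal_mult)
      finally show ?thesis unfolding 1 .
    qed
  qed
  also have "\<dots> = ennreal (4 * W)"
    using W_nonneg by (simp add: nn_integral_cmult nn_integral_Omega ennreal_mult)
  finally show ?thesis .
qed

text \<open>Tonelli lets the sphere be integrated first. At radius r, homogeneity gives \<Omega>(r
  \<theta> - y) = \<Omega>(\<theta> - y/r), and the smoothness hypothesis with \<delta> = |y|/r
  \<le> 1/(2n) yields C n |y| W / r. Together with dr/r, integration from e to infinity leaves C n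
  |y| W / e \<le> C W.\<close>

lemma nn_integral_Omega_diff:
  assumes y: "y \<in> space (Rn n)" and e: "e > 0" "vnorm n y \<le> e / (2 * n)"
  shows "(\<integral>\<^sup>+w. ennreal (cmod (\<Omega> (vsub n w y) - \<Omega> w) / vnorm n w ^ n) * indicator {e..} (vnorm n w) \<partial>Rn n) \<le> ennreal (C * W)"
proof (cases "vnorm n y = 0")
  \<comment> \<open>Here y has no direction, and \<delta> = 0 lies outside the range of the
    smoothness hypothesis.\<close>
  case True
  then have "vsub n w y = w" if "w \<in> space (Rn n)" for w
    using that y vnorm_eq_0_iff[OF y] by (auto simp: vsub_def space_Rn extensional_def)
  then have "(\<integral>\<^sup>+w. ennreal (cmod (\<Omega> (vsub n w y) - \<Omega> w) / vnorm n w ^ n) * indicator {e..} (vnorm n w) \<partial>Rn n) = integral\<^sup>N (Rn n) (\<lambda>_. 0)"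
    by (intro nn_integral_cong) simp
  then show ?thesis by simp
next
  case False
  then have y0: "vnorm n y > 0" using vnorm_nonneg[of n y] by linarith
  have [measurable]: "y \<in> space (Rn n)" by (fact y)
  interpret P: pair_sigma_finite "sphere_measure n" "lborel :: real measure" ..
  let ?f = "\<lambda>w. ennreal (cmod (\<Omega> (vsub n w y) - \<Omega> w) / vnorm n w ^ n) * indicator {e..} (vnorm n w)"
  have "(\<integral>\<^sup>+w. ?f w \<partial>Rn n) = (\<integral>\<^sup>+\<theta>. \<integral>\<^sup>+r. ?f (vscale n r \<theta>) \<partial>radial_measure n \<partial>sphere_measure n)"
    by (rule nn_integral_polar[OF n]) measurable
  also have "\<dots> = (\<integral>\<^sup>+\<theta>. \<integral>\<^sup>+r. ennreal (cmod (\<Omega> (vsub n (vscale n r \<theta>) y) - \<Omega> \<theta>)) * (ennreal (1 / r) * indicator {e..} r) \<partial>lborel \<partial>sphere_measure n)"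
  proof (rule nn_integral_cong_AE, use AE_sphere_measure[OF n] in eventually_elim)
    fix \<theta> assume \<theta>: "\<theta> \<in> space (Rn n) \<and> vnorm n \<theta> = 1"
    then have [measurable]: "\<theta> \<in> space (Rn n)" by simp
    have "(\<integral>\<^sup>+r. ?f (vscale n r \<theta>) \<partial>radial_measure n) = (\<integral>\<^sup>+r. ennreal (r ^ (n - 1)) * ?f (vscale n r \<theta>) * indicator {0<..} r \<partial>lborel)"
      by (rule nn_integral_radial) measurable
    also have "\<dots> = (\<integral>\<^sup>+r. ennreal (cmod (\<Omega> (vsub n (vscale n r \<theta>) y) - \<Omega> \<theta>)) * (ennreal (1 / r) * indicator {e..} r) \<partial>lborel)"
    proof (rule nn_integral_cong)
      fix r :: real
      show "ennreal (r ^ (n - 1)) * ?f (vscale n r \<theta>) * indicator {0<..} r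
        = ennreal (cmod (\<Omega> (vsub n (vscale n r \<theta>) y) - \<Omega> \<theta>)) * (ennreal (1 / r) * indicator {e..} r)"
      proof (cases "r \<ge> e")
        case True
        then have r: "r > 0" using e by simp
        have a: "r ^ (n - 1) / r ^ n = 1 / r" using n r by (cases n) auto
        have "ennreal (r ^ (n - 1)) * ennreal (cmod (\<Omega> (vsub n (vscale n r \<theta>) y) - \<Omega> \<theta>) / r ^ n)
          = ennreal (cmod (\<Omega> (vsub n (vscale n r \<theta>) y) - \<Omega> \<theta>) * (r ^ (n - 1) / r ^ n))"
          using r by (subst ennreal_mult[symmetric]) (auto simp: mult_ac)
        also have "\<dots> = ennreal (cmod (\<Omega> (vsub n (vscale n r \<theta>) y) - \<Omega> \<theta>)) * ennreal (1 / r)"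
          unfolding a using r by (subst ennreal_mult) auto
        finally show ?thesis using r True \<theta> by (simp add: vnorm_vscale Omega_vscale)
      qed (use \<theta> e in \<open>auto simp: vnorm_vscale indicator_def\<close>)
    qed
    finally show "(\<integral>\<^sup>+r. ?f (vscale n r \<theta>) \<partial>radial_measure n) = (\<integral>\<^sup>+r. ennreal (cmod (\<Omega> (vsub n (vscale n r \<theta>) y) - \<Omega> \<theta>)) * (ennreal (1 / r) * indicator {e..} r) \<partial>lborel)" .
  qed
  also have "\<dots> = (\<integral>\<^sup>+r. \<integral>\<^sup>+\<theta>. ennreal (cmod (\<Omega> (vsub n (vscale n r \<theta>) y) - \<Omega> \<theta>)) * (ennreal (1 / r) * indicator {e..} r) \<partial>sphere_measure n \<partial>lborel)"
    by (rule P.Fubini'[symmetric]) measurable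
  also have "\<dots> \<le> (\<integral>\<^sup>+r. ennreal (C * n * vnorm n y * W) * (ennreal (1 / r\<^sup>2) * indicator {e..} r) \<partial>lborel)"
  proof (rule nn_integral_mono)
    fix r :: real
    show "(\<integral>\<^sup>+\<theta>. ennreal (cmod (\<Omega> (vsub n (vscale n r \<theta>) y) - \<Omega> \<theta>)) * (ennreal (1 / r) * indicator {e..} r) \<partial>sphere_measure n)
      \<le> ennreal (C * n * vnorm n y * W) * (ennreal (1 / r\<^sup>2) * indicator {e..} r)"
    proof (cases "r \<ge> e")
      case True
      then have r: "r > 0" using e by simp
      let ?\<xi> = "vnormalize n y" and ?d = "vnorm n y / r"
      have "vnorm n y \<le> r / (2 * n)" using e(2) divide_right_mono[OF True, of "2 * n"] by simp
      then have d: "?d \<le> 1 / (2 * n)" using r by (simp add: field_simps)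
      also have "\<dots> < 1 / n" using n by (simp add: field_simps)
      finally have d1: "?d < 1 / n" .
      have d2: "?d > 0" using y0 r by simp
      have "1 / real n \<le> 1" using n by simp
      with d1 have d3: "?d < 1" by linarith
      have xi: "?\<xi> \<in> unit_sphere n" using y0 by (simp add: unit_sphere_def vnorm_vnormalize) (simp add: vnormalize_def)
      have "(\<integral>\<^sup>+\<theta>. ennreal (cmod (\<Omega> (vsub n (vscale n r \<theta>) y) - \<Omega> \<theta>)) \<partial>sphere_measure n)
         = (\<integral>\<^sup>+\<theta>. ennreal (cmod (\<Omega> (vsub n \<theta> (vscale n ?d ?\<xi>)) - \<Omega> \<theta>)) \<partial>sphere_measure n)"
      proof (rule nn_integral_cong_AE, use AE_sphere_measure[OF n] in eventually_elim)
        fix \<theta> assume \<theta>: "\<theta> \<in> space (Rn n) \<and> vnorm n \<theta> = 1"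
        have "r * (?d * (1 / vnorm n y * y i)) = y i" for i
          using r y0 by simp
        then have eq: "vsub n (vscale n r \<theta>) y = vscale n r (vsub n \<theta> (vscale n ?d ?\<xi>))"
          by (simp add: vsub_def vscale_def vnormalize_def right_diff_distrib cong: restrict_cong)
        \<comment> \<open>Homogeneity of \<Omega> holds away from the origin only, so \<theta> -
          \<delta> \<xi> \<noteq> 0 has to be secured; it follows from |\<theta>| = 1 >
          \<delta>.\<close>
        have "vnorm n \<theta> \<le> vnorm n (vsub n \<theta> (vscale n ?d ?\<xi>)) + vnorm n (vscale n ?d ?\<xi>)"
          by (rule vnorm_le_vsub)
        also have "vnorm n (vscale n ?d ?\<xi>) = ?d"
          using r y0 by (simp add: vnorm_vscale vnorm_vnormalize)
        finally have "vnorm n (vsub n \<theta> (vscale n ?d ?\<xi>)) \<noteq> 0" using \<theta> d3 by auto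
        then have "\<Omega> (vsub n (vscale n r \<theta>) y) = \<Omega> (vsub n \<theta> (vscale n ?d ?\<xi>))"
          unfolding eq by (intro Omega_vscale r) auto
        then show "ennreal (cmod (\<Omega> (vsub n (vscale n r \<theta>) y) - \<Omega> \<theta>)) = ennreal (cmod (\<Omega> (vsub n \<theta> (vscale n ?d ?\<xi>)) - \<Omega> \<theta>))"
          by simp
      qed
      also have "\<dots> \<le> ennreal (C * n * ?d * W)"
        using adm xi d1 d2 unfolding admissible_Omega_def W_def by blast
      finally have 1: "(\<integral>\<^sup>+\<theta>. ennreal (cmod (\<Omega> (vsub n (vscale n r \<theta>) y) - \<Omega> \<theta>)) \<partial>sphere_measure n) \<le> ennreal (C * n * ?d * W)" .
      have "(\<integral>\<^sup>+\<theta>. ennreal (cmod (\<Omega> (vsub n (vscale n r \<theta>) y) - \<Omega> \<theta>)) * (ennreal (1 / r) * indicator {e..} r) \<partial>sphere_measure n)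
        = (\<integral>\<^sup>+\<theta>. ennreal (cmod (\<Omega> (vsub n (vscale n r \<theta>) y) - \<Omega> \<theta>)) \<partial>sphere_measure n) * ennreal (1 / r)"
        using True by (subst nn_integral_multc) auto
      also have "\<dots> \<le> ennreal (C * n * ?d * W) * ennreal (1 / r)"
        using 1 by (rule mult_right_mono) simp
      also have "\<dots> = ennreal (C * n * vnorm n y * W) * ennreal (1 / r\<^sup>2)"
        using C W_nonneg y0 r by (simp add: ennreal_mult[symmetric] power2_eq_square)
      finally show ?thesis using True by simp
    qed simp
  qed
  also have "\<dots> = ennreal (C * n * vnorm n y * W) * ennreal (1 / e)"
    by (subst nn_integral_cmult) (simp_all add: nn_integral_inverse_square e)
  also have "\<dots> = ennreal (C * W * (n * vnorm n y / e))"
    using C W_nonneg y0 e by (simp add: ennreal_mult[symmetric] mult_ac)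
  also have "\<dots> \<le> ennreal (C * W * 1)"
  proof (intro ennreal_leI mult_left_mono)
    have "n * vnorm n y \<le> e / 2" using e n by (simp add: field_simps)
    then show "n * vnorm n y / e \<le> 1" using e by (simp add: field_simps)
  qed (use C W_nonneg in auto)
  finally show ?thesis by simp
qed

text \<open>The constants \<open>HC\<close> and \<open>cz_const\<close> depend on \<open>n\<close>. They enter only the qualitative statement that principal
  values exist almost everywhere, never the final estimate.\<close>

definition "HC = C + 4 ^ n"

lemma HC_pos: "HC > 0" using C by (simp add: HC_def add_pos_pos)

text \<open>Hormander's condition. The difference splits into (\<Omega>(w - y) - \<Omega>(w)) /
  |w|^n, which is \<open>nn_integral_Omega_diff\<close>, and \<Omega>(w - y) times a difference of
  inverse powers, which gains a factor |y| / |w - y| and becomes integrable at infinity by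
  \<open>nn_integral_K_tail\<close>.\<close>

lemma hormander:
  assumes y: "y \<in> space (Rn n)" and e: "e > 0" "vnorm n y \<le> e / (2 * n)"
  shows "(\<integral>\<^sup>+w. ennreal (cmod (K (vsub n w y) - K w)) * indicator {e..} (vnorm n w) \<partial>Rn n) \<le> ennreal (HC * W)"
proof -
  have [measurable]: "y \<in> space (Rn n)" by (fact y)
  let ?c = "real n * 4 ^ n * vnorm n y"
  \<comment> \<open>Evaluated at w - y, so that translation invariance reduces it to a tail
    integral; since |y| \<le> e/2, the relevant radii start at e/2.\<close>
  let ?g = "\<lambda>w. ennreal (cmod (K w) / vnorm n w) * indicator {e/2..} (vnorm n w)"
  have y2: "vnorm n y \<le> e / 2"
  proof -
    have "e / (2 * n) \<le> e / 2" using e n by (intro divide_left_mono) auto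
    with e show ?thesis by linarith
  qed
  have "(\<integral>\<^sup>+w. ennreal (cmod (K (vsub n w y) - K w)) * indicator {e..} (vnorm n w) \<partial>Rn n)
    \<le> (\<integral>\<^sup>+w. ennreal (cmod (\<Omega> (vsub n w y) - \<Omega> w) / vnorm n w ^ n) * indicator {e..} (vnorm n w)
         + ennreal ?c * ?g (vsub n w y) \<partial>Rn n)"
  proof (rule nn_integral_mono)
    fix w assume w: "w \<in> space (Rn n)"
    show "ennreal (cmod (K (vsub n w y) - K w)) * indicator {e..} (vnorm n w)
      \<le> ennreal (cmod (\<Omega> (vsub n w y) - \<Omega> w) / vnorm n w ^ n) * indicator {e..} (vnorm n w)
         + ennreal ?c * ?g (vsub n w y)"
    proof (cases "vnorm n w \<ge> e")
      case True
      define a where "a = vnorm n (vsub n w y)"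
      define b where "b = vnorm n w"
      have ab: "b \<le> a + vnorm n y" "a \<le> b + vnorm n y" "b \<ge> e"
        using vnorm_le_vsub[of n w y] vnorm_vsub_le[of n w y] True by (auto simp: a_def b_def)
      have a: "a \<ge> e / 2" "a > 0" "b > 0" "b \<le> 2 * a" "a \<le> 2 * b" "\<bar>a - b\<bar> \<le> vnorm n y"
        using ab y2 e by auto
      have "K (vsub n w y) - K w = (\<Omega> (vsub n w y) - \<Omega> w) / of_real (b ^ n) + \<Omega> (vsub n w y) * of_real (1 / a ^ n - 1 / b ^ n)"
        by (simp add: kernel_def a_def[symmetric] b_def[symmetric] diff_divide_distrib algebra_simps)
      then have "cmod (K (vsub n w y) - K w) \<le> cmod ((\<Omega> (vsub n w y) - \<Omega> w) / of_real (b ^ n)) + cmod (\<Omega> (vsub n w y) * of_real (1 / a ^ n - 1 / b ^ n))"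
        by (simp only: norm_triangle_ineq)
      also have "\<dots> = cmod (\<Omega> (vsub n w y) - \<Omega> w) / b ^ n + cmod (\<Omega> (vsub n w y)) * \<bar>1 / a ^ n - 1 / b ^ n\<bar>"
        using a by (simp only: norm_divide norm_mult norm_of_real) (simp add: power_abs)
      also have "\<dots> \<le> cmod (\<Omega> (vsub n w y) - \<Omega> w) / b ^ n + cmod (\<Omega> (vsub n w y)) * (?c / a / a ^ n)"
      proof (intro add_left_mono mult_left_mono)
        have "\<bar>1 / a ^ n - 1 / b ^ n\<bar> \<le> real n * 4 ^ n * \<bar>a - b\<bar> / a / a ^ n"
          by (rule inverse_power_diff_le) (use a in auto)
        also have "\<dots> \<le> ?c / a / a ^ n" using a by (intro divide_right_mono mult_left_mono) auto
        finally show "\<bar>1 / a ^ n - 1 / b ^ n\<bar> \<le> ?c / a / a ^ n" .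
      qed simp
      also have "cmod (\<Omega> (vsub n w y)) * (?c / a / a ^ n) = ?c * (cmod (K (vsub n w y)) / a)"
        using a by (simp add: kernel_def a_def[symmetric] norm_divide norm_power mult_ac)
      finally have "ennreal (cmod (K (vsub n w y) - K w)) \<le> ennreal (cmod (\<Omega> (vsub n w y) - \<Omega> w) / b ^ n + ?c * (cmod (K (vsub n w y)) / a))"
        by (rule ennreal_leI)
      also have "\<dots> = ennreal (cmod (\<Omega> (vsub n w y) - \<Omega> w) / b ^ n) + ennreal ?c * ennreal (cmod (K (vsub n w y)) / a)"
        using a by (simp add: ennreal_mult[symmetric])
      finally show ?thesis using True a by (simp add: a_def b_def)
    qed simp
  qed
  also have "\<dots> = (\<integral>\<^sup>+w. ennreal (cmod (\<Omega> (vsub n w y) - \<Omega> w) / vnorm n w ^ n) * indicator {e..} (vnorm n w) \<partial>Rn n)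
         + ennreal ?c * (\<integral>\<^sup>+w. ?g (vsub n w y) \<partial>Rn n)"
    by (subst nn_integral_add) (auto simp: nn_integral_cmult)
  also have "(\<integral>\<^sup>+w. ?g (vsub n w y) \<partial>Rn n) = (\<integral>\<^sup>+w. ?g w \<partial>Rn n)"
    by (rule nn_integral_vsub_right) measurable
  also have "\<dots> = ennreal (W / (e / 2))" by (rule nn_integral_K_tail) (use e in simp)
  also have "(\<integral>\<^sup>+w. ennreal (cmod (\<Omega> (vsub n w y) - \<Omega> w) / vnorm n w ^ n) * indicator {e..} (vnorm n w) \<partial>Rn n) + ennreal ?c * ennreal (W / (e / 2))
    \<le> ennreal (C * W) + ennreal (4 ^ n * W)"
  proof (intro add_mono nn_integral_Omega_diff y e)
    have "?c * (W / (e / 2)) = 4 ^ n * W * (2 * (n * vnorm n y) / e)" by simp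
    also have "\<dots> \<le> 4 ^ n * W * 1"
    proof (intro mult_left_mono)
      have "n * vnorm n y \<le> e / 2" using e n by (simp add: field_simps)
      then show "2 * (n * vnorm n y) / e \<le> 1" using e by (simp add: field_simps)
    qed (use W_nonneg in auto)
    finally have "?c * (W / (e / 2)) \<le> 4 ^ n * W" by simp
    then show "ennreal ?c * ennreal (W / (e / 2)) \<le> ennreal (4 ^ n * W)"
      using W_nonneg e by (subst ennreal_mult[symmetric]) (auto intro!: ennreal_leI)
  qed
  also have "\<dots> = ennreal (HC * W)" using C W_nonneg by (simp add: HC_def distrib_right)
  finally show ?thesis by (simp add: add_mono)
qed

end

subsection \<open>Point masses and random approximation\<close>

lemma outer_leb_eq: "A \<in> sets (Rn n) \<Longrightarrow> outer_leb n A = emeasure (Rn n) A"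
  unfolding outer_leb_def
  by (rule antisym[OF INF_lower2[of A] INF_greatest]) (auto intro: emeasure_mono)

lemma outer_leb_le: "A \<subseteq> B \<Longrightarrow> B \<in> sets (Rn n) \<Longrightarrow> outer_leb n A \<le> emeasure (Rn n) B"
  unfolding outer_leb_def by (rule INF_lower) auto

text \<open>Induction on N by integrating out the last coordinate. In the expansion of |s +
  \<phi>(y)|^2 the cross term vanishes because \<phi> has mean zero; boundedness of \<phi> supplies
  all integrability.\<close>

lemma second_moment_sum:
  fixes \<phi> :: "'a \<Rightarrow> complex"
  assumes P: "prob_space P" and [measurable]: "\<phi> \<in> borel_measurable P"
    and bound: "\<And>y. cmod (\<phi> y) \<le> B" and zero: "(\<integral>y. \<phi> y \<partial>P) = 0"
  shows "(\<integral>c. (cmod (\<Sum>k<N. \<phi> (c k)))\<^sup>2 \<partial>PiM {..<N} (\<lambda>_::nat. P)) = N * (\<integral>y. (cmod (\<phi> y))\<^sup>2 \<partial>P)"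
proof (induction N)
  case 0
  show ?case by simp
next
  case (Suc N)
  interpret P: prob_space P by fact
  interpret product_sigma_finite "\<lambda>_::nat. P" by standard
  interpret PN: prob_space "PiM I (\<lambda>_::nat. P)" for I by (rule prob_space_PiM) (rule P.prob_space_axioms)
  have comp[measurable]: "(\<lambda>c. c k) \<in> measurable (PiM I (\<lambda>_::nat. P)) P" if "k \<in> I" for k I
    using that by measurable
  have bS: "cmod (\<Sum>k<N. \<phi> (c k)) \<le> N * B" for N and c :: "nat \<Rightarrow> 'a"
    using sum_norm_le[of "{..<N}" "\<lambda>k. \<phi> (c k)" "\<lambda>_. B"] bound by simp
  have mS[measurable]: "(\<lambda>c. \<Sum>k<N. \<phi> (c k)) \<in> borel_measurable (PiM {..<N} (\<lambda>_::nat. P))" for N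
    by (rule borel_measurable_sum) auto
  have iS: "integrable (PiM {..<N} (\<lambda>_::nat. P)) (\<lambda>c. (cmod (\<Sum>k<N. \<phi> (c k)))\<^sup>2)" for N
    by (rule PN.integrable_const_bound[where B="(N * B)\<^sup>2"]) (auto intro!: power_mono bS)
  have i1: "integrable P \<phi>" by (rule P.integrable_const_bound[where B=B]) (use bound in auto)
  have i2: "integrable P (\<lambda>y. (cmod (\<phi> y))\<^sup>2)"
    by (rule P.integrable_const_bound[where B="B\<^sup>2"]) (auto intro!: power_mono bound)
  have ins: "{..<Suc N} = insert N {..<N}" by auto
  have "(\<integral>c. (cmod (\<Sum>k<Suc N. \<phi> (c k)))\<^sup>2 \<partial>PiM {..<Suc N} (\<lambda>_::nat. P))
    = (\<integral>c. (\<integral>y. (cmod (\<Sum>k<Suc N. \<phi> ((c(N := y)) k)))\<^sup>2 \<partial>P) \<partial>PiM {..<N} (\<lambda>_::nat. P))"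
    using iS[of "Suc N"] unfolding ins by (intro product_integral_insert) auto
  also have "\<dots> = (\<integral>c. (cmod (\<Sum>k<N. \<phi> (c k)))\<^sup>2 + (\<integral>y. (cmod (\<phi> y))\<^sup>2 \<partial>P) \<partial>PiM {..<N} (\<lambda>_::nat. P))"
  proof (rule Bochner_Integration.integral_cong[OF refl])
    fix c :: "nat \<Rightarrow> 'a"
    define s where "s = (\<Sum>k<N. \<phi> (c k))"
    have "(\<Sum>k<Suc N. \<phi> ((c(N := y)) k)) = s + \<phi> y" for y
      by (simp add: s_def)
    then have "(\<integral>y. (cmod (\<Sum>k<Suc N. \<phi> ((c(N := y)) k)))\<^sup>2 \<partial>P) = (\<integral>y. (cmod s)\<^sup>2 + (2 * (\<phi> y \<bullet> s) + (cmod (\<phi> y))\<^sup>2) \<partial>P)"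
      by (simp add: power2_norm_eq_inner inner_add_left inner_add_right inner_commute algebra_simps)
    also have "\<dots> = (cmod s)\<^sup>2 + (2 * (\<integral>y. \<phi> y \<bullet> s \<partial>P) + (\<integral>y. (cmod (\<phi> y))\<^sup>2 \<partial>P))"
      using i1 i2 by (simp add: P.prob_space)
    also have "(\<integral>y. \<phi> y \<bullet> s \<partial>P) = 0" using integral_inner_left[of s P \<phi>] i1 zero by auto
    finally show "(\<integral>y. (cmod (\<Sum>k<Suc N. \<phi> ((c(N := y)) k)))\<^sup>2 \<partial>P) = (cmod (\<Sum>k<N. \<phi> (c k)))\<^sup>2 + (\<integral>y. (cmod (\<phi> y))\<^sup>2 \<partial>P)"
      by (simp add: s_def)
  qed
  also have "\<dots> = N * (\<integral>y. (cmod (\<phi> y))\<^sup>2 \<partial>P) + (\<integral>y. (cmod (\<phi> y))\<^sup>2 \<partial>P)"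
    using iS[of N] Suc by (simp add: PN.prob_space)
  finally show ?case by (simp add: algebra_simps)
qed

context singular_kernel begin

text \<open>For small \<epsilon> no truncation takes effect at a point c \<noteq> x, and for c = x
  both sides are 0 by \<open>K_origin\<close>; the principal value is the limit of an eventually
  constant function.\<close>

lemma sio_dirac_eq:
  assumes "\<And>a c. (a, c) \<in> set \<nu> \<Longrightarrow> c \<in> space (Rn n)" "x \<in> space (Rn n)"
  shows "sio_dirac n \<Omega> \<nu> x = (\<Sum>(a, c)\<leftarrow>\<nu>. of_real a * K (vsub n x c))"
proof -
  have "((\<lambda>\<epsilon>. \<Sum>(a, c)\<leftarrow>\<nu>. (if vnorm n (vsub n x c) \<ge> \<epsilon> then complex_of_real a * K (vsub n x c) else 0))
     \<longlongrightarrow> (\<Sum>(a, c)\<leftarrow>\<nu>. of_real a * K (vsub n x c))) (at_right 0)"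
  proof (induction \<nu>)
    case (Cons p \<nu>)
    obtain a c where p: "p = (a, c)" by force
    have "((\<lambda>\<epsilon>. if vnorm n (vsub n x c) \<ge> \<epsilon> then complex_of_real a * K (vsub n x c) else 0) \<longlongrightarrow> of_real a * K (vsub n x c)) (at_right 0)"
    proof (cases "vnorm n (vsub n x c) = 0")
      case False
      then have pos: "vnorm n (vsub n x c) > 0" using vnorm_nonneg[of n "vsub n x c"] by linarith
      show ?thesis
        by (rule tendsto_eventually)
           (use eventually_at_right_less[of "0::real"] eventually_at_right_real[OF pos] in eventually_elim, auto)
    qed (simp add: K_origin cong: if_cong)
    from tendsto_add[OF this Cons.IH] show ?case by (simp add: p)
  qed simp
  then show ?thesis unfolding sio_dirac_def by (intro tendsto_Lim) auto
qed

text \<open>The weak type (1,1) inequality with constant s for N equal masses a at the points c k.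
  Equal masses are what sampling produces. The level sets are measurable, so \<open>emeasure\<close>
  takes the place of the outer measure.\<close>

definition dirac_weak :: "real \<Rightarrow> bool" where
  "dirac_weak s \<longleftrightarrow> s \<ge> 0 \<and> (\<forall>(N::nat) (a::real) (c :: nat \<Rightarrow> nat \<Rightarrow> real) (l::real).
     0 < a \<longrightarrow> (\<forall>k<N. c k \<in> space (Rn n)) \<longrightarrow> 0 < l \<longrightarrow>
     emeasure (Rn n) {x \<in> space (Rn n). l < cmod (of_real a * (\<Sum>k<N. K (vsub n x (c k))))} \<le> ennreal (s * (N * a) / l))"

text \<open>The kernel is homogeneous of degree \<open>-n\<close>, so dilating a configuration by \<open>\<rho>\<close> and multiplying its
  masses by \<open>\<rho>\<^sup>n\<close> multiplies the measure of the level set by \<open>\<rho>\<^sup>n\<close>; hence the supremum for one total mass and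
  one level controls all of them.\<close>

lemma dirac_weakI:
  assumes m0: "m0 > 0" and lam: "lam > 0" and r: "r \<ge> 0"
    and sup: "(SUP \<nu> \<in> {\<nu> :: (real \<times> (nat \<Rightarrow> real)) list. (\<forall>(a, c) \<in> set \<nu>. a > 0 \<and> c \<in> space (Rn n)) \<and> (\<Sum>(a, c)\<leftarrow>\<nu>. a) \<le> m0}.
        outer_leb n {x \<in> space (Rn n). cmod (sio_dirac n \<Omega> \<nu> x) > lam}) \<le> ennreal r"
  shows "dirac_weak (r * lam / m0)"
proof -
  have "emeasure (Rn n) {x \<in> space (Rn n). l < cmod (of_real a * (\<Sum>k<N. K (vsub n x (c k))))} \<le> ennreal (r * lam / m0 * (N * a) / l)"
    (is "emeasure _ ?E \<le> _")
    if a: "a > 0" and c: "\<forall>k<N. c k \<in> space (Rn n)" and l: "l > 0" for N :: nat and a l :: real and c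
  proof (cases "N = 0")
    case True
    then show ?thesis using l by simp
  next
    case False
    \<comment> \<open>t will be \<rho>^n for the dilation factor \<rho>. It is determined by two
      requirements: the level l has to become lam, which forces the new masses b = a lam t / l, and
      these masses have to add up to m0.\<close>
    define t where "t = m0 * l / (N * a * lam)"
    have t: "t > 0" using False assms a l by (simp add: t_def)
    define \<rho> where "\<rho> = root n t"
    have \<rho>: "\<rho> > 0" "\<rho> ^ n = t" using t n by (auto simp: \<rho>_def)
    define b where "b = a * lam / l * t"
    have b: "b > 0" using a lam l t by (simp add: b_def)
    define \<nu> where "\<nu> = map (\<lambda>k. (b, vscale n \<rho> (c k))) [0..<N]"
    have \<nu>1: "\<forall>(a, c) \<in> set \<nu>. a > 0 \<and> c \<in> space (Rn n)" using b by (auto simp: \<nu>_def)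
    have "(\<Sum>(a, c)\<leftarrow>\<nu>. a) = N * b" by (simp add: \<nu>_def comp_def sum_list_triv)
    also have "\<dots> = m0" using a lam l False by (simp add: b_def t_def)
    finally have \<nu>2: "(\<Sum>(a, c)\<leftarrow>\<nu>. a) \<le> m0" by simp
    have eq: "sio_dirac n \<Omega> \<nu> x = of_real b * (\<Sum>k<N. K (vsub n x (vscale n \<rho> (c k))))" if "x \<in> space (Rn n)" for x
      using \<nu>1 that by (subst sio_dirac_eq) (auto simp: \<nu>_def comp_def sum_list_sum_nth sum_distrib_left atLeast0LessThan)
    let ?A = "{x \<in> space (Rn n). cmod (sio_dirac n \<Omega> \<nu> x) > lam}"
    have A: "?A = {x \<in> space (Rn n). cmod (of_real b * (\<Sum>k<N. K (vsub n x (vscale n \<rho> (c k))))) > lam}"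
      using eq by auto
    have Am: "?A \<in> sets (Rn n)" unfolding A by measurable
    have "ennreal t * emeasure (Rn n) {x \<in> space (Rn n). vscale n \<rho> x \<in> ?A} = emeasure (Rn n) ?A"
      using emeasure_Rn_dilate[OF \<rho>(1) Am] \<rho>(2) by simp
    also have "\<dots> = outer_leb n ?A" by (rule outer_leb_eq[OF Am, symmetric])
    also have "\<dots> \<le> ennreal r"
      by (rule order.trans[OF SUP_upper sup]) (use \<nu>1 \<nu>2 in simp)
    finally have 1: "ennreal t * emeasure (Rn n) {x \<in> space (Rn n). vscale n \<rho> x \<in> ?A} \<le> ennreal r" .
    have "{x \<in> space (Rn n). vscale n \<rho> x \<in> ?A} = ?E"
    proof -
      have "cmod (of_real b * (\<Sum>k<N. K (vsub n (vscale n \<rho> x) (vscale n \<rho> (c k))))) > lam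
         \<longleftrightarrow> l < cmod (of_real a * (\<Sum>k<N. K (vsub n x (c k))))" for x
      proof -
        have "vsub n (vscale n \<rho> x) (vscale n \<rho> y) = vscale n \<rho> (vsub n x y)" for y
          by (auto simp: vsub_def vscale_def algebra_simps)
        then have "(\<Sum>k<N. K (vsub n (vscale n \<rho> x) (vscale n \<rho> (c k)))) = (\<Sum>k<N. K (vsub n x (c k))) / of_real t"
          using \<rho> by (simp add: K_vscale sum_divide_distrib)
        then have "cmod (of_real b * (\<Sum>k<N. K (vsub n (vscale n \<rho> x) (vscale n \<rho> (c k))))) = lam / l * cmod (of_real a * (\<Sum>k<N. K (vsub n x (c k))))"
          using a b lam l t by (simp add: norm_mult norm_divide) (simp add: b_def)
        then show ?thesis using lam l mult_less_cancel_left_pos[of "lam / l" l] by simp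
      qed
      then show ?thesis unfolding A by auto
    qed
    with 1 have "ennreal t * emeasure (Rn n) ?E \<le> ennreal r" by simp
    then have "ennreal (1 / t) * (ennreal t * emeasure (Rn n) ?E) \<le> ennreal (1 / t) * ennreal r"
      by (rule mult_left_mono) simp
    then have "emeasure (Rn n) ?E \<le> ennreal (1 / t * r)"
      using t r by (simp add: mult.assoc[symmetric] ennreal_mult[symmetric])
    also have "1 / t * r = r * lam / m0 * (N * a) / l" by (simp add: t_def)
    finally show ?thesis .
  qed
  then show ?thesis unfolding dirac_weak_def using assms by auto
qed

section \<open>The kernel truncated by size and its random approximation\<close>

definition KM :: "real \<Rightarrow> (nat \<Rightarrow> real) \<Rightarrow> complex" where
  "KM M w = (if cmod (K w) \<le> M then K w else 0)"

definition TM :: "real \<Rightarrow> ((nat \<Rightarrow> real) \<Rightarrow> complex) \<Rightarrow> (nat \<Rightarrow> real) \<Rightarrow> complex" where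
  "TM M f x = (\<integral>y. KM M (vsub n x y) * f y \<partial>Rn n)"

text \<open>Divided by the tolerance s, this bounds the probability that sampling fails at
  x.\<close>

definition VM :: "real \<Rightarrow> ((nat \<Rightarrow> real) \<Rightarrow> real) \<Rightarrow> (nat \<Rightarrow> real) \<Rightarrow> real" where
  "VM M f x = (\<integral>y. f y * vM M (vsub n x y) \<partial>Rn n)"

lemma KM_measurable [measurable (raw)]:
  assumes [measurable]: "f \<in> measurable N (Rn n)"
  shows "(\<lambda>w. KM M (f w)) \<in> borel_measurable N"
  unfolding KM_def by measurable

lemma KM_le: "M \<ge> 0 \<Longrightarrow> cmod (KM M w) \<le> M" "cmod (KM M w) \<le> cmod (K w)"
  by (auto simp: KM_def)

lemma vM_le_M: "M > 0 \<Longrightarrow> vM M w \<le> M"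
  by (auto simp: vM_def power2_eq_square field_simps intro: mult_mono)

lemma integrable_KM_mult:
  assumes "M \<ge> 0" "integrable (Rn n) f"
  shows "integrable (Rn n) (\<lambda>y. KM M (vsub n x y) * f y)"
proof (rule Bochner_Integration.integrable_bound)
  show "integrable (Rn n) (\<lambda>y. M * cmod (f y))" using assms by auto
  show "(\<lambda>y. KM M (vsub n x y) * f y) \<in> borel_measurable (Rn n)" using assms by measurable
qed (use assms KM_le in \<open>auto simp: norm_mult intro!: mult_right_mono\<close>)

lemma integrable_vM_mult:
  assumes "M > 0" "integrable (Rn n) f"
  shows "integrable (Rn n) (\<lambda>y. f y * vM M (vsub n x y))"
proof (rule Bochner_Integration.integrable_bound)
  show "integrable (Rn n) (\<lambda>y. M * f y)" using assms by auto
  show "(\<lambda>y. f y * vM M (vsub n x y)) \<in> borel_measurable (Rn n)" using assms by measurable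
  show "AE y in Rn n. norm (f y * vM M (vsub n x y)) \<le> norm (M * f y)"
  proof (rule AE_I2)
    fix y
    have "\<bar>f y\<bar> * vM M (vsub n x y) \<le> \<bar>f y\<bar> * M"
      by (rule mult_left_mono[OF vM_le_M[OF assms(1)]]) simp
    then show "norm (f y * vM M (vsub n x y)) \<le> norm (M * f y)"
      using assms(1) vM_nonneg[OF assms(1)] by (simp add: abs_mult mult.commute)
  qed
qed

lemma TM_measurable [measurable]:
  assumes [measurable]: "f \<in> borel_measurable (Rn n)"
  shows "TM M f \<in> borel_measurable (Rn n)"
  unfolding TM_def by measurable

lemma TM_le:
  assumes "M \<ge> 0" "integrable (Rn n) f"
  shows "cmod (TM M f x) \<le> M * (\<integral>y. cmod (f y) \<partial>Rn n)"
proof -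
  have "cmod (TM M f x) \<le> (\<integral>y. cmod (KM M (vsub n x y) * f y) \<partial>Rn n)"
    unfolding TM_def by (rule integral_norm_bound)
  also have "\<dots> \<le> (\<integral>y. M * cmod (f y) \<partial>Rn n)"
  proof (rule integral_mono)
    show "integrable (Rn n) (\<lambda>y. cmod (KM M (vsub n x y) * f y))"
      by (rule integrable_norm[OF integrable_KM_mult[OF assms]])
  qed (use assms KM_le in \<open>auto simp: norm_mult intro!: mult_right_mono\<close>)
  finally show ?thesis by simp
qed

text \<open>Since \<open>N * s = M * m\<close>, each sample carries the mass m/N = s/M. An error
  above s requires that |K(x - c k)| > M for some k, or that the sum of the N centred values of
  \<open>KM\<close> exceeds M. The union bound and Chebyshev's inequality give at most N P(|K| > M)
  + N E|KM|^2 / M^2, which is N/M times the mean of \<open>vM\<close>, that is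
  \<open>VM M f x / s\<close>.\<close>

lemma random_approximation:
  fixes f :: "(nat \<Rightarrow> real) \<Rightarrow> real" and N :: nat and m s M :: real and x :: "nat \<Rightarrow> real"
  assumes f0: "\<And>y. f y \<ge> 0" and f: "integrable (Rn n) f" and m: "(\<integral>y. f y \<partial>Rn n) = m" "m > 0"
    and M: "M > 0" and s: "s > 0" and N: "N * s = M * m" and x: "x \<in> space (Rn n)"
  defines "P \<equiv> density (Rn n) (\<lambda>y. ennreal (f y / m))"
  defines "PN \<equiv> PiM {..<N} (\<lambda>_::nat. P)"
  shows "prob_space P"
    and "emeasure PN {c \<in> space PN. s < cmod (of_real (m / N) * (\<Sum>k<N. K (vsub n x (c k))) - TM M (\<lambda>y. of_real (f y)) x)}
      \<le> ennreal (VM M f x / s)"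
proof -
  have fm[measurable]: "f \<in> borel_measurable (Rn n)" using f by auto
  have [measurable]: "x \<in> space (Rn n)" by (fact x)
  have setsP[measurable_cong, simp]: "sets P = sets (Rn n)" by (simp add: P_def)
  have spaceP[simp]: "space P = space (Rn n)" by (simp add: P_def)
  have Npos: "real N > 0" using N M m s by (metis mult_pos_pos zero_less_mult_pos2)
  show P: "prob_space P"
  proof
    have "emeasure P (space P) = (\<integral>\<^sup>+y. ennreal (f y / m) \<partial>Rn n)"
      unfolding P_def by (subst emeasure_density) (auto intro!: nn_integral_cong)
    also have "\<dots> = ennreal (\<integral>y. f y / m \<partial>Rn n)"
      by (rule nn_integral_eq_integral) (use f f0 m in auto)
    also have "\<dots> = 1" using m by simp
    finally show "emeasure P (space P) = 1" .
  qed
  interpret P: prob_space P by fact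
  interpret PN: prob_space PN unfolding PN_def by (rule prob_space_PiM) (rule P)
  have P1: "measure P (space (Rn n)) = 1" using P.prob_space by simp
  have comp[measurable]: "(\<lambda>c. c k) \<in> measurable PN P" if "k < N" for k
    unfolding PN_def by (rule measurable_component_singleton) (use that in simp)
  have comp'[measurable]: "(\<lambda>c. c k) \<in> measurable PN (Rn n)" if "k < N" for k
    using comp[OF that] by (simp cong: measurable_cong_sets)
  have distr_comp: "distr PN P (\<lambda>c. c k) = P" if "k < N" for k
    unfolding PN_def by (rule distr_PiM_component) (use P that in auto)
  have intP: "(\<integral>y. g y \<partial>P) = (\<integral>y. (f y / m) *\<^sub>R g y \<partial>Rn n)" if "g \<in> borel_measurable (Rn n)" for g :: "_ \<Rightarrow> 'c::{banach, second_countable_topology}"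
    unfolding P_def by (rule integral_density) (use that f0 m in auto)
  define \<mu> where "\<mu> = (\<integral>y. KM M (vsub n x y) \<partial>P)"
  have \<mu>: "TM M (\<lambda>y. of_real (f y)) x = of_real m * \<mu>"
  proof -
    have "of_real m * \<mu> = (\<integral>y. of_real m * ((f y / m) *\<^sub>R KM M (vsub n x y)) \<partial>Rn n)"
      unfolding \<mu>_def by (subst intP) (simp_all only: integral_mult_right_zero, measurable)
    also have "\<dots> = TM M (\<lambda>y. of_real (f y)) x"
      unfolding TM_def using m by (intro Bochner_Integration.integral_cong) (auto simp: scaleR_conv_of_real)
    finally show ?thesis by simp
  qed
  have KMP[measurable]: "(\<lambda>y. KM M (vsub n x y)) \<in> borel_measurable P"
    by (subst measurable_cong_sets[OF setsP refl]) measurable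
  define \<phi> where "\<phi> y = KM M (vsub n x y) - \<mu>" for y
  have \<phi>m[measurable]: "\<phi> \<in> borel_measurable P" "\<phi> \<in> borel_measurable (Rn n)" unfolding \<phi>_def by measurable
  have iKM: "integrable P (\<lambda>y. KM M (vsub n x y))"
    by (rule P.integrable_const_bound[where B=M]) (use M KM_le in auto)
  have "(\<integral>y. cmod (KM M (vsub n x y)) \<partial>P) \<le> M"
    by (rule P.integral_le_const) (use iKM M KM_le in auto)
  then have \<mu>_le: "cmod \<mu> \<le> M"
    unfolding \<mu>_def by (rule order.trans[OF integral_norm_bound])
  have iKM2: "integrable P (\<lambda>y. (cmod (KM M (vsub n x y)))\<^sup>2)"
    by (rule P.integrable_const_bound[where B="M\<^sup>2"]) (use M KM_le in \<open>auto intro!: power_mono\<close>)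
  have \<phi>_bound: "cmod (\<phi> y) \<le> 2 * M" for y
    using norm_triangle_ineq4[of "KM M (vsub n x y)" \<mu>] KM_le(1)[of M "vsub n x y"] \<mu>_le M by (simp add: \<phi>_def)
  have \<phi>_zero: "(\<integral>y. \<phi> y \<partial>P) = 0"
    using iKM by (simp add: \<phi>_def \<mu>_def P1)
  have \<phi>2: "(\<integral>y. (cmod (\<phi> y))\<^sup>2 \<partial>P) \<le> (\<integral>y. (cmod (KM M (vsub n x y)))\<^sup>2 \<partial>P)"
  proof -
    have "(cmod (\<phi> y))\<^sup>2 = (cmod (KM M (vsub n x y)))\<^sup>2 - 2 * (KM M (vsub n x y) \<bullet> \<mu>) + (cmod \<mu>)\<^sup>2" for y
      by (simp add: \<phi>_def power2_norm_eq_inner inner_diff_left inner_diff_right inner_commute)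
    then have "(\<integral>y. (cmod (\<phi> y))\<^sup>2 \<partial>P) = (\<integral>y. (cmod (KM M (vsub n x y)))\<^sup>2 \<partial>P) - 2 * (\<integral>y. KM M (vsub n x y) \<bullet> \<mu> \<partial>P) + (cmod \<mu>)\<^sup>2"
      using iKM iKM2 by (simp add: P1)
    also have "(\<integral>y. KM M (vsub n x y) \<bullet> \<mu> \<partial>P) = (cmod \<mu>)\<^sup>2"
      using iKM by (simp add: \<mu>_def[symmetric] power2_norm_eq_inner)
    finally show ?thesis by simp
  qed
  let ?B1 = "\<lambda>k. {c \<in> space PN. M < cmod (K (vsub n x (c k)))}"
  let ?B2 = "{c \<in> space PN. M < cmod (\<Sum>k<N. \<phi> (c k))}"
  have mN: "m / N = s / M" using N Npos M by (simp add: field_simps)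
  have sub: "{c \<in> space PN. s < cmod (of_real (m / N) * (\<Sum>k<N. K (vsub n x (c k))) - TM M (\<lambda>y. of_real (f y)) x)} \<subseteq> (\<Union>k<N. ?B1 k) \<union> ?B2"
  proof
    fix c assume c: "c \<in> {c \<in> space PN. s < cmod (of_real (m / N) * (\<Sum>k<N. K (vsub n x (c k))) - TM M (\<lambda>y. of_real (f y)) x)}"
    show "c \<in> (\<Union>k<N. ?B1 k) \<union> ?B2"
    proof (rule ccontr)
      assume neg: "c \<notin> (\<Union>k<N. ?B1 k) \<union> ?B2"
      then have "\<And>k. k < N \<Longrightarrow> K (vsub n x (c k)) = \<phi> (c k) + \<mu>" using c by (auto simp: \<phi>_def KM_def not_less)
      then have "(\<Sum>k<N. K (vsub n x (c k))) = (\<Sum>k<N. \<phi> (c k)) + of_nat N * \<mu>" by (simp add: sum.distrib)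
      then have "of_real (m / N) * (\<Sum>k<N. K (vsub n x (c k))) - TM M (\<lambda>y. of_real (f y)) x = of_real (m / N) * (\<Sum>k<N. \<phi> (c k))"
        using Npos unfolding \<mu> by (simp add: algebra_simps)
      then have "s < (s / M) * cmod (\<Sum>k<N. \<phi> (c k))"
        using c s M unfolding mN by (simp add: norm_mult norm_divide)
      moreover have "(s / M) * cmod (\<Sum>k<N. \<phi> (c k)) \<le> (s / M) * M"
        using neg c s M by (intro mult_left_mono) auto
      ultimately show False using M by simp
    qed
  qed
  have B1: "emeasure PN (?B1 k) = ennreal (\<integral>y. indicator {y. M < cmod (K (vsub n x y))} y \<partial>P)" if k: "k < N" for k
  proof -
    have "emeasure PN (?B1 k) = emeasure (distr PN P (\<lambda>c. c k)) {y \<in> space P. M < cmod (K (vsub n x y))}"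
      using k comp[OF k] by (subst emeasure_distr) (use measurable_space[OF comp'[OF k]] in \<open>auto intro!: arg_cong[where f="emeasure PN"]\<close>)
    also have "\<dots> = ennreal (measure P {y \<in> space P. M < cmod (K (vsub n x y))})"
      unfolding distr_comp[OF k] by (simp add: P.emeasure_eq_measure)
    also have "measure P {y \<in> space P. M < cmod (K (vsub n x y))} = (\<integral>y. indicator {y \<in> space P. M < cmod (K (vsub n x y))} y \<partial>P)"
      by simp
    also have "\<dots> = (\<integral>y. indicator {y. M < cmod (K (vsub n x y))} y \<partial>P)"
      by (rule Bochner_Integration.integral_cong) (auto simp: indicator_def)
    finally show ?thesis .
  qed
  have B2: "emeasure PN ?B2 \<le> ennreal (N * (\<integral>y. (cmod (\<phi> y))\<^sup>2 \<partial>P) / M\<^sup>2)"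
  proof -
    have mS[measurable]: "(\<lambda>c. \<Sum>k<N. \<phi> (c k)) \<in> borel_measurable PN"
      by (rule borel_measurable_sum) auto
    have "cmod (\<Sum>k<N. \<phi> (c k)) \<le> N * (2 * M)" for c
      using sum_norm_le[of "{..<N}" "\<lambda>k. \<phi> (c k)" "\<lambda>_. 2 * M"] \<phi>_bound by simp
    then have "integrable PN (\<lambda>c. (cmod (\<Sum>k<N. \<phi> (c k)))\<^sup>2)"
      by (intro PN.integrable_const_bound[where B="(N * (2 * M))\<^sup>2"]) (auto intro!: power_mono)
    then have "measure PN {c \<in> space PN. M\<^sup>2 \<le> (cmod (\<Sum>k<N. \<phi> (c k)))\<^sup>2} \<le> (\<integral>c. (cmod (\<Sum>k<N. \<phi> (c k)))\<^sup>2 \<partial>PN) / M\<^sup>2"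
      by (rule integral_Markov_inequality_measure[where A="{}"]) (use M in auto)
    also have "\<dots> = N * (\<integral>y. (cmod (\<phi> y))\<^sup>2 \<partial>P) / M\<^sup>2"
      unfolding PN_def by (subst second_moment_sum[OF P \<phi>m(1) \<phi>_bound \<phi>_zero]) simp
    finally have 1: "measure PN {c \<in> space PN. M\<^sup>2 \<le> (cmod (\<Sum>k<N. \<phi> (c k)))\<^sup>2} \<le> N * (\<integral>y. (cmod (\<phi> y))\<^sup>2 \<partial>P) / M\<^sup>2" .
    have "measure PN ?B2 \<le> measure PN {c \<in> space PN. M\<^sup>2 \<le> (cmod (\<Sum>k<N. \<phi> (c k)))\<^sup>2}"
      by (rule PN.finite_measure_mono) (use M in \<open>auto intro!: power_mono\<close>)
    with 1 show ?thesis by (simp add: PN.emeasure_eq_measure ennreal_leI)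
  qed
  have "emeasure PN {c \<in> space PN. s < cmod (of_real (m / N) * (\<Sum>k<N. K (vsub n x (c k))) - TM M (\<lambda>y. of_real (f y)) x)}
     \<le> emeasure PN ((\<Union>k<N. ?B1 k) \<union> ?B2)"
    by (rule emeasure_mono[OF sub]) measurable
  also have "\<dots> \<le> emeasure PN (\<Union>k<N. ?B1 k) + emeasure PN ?B2"
    by (rule emeasure_subadditive) measurable
  also have "\<dots> \<le> (\<Sum>k<N. emeasure PN (?B1 k)) + emeasure PN ?B2"
    by (intro add_right_mono emeasure_subadditive_finite) auto
  also have "(\<Sum>k<N. emeasure PN (?B1 k)) = ennreal (N * (\<integral>y. indicator {y. M < cmod (K (vsub n x y))} y \<partial>P))"
    by (simp add: B1 ennreal_mult ennreal_of_nat_eq_real_of_nat)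
  also have "ennreal (N * (\<integral>y. indicator {y. M < cmod (K (vsub n x y))} y \<partial>P)) + emeasure PN ?B2
     \<le> ennreal (N * (\<integral>y. indicator {y. M < cmod (K (vsub n x y))} y \<partial>P)) + ennreal (N * (\<integral>y. (cmod (\<phi> y))\<^sup>2 \<partial>P) / M\<^sup>2)"
    by (rule add_left_mono[OF B2])
  also have "\<dots> = ennreal (N * (\<integral>y. indicator {y. M < cmod (K (vsub n x y))} y \<partial>P) + N * (\<integral>y. (cmod (\<phi> y))\<^sup>2 \<partial>P) / M\<^sup>2)"
    by (subst ennreal_plus) auto
  also have "\<dots> \<le> ennreal (VM M f x / s)"
  proof (rule ennreal_leI)
    have "{y. M < cmod (K (vsub n x y))} \<inter> space P = {y \<in> space (Rn n). M < cmod (K (vsub n x y))}" by auto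
    also have "\<dots> \<in> sets P" unfolding setsP by measurable
    finally have [measurable]: "(indicator {y. M < cmod (K (vsub n x y))} :: _ \<Rightarrow> real) \<in> borel_measurable P"
      by (simp add: borel_measurable_indicator_iff)
    have iI: "integrable P (indicator {y. M < cmod (K (vsub n x y))} :: _ \<Rightarrow> real)"
      by (rule P.integrable_const_bound[where B=1]) (auto simp: indicator_def)
    have "N * (\<integral>y. indicator {y. M < cmod (K (vsub n x y))} y \<partial>P) + N * (\<integral>y. (cmod (\<phi> y))\<^sup>2 \<partial>P) / M\<^sup>2
      \<le> N * (\<integral>y. indicator {y. M < cmod (K (vsub n x y))} y \<partial>P) + N * (\<integral>y. (cmod (KM M (vsub n x y)))\<^sup>2 \<partial>P) / M\<^sup>2"
      by (intro add_left_mono divide_right_mono mult_left_mono \<phi>2) auto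
    also have "\<dots> = (N / M) * (\<integral>y. M * indicator {y. M < cmod (K (vsub n x y))} y + (cmod (KM M (vsub n x y)))\<^sup>2 / M \<partial>P)"
      using iI iKM2 M by (simp add: power2_eq_square field_simps)
    also have "(\<integral>y. M * indicator {y. M < cmod (K (vsub n x y))} y + (cmod (KM M (vsub n x y)))\<^sup>2 / M \<partial>P) = (\<integral>y. vM M (vsub n x y) \<partial>P)"
      by (rule Bochner_Integration.integral_cong) (auto simp: vM_def KM_def indicator_def)
    also have "\<dots> = VM M f x / m" unfolding VM_def by (subst intP) auto
    also have "(N / M) * (VM M f x / m) = VM M f x / s"
      using N M m s Npos by (simp add: field_simps)
    finally show "N * (\<integral>y. indicator {y. M < cmod (K (vsub n x y))} y \<partial>P) + N * (\<integral>y. (cmod (\<phi> y))\<^sup>2 \<partial>P) / M\<^sup>2 \<le> VM M f x / s" .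
  qed
  finally show "emeasure PN {c \<in> space PN. s < cmod (of_real (m / N) * (\<Sum>k<N. K (vsub n x (c k))) - TM M (\<lambda>y. of_real (f y)) x)} \<le> ennreal (VM M f x / s)" .
qed

text \<open>For each x in E the bound on \<open>VM\<close> makes sampling fail with probability at
  most 1/10, so with probability at least 9/10 the random point masses exceed 9/10 \<mu> at x. After
  exchanging the order of integration, 9/10 |E| is at most the mean measure of the level sets of the
  random configurations, and \<open>dirac_weak\<close> bounds each of them.\<close>

lemma TM_weak_set:
  fixes f :: "(nat \<Rightarrow> real) \<Rightarrow> real"
  assumes D: "dirac_weak \<sigma>" and f0: "\<And>y. f y \<ge> 0" and f: "integrable (Rn n) f"
    and M: "M > 0" and \<mu>: "\<mu> > 0" and E[measurable]: "E \<in> sets (Rn n)"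
    and big: "\<And>x. x \<in> E \<Longrightarrow> \<mu> < cmod (TM M (\<lambda>y. of_real (f y)) x)"
    and V: "\<And>x. x \<in> E \<Longrightarrow> VM M f x \<le> \<mu> / 110"
  shows "emeasure (Rn n) E \<le> ennreal (3 / 2 * \<sigma> * (\<integral>y. f y \<partial>Rn n) / \<mu>)"
proof -
  define m where "m = (\<integral>y. f y \<partial>Rn n)"
  have m0: "m \<ge> 0" unfolding m_def using f0 by simp
  have \<sigma>: "\<sigma> \<ge> 0" using D by (simp add: dirac_weak_def)
  have le: "cmod (TM M (\<lambda>y. of_real (f y)) x) \<le> M * m" for x
    using TM_le[of M "\<lambda>y. of_real (f y)" x] M f f0 by (simp add: m_def)
  show ?thesis
  proof (cases "M * m < \<mu>")
    \<comment> \<open>Here \<open>TM_le\<close> forces E to be empty. In the other case M m / s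
      \<ge> 10, which limits the effect of rounding N.\<close>
    case True
    have "x \<notin> E" for x using big[of x] le[of x] True by linarith
    then have "E = {}" by auto
    then show ?thesis by simp
  next
    case False
    then have mpos: "m > 0" using m0 M \<mu> by (metis less_eq_real_def mult_zero_right)
    define s where "s = \<mu> / 10"
    have s: "s > 0" using \<mu> by (simp add: s_def)
    define N where "N = nat \<lceil>M * m / s\<rceil>"
    have Ms: "M * m / s \<ge> 10" using False s by (simp add: s_def field_simps)
    have N1: "M * m / s \<le> N" unfolding N_def by (rule real_nat_ceiling_ge)
    have N2: "N \<le> M * m / s + 1" unfolding N_def using Ms by linarith
    \<comment> \<open>\<open>random_approximation\<close> requires N s = M m exactly. Rounding M m /
      s up to an integer is compensated by multiplying f by \<theta>, which lies between 1 and
      11/10.\<close>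
    define \<theta> where "\<theta> = N * s / (M * m)"
    have Mm: "M * m > 0" using M mpos by simp
    have \<theta>: "\<theta> \<ge> 1" "\<theta> \<le> 11 / 10"
    proof -
      show "\<theta> \<ge> 1" using N1 s Mm by (simp add: \<theta>_def field_simps)
      have "N * s \<le> M * m + s" using N2 s by (simp add: field_simps)
      also have "\<dots> \<le> 11 / 10 * (M * m)" using Ms s by (simp add: field_simps)
      finally show "\<theta> \<le> 11 / 10" using Mm by (simp add: \<theta>_def field_simps)
    qed
    define f' where "f' y = \<theta> * f y" for y
    have f': "integrable (Rn n) f'" "\<And>y. f' y \<ge> 0" using f f0 \<theta> by (auto simp: f'_def [abs_def])
    have m': "(\<integral>y. f' y \<partial>Rn n) = \<theta> * m" by (simp add: f'_def m_def)
    have m'pos: "\<theta> * m > 0" using \<theta> mpos by simp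
    have NsM: "N * s = M * (\<theta> * m)" using M mpos by (simp add: \<theta>_def)
    have Npos: "N > 0" using N1 Ms by (cases N) auto
    define P where "P = density (Rn n) (\<lambda>y. ennreal (f' y / (\<theta> * m)))"
    define PN where "PN = PiM {..<N} (\<lambda>_::nat. P)"
    note ra = random_approximation[OF f'(2,1) m' m'pos M s NsM, folded P_def, folded PN_def]
    have zero: "(\<lambda>i\<in>{..<n}. 0) \<in> space (Rn n)" by (simp add: space_Rn)
    interpret P: prob_space P by (rule ra(1)[OF zero])
    interpret PN: prob_space PN unfolding PN_def by (rule prob_space_PiM) (rule P.prob_space_axioms)
    interpret pair: pair_sigma_finite "Rn n" PN ..
    have setsP[measurable_cong, simp]: "sets P = sets (Rn n)" by (simp add: P_def)
    have comp'[measurable]: "(\<lambda>c. c k) \<in> measurable PN (Rn n)" if "k < N" for k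
    proof -
      have "(\<lambda>c. c k) \<in> measurable PN P"
        unfolding PN_def by (rule measurable_component_singleton) (use that in simp)
      then show ?thesis by (simp cong: measurable_cong_sets)
    qed
    define a where "a = \<theta> * m / N"
    have a: "a > 0" using m'pos Npos by (simp add: a_def)
    define G where "G x c \<longleftrightarrow> 9 / 10 * \<mu> < cmod (of_real a * (\<Sum>k<N. K (vsub n x (c k))))" for x c
    have G[measurable]: "Measurable.pred (Rn n \<Otimes>\<^sub>M PN) (\<lambda>z. G (fst z) (snd z))"
      unfolding G_def by measurable
    have prob: "ennreal (9 / 10) \<le> emeasure PN {c \<in> space PN. G x c}" if x: "x \<in> E" for x
    proof -
      have xs[measurable]: "x \<in> space (Rn n)" using x E sets.sets_into_space by blast
      let ?T = "TM M (\<lambda>y. of_real (f' y)) x"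
      let ?B = "{c \<in> space PN. s < cmod (of_real (\<theta> * m / N) * (\<Sum>k<N. K (vsub n x (c k))) - ?T)}"
      have "emeasure PN ?B \<le> ennreal (VM M f' x / s)" by (rule ra(2)[OF xs])
      \<comment> \<open>The constant 110 is made for this: 11/10 * \<mu>/110 = \<mu>/100 =
        s/10.\<close>
      moreover have "VM M f' x / s \<le> 1 / 10"
      proof -
        have "VM M f' x = \<theta> * VM M f x" unfolding VM_def f'_def by (simp add: mult.assoc)
        also have "\<dots> \<le> \<theta> * (\<mu> / 110)" using V[OF x] \<theta> by (intro mult_left_mono) auto
        also have "\<dots> \<le> 11 / 10 * (\<mu> / 110)" using \<theta> \<mu> by (intro mult_right_mono) auto
        finally show ?thesis using \<mu> by (simp add: s_def field_simps)
      qed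
      ultimately have "emeasure PN ?B \<le> ennreal (1 / 10)" by (meson ennreal_leI order.trans)
      then have B: "measure PN ?B \<le> 1 / 10" by (simp add: PN.emeasure_eq_measure ennreal_le_iff)
      have "?B \<in> sets PN" by measurable
      then have "measure PN (space PN - ?B) \<ge> 9 / 10" using B by (subst PN.prob_compl) auto
      also have "measure PN (space PN - ?B) \<le> measure PN {c \<in> space PN. G x c}"
      proof (rule PN.finite_measure_mono)
        show "{c \<in> space PN. G x c} \<in> sets PN" unfolding G_def by measurable
        show "space PN - ?B \<subseteq> {c \<in> space PN. G x c}"
        proof
          fix c assume c: "c \<in> space PN - ?B"
          have "?T = of_real \<theta> * TM M (\<lambda>y. of_real (f y)) x"
            unfolding TM_def f'_def by (simp add: mult.left_commute)
          then have "cmod ?T \<ge> 1 * cmod (TM M (\<lambda>y. of_real (f y)) x)"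
            using \<theta> by (simp only: norm_mult norm_of_real) (intro mult_right_mono, auto)
          then have T: "cmod ?T > \<mu>" using big[OF x] by simp
          have "cmod ?T \<le> cmod (of_real a * (\<Sum>k<N. K (vsub n x (c k)))) + cmod (of_real a * (\<Sum>k<N. K (vsub n x (c k))) - ?T)"
            by (metis norm_minus_commute norm_triangle_sub)
          also have "cmod (of_real a * (\<Sum>k<N. K (vsub n x (c k))) - ?T) \<le> s" using c by (auto simp: a_def)
          finally show "c \<in> {c \<in> space PN. G x c}" using c T \<mu> by (simp add: G_def s_def)
        qed
      qed
      finally show ?thesis by (simp add: PN.emeasure_eq_measure ennreal_leI)
    qed
    have meas2: "emeasure (Rn n) {x \<in> space (Rn n). G x c} \<le> ennreal (\<sigma> * (\<theta> * m) / (9 / 10 * \<mu>))" if c: "c \<in> space PN" for c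
    proof -
      have ck: "\<forall>k<N. c k \<in> space (Rn n)" using measurable_space[OF comp' c] by simp
      have "emeasure (Rn n) {x \<in> space (Rn n). G x c} \<le> ennreal (\<sigma> * (N * a) / (9 / 10 * \<mu>))"
        unfolding G_def by (rule D[unfolded dirac_weak_def, THEN conjunct2, rule_format]) (use a ck \<mu> in auto)
      also have "N * a = \<theta> * m" using Npos by (simp add: a_def)
      finally show ?thesis .
    qed
    have "ennreal (9 / 10) * emeasure (Rn n) E = (\<integral>\<^sup>+x. ennreal (9 / 10) * indicator E x \<partial>Rn n)"
      by (simp add: nn_integral_cmult)
    also have "\<dots> \<le> (\<integral>\<^sup>+x. \<integral>\<^sup>+c. indicator {z. G (fst z) (snd z)} (x, c) \<partial>PN \<partial>Rn n)"
    proof (rule nn_integral_mono)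
      fix x assume x: "x \<in> space (Rn n)"
      have "(\<integral>\<^sup>+c. indicator {z. G (fst z) (snd z)} (x, c) \<partial>PN) = (\<integral>\<^sup>+c. indicator {c \<in> space PN. G x c} c \<partial>PN)"
        by (rule nn_integral_cong) (auto simp: indicator_def)
      also have "\<dots> = emeasure PN {c \<in> space PN. G x c}"
        using x unfolding G_def by (intro nn_integral_indicator) measurable
      finally show "ennreal (9 / 10) * indicator E x \<le> (\<integral>\<^sup>+c. indicator {z. G (fst z) (snd z)} (x, c) \<partial>PN)"
        using prob[of x] by (auto simp: indicator_def)
    qed
    also have "\<dots> = (\<integral>\<^sup>+c. \<integral>\<^sup>+x. indicator {z. G (fst z) (snd z)} (x, c) \<partial>Rn n \<partial>PN)"
      by (rule pair.Fubini'[symmetric]) (simp add: split_beta')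
    also have "\<dots> \<le> (\<integral>\<^sup>+c. ennreal (\<sigma> * (\<theta> * m) / (9 / 10 * \<mu>)) \<partial>PN)"
    proof (rule nn_integral_mono)
      fix c assume c: "c \<in> space PN"
      have ck[measurable]: "c k \<in> space (Rn n)" if "k < N" for k by (rule measurable_space[OF comp'[OF that] c])
      have "(\<integral>\<^sup>+x. indicator {z. G (fst z) (snd z)} (x, c) \<partial>Rn n) = (\<integral>\<^sup>+x. indicator {x \<in> space (Rn n). G x c} x \<partial>Rn n)"
        by (rule nn_integral_cong) (auto simp: indicator_def)
      also have "\<dots> = emeasure (Rn n) {x \<in> space (Rn n). G x c}"
        using ck unfolding G_def by (intro nn_integral_indicator) measurable
      finally show "(\<integral>\<^sup>+x. indicator {z. G (fst z) (snd z)} (x, c) \<partial>Rn n) \<le> ennreal (\<sigma> * (\<theta> * m) / (9 / 10 * \<mu>))"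
        using meas2[OF c] by simp
    qed
    also have "\<dots> = ennreal (\<sigma> * (\<theta> * m) / (9 / 10 * \<mu>))" by (simp add: PN.emeasure_space_1)
    finally have "ennreal (10 / 9) * (ennreal (9 / 10) * emeasure (Rn n) E) \<le> ennreal (10 / 9) * ennreal (\<sigma> * (\<theta> * m) / (9 / 10 * \<mu>))"
      by (rule mult_left_mono) simp
    then have "emeasure (Rn n) E \<le> ennreal (10 / 9 * (\<sigma> * (\<theta> * m) / (9 / 10 * \<mu>)))"
      using \<sigma> \<theta> mpos \<mu> by (simp add: mult.assoc[symmetric] ennreal_mult[symmetric])
    \<comment> \<open>The losses 10/9 (probability), 10/9 (level) and 11/10 (rounding) multiply to
      110/81 < 3/2.\<close>
    also have "\<dots> \<le> ennreal (3 / 2 * \<sigma> * m / \<mu>)"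
    proof (rule ennreal_leI)
      have "\<sigma> * m * \<theta> \<le> \<sigma> * m * (11 / 10)" using \<theta> \<sigma> mpos by (intro mult_left_mono) auto
      moreover have "\<sigma> * m \<ge> 0" using \<sigma> mpos by simp
      ultimately have "100 / 81 * (\<sigma> * m * \<theta>) \<le> 3 / 2 * (\<sigma> * m)" by linarith
      then have "100 / 81 * (\<sigma> * m * \<theta>) / \<mu> \<le> 3 / 2 * (\<sigma> * m) / \<mu>" using \<mu> by (intro divide_right_mono) auto
      then show "10 / 9 * (\<sigma> * (\<theta> * m) / (9 / 10 * \<mu>)) \<le> 3 / 2 * \<sigma> * m / \<mu>"
        by (simp add: mult_ac)
    qed
    finally show ?thesis by (simp add: m_def)
  qed
qed

end

subsection \<open>Functions that are locally constant almost everywhere\<close>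

context singular_kernel begin

section \<open>Bounded densities and the truncation defect\<close>

lemma VM_le:
  assumes f: "integrable (Rn n) f" "\<And>y. 0 \<le> f y" "\<And>y. f y \<le> t" and M: "M > 0"
  shows "VM M f x \<le> 4 * t * W"
proof -
  have [measurable]: "f \<in> borel_measurable (Rn n)" using f by auto
  have t: "t \<ge> 0" using f(2,3) order.trans by blast
  have "ennreal (VM M f x) = (\<integral>\<^sup>+y. ennreal (f y * vM M (vsub n x y)) \<partial>Rn n)"
    unfolding VM_def by (rule nn_integral_eq_integral[symmetric, OF integrable_vM_mult[OF M f(1)]])
      (use f vM_nonneg[OF M] in auto)
  also have "\<dots> \<le> (\<integral>\<^sup>+y. ennreal t * ennreal (vM M (vsub n x y)) \<partial>Rn n)"
    using f t vM_nonneg[OF M] by (intro nn_integral_mono) (simp add: ennreal_mult[symmetric] mult_right_mono)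
  also have "\<dots> = ennreal t * (\<integral>\<^sup>+y. ennreal (vM M y) \<partial>Rn n)"
    by (subst nn_integral_cmult) (auto simp: nn_integral_vsub_left[where F="\<lambda>y. ennreal (vM M y)"])
  also have "\<dots> \<le> ennreal t * ennreal (4 * W)" by (rule mult_left_mono[OF nn_integral_vM[OF M]]) simp
  also have "\<dots> = ennreal (4 * t * W)" using t W_nonneg by (simp add: ennreal_mult[symmetric] mult_ac)
  finally show ?thesis using t W_nonneg by (subst (asm) ennreal_le_iff) auto
qed

text \<open>\<open>VM_le\<close> bounds \<open>VM\<close> by 4 t W everywhere, so \<mu> \<ge> 440 t
  W with 440 = 4 * 110 is exactly what \<open>TM_weak_set\<close> needs.\<close>

lemma TM_weak_bounded:
  fixes f :: "(nat \<Rightarrow> real) \<Rightarrow> real"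
  assumes D: "dirac_weak \<sigma>" and f: "integrable (Rn n) f" "\<And>y. 0 \<le> f y" "\<And>y. f y \<le> t"
    and M: "M > 0" and \<mu>: "\<mu> > 0" "\<mu> \<ge> 440 * t * W"
  shows "emeasure (Rn n) {x \<in> space (Rn n). \<mu> < cmod (TM M (\<lambda>y. of_real (f y)) x)} \<le> ennreal (3 / 2 * \<sigma> * (\<integral>y. f y \<partial>Rn n) / \<mu>)"
proof (rule TM_weak_set[OF D f(2,1) M \<mu>(1)])
  have [measurable]: "f \<in> borel_measurable (Rn n)" using f by auto
  show "{x \<in> space (Rn n). \<mu> < cmod (TM M (\<lambda>y. of_real (f y)) x)} \<in> sets (Rn n)" by measurable
  show "VM M f x \<le> \<mu> / 110" for x using VM_le[OF f M, of x] \<mu> by simp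
qed simp

text \<open>Truncated by distance, this integral would vanish by the mean zero of \<Omega>.
  Truncation by size keeps in each direction the radii with r^n \<ge> |\<Omega>|/M, so the value is
  1/n times the integral of \<Omega> ln(M/|\<Omega>|) over |\<Omega>| < M, a quantity of L log L
  type.\<close>

definition bM :: "real \<Rightarrow> complex" where
  "bM M = (\<integral>w. KM M w * of_real (indicator {..<1} (vnorm n w)) \<partial>Rn n)"

lemma finite_ball: "emeasure (Rn n) {y \<in> space (Rn n). vnorm n (vsub n x y) < r} < \<infinity>"
proof -
  have "emeasure (Rn n) {y \<in> space (Rn n). vnorm n (vsub n x y) < r} \<le> emeasure (Rn n) {y \<in> space (Rn n). vnorm n (vsub n x y) \<le> max r 0}"
    by (rule emeasure_mono) auto
  also have "\<dots> \<le> ennreal ((2 * max r 0) ^ n)" by (rule emeasure_Rn_ball_le) simp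
  finally show ?thesis by (rule le_less_trans) simp
qed

lemma integrable_ball:
  "integrable (Rn n) (\<lambda>y. indicator {..<r} (vnorm n (vsub n x y)) :: real)"
proof -
  have "integrable (Rn n) (indicator {y \<in> space (Rn n). vnorm n (vsub n x y) < r} :: _ \<Rightarrow> real)"
    using finite_ball[of x r] by (intro integrable_real_indicator) auto
  then show ?thesis
    by (rule Bochner_Integration.integrable_cong[THEN iffD1, rotated -1]) (auto simp: indicator_def)
qed

lemma KM_tendsto: "((\<lambda>M. KM M w) \<longlongrightarrow> K w) at_top"
  by (rule tendsto_eventually) (use eventually_ge_at_top[of "cmod (K w)"] in \<open>eventually_elim, simp add: KM_def\<close>)

lemma vM_tendsto: "((\<lambda>M. vM M w) \<longlongrightarrow> 0) at_top"
proof -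
  have "((\<lambda>M. (cmod (K w))\<^sup>2 / M) \<longlongrightarrow> 0) at_top"
    by (intro tendsto_divide_0[OF tendsto_const] filterlim_at_top_imp_at_infinity filterlim_ident)
  then show ?thesis
    by (rule Lim_transform_eventually)
       (use eventually_ge_at_top[of "cmod (K w)"] in \<open>eventually_elim, simp add: vM_def\<close>)
qed

lemma TM_alt:
  assumes [measurable]: "f \<in> borel_measurable (Rn n)"
  shows "TM M f x = (\<integral>w. KM M w * f (vsub n x w) \<partial>Rn n)"
proof -
  have "(\<integral>w. KM M w * f (vsub n x w) \<partial>Rn n) = (\<integral>y. KM M (vsub n x y) * f (vsub n x (vsub n x y)) \<partial>Rn n)"
    by (rule integral_vsub_left[symmetric]) measurable
  also have "\<dots> = TM M f x"
    unfolding TM_def by (rule Bochner_Integration.integral_cong) (auto simp: vsub_vsub)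
  finally show ?thesis by simp
qed

text \<open>The constants \<open>bM M\<close> measure how truncation by the size of the kernel deviates from truncation by the
  distance. They are controlled by testing on the indicator of the unit ball: by the chord identity,
  \<open>TM M 1\<^sub>B x + TM M 1\<^sub>B (-x)\<close> tends to \<open>2 bM M\<close> inside the ball.\<close>

lemma TM_ball_symmetric:
  assumes x: "vnorm n x < 1"
  defines "B \<equiv> \<lambda>y. of_real (indicator {..<1} (vnorm n y)) :: complex"
  shows "((\<lambda>M. TM M B x + TM M B (vscale n (-1) x) - 2 * bM M) \<longlongrightarrow> 0) at_top"
proof -
  define \<psi> :: "(nat \<Rightarrow> real) \<Rightarrow> real" where
    "\<psi> w = indicator {..<1::real} (vnorm n (vsub n w x)) + indicator {..<1} (vnorm n (vsub n w (vscale n (-1) x)))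
     - 2 * indicator {..<1} (vnorm n w)" for w
  note ch = integral_K_chords[OF x, folded \<psi>_def]
  have [measurable]: "B \<in> borel_measurable (Rn n)" unfolding B_def by measurable
  have [measurable]: "\<psi> \<in> borel_measurable (Rn n)"
  proof -
    have [measurable]: "(\<lambda>w. vsub n w x) \<in> measurable (Rn n) (Rn n)" by measurable
    show ?thesis unfolding \<psi>_def by measurable
  qed
  have n0: "vnorm n y = vnorm n (vsub n (\<lambda>i. 0) y)" for y by (simp add: vnorm_def vsub_def)
  have iB: "integrable (Rn n) (\<lambda>w. B (vsub n z w))" for z
    unfolding B_def by (rule integrable_of_real[OF integrable_ball])
  have iB': "integrable (Rn n) (\<lambda>w. of_real (indicator {..<1} (vnorm n w)) :: complex)"
    using integrable_ball[of 1 "\<lambda>i. 0"] by (simp add: n0[symmetric])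
  have iK: "integrable (Rn n) (\<lambda>w. KM M w * g w)" if "integrable (Rn n) g" "M \<ge> 0" for g M
  proof (rule Bochner_Integration.integrable_bound)
    show "integrable (Rn n) (\<lambda>y. M * cmod (g y))" using that by auto
    show "(\<lambda>y. KM M y * g y) \<in> borel_measurable (Rn n)" using that by measurable
  qed (use that KM_le in \<open>auto simp: norm_mult intro!: mult_right_mono\<close>)
  have eq: "TM M B x + TM M B (vscale n (-1) x) - 2 * bM M = (\<integral>w. KM M w * of_real (\<psi> w) \<partial>Rn n)" if "M \<ge> 0" for M
  proof -
    have "TM M B x + TM M B (vscale n (-1) x) - 2 * bM M = (\<integral>w. KM M w * B (vsub n x w) + KM M w * B (vsub n (vscale n (-1) x) w)
       - 2 * (KM M w * of_real (indicator {..<1} (vnorm n w))) \<partial>Rn n)"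
      unfolding TM_alt[OF \<open>B \<in> borel_measurable (Rn n)\<close>] bM_def
      using iK[OF iB that] iK[OF iB' that] by simp
    also have "\<dots> = (\<integral>w. KM M w * of_real (\<psi> w) \<partial>Rn n)"
      by (rule Bochner_Integration.integral_cong) (auto simp: B_def \<psi>_def algebra_simps vnorm_vsub_commute[of n x] vnorm_vsub_commute[of n "vscale n (-1) x"])
    finally show ?thesis .
  qed
  have "((\<lambda>M. \<integral>w. KM M w * of_real (\<psi> w) \<partial>Rn n) \<longlongrightarrow> (\<integral>w. K w * of_real (\<psi> w) \<partial>Rn n)) at_top"
  proof (rule integral_dominated_convergence_at_top)
    show "integrable (Rn n) (\<lambda>w. cmod (K w * of_real (\<psi> w)))" using ch(1) by (rule integrable_norm)
    show "AE w in Rn n. ((\<lambda>M. KM M w * of_real (\<psi> w)) \<longlongrightarrow> K w * of_real (\<psi> w)) at_top"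
      by (intro AE_I2 tendsto_mult KM_tendsto tendsto_const)
    show "\<forall>\<^sub>F M in at_top. AE w in Rn n. norm (KM M w * of_real (\<psi> w)) \<le> cmod (K w * of_real (\<psi> w))"
      by (intro always_eventually allI AE_I2) (simp add: norm_mult mult_right_mono KM_le)
  qed measurable
  then show ?thesis
    unfolding ch(2) by (rule Lim_transform_eventually) (use eventually_ge_at_top[of 0] in \<open>eventually_elim, simp add: eq\<close>)
qed

text \<open>If |bM| > \<beta> along a sequence of values M, then for every x in the unit ball B the
  modulus of \<open>TM\<close> applied to its indicator eventually exceeds \<mu> at x or at -x.
  Fatou's lemma bounds |B| by twice the lim inf of the measures of these level sets, hence by 2 *
  3/2 \<sigma> |B| / \<mu>, which is less than |B| as \<mu> > 3 \<sigma>.\<close>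

lemma bM_bound:
  assumes D: "dirac_weak \<sigma>" and \<beta>: "\<beta> > 3 * \<sigma> + 440 * W"
  shows "\<forall>\<^sub>F M in at_top. cmod (bM M) \<le> \<beta>"
proof (rule ccontr)
  assume "\<not> ?thesis"
  then have freq: "\<exists>M>z. cmod (bM M) > \<beta>" for z
    by (force simp: eventually_at_top_dense not_le)
  define Mk where "Mk k = (SOME M. M > real k \<and> cmod (bM M) > \<beta>)" for k :: nat
  have Mk: "Mk k > real k" "cmod (bM (Mk k)) > \<beta>" for k
    using someI_ex[OF freq[of "real k"]] by (auto simp: Mk_def)
  have Mk_lim: "filterlim Mk at_top sequentially"
    by (rule filterlim_at_top_mono[OF filterlim_real_sequentially]) (intro always_eventually allI less_imp_le Mk)
  have \<sigma>: "\<sigma> \<ge> 0" using D by (simp add: dirac_weak_def)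
  \<comment> \<open>Strictly between the threshold and \<beta>: above 3 \<sigma> for the
    contradiction, above 440 W for \<open>TM_weak_bounded\<close> with t = 1, and below \<beta> to
    absorb the error in the limit.\<close>
  define \<mu> where "\<mu> = (3 * \<sigma> + 440 * W + \<beta>) / 2"
  have \<mu>: "\<mu> < \<beta>" "\<mu> > 3 * \<sigma>" "\<mu> \<ge> 440 * 1 * W" "\<mu> > 0"
    using \<beta> \<sigma> W_nonneg by (auto simp: \<mu>_def)
  define b :: "(nat \<Rightarrow> real) \<Rightarrow> real" where "b y = indicator {..<1} (vnorm n y)" for y
  let ?Ball = "{y \<in> space (Rn n). vnorm n y < 1}"
  have n0: "vnorm n y = vnorm n (vsub n (\<lambda>i. 0) y)" for y by (simp add: vnorm_def vsub_def)
  have b: "integrable (Rn n) b" "\<And>y. 0 \<le> b y" "\<And>y. b y \<le> 1"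
    using integrable_ball[of 1 "\<lambda>i. 0"] by (auto simp: b_def[abs_def] n0[symmetric])
  define v where "v = (\<integral>y. b y \<partial>Rn n)"
  have Ball_v: "emeasure (Rn n) ?Ball = ennreal v"
  proof -
    have "ennreal v = (\<integral>\<^sup>+y. ennreal (b y) \<partial>Rn n)" unfolding v_def by (rule nn_integral_eq_integral[symmetric]) (use b in auto)
    also have "\<dots> = (\<integral>\<^sup>+y. indicator ?Ball y \<partial>Rn n)" by (rule nn_integral_cong) (auto simp: b_def indicator_def)
    also have "\<dots> = emeasure (Rn n) ?Ball" by (rule nn_integral_indicator) measurable
    finally show ?thesis by simp
  qed
  have v: "v > 0"
  proof -
    have "ennreal ((1 / (2 * n)) ^ n) = emeasure (Rn n) (Pi\<^sub>E {..<n} (\<lambda>i. {0..<0 + 1 / (2 * n)}))"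
      by (rule emeasure_Rn_cube(1)[symmetric]) simp
    also have "\<dots> \<le> emeasure (Rn n) ?Ball"
    proof (rule emeasure_mono)
      show "Pi\<^sub>E {..<n} (\<lambda>i. {0..<0 + 1 / (2 * n)}) \<subseteq> ?Ball"
      proof
        fix y assume y: "y \<in> Pi\<^sub>E {..<n} (\<lambda>i. {0..<0 + 1 / (2 * n)})"
        have "vnorm n y \<le> (\<Sum>i<n. \<bar>y i\<bar>)" by (rule vnorm_le_sum)
        also have "\<dots> \<le> (\<Sum>i<n. 1 / (2 * n))" using y by (intro sum_mono) (auto simp: PiE_def Pi_def abs_le_iff less_imp_le)
        also have "\<dots> < 1" using n by simp
        finally show "y \<in> ?Ball" using y by (auto simp: space_Rn PiE_def)
      qed
    qed measurable
    finally have "(1 / (2 * n)) ^ n \<le> v"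
      unfolding Ball_v using b by (subst (asm) ennreal_le_iff) (auto simp: v_def)
    moreover have "(1 / real (2 * n)) ^ n > 0" using n by simp
    ultimately show ?thesis by linarith
  qed
  define E where "E k = {x \<in> space (Rn n). \<mu> < cmod (TM (Mk k) (\<lambda>y. of_real (b y)) x)}" for k
  have bm[measurable]: "b \<in> borel_measurable (Rn n)" using b by auto
  have E[measurable]: "E k \<in> sets (Rn n)" for k unfolding E_def by measurable
  have Ele: "emeasure (Rn n) (E k) \<le> ennreal (3 / 2 * \<sigma> * v / \<mu>)" for k
    unfolding E_def v_def by (rule TM_weak_bounded[OF D b]) (use \<mu> Mk(1)[of k] in auto)
  have refl: "(\<integral>\<^sup>+x. F (vscale n (-1) x) \<partial>Rn n) = (\<integral>\<^sup>+x. F x \<partial>Rn n)" if "F \<in> borel_measurable (Rn n)" for F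
    using nn_integral_Rn_affine[of "-1" F n "\<lambda>_. 0"] that by (simp add: vscale_def)
  let ?h = "\<lambda>k x. indicator (E k) x + indicator (E k) (vscale n (-1) x) :: ennreal"
  have "ennreal v = (\<integral>\<^sup>+x. indicator ?Ball x \<partial>Rn n)" by (simp add: Ball_v[symmetric])
  also have "\<dots> \<le> (\<integral>\<^sup>+x. liminf (\<lambda>k. ?h k x) \<partial>Rn n)"
  proof (rule nn_integral_mono)
    fix x assume xs: "x \<in> space (Rn n)"
    show "indicator ?Ball x \<le> liminf (\<lambda>k. ?h k x)"
    proof (cases "vnorm n x < 1")
      case True
      have "((\<lambda>k. TM (Mk k) (\<lambda>y. of_real (b y)) x + TM (Mk k) (\<lambda>y. of_real (b y)) (vscale n (-1) x) - 2 * bM (Mk k)) \<longlongrightarrow> 0) sequentially"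
        unfolding b_def by (rule filterlim_compose[OF TM_ball_symmetric[OF True] Mk_lim])
      then have "\<forall>\<^sub>F k in sequentially. cmod (TM (Mk k) (\<lambda>y. of_real (b y)) x + TM (Mk k) (\<lambda>y. of_real (b y)) (vscale n (-1) x) - 2 * bM (Mk k)) < 2 * (\<beta> - \<mu>)"
        using \<mu> by (auto dest: tendstoD[where e="2 * (\<beta> - \<mu>)"])
      then have "\<forall>\<^sub>F k in sequentially. 1 \<le> ?h k x"
      proof eventually_elim
        case (elim k)
        let ?a = "TM (Mk k) (\<lambda>y. of_real (b y)) x" and ?c = "TM (Mk k) (\<lambda>y. of_real (b y)) (vscale n (-1) x)"
        have "2 * cmod (bM (Mk k)) \<le> cmod ?a + cmod ?c + cmod (?a + ?c - 2 * bM (Mk k))"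
        proof -
          have "2 * bM (Mk k) = ?a + ?c - (?a + ?c - 2 * bM (Mk k))" by simp
          then have "cmod (2 * bM (Mk k)) \<le> cmod (?a + ?c) + cmod (?a + ?c - 2 * bM (Mk k))" by (metis norm_triangle_ineq4)
          then show ?thesis using norm_triangle_ineq[of ?a ?c] by (simp add: norm_mult)
        qed
        moreover have "2 * \<mu> < p + q" if "2 * s \<le> p + q + r" "r < 2 * (\<beta> - \<mu>)" "\<beta> < s" for p q r s :: real
        proof -
          have "2 * \<beta> < 2 * s" using that(3) by simp
          also have "\<dots> \<le> p + q + r" by (rule that(1))
          also have "\<dots> < p + q + 2 * (\<beta> - \<mu>)" by (rule add_strict_left_mono[OF that(2)])
          finally show ?thesis by (simp add: right_diff_distrib)
        qed
        ultimately have "2 * \<mu> < cmod ?a + cmod ?c" using elim Mk(2)[of k] by blast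
        then have "\<mu> < cmod ?a \<or> \<mu> < cmod ?c" by (cases "\<mu> < cmod ?a") auto
        then have "x \<in> E k \<or> vscale n (-1) x \<in> E k" using xs by (auto simp: E_def)
        then show ?case by (auto simp: indicator_def)
      qed
      then show ?thesis by (intro Liminf_bounded) (simp add: True xs)
    qed (simp add: indicator_def)
  qed
  also have "\<dots> \<le> liminf (\<lambda>k. \<integral>\<^sup>+x. ?h k x \<partial>Rn n)"
    by (rule nn_integral_liminf) measurable
  also have "(\<lambda>k. \<integral>\<^sup>+x. ?h k x \<partial>Rn n) = (\<lambda>k. 2 * emeasure (Rn n) (E k))"
  proof
    fix k
    have "(\<integral>\<^sup>+x. ?h k x \<partial>Rn n) = (\<integral>\<^sup>+x. indicator (E k) x \<partial>Rn n) + (\<integral>\<^sup>+x. indicator (E k) (vscale n (-1) x) \<partial>Rn n)"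
      by (rule nn_integral_add) measurable
    also have "(\<integral>\<^sup>+x. indicator (E k) (vscale n (-1) x) \<partial>Rn n) = (\<integral>\<^sup>+x. indicator (E k) x \<partial>Rn n)"
      by (rule refl) measurable
    finally show "(\<integral>\<^sup>+x. ?h k x \<partial>Rn n) = 2 * emeasure (Rn n) (E k)" by (simp add: mult_2)
  qed
  also have "liminf (\<lambda>k. 2 * emeasure (Rn n) (E k)) \<le> limsup (\<lambda>k. 2 * emeasure (Rn n) (E k))"
    by (rule Liminf_le_Limsup) simp
  also have "\<dots> \<le> 2 * ennreal (3 / 2 * \<sigma> * v / \<mu>)"
    by (rule Limsup_bounded) (intro always_eventually allI mult_left_mono Ele, simp)
  also have "\<dots> = ennreal (3 * \<sigma> * v / \<mu>)"
  proof -
    have "2 * ennreal (3 / 2 * \<sigma> * v / \<mu>) = ennreal 2 * ennreal (3 / 2 * \<sigma> * v / \<mu>)" by simp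
    also have "\<dots> = ennreal (2 * (3 / 2 * \<sigma> * v / \<mu>))" using \<sigma> v \<mu> by (subst ennreal_mult) auto
    also have "2 * (3 / 2 * \<sigma> * v / \<mu>) = 3 * \<sigma> * v / \<mu>" by simp
    finally show ?thesis .
  qed
  finally have "v \<le> 3 * \<sigma> * v / \<mu>" using \<sigma> v \<mu> by (subst (asm) ennreal_le_iff) auto
  then have "\<mu> * v \<le> 3 * \<sigma> * v" using \<mu> by (simp add: field_simps)
  then show False using v \<mu> by simp
qed

definition TR :: "real \<Rightarrow> ((nat \<Rightarrow> real) \<Rightarrow> complex) \<Rightarrow> (nat \<Rightarrow> real) \<Rightarrow> complex" where
  "TR \<epsilon> f x = (\<integral>y. indicator {y. vnorm n (vsub n x y) \<ge> \<epsilon>} y *\<^sub>R (K (vsub n x y) * f y) \<partial>Rn n)"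

lemma sio_eq: "((\<lambda>\<epsilon>. TR \<epsilon> f x) \<longlongrightarrow> L) (at_right 0) \<Longrightarrow> sio n \<Omega> f x = L"
  unfolding sio_def TR_def by (rule tendsto_Lim) auto

end

definition locconst :: "nat \<Rightarrow> ((nat \<Rightarrow> real) \<Rightarrow> 'b) \<Rightarrow> (nat \<Rightarrow> real) \<Rightarrow> bool" where
  "locconst n f x \<longleftrightarrow> (\<exists>r>0. \<forall>y\<in>space (Rn n). vnorm n (vsub n x y) < r \<longrightarrow> f y = f x)"

text \<open>Local constancy almost everywhere replaces smoothness: near such a point the mean zero
  of \<Omega> makes the truncated integrals constant in \<epsilon>, and indicators of boxes already
  qualify.\<close>

definition nice :: "nat \<Rightarrow> ((nat \<Rightarrow> real) \<Rightarrow> 'b::real_normed_vector) \<Rightarrow> bool" where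
  "nice n f \<longleftrightarrow> f \<in> borel_measurable (Rn n) \<and> (\<exists>B. \<forall>y. norm (f y) \<le> B) \<and>
     (\<exists>R. \<forall>y\<in>space (Rn n). vnorm n y > R \<longrightarrow> f y = 0) \<and> (AE x in Rn n. locconst n f x)"

lemma locconst_compose: "locconst n f x \<Longrightarrow> locconst n (\<lambda>y. g (f y)) x"
  unfolding locconst_def by (auto; metis)

lemma nice_compose:
  fixes f :: "_ \<Rightarrow> 'b::{banach, second_countable_topology}" and g :: "'b \<Rightarrow> 'c::{banach, second_countable_topology}"
  assumes "nice n f" and [measurable]: "g \<in> borel_measurable borel" and "g 0 = 0" and "\<And>z. norm (g z) \<le> L * norm z"
  shows "nice n (\<lambda>y. g (f y))"
proof -
  obtain B R where *: "f \<in> borel_measurable (Rn n)" "\<And>y. norm (f y) \<le> B" "\<And>y. y \<in> space (Rn n) \<Longrightarrow> vnorm n y > R \<Longrightarrow> f y = 0"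
    "AE x in Rn n. locconst n f x" using assms(1) unfolding nice_def by blast
  have L: "norm (g (f y)) \<le> \<bar>L\<bar> * B" for y
  proof -
    have "norm (g (f y)) \<le> L * norm (f y)" by fact
    also have "\<dots> \<le> \<bar>L\<bar> * norm (f y)" by (rule mult_right_mono) auto
    also have "\<dots> \<le> \<bar>L\<bar> * B" by (rule mult_left_mono[OF *(2)]) simp
    finally show ?thesis .
  qed
  have [measurable]: "f \<in> borel_measurable (Rn n)" by fact
  show ?thesis unfolding nice_def
    using *(3) assms(3) L
    by (intro conjI exI[of _ "\<bar>L\<bar> * B"] exI[of _ R]) (auto intro: eventually_mono[OF *(4)] locconst_compose)
qed

context singular_kernel begin

section \<open>Principal values and limits in M at points of local constancy\<close>

lemma nice_integrable:
  fixes f :: "_ \<Rightarrow> 'b::{banach, second_countable_topology}"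
  assumes "nice n f" shows "integrable (Rn n) f"
proof -
  obtain B R where *: "f \<in> borel_measurable (Rn n)" "\<And>y. norm (f y) \<le> B" "\<And>y. y \<in> space (Rn n) \<Longrightarrow> vnorm n y > R \<Longrightarrow> f y = 0"
    using assms unfolding nice_def by blast
  have n0: "vnorm n y = vnorm n (vsub n (\<lambda>i. 0) y)" for y by (simp add: vnorm_def vsub_def)
  show ?thesis
  proof (rule Bochner_Integration.integrable_bound)
    show "integrable (Rn n) (\<lambda>y. B * indicator {..<R + 1} (vnorm n (vsub n (\<lambda>i. 0) y)) :: real)"
      using integrable_ball by auto
    show "AE y in Rn n. norm (f y) \<le> norm (B * indicator {..<R + 1} (vnorm n (vsub n (\<lambda>i. 0) y)) :: real)"
    proof (rule AE_I2)
      fix y assume y: "y \<in> space (Rn n)"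
      have "B \<ge> 0" using *(2)[of y] norm_ge_zero order.trans by blast
      then show "norm (f y) \<le> norm (B * indicator {..<R + 1} (vnorm n (vsub n (\<lambda>i. 0) y)) :: real)"
        using *(2)[of y] *(3)[OF y] by (cases "vnorm n y > R") (auto simp: n0[symmetric] indicator_def)
    qed
  qed fact
qed

lemma integrable_K_sub:
  assumes "0 < a" and [measurable]: "g \<in> borel_measurable (Rn n)"
    and g: "\<And>y. y \<in> space (Rn n) \<Longrightarrow> cmod (g y) \<le> B * indicator {a..b} (vnorm n (vsub n x y))" and B: "B \<ge> 0"
  shows "integrable (Rn n) (\<lambda>y. K (vsub n x y) * g y)"
proof -
  have "integrable (Rn n) (\<lambda>w. K w * g (vsub n x w))"
  proof (rule integrable_K_annulus[OF assms(1) _ _ B])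
    fix w assume "w \<in> space (Rn n)"
    then show "cmod (g (vsub n x w)) \<le> B * indicator {a..b} (vnorm n w)"
      using g[of "vsub n x w"] by (simp add: vsub_vsub)
  qed measurable
  then have "integrable (Rn n) (\<lambda>y. K (vsub n x y) * g (vsub n x (vsub n x y)))"
    by (subst integrable_vsub_left_iff[where F="\<lambda>w. K w * g (vsub n x w)"]) auto
  then show ?thesis
    by (rule Bochner_Integration.integrable_cong[THEN iffD1, rotated -1]) (auto simp: vsub_vsub)
qed

lemma integral_K_sub_annulus:
  assumes "0 < a"
  shows "(\<integral>y. K (vsub n x y) * of_real (indicator {a..<b} (vnorm n (vsub n x y))) \<partial>Rn n) = 0"
  using integral_K_annulus[OF assms, of b]
    integral_vsub_left[of "\<lambda>w. K w * of_real (indicator {a..<b} (vnorm n w))" n x] by simp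

text \<open>Collects the data of a point of local constancy. Distances are measured from x, and r
  \<le> 1 fits the unit ball in the definition of \<open>bM\<close>.\<close>

definition good_at :: "((nat \<Rightarrow> real) \<Rightarrow> 'b::real_normed_vector) \<Rightarrow> (nat \<Rightarrow> real) \<Rightarrow> real \<Rightarrow> real \<Rightarrow> real \<Rightarrow> bool" where
  "good_at f x B r R \<longleftrightarrow> x \<in> space (Rn n) \<and> f \<in> borel_measurable (Rn n) \<and> B \<ge> 0 \<and> (\<forall>y. norm (f y) \<le> B) \<and> 0 < r \<and> r \<le> 1 \<and> r < R \<and>
    (\<forall>y\<in>space (Rn n). vnorm n (vsub n x y) < r \<longrightarrow> f y = f x) \<and> (\<forall>y\<in>space (Rn n). vnorm n (vsub n x y) > R \<longrightarrow> f y = 0)"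

lemma good_atE:
  assumes "nice n f" "locconst n f x" "x \<in> space (Rn n)"
  obtains B r R where "good_at f x B r R"
proof -
  obtain B R where *: "f \<in> borel_measurable (Rn n)" "\<And>y. norm (f y) \<le> B" "\<And>y. y \<in> space (Rn n) \<Longrightarrow> vnorm n y > R \<Longrightarrow> f y = 0"
    using assms(1) unfolding nice_def by blast
  obtain r where r: "r > 0" "\<And>y. y \<in> space (Rn n) \<Longrightarrow> vnorm n (vsub n x y) < r \<Longrightarrow> f y = f x"
    using assms(2) unfolding locconst_def by blast
  have "B \<ge> 0" using *(2)[of x] norm_ge_zero order.trans by blast
  moreover have "f y = 0" if "y \<in> space (Rn n)" "vnorm n (vsub n x y) > max 2 (vnorm n x + R)" for y
    using that vnorm_vsub_le[of n x y] by (intro *(3)) auto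
  ultimately have "good_at f x B (min r 1) (max 2 (vnorm n x + R))"
    unfolding good_at_def using * r assms(3) by auto
  then show ?thesis by (rule that)
qed

lemma good_at_integrable:
  assumes "good_at f x B r R" "0 < \<epsilon>"
  shows "integrable (Rn n) (\<lambda>y. indicator {y. vnorm n (vsub n x y) \<ge> \<epsilon>} y *\<^sub>R (K (vsub n x y) * f y))"
proof -
  have [measurable]: "f \<in> borel_measurable (Rn n)" "x \<in> space (Rn n)" using assms(1) by (auto simp: good_at_def)
  have "integrable (Rn n) (\<lambda>y. K (vsub n x y) * (of_real (indicator {\<epsilon>..} (vnorm n (vsub n x y))) * f y))"
    by (rule integrable_K_sub[where a=\<epsilon> and b=R and B=B])
       (use assms in \<open>auto simp: good_at_def indicator_def norm_mult not_le\<close>)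
  then show ?thesis
    by (rule Bochner_Integration.integrable_cong[THEN iffD1, rotated -1]) (auto simp: indicator_def)
qed

text \<open>On \<epsilon> \<le> |x - y| < r the function equals f x, and the integral of the kernel
  over this annulus vanishes.\<close>

lemma good_at_TR:
  assumes g: "good_at f x B r R" and e: "0 < \<epsilon>" "\<epsilon> \<le> r"
  shows "TR \<epsilon> f x = TR r f x"
proof -
  have [measurable]: "f \<in> borel_measurable (Rn n)" "x \<in> space (Rn n)" using g by (auto simp: good_at_def)
  have "TR \<epsilon> f x - TR r f x = (\<integral>y. indicator {y. vnorm n (vsub n x y) \<ge> \<epsilon>} y *\<^sub>R (K (vsub n x y) * f y)
       - indicator {y. vnorm n (vsub n x y) \<ge> r} y *\<^sub>R (K (vsub n x y) * f y) \<partial>Rn n)"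
    unfolding TR_def using good_at_integrable[OF g e(1)] good_at_integrable[OF g] e
    by (subst Bochner_Integration.integral_diff) auto
  also have "\<dots> = (\<integral>y. f x * (K (vsub n x y) * of_real (indicator {\<epsilon>..<r} (vnorm n (vsub n x y)))) \<partial>Rn n)"
    by (rule Bochner_Integration.integral_cong) (use g e in \<open>auto simp: good_at_def indicator_def\<close>)
  also have "\<dots> = 0" using integral_K_sub_annulus[OF e(1), of x r] by simp
  finally show ?thesis by simp
qed

lemma good_at_tendsto:
  assumes g: "good_at f x B r R"
  shows "((\<lambda>\<epsilon>. TR \<epsilon> f x) \<longlongrightarrow> TR r f x) (at_right 0)" "sio n \<Omega> f x = TR r f x"
proof -
  have r: "r > 0" using g by (simp add: good_at_def)
  show 1: "((\<lambda>\<epsilon>. TR \<epsilon> f x) \<longlongrightarrow> TR r f x) (at_right 0)"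
    by (rule tendsto_eventually)
       (use eventually_at_right_less[of "0::real"] eventually_at_right_real[OF r] in \<open>eventually_elim, auto intro: good_at_TR[OF g]\<close>)
  show "sio n \<Omega> f x = TR r f x" by (rule sio_eq[OF 1])
qed

text \<open>Subtracting f x times the indicator of the unit ball around x removes the singularity:
  the difference vanishes near x, so dominated convergence replaces \<open>KM\<close> by
  \<open>K\<close>. The subtracted part is f x * bM M, and with the full kernel its portion over r
  \<le> |x - y| < 1 integrates to 0.\<close>

lemma TM_limit:
  assumes g: "good_at f x B r R"
  shows "((\<lambda>M. TM M f x - f x * bM M) \<longlongrightarrow> sio n \<Omega> f x) at_top"
proof -
  have fm[measurable]: "f \<in> borel_measurable (Rn n)" and x[measurable]: "x \<in> space (Rn n)" 
    and B: "B \<ge> 0" "\<And>y. cmod (f y) \<le> B" and r: "0 < r" "r \<le> 1" "r < R"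
    and near: "\<And>y. y \<in> space (Rn n) \<Longrightarrow> vnorm n (vsub n x y) < r \<Longrightarrow> f y = f x"
    and far: "\<And>y. y \<in> space (Rn n) \<Longrightarrow> vnorm n (vsub n x y) > R \<Longrightarrow> f y = 0" using g by (auto simp: good_at_def)
  let ?b = "\<lambda>y. of_real (indicator {..<1} (vnorm n (vsub n x y))) :: complex"
  let ?g = "\<lambda>y. f y - f x * ?b y"
  have bound: "cmod (?g y) \<le> 2 * B * indicator {r..max R 1} (vnorm n (vsub n x y))" if "y \<in> space (Rn n)" for y
  proof -
    have "cmod (?g y) \<le> cmod (f y) + cmod (f x * ?b y)" by (rule norm_triangle_ineq4)
    also have "\<dots> \<le> B + B" using B by (intro add_mono) (auto simp: norm_mult indicator_def)
    finally show ?thesis using near[OF that] far[OF that] r by (auto simp: indicator_def)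
  qed
  have int: "integrable (Rn n) (\<lambda>y. K (vsub n x y) * ?g y)"
    by (rule integrable_K_sub[OF r(1) _ bound]) (use B in auto)
  have fint: "integrable (Rn n) f"
  proof (rule Bochner_Integration.integrable_bound)
    show "integrable (Rn n) (\<lambda>y. B * indicator {..<R + 1} (vnorm n (vsub n x y)) :: real)" using integrable_ball by auto
    show "AE y in Rn n. norm (f y) \<le> norm (B * indicator {..<R + 1} (vnorm n (vsub n x y)) :: real)"
    proof (rule AE_I2)
      fix y assume "y \<in> space (Rn n)"
      then show "norm (f y) \<le> norm (B * indicator {..<R + 1} (vnorm n (vsub n x y)) :: real)"
        using B(1) B(2)[of y] far[of y] by (cases "vnorm n (vsub n x y) > R") (auto simp: indicator_def)
    qed
  qed fact
  have bint: "integrable (Rn n) ?b" by (rule integrable_of_real[OF integrable_ball])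
  have bM_eq: "bM M = (\<integral>y. KM M (vsub n x y) * ?b y \<partial>Rn n)" for M
    unfolding bM_def using integral_vsub_left[of "\<lambda>w. KM M w * of_real (indicator {..<1} (vnorm n w))" n x] by simp
  have eq: "TM M f x - f x * bM M = (\<integral>y. KM M (vsub n x y) * ?g y \<partial>Rn n)" if "M \<ge> 0" for M
  proof -
    have "TM M f x - f x * bM M = (\<integral>y. KM M (vsub n x y) * f y - f x * (KM M (vsub n x y) * ?b y) \<partial>Rn n)"
      unfolding TM_def bM_eq using integrable_KM_mult[OF that fint, of x] integrable_KM_mult[OF that bint, of x] by simp
    then show ?thesis by (simp add: algebra_simps)
  qed
  have "((\<lambda>M. \<integral>y. KM M (vsub n x y) * ?g y \<partial>Rn n) \<longlongrightarrow> (\<integral>y. K (vsub n x y) * ?g y \<partial>Rn n)) at_top"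
  proof (rule integral_dominated_convergence_at_top)
    show "integrable (Rn n) (\<lambda>y. cmod (K (vsub n x y) * ?g y))" using int by (rule integrable_norm)
    show "AE y in Rn n. ((\<lambda>M. KM M (vsub n x y) * ?g y) \<longlongrightarrow> K (vsub n x y) * ?g y) at_top"
      by (intro AE_I2 tendsto_mult KM_tendsto tendsto_const)
    show "\<forall>\<^sub>F M in at_top. AE y in Rn n. norm (KM M (vsub n x y) * ?g y) \<le> cmod (K (vsub n x y) * ?g y)"
      by (intro always_eventually allI AE_I2) (simp add: norm_mult mult_right_mono KM_le)
  qed measurable
  moreover have "(\<integral>y. K (vsub n x y) * ?g y \<partial>Rn n) = sio n \<Omega> f x"
  proof -
    have i2: "integrable (Rn n) (\<lambda>y. K (vsub n x y) * of_real (indicator {r..<1} (vnorm n (vsub n x y))))"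
      by (rule integrable_K_sub[where a=r and b=1 and B=1]) (use r in \<open>auto simp: indicator_def\<close>)
    have "(\<integral>y. K (vsub n x y) * ?g y \<partial>Rn n) = (\<integral>y. indicator {y. vnorm n (vsub n x y) \<ge> r} y *\<^sub>R (K (vsub n x y) * f y)
       - f x * (K (vsub n x y) * of_real (indicator {r..<1} (vnorm n (vsub n x y)))) \<partial>Rn n)"
      by (rule Bochner_Integration.integral_cong) (use near r in \<open>auto simp: indicator_def algebra_simps\<close>)
    also have "\<dots> = TR r f x - f x * 0"
      unfolding TR_def using good_at_integrable[OF g r(1)] i2
      by (subst Bochner_Integration.integral_diff) (auto simp: integral_K_sub_annulus[OF r(1), of x 1])
    finally show ?thesis by (simp add: good_at_tendsto(2)[OF g])
  qed
  ultimately have "((\<lambda>M. \<integral>y. KM M (vsub n x y) * ?g y \<partial>Rn n) \<longlongrightarrow> sio n \<Omega> f x) at_top" by simp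
  then show ?thesis
    by (rule Lim_transform_eventually) (use eventually_ge_at_top[of 0] in \<open>eventually_elim, simp add: eq\<close>)
qed

text \<open>The far part tends to 0 by dominated convergence. The mass of \<open>vM\<close>
  concentrates at the origin, so for the near part, where f equals f x, the bound 4 W f x of
  \<open>VM_le\<close> is kept.\<close>

lemma VM_limit:
  fixes f :: "(nat \<Rightarrow> real) \<Rightarrow> real"
  assumes g: "good_at f x B r R" and f0: "\<And>y. f y \<ge> 0" and fint: "integrable (Rn n) f" and \<delta>: "4 * W * f x < \<delta>"
  shows "\<forall>\<^sub>F M in at_top. VM M f x \<le> \<delta>"
proof -
  have fm[measurable]: "f \<in> borel_measurable (Rn n)" and x[measurable]: "x \<in> space (Rn n)" 
    and B: "B \<ge> 0" "\<And>y. norm (f y) \<le> B" and r: "0 < r" "r \<le> 1" "r < R"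
    and near: "\<And>y. y \<in> space (Rn n) \<Longrightarrow> vnorm n (vsub n x y) < r \<Longrightarrow> f y = f x"
    and far: "\<And>y. y \<in> space (Rn n) \<Longrightarrow> vnorm n (vsub n x y) > R \<Longrightarrow> f y = 0" using g by (auto simp: good_at_def)
  let ?h = "\<lambda>y. indicator {r..} (vnorm n (vsub n x y)) * f y"
  have "integrable (Rn n) (\<lambda>y. K (vsub n x y) * of_real (?h y))"
    by (rule integrable_K_sub[where a=r and b=R and B=B])
       (use r B far in \<open>auto simp: indicator_def not_le\<close>)
  then have int: "integrable (Rn n) (\<lambda>y. cmod (K (vsub n x y) * of_real (?h y)))" by (rule integrable_norm)
  have "((\<lambda>M. \<integral>y. ?h y * vM M (vsub n x y) \<partial>Rn n) \<longlongrightarrow> (\<integral>y. ?h y * 0 \<partial>Rn n)) at_top"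
  proof (rule integral_dominated_convergence_at_top[OF _ _ int])
    show "AE y in Rn n. ((\<lambda>M. ?h y * vM M (vsub n x y)) \<longlongrightarrow> ?h y * 0) at_top"
      by (intro AE_I2 tendsto_mult vM_tendsto tendsto_const)
    show "\<forall>\<^sub>F M in at_top. AE y in Rn n. norm (?h y * vM M (vsub n x y)) \<le> cmod (K (vsub n x y) * of_real (?h y))"
      using eventually_gt_at_top[of 0]
    proof eventually_elim
      case (elim M)
      have "\<bar>?h y\<bar> * \<bar>vM M (vsub n x y)\<bar> \<le> \<bar>?h y\<bar> * cmod (K (vsub n x y))" for y
        using vM_nonneg[OF elim, of "vsub n x y"] vM_le[OF elim, of "vsub n x y"] by (intro mult_left_mono) auto
      then show ?case by (simp only: norm_mult norm_of_real real_norm_def abs_mult mult_ac) auto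
    qed
  qed measurable
  then have "\<forall>\<^sub>F M in at_top. (\<integral>y. ?h y * vM M (vsub n x y) \<partial>Rn n) < \<delta> - 4 * W * f x"
    using \<delta> by (intro order_tendstoD(2)) auto
  then show ?thesis using eventually_gt_at_top[of 0]
  proof eventually_elim
    case (elim M)
    have i0: "integrable (Rn n) (\<lambda>y. f x * indicator {..<r} (vnorm n (vsub n x y)) :: real)" using integrable_ball by auto
    have ih: "integrable (Rn n) ?h"
      by (rule Bochner_Integration.integrable_bound[OF fint]) (auto simp: indicator_def)
    have "VM M f x = (\<integral>y. (f x * indicator {..<r} (vnorm n (vsub n x y))) * vM M (vsub n x y) + ?h y * vM M (vsub n x y) \<partial>Rn n)"
      unfolding VM_def by (rule Bochner_Integration.integral_cong) (use near in \<open>auto simp: indicator_def\<close>)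
    also have "\<dots> = VM M (\<lambda>y. f x * indicator {..<r} (vnorm n (vsub n x y))) x + (\<integral>y. ?h y * vM M (vsub n x y) \<partial>Rn n)"
      unfolding VM_def using integrable_vM_mult[OF elim(2) i0, of x] integrable_vM_mult[OF elim(2) ih, of x]
      by (rule Bochner_Integration.integral_add)
    also have "VM M (\<lambda>y. f x * indicator {..<r} (vnorm n (vsub n x y))) x \<le> 4 * f x * W"
      by (rule VM_le[OF i0]) (use f0 elim in \<open>auto simp: indicator_def\<close>)
    finally show ?case using elim by (simp add: mult_ac)
  qed
qed

text \<open>The exceptional set unites G, where f is too large for sampling to be reliable in the
  limit, with the lim inf L of the sets on which |TM| > \<mu> and \<open>VM\<close> is small. At a
  point of local constancy outside G, a value |T f| > \<mu> + B f would force |TM| > \<mu> for all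
  large M, because TM - f bM converges to T f; as \<open>VM\<close> is eventually small there, the
  point would lie in L.\<close>

lemma sio_weak_nice_nonneg:
  fixes f :: "(nat \<Rightarrow> real) \<Rightarrow> real"
  assumes D: "dirac_weak \<sigma>" and f: "nice n f" and f0: "\<And>y. f y \<ge> 0"
    and B: "\<forall>\<^sub>F M in at_top. cmod (bM M) \<le> B" and \<mu>: "\<mu> > 0"
  shows "\<exists>E\<in>sets (Rn n). emeasure (Rn n) E \<le> ennreal ((3 / 2 * \<sigma> + 440 * W) * (\<integral>y. f y \<partial>Rn n) / \<mu>) \<and>
     (\<forall>x\<in>space (Rn n). locconst n f x \<longrightarrow> x \<notin> E \<longrightarrow> cmod (sio n \<Omega> (\<lambda>y. of_real (f y)) x) \<le> \<mu> + B * f x)"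
proof -
  have fint: "integrable (Rn n) f" by (rule nice_integrable[OF f])
  have [measurable]: "f \<in> borel_measurable (Rn n)" using fint by auto
  have \<sigma>: "\<sigma> \<ge> 0" using D by (simp add: dirac_weak_def)
  define m where "m = (\<integral>y. f y \<partial>Rn n)"
  have m: "m \<ge> 0" unfolding m_def using f0 by simp
  define Mk where "Mk k = real k + 1" for k :: nat
  have Mk_lim: "filterlim Mk at_top sequentially" unfolding Mk_def by real_asymp
  define G where "G = {x \<in> space (Rn n). \<mu> / 110 \<le> 4 * W * f x}"
  define A where "A k = {x \<in> space (Rn n). \<mu> < cmod (TM (Mk k) (\<lambda>y. of_real (f y)) x) \<and> VM (Mk k) f x \<le> \<mu> / 110}" for k
  have [measurable]: "VM M f \<in> borel_measurable (Rn n)" for M unfolding VM_def by measurable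
  have A[measurable]: "A k \<in> sets (Rn n)" for k unfolding A_def by measurable
  have G[measurable]: "G \<in> sets (Rn n)" unfolding G_def by measurable
  have Ale: "emeasure (Rn n) (A k) \<le> ennreal (3 / 2 * \<sigma> * m / \<mu>)" for k
    unfolding m_def by (rule TM_weak_set[OF D f0 fint _ \<mu> A]) (auto simp: A_def Mk_def)
  \<comment> \<open>By continuity from below, a lim inf set inherits the bound that all the A k
    share.\<close>
  define L where "L = (\<Union>j. \<Inter>k\<in>{j..}. A k)"
  have L[measurable]: "L \<in> sets (Rn n)" unfolding L_def by measurable
  have Lle: "emeasure (Rn n) L \<le> ennreal (3 / 2 * \<sigma> * m / \<mu>)"
  proof -
    have "emeasure (Rn n) L = (SUP j. emeasure (Rn n) (\<Inter>k\<in>{j..}. A k))"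
      unfolding L_def by (rule SUP_emeasure_incseq[symmetric]) (auto simp: incseq_def)
    also have "\<dots> \<le> ennreal (3 / 2 * \<sigma> * m / \<mu>)"
    proof (rule SUP_least)
      fix j show "emeasure (Rn n) (\<Inter>k\<in>{j..}. A k) \<le> ennreal (3 / 2 * \<sigma> * m / \<mu>)"
        by (rule order.trans[OF emeasure_mono Ale[of j]]) auto
    qed
    finally show ?thesis .
  qed
  have Gle: "emeasure (Rn n) G \<le> ennreal (440 * W * m / \<mu>)"
  proof -
    have "emeasure (Rn n) G \<le> emeasure (Rn n) {x \<in> space (Rn n). 1 \<le> 440 * W / \<mu> * f x}"
      by (rule emeasure_mono) (use \<mu> in \<open>auto simp: G_def field_simps\<close>)
    also have "\<dots> \<le> (\<integral>\<^sup>+x. ennreal (440 * W / \<mu> * f x) \<partial>Rn n)"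
    proof -
      have "emeasure (Rn n) {x \<in> space (Rn n). 1 \<le> 440 * W / \<mu> * f x} = (\<integral>\<^sup>+x. indicator {x \<in> space (Rn n). 1 \<le> 440 * W / \<mu> * f x} x \<partial>Rn n)"
        by (rule nn_integral_indicator[symmetric]) measurable
      also have "\<dots> \<le> (\<integral>\<^sup>+x. ennreal (440 * W / \<mu> * f x) \<partial>Rn n)"
        by (rule nn_integral_mono) (auto simp: indicator_def)
      finally show ?thesis .
    qed
    also have "\<dots> = ennreal (\<integral>x. 440 * W / \<mu> * f x \<partial>Rn n)"
      by (rule nn_integral_eq_integral) (use fint f0 W_nonneg \<mu> in auto)
    finally show ?thesis by (simp add: m_def)
  qed
  have "emeasure (Rn n) (G \<union> L) \<le> ennreal (440 * W * m / \<mu>) + ennreal (3 / 2 * \<sigma> * m / \<mu>)"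
    by (rule order.trans[OF emeasure_subadditive[OF G L] add_mono[OF Gle Lle]])
  also have "\<dots> = ennreal ((3 / 2 * \<sigma> + 440 * W) * m / \<mu>)"
    using W_nonneg \<sigma> m \<mu> by (simp add: ennreal_plus[symmetric] distrib_right add_divide_distrib del: ennreal_plus)
  finally have GL: "emeasure (Rn n) (G \<union> L) \<le> ennreal ((3 / 2 * \<sigma> + 440 * W) * m / \<mu>)" .
  have "cmod (sio n \<Omega> (\<lambda>y. of_real (f y)) x) \<le> \<mu> + B * f x"
    if x: "x \<in> space (Rn n)" and lc: "locconst n f x" and nG: "x \<notin> G \<union> L" for x
  proof (rule ccontr)
    assume "\<not> ?thesis"
    then have gt: "cmod (sio n \<Omega> (\<lambda>y. of_real (f y)) x) > \<mu> + B * f x" by simp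
    obtain B' r R where g: "good_at f x B' r R" by (rule good_atE[OF f lc x])
    then have g': "good_at (\<lambda>y. complex_of_real (f y)) x B' r R" by (auto simp: good_at_def)
    have "((\<lambda>M. cmod (TM M (\<lambda>y. of_real (f y)) x - of_real (f x) * bM M)) \<longlongrightarrow> cmod (sio n \<Omega> (\<lambda>y. of_real (f y)) x)) at_top"
      by (rule tendsto_norm[OF TM_limit[OF g']])
    from order_tendstoD(1)[OF this gt]
    have "\<forall>\<^sub>F M in at_top. cmod (TM M (\<lambda>y. of_real (f y)) x - of_real (f x) * bM M) > \<mu> + B * f x" .
    moreover have "\<forall>\<^sub>F M in at_top. VM M f x \<le> \<mu> / 110"
      by (rule VM_limit[OF g f0 fint]) (use nG x in \<open>auto simp: G_def not_le\<close>)
    ultimately have "\<forall>\<^sub>F M in at_top. \<mu> < cmod (TM M (\<lambda>y. of_real (f y)) x) \<and> VM M f x \<le> \<mu> / 110"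
      using B
    proof eventually_elim
      case (elim M)
      have "cmod (TM M (\<lambda>y. of_real (f y)) x - of_real (f x) * bM M) \<le> cmod (TM M (\<lambda>y. of_real (f y)) x) + cmod (of_real (f x) * bM M)"
        by (rule norm_triangle_ineq4)
      also have "cmod (of_real (f x) * bM M) \<le> B * f x"
        using f0[of x] elim by (simp add: norm_mult mult.commute[of "f x"] mult_right_mono)
      finally show ?case using elim by simp
    qed
    from eventually_compose_filterlim[OF this Mk_lim]
    have "\<forall>\<^sub>F k in sequentially. x \<in> A k" using x by (auto simp: A_def)
    then have "x \<in> L" by (auto simp: L_def eventually_sequentially)
    with nG show False by simp
  qed
  with GL show ?thesis by (intro bexI[of _ "G \<union> L"]) (auto simp: m_def)
qed

end

text \<open>For j = 0, 1, 2, 3 these are the positive parts of Re z, Im z, -Re z and -Im z. The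
  masses in the hypothesis are positive, so complex densities have to be split in this way.\<close>

definition cpart :: "nat \<Rightarrow> complex \<Rightarrow> real" where
  "cpart j z = max 0 (Re (z * (- \<i>) ^ j))"

lemma cpart_nonneg [simp]: "0 \<le> cpart j z" by (simp add: cpart_def)

lemma cpart_le: "cpart j z \<le> cmod z"
proof -
  have "Re (z * (- \<i>) ^ j) \<le> cmod (z * (- \<i>) ^ j)" by (rule complex_Re_le_cmod)
  then show ?thesis by (simp add: cpart_def norm_mult norm_power)
qed

lemma cpart_0 [simp]: "cpart j 0 = 0" by (simp add: cpart_def)

lemma cpart_measurable [measurable]: "cpart j \<in> borel_measurable borel"
  unfolding cpart_def by measurable

lemma lessThan_4: "{..<4::nat} = {0, 1, 2, 3}" by auto

lemma i_cubed: "\<i> ^ 3 = - \<i>" by (simp add: eval_nat_numeral)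

lemma cpart_sum: "(\<Sum>j<4. \<i> ^ j * of_real (cpart j z)) = z"
  unfolding lessThan_4
  by (simp add: cpart_def complex_eq_iff i_cubed power3_eq_cube max_def)

text \<open>The sum is |Re z| + |Im z|, at most sqrt 2 |z|; 3/2 is a rational majorant.\<close>

lemma cpart_sum_le: "(\<Sum>j<4. cpart j z) \<le> 3 / 2 * cmod z"
proof -
  have "(\<Sum>j<4. cpart j z) = \<bar>Re z\<bar> + \<bar>Im z\<bar>"
    unfolding lessThan_4 by (simp add: cpart_def power3_eq_cube max_def abs_if)
  also have "\<dots> \<le> 3 / 2 * cmod z"
  proof (rule power2_le_imp_le)
    have "(\<bar>Re z\<bar> + \<bar>Im z\<bar>)\<^sup>2 = (Re z)\<^sup>2 + (Im z)\<^sup>2 + 2 * (\<bar>Re z\<bar> * \<bar>Im z\<bar>)" by (simp add: power2_sum)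
    also have "2 * (\<bar>Re z\<bar> * \<bar>Im z\<bar>) \<le> (Re z)\<^sup>2 + (Im z)\<^sup>2"
      using sum_squares_bound[of "\<bar>Re z\<bar>" "\<bar>Im z\<bar>"] by simp
    finally have "(\<bar>Re z\<bar> + \<bar>Im z\<bar>)\<^sup>2 \<le> 2 * (cmod z)\<^sup>2" by (simp add: cmod_power2)
    also have "\<dots> \<le> 9 / 4 * (cmod z)\<^sup>2" by (rule mult_right_mono) auto
    finally show "(\<bar>Re z\<bar> + \<bar>Im z\<bar>)\<^sup>2 \<le> (3 / 2 * cmod z)\<^sup>2"
      by (simp add: power_mult_distrib power2_eq_square)
  qed simp
  finally show ?thesis .
qed

lemma cpart_integral:
  fixes f g :: "'a \<Rightarrow> complex"
  assumes "integrable M (\<lambda>y. g y * f y)" and [measurable]: "f \<in> borel_measurable M" "g \<in> borel_measurable M"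
  shows "integrable M (\<lambda>y. g y * of_real (cpart j (f y)))"
    "(\<integral>y. g y * f y \<partial>M) = (\<Sum>j<4. \<i> ^ j * (\<integral>y. g y * of_real (cpart j (f y)) \<partial>M))"
proof -
  show int: "integrable M (\<lambda>y. g y * of_real (cpart j (f y)))" for j
    by (rule Bochner_Integration.integrable_bound[OF assms(1)])
       (auto simp: norm_mult intro!: mult_left_mono cpart_le)
  have "g y * f y = (\<Sum>j<4. \<i> ^ j * (g y * of_real (cpart j (f y))))" for y
    by (subst cpart_sum[of "f y", symmetric]) (simp add: sum_distrib_left mult_ac)
  then have "(\<integral>y. g y * f y \<partial>M) = (\<integral>y. (\<Sum>j<4. \<i> ^ j * (g y * of_real (cpart j (f y)))) \<partial>M)"
    by simp
  also have "\<dots> = (\<Sum>j<4. \<integral>y. \<i> ^ j * (g y * of_real (cpart j (f y))) \<partial>M)"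
    by (rule Bochner_Integration.integral_sum) (use int in auto)
  finally show "(\<integral>y. g y * f y \<partial>M) = (\<Sum>j<4. \<i> ^ j * (\<integral>y. g y * of_real (cpart j (f y)) \<partial>M))"
    by simp
qed

lemma cpart_integral_sum_le:
  assumes "integrable M f"
  shows "integrable M (\<lambda>y. cpart j (f y))" "(\<Sum>j<4. \<integral>y. cpart j (f y) \<partial>M) \<le> 3 / 2 * (\<integral>y. cmod (f y) \<partial>M)"
proof -
  have [measurable]: "f \<in> borel_measurable M" using assms by auto
  show i: "integrable M (\<lambda>y. cpart j (f y))" for j
    by (rule Bochner_Integration.integrable_bound[OF integrable_norm[OF assms]]) (auto intro: cpart_le)
  have "(\<Sum>j<4. \<integral>y. cpart j (f y) \<partial>M) = (\<integral>y. (\<Sum>j<4. cpart j (f y)) \<partial>M)"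
    by (rule Bochner_Integration.integral_sum[symmetric]) (rule i)
  also have "\<dots> \<le> (\<integral>y. 3 / 2 * cmod (f y) \<partial>M)"
    by (rule integral_mono) (use assms i cpart_sum_le in auto)
  finally show "(\<Sum>j<4. \<integral>y. cpart j (f y) \<partial>M) \<le> 3 / 2 * (\<integral>y. cmod (f y) \<partial>M)" by simp
qed

lemma norm_cpart_sum_le: "cmod (\<Sum>j<4. \<i> ^ j * a j) \<le> (\<Sum>j<4. cmod (a j))"
  by (rule order.trans[OF norm_sum]) (simp add: norm_mult norm_power)

lemma emeasure_UN4_le:
  assumes "\<And>j. j < 4 \<Longrightarrow> E j \<in> sets M" "\<And>j. j < (4::nat) \<Longrightarrow> emeasure M (E j) \<le> ennreal (c * a j)" "c \<ge> 0" "\<And>j. a j \<ge> 0"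
  shows "emeasure M (\<Union>j<4. E j) \<le> ennreal (c * (\<Sum>j<4. a j))"
proof -
  have "emeasure M (\<Union>j<4. E j) \<le> (\<Sum>j<4. emeasure M (E j))"
    by (rule emeasure_subadditive_finite) (use assms in auto)
  also have "\<dots> \<le> (\<Sum>j<4. ennreal (c * a j))" by (intro sum_mono assms) auto
  also have "\<dots> = ennreal (c * (\<Sum>j<4. a j))"
    using assms by (subst sum_ennreal) (auto simp: sum_distrib_left)
  finally show ?thesis .
qed

lemma emeasure_Markov:
  fixes f :: "'a \<Rightarrow> real"
  assumes f: "integrable M f" "\<And>x. f x \<ge> 0" and c: "c > 0"
  shows "{x \<in> space M. c < f x} \<in> sets M" "emeasure M {x \<in> space M. c < f x} \<le> ennreal ((\<integral>x. f x \<partial>M) / c)"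
proof -
  have [measurable]: "f \<in> borel_measurable M" using f by auto
  show m: "{x \<in> space M. c < f x} \<in> sets M" by measurable
  have "emeasure M {x \<in> space M. c < f x} = (\<integral>\<^sup>+x. indicator {x \<in> space M. c < f x} x \<partial>M)"
    by (rule nn_integral_indicator[symmetric, OF m])
  also have "\<dots> \<le> (\<integral>\<^sup>+x. ennreal (f x / c) \<partial>M)"
    by (rule nn_integral_mono) (use c in \<open>auto simp: indicator_def\<close>)
  also have "\<dots> = ennreal (\<integral>x. f x / c \<partial>M)" by (rule nn_integral_eq_integral) (use f c in auto)
  finally show "emeasure M {x \<in> space M. c < f x} \<le> ennreal ((\<integral>x. f x \<partial>M) / c)" by simp
qed

context singular_kernel begin

text \<open>Half of the level goes to the four parts, lam/8 each, and half to the error term, B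
  times the sum of the parts, which Chebyshev's inequality controls. The factors 8 and 2 give 8 (3/2
  \<sigma> + 440 W) + 2 B = 18 \<sigma> + 4400 W + 2, and the 3/2 of \<open>cpart_sum_le\<close>
  turns this into the stated constant.\<close>

lemma sio_weak_nice:
  fixes f :: "(nat \<Rightarrow> real) \<Rightarrow> complex"
  assumes D: "dirac_weak \<sigma>" and f: "nice n f" and lam: "lam > 0"
  shows "\<exists>E\<in>sets (Rn n). emeasure (Rn n) E \<le> ennreal ((27 * \<sigma> + 6600 * W + 3) * (\<integral>y. cmod (f y) \<partial>Rn n) / lam) \<and>
     (AE x in Rn n. x \<notin> E \<longrightarrow> cmod (sio n \<Omega> f x) \<le> lam)"
proof -
  \<comment> \<open>The summand 1 secures the strict inequality required by \<open>bM_bound\<close>;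
    it is the main source of the additive absolute constant in the final estimate.\<close>
  define B where "B = 3 * \<sigma> + 440 * W + 1"
  have \<sigma>: "\<sigma> \<ge> 0" using D by (simp add: dirac_weak_def)
  have B: "\<forall>\<^sub>F M in at_top. cmod (bM M) \<le> B" by (rule bM_bound[OF D]) (simp add: B_def)
  have B0: "B > 0" using \<sigma> W_nonneg by (simp add: B_def add_pos_nonneg)
  have fint: "integrable (Rn n) f" by (rule nice_integrable[OF f])
  have [measurable]: "f \<in> borel_measurable (Rn n)" using fint by auto
  define F where "F = (\<integral>y. cmod (f y) \<partial>Rn n)"
  define a where "a j = (\<integral>y. cpart j (f y) \<partial>Rn n)" for j
  have a0: "a j \<ge> 0" for j by (simp add: a_def)
  have aF: "(\<Sum>j<4. a j) \<le> 3 / 2 * F" unfolding a_def F_def by (rule cpart_integral_sum_le(2)[OF fint])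
  have nj: "nice n (\<lambda>y. cpart j (f y))" for j
    by (rule nice_compose[OF f, where L=1]) (use cpart_le in \<open>auto simp: abs_of_nonneg\<close>)
  have "\<exists>E\<in>sets (Rn n). emeasure (Rn n) E \<le> ennreal ((3 / 2 * \<sigma> + 440 * W) * a j / (lam / 8)) \<and>
     (\<forall>x\<in>space (Rn n). locconst n (\<lambda>y. cpart j (f y)) x \<longrightarrow> x \<notin> E \<longrightarrow> cmod (sio n \<Omega> (\<lambda>y. of_real (cpart j (f y))) x) \<le> lam / 8 + B * cpart j (f x))" for j
    unfolding a_def by (rule sio_weak_nice_nonneg[OF D nj _ B]) (use lam in auto)
  then obtain E where E: "\<And>j. E j \<in> sets (Rn n)" "\<And>j. emeasure (Rn n) (E j) \<le> ennreal ((3 / 2 * \<sigma> + 440 * W) * a j / (lam / 8))"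
    "\<And>j x. x \<in> space (Rn n) \<Longrightarrow> locconst n (\<lambda>y. cpart j (f y)) x \<Longrightarrow> x \<notin> E j \<Longrightarrow> cmod (sio n \<Omega> (\<lambda>y. of_real (cpart j (f y))) x) \<le> lam / 8 + B * cpart j (f x)"
    by metis
  define H where "H = {x \<in> space (Rn n). lam / 2 < B * (\<Sum>j<4. cpart j (f x))}"
  have iH: "integrable (Rn n) (\<lambda>x. B * (\<Sum>j<4. cpart j (f x)))"
    using cpart_integral_sum_le(1)[OF fint] by auto
  have Hle: "H \<in> sets (Rn n)" "emeasure (Rn n) H \<le> ennreal (B * (\<Sum>j<4. a j) / (lam / 2))"
  proof -
    have "(\<integral>x. B * (\<Sum>j<4. cpart j (f x)) \<partial>Rn n) = B * (\<Sum>j<4. a j)"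
      using cpart_integral_sum_le(1)[OF fint] by (simp add: a_def)
    then show "H \<in> sets (Rn n)" "emeasure (Rn n) H \<le> ennreal (B * (\<Sum>j<4. a j) / (lam / 2))"
      using emeasure_Markov[OF iH _ half_gt_zero[OF lam]] B0 by (auto simp: H_def sum_nonneg)
  qed
  have U: "emeasure (Rn n) (\<Union>j<4. E j) \<le> ennreal (8 * (3 / 2 * \<sigma> + 440 * W) / lam * (\<Sum>j<4. a j))"
    by (rule emeasure_UN4_le) (use E a0 \<sigma> W_nonneg lam in \<open>auto simp: mult_ac\<close>)
  have EU: "(\<Union>j<4. E j) \<in> sets (Rn n)" using E by auto
  have "emeasure (Rn n) ((\<Union>j<4. E j) \<union> H) \<le> ennreal (8 * (3 / 2 * \<sigma> + 440 * W) / lam * (\<Sum>j<4. a j)) + ennreal (B * (\<Sum>j<4. a j) / (lam / 2))"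
    by (rule order.trans[OF emeasure_subadditive[OF EU Hle(1)] add_mono[OF U Hle(2)]])
  also have "\<dots> = ennreal (8 * (3 / 2 * \<sigma> + 440 * W) / lam * (\<Sum>j<4. a j) + B * (\<Sum>j<4. a j) / (lam / 2))"
    by (rule ennreal_plus[symmetric])
       (use a0 \<sigma> W_nonneg lam B0 in \<open>auto intro!: mult_nonneg_nonneg divide_nonneg_nonneg sum_nonneg\<close>)
  also have "8 * (3 / 2 * \<sigma> + 440 * W) / lam * (\<Sum>j<4. a j) + B * (\<Sum>j<4. a j) / (lam / 2)
      = (18 * \<sigma> + 4400 * W + 2) / lam * (\<Sum>j<4. a j)"
    using lam by (simp add: B_def field_simps)
  also have "\<dots> \<le> ennreal ((27 * \<sigma> + 6600 * W + 3) * F / lam)"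
  proof (rule ennreal_leI)
    have "(18 * \<sigma> + 4400 * W + 2) / lam * (\<Sum>j<4. a j) \<le> (18 * \<sigma> + 4400 * W + 2) / lam * (3 / 2 * F)"
      by (rule mult_left_mono[OF aF]) (use \<sigma> W_nonneg lam in auto)
    also have "\<dots> = (27 * \<sigma> + 6600 * W + 3) * F / lam" by (simp add: algebra_simps)
    finally show "(18 * \<sigma> + 4400 * W + 2) / lam * (\<Sum>j<4. a j) \<le> (27 * \<sigma> + 6600 * W + 3) * F / lam" .
  qed
  finally have le: "emeasure (Rn n) ((\<Union>j<4. E j) \<union> H) \<le> ennreal ((27 * \<sigma> + 6600 * W + 3) * F / lam)" .
  have "AE x in Rn n. locconst n f x" using f by (simp add: nice_def)
  then have "AE x in Rn n. x \<notin> (\<Union>j<4. E j) \<union> H \<longrightarrow> cmod (sio n \<Omega> f x) \<le> lam"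
    using AE_space
  proof eventually_elim
    case (elim x)
    show ?case
    proof
      assume nE: "x \<notin> (\<Union>j<4. E j) \<union> H"
      obtain B' r R where g: "good_at f x B' r R" by (rule good_atE[OF f elim])
      have "good_at (\<lambda>y. complex_of_real (cpart j (f y))) x B' r R" for j
      proof -
        have "cmod (complex_of_real (cpart j (f y))) \<le> B'" for y
          using g cpart_le[of j "f y"] order.trans by (fastforce simp: good_at_def)
        then show ?thesis using g by (auto simp: good_at_def)
      qed
      note gj = good_at_tendsto(2)[OF this]
      have r: "r > 0" using g by (simp add: good_at_def)
      have [measurable]: "x \<in> space (Rn n)" by (rule elim(2))
      \<comment> \<open>Attaching the indicator to the kernel makes the integrand a fixed factor
        times h, as \<open>cpart_integral\<close> expects.\<close>
      have TR_alt: "TR r h x = (\<integral>y. (of_real (indicator {r..} (vnorm n (vsub n x y))) * K (vsub n x y)) * h y \<partial>Rn n)" for h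
        unfolding TR_def by (rule Bochner_Integration.integral_cong) (auto simp: indicator_def)
      have "integrable (Rn n) (\<lambda>y. (of_real (indicator {r..} (vnorm n (vsub n x y))) * K (vsub n x y)) * f y)"
        using good_at_integrable[OF g r]
        by (rule Bochner_Integration.integrable_cong[THEN iffD1, rotated -1]) (auto simp: indicator_def)
      then have "TR r f x = (\<Sum>j<4. \<i> ^ j * TR r (\<lambda>y. of_real (cpart j (f y))) x)"
        unfolding TR_alt by (rule cpart_integral(2)) measurable
      then have "sio n \<Omega> f x = (\<Sum>j<4. \<i> ^ j * sio n \<Omega> (\<lambda>y. of_real (cpart j (f y))) x)"
        by (simp only: good_at_tendsto(2)[OF g] gj)
      then have "cmod (sio n \<Omega> f x) \<le> (\<Sum>j<4. cmod (sio n \<Omega> (\<lambda>y. of_real (cpart j (f y))) x))"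
        by (simp only: norm_cpart_sum_le)
      also have "\<dots> \<le> (\<Sum>j<4. lam / 8 + B * cpart j (f x))"
        using nE elim by (intro sum_mono E(3)) (auto intro: locconst_compose)
      also have "\<dots> = lam / 2 + B * (\<Sum>j<4. cpart j (f x))" by (simp add: sum.distrib sum_distrib_left)
      also have "\<dots> \<le> lam / 2 + lam / 2" using nE elim by (intro add_left_mono) (auto simp: H_def)
      finally show "cmod (sio n \<Omega> f x) \<le> lam" by simp
    qed
  qed
  with le EU Hle(1) show ?thesis by (intro bexI[of _ "(\<Union>j<4. E j) \<union> H"]) (auto simp: F_def)
qed

end

subsection \<open>Density of locally constant functions\<close>

text \<open>Half-open boxes are an intersection-stable generator. \<open>sets_PiM_sigma\<close>
  produces it from half-open intervals, of which countably many cover the line.\<close>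

lemma sets_Rn_boxes:
  "sets (Rn n) = sigma_sets (space (Rn n)) (range (\<lambda>(a, b). Pi\<^sub>E {..<n} (\<lambda>i. {a i<..b i :: real})))"
proof -
  let ?E = "range (\<lambda>(a, b). {a<..b::real})"
  have cover: "\<exists>S\<subseteq>?E. countable S \<and> (UNIV :: real set) = \<Union>S"
  proof (intro exI conjI)
    show "range (\<lambda>k::nat. {- real k<..real k}) \<subseteq> ?E" by auto
    show "(UNIV :: real set) = \<Union> (range (\<lambda>k::nat. {- real k<..real k}))"
    proof -
      have "x \<in> \<Union> (range (\<lambda>k::nat. {- real k<..real k}))" for x :: real
      proof -
        obtain k :: nat where "\<bar>x\<bar> < real k" using reals_Archimedean2 by blast
        then show ?thesis by (auto intro!: exI[of _ k])
      qed
      then show ?thesis by blast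
    qed
  qed auto
  have "sets (Rn n) = sets (\<Pi>\<^sub>M i\<in>{..<n}. sigma UNIV ?E)"
    unfolding sets_Rn by (simp add: borel_sigma_sets_Ioc)
  also have "\<dots> = sets (sigma (\<Pi>\<^sub>E i\<in>{..<n}. UNIV) {{f\<in>(\<Pi>\<^sub>E i\<in>{..<n}. UNIV). \<forall>i\<in>j. f i \<in> A i} | A j. j \<in> {{..<n}} \<and> A \<in> Pi j (\<lambda>_. ?E)})"
    by (rule sets_PiM_sigma) (use cover in auto)
  also have "{{f\<in>(\<Pi>\<^sub>E i\<in>{..<n}. UNIV). \<forall>i\<in>j. f i \<in> A i} | A j. j \<in> {{..<n}} \<and> A \<in> Pi j (\<lambda>_. ?E)}
     = range (\<lambda>(a, b). Pi\<^sub>E {..<n} (\<lambda>i. {a i<..b i}))" (is "?l = ?r")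
  proof (intro equalityI subsetI)
    fix X assume "X \<in> ?l"
    then obtain A where X: "X = {f\<in>(\<Pi>\<^sub>E i\<in>{..<n}. UNIV). \<forall>i\<in>{..<n}. f i \<in> A i}" and A: "A \<in> Pi {..<n} (\<lambda>_. ?E)" by auto
    have "\<exists>p. A i = {fst p<..snd p}" if "i < n" for i using A that by (auto simp: Pi_def image_iff)
    then obtain p where p: "\<And>i. i < n \<Longrightarrow> A i = {fst (p i)<..snd (p i)}" by metis
    have "X = Pi\<^sub>E {..<n} (\<lambda>i. {fst (p i)<..snd (p i)})"
      unfolding X using p by (auto simp: PiE_def Pi_def)
    then show "X \<in> ?r" by (auto intro!: image_eqI[where x="(\<lambda>i. fst (p i), \<lambda>i. snd (p i))"])
  next
    fix X assume "X \<in> ?r"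
    then obtain a b where X: "X = Pi\<^sub>E {..<n} (\<lambda>i. {a i<..b i})" by auto
    have "X = {f\<in>(\<Pi>\<^sub>E i\<in>{..<n}. UNIV). \<forall>i\<in>{..<n}. f i \<in> {a i<..b i}}"
      unfolding X by (auto simp: PiE_def Pi_def)
    then show "X \<in> ?l" by (intro CollectI exI[of _ "\<lambda>i. {a i<..b i}"] exI[of _ "{..<n}"]) auto
  qed
  finally show ?thesis
    by (subst (asm) sets_measure_of) (auto simp: space_Rn PiE_UNIV_domain PiE_def)
qed

lemma AE_component_neq:
  assumes "i < n" shows "AE x in Rn n. x i \<noteq> c"
proof (rule AE_I')
  let ?N = "Pi\<^sub>E {..<n} (\<lambda>j. if j = i then {c} else UNIV)"
  have "emeasure (Rn n) ?N = 0"
    by (subst emeasure_Rn_PiE) (use assms in \<open>auto intro!: prod_zero bexI[of _ i]\<close>)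
  then show "?N \<in> null_sets (Rn n)" by (auto simp: null_sets_def intro!: PiE_sets_Rn)
  show "{x \<in> space (Rn n). \<not> x i \<noteq> c} \<subseteq> ?N" by (auto simp: space_Rn PiE_def)
qed

text \<open>Off the finitely many hyperplanes that contain the faces, the least distance to them is
  a radius of local constancy.\<close>

lemma nice_box: "nice n (indicator (Pi\<^sub>E {..<n} (\<lambda>i. {a i<..b i :: real})) :: _ \<Rightarrow> real)"
  unfolding nice_def
proof (intro conjI)
  let ?X = "Pi\<^sub>E {..<n} (\<lambda>i. {a i<..b i :: real})"
  have "?X \<in> sets (Rn n)" by (rule PiE_sets_Rn) auto
  then show "indicator ?X \<in> borel_measurable (Rn n)" by simp
  show "\<exists>B. \<forall>y. norm (indicator ?X y :: real) \<le> B" by (intro exI[of _ 1]) (auto simp: indicator_def)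
  show "\<exists>R. \<forall>y\<in>space (Rn n). R < vnorm n y \<longrightarrow> (indicator ?X y :: real) = 0"
  proof (intro exI[of _ "\<Sum>i<n. \<bar>a i\<bar> + \<bar>b i\<bar>"] ballI impI)
    fix y assume y: "(\<Sum>i<n. \<bar>a i\<bar> + \<bar>b i\<bar>) < vnorm n y"
    have "y \<notin> ?X"
    proof
      assume "y \<in> ?X"
      then have "\<bar>y i\<bar> \<le> \<bar>a i\<bar> + \<bar>b i\<bar>" if "i < n" for i using that by (force simp: PiE_def Pi_def abs_if)
      then have "(\<Sum>i<n. \<bar>y i\<bar>) \<le> (\<Sum>i<n. \<bar>a i\<bar> + \<bar>b i\<bar>)" by (intro sum_mono) auto
      with vnorm_le_sum[of n y] y show False by linarith
    qed
    then show "(indicator ?X y :: real) = 0" by simp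
  qed
  have "AE x in Rn n. \<forall>i\<in>{..<n}. x i \<noteq> a i \<and> x i \<noteq> b i"
    by (subst AE_finite_all) (auto intro: AE_component_neq)
  then show "AE x in Rn n. locconst n (indicator ?X :: _ \<Rightarrow> real) x" using AE_space
  proof eventually_elim
    case (elim x)
    define r where "r = Min (insert 1 ((\<lambda>i. min \<bar>x i - a i\<bar> \<bar>x i - b i\<bar>) ` {..<n}))"
    have r: "r > 0" unfolding r_def using elim by (subst Min_gr_iff) auto
    have r': "r \<le> \<bar>x i - a i\<bar>" "r \<le> \<bar>x i - b i\<bar>" if "i < n" for i
    proof -
      have "r \<le> min \<bar>x i - a i\<bar> \<bar>x i - b i\<bar>" unfolding r_def using that by (intro Min_le) auto
      then show "r \<le> \<bar>x i - a i\<bar>" "r \<le> \<bar>x i - b i\<bar>" by auto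
    qed
    have "(indicator ?X y :: real) = indicator ?X x" if y: "y \<in> space (Rn n)" "vnorm n (vsub n x y) < r" for y
    proof -
      have "y i \<in> {a i<..b i} \<longleftrightarrow> x i \<in> {a i<..b i}" if "i < n" for i
      proof -
        have "\<bar>x i - y i\<bar> < r" using component_le_vnorm[OF that, of "vsub n x y"] y that by (simp add: vsub_def)
        then show ?thesis using r'[OF that] by auto
      qed
      then have "y \<in> ?X \<longleftrightarrow> x \<in> ?X" using y elim by (auto simp: PiE_def Pi_def space_Rn)
      then show ?thesis by (simp add: indicator_def)
    qed
    with r show ?case unfolding locconst_def by blast
  qed
qed

lemma nice_add:
  fixes f g :: "_ \<Rightarrow> 'b::{banach, second_countable_topology}"
  assumes "nice n f" "nice n g"
  shows "nice n (\<lambda>x. f x + g x)"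
proof -
  obtain B R where f: "f \<in> borel_measurable (Rn n)" "\<And>y. norm (f y) \<le> B" "\<And>y. y \<in> space (Rn n) \<Longrightarrow> vnorm n y > R \<Longrightarrow> f y = 0"
    "AE x in Rn n. locconst n f x" using assms(1) unfolding nice_def by blast
  obtain B' R' where g: "g \<in> borel_measurable (Rn n)" "\<And>y. norm (g y) \<le> B'" "\<And>y. y \<in> space (Rn n) \<Longrightarrow> vnorm n y > R' \<Longrightarrow> g y = 0"
    "AE x in Rn n. locconst n g x" using assms(2) unfolding nice_def by blast
  have [measurable]: "f \<in> borel_measurable (Rn n)" "g \<in> borel_measurable (Rn n)" by fact+
  show ?thesis unfolding nice_def
  proof (intro conjI)
    show "(\<lambda>x. f x + g x) \<in> borel_measurable (Rn n)" by measurable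
    show "\<exists>B. \<forall>y. norm (f y + g y) \<le> B"
      by (intro exI[of _ "B + B'"] allI order.trans[OF norm_triangle_ineq] add_mono f g)
    show "\<exists>R. \<forall>y\<in>space (Rn n). R < vnorm n y \<longrightarrow> f y + g y = 0"
      using f(3) g(3) by (intro exI[of _ "max R R'"]) auto
    show "AE x in Rn n. locconst n (\<lambda>x. f x + g x) x"
      using f(4) g(4)
    proof eventually_elim
      case (elim x)
      then obtain r s where "r > 0" "\<forall>y\<in>space (Rn n). vnorm n (vsub n x y) < r \<longrightarrow> f y = f x"
        "s > 0" "\<forall>y\<in>space (Rn n). vnorm n (vsub n x y) < s \<longrightarrow> g y = g x" unfolding locconst_def by blast
      then show ?case unfolding locconst_def by (intro exI[of _ "min r s"]) auto
    qed
  qed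
qed

context singular_kernel begin

text \<open>Membership in the L^1 closure of the class \<open>nice\<close>, as a predicate suited to
  induction over sets and over integrable functions.\<close>

definition approx :: "((nat \<Rightarrow> real) \<Rightarrow> 'b::{banach, second_countable_topology}) \<Rightarrow> bool" where
  "approx f \<longleftrightarrow> integrable (Rn n) f \<and> (\<forall>e>0. \<exists>\<phi>. nice n \<phi> \<and> (\<integral>x. norm (f x - \<phi> x) \<partial>Rn n) < e)"

lemma approx_nice: "nice n f \<Longrightarrow> approx f"
  unfolding approx_def by (auto simp: nice_integrable intro!: exI[of _ f])

lemma approx_L1_lim:
  assumes f: "integrable (Rn n) f" and ap: "\<And>e. e > 0 \<Longrightarrow> \<exists>h. approx h \<and> (\<integral>x. norm (f x - h x) \<partial>Rn n) < e"
  shows "approx f"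
  unfolding approx_def
proof (intro conjI f allI impI)
  fix e :: real assume e: "e > 0"
  obtain h where h: "approx h" "(\<integral>x. norm (f x - h x) \<partial>Rn n) < e / 2" using ap[of "e / 2"] e by auto
  obtain \<phi> where \<phi>: "nice n \<phi>" "(\<integral>x. norm (h x - \<phi> x) \<partial>Rn n) < e / 2" using h(1) e unfolding approx_def by (meson half_gt_zero)
  have hi: "integrable (Rn n) h" using h by (simp add: approx_def)
  note pi = nice_integrable[OF \<phi>(1)]
  have "(\<integral>x. norm (f x - \<phi> x) \<partial>Rn n) \<le> (\<integral>x. norm (f x - h x) + norm (h x - \<phi> x) \<partial>Rn n)"
  proof (rule integral_mono)
    show "norm (f x - \<phi> x) \<le> norm (f x - h x) + norm (h x - \<phi> x)" for x
      using norm_triangle_ineq[of "f x - h x" "h x - \<phi> x"] by simp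
  qed (use f hi pi in auto)
  also have "\<dots> = (\<integral>x. norm (f x - h x) \<partial>Rn n) + (\<integral>x. norm (h x - \<phi> x) \<partial>Rn n)"
    using f hi pi by simp
  also have "\<dots> < e" using h \<phi> by simp
  finally show "\<exists>\<phi>. nice n \<phi> \<and> (\<integral>x. norm (f x - \<phi> x) \<partial>Rn n) < e" using \<phi>(1) by blast
qed

lemma approx_add:
  assumes "approx f" "approx g" shows "approx (\<lambda>x. f x + g x)"
  unfolding approx_def
proof (intro conjI allI impI)
  have fi: "integrable (Rn n) f" and gi: "integrable (Rn n) g" using assms by (auto simp: approx_def)
  then show "integrable (Rn n) (\<lambda>x. f x + g x)" by simp
  fix e :: real assume e: "e > 0"
  obtain \<phi> where \<phi>: "nice n \<phi>" "(\<integral>x. norm (f x - \<phi> x) \<partial>Rn n) < e / 2" using assms(1) e unfolding approx_def by (meson half_gt_zero)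
  obtain \<psi> where \<psi>: "nice n \<psi>" "(\<integral>x. norm (g x - \<psi> x) \<partial>Rn n) < e / 2" using assms(2) e unfolding approx_def by (meson half_gt_zero)
  note pi = nice_integrable[OF \<phi>(1)] nice_integrable[OF \<psi>(1)]
  have "(\<integral>x. norm (f x + g x - (\<phi> x + \<psi> x)) \<partial>Rn n) \<le> (\<integral>x. norm (f x - \<phi> x) + norm (g x - \<psi> x) \<partial>Rn n)"
    by (rule integral_mono) (use fi gi pi in \<open>auto intro: norm_diff_triangle_ineq\<close>)
  also have "\<dots> = (\<integral>x. norm (f x - \<phi> x) \<partial>Rn n) + (\<integral>x. norm (g x - \<psi> x) \<partial>Rn n)"
    using fi gi pi by simp
  also have "\<dots> < e" using \<phi> \<psi> by simp
  finally show "\<exists>\<phi>. nice n \<phi> \<and> (\<integral>x. norm (f x + g x - \<phi> x) \<partial>Rn n) < e"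
    using nice_add[OF \<phi>(1) \<psi>(1)] by blast
qed

lemma approx_scaleR:
  fixes f :: "_ \<Rightarrow> real" and c :: "'b::{banach, second_countable_topology}"
  assumes "approx f" shows "approx (\<lambda>x. f x *\<^sub>R c)"
  unfolding approx_def
proof (intro conjI allI impI)
  have fi: "integrable (Rn n) f" using assms by (auto simp: approx_def)
  then show "integrable (Rn n) (\<lambda>x. f x *\<^sub>R c)" by simp
  fix e :: real assume e: "e > 0"
  have "e / (norm c + 1) > 0" using e by (simp add: add_nonneg_pos)
  then obtain \<phi> where \<phi>: "nice n \<phi>" "(\<integral>x. norm (f x - \<phi> x) \<partial>Rn n) < e / (norm c + 1)" using assms unfolding approx_def by meson
  have "(\<integral>x. norm (f x *\<^sub>R c - \<phi> x *\<^sub>R c) \<partial>Rn n) = (\<integral>x. norm (f x - \<phi> x) \<partial>Rn n) * norm c"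
    by (simp add: scaleR_diff_left[symmetric])
  also have "\<dots> \<le> (\<integral>x. norm (f x - \<phi> x) \<partial>Rn n) * (norm c + 1)" by (rule mult_left_mono) auto
  also have "\<dots> < e / (norm c + 1) * (norm c + 1)" by (rule mult_strict_right_mono[OF \<phi>(2)]) (simp add: add_nonneg_pos)
  also have "\<dots> = e"
  proof -
    have "norm c + 1 \<noteq> 0" using norm_ge_zero[of c] by linarith
    then show ?thesis by simp
  qed
  finally have "(\<integral>x. norm (f x *\<^sub>R c - \<phi> x *\<^sub>R c) \<partial>Rn n) < e" .
  moreover have "nice n (\<lambda>x. \<phi> x *\<^sub>R c)"
    by (rule nice_compose[OF \<phi>(1), where L="norm c"]) (auto simp: mult.commute)
  ultimately show "\<exists>\<phi>. nice n \<phi> \<and> (\<integral>x. norm (f x *\<^sub>R c - \<phi> x) \<partial>Rn n) < e" by blast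
qed

lemma approx_lim:
  fixes f :: "_ \<Rightarrow> 'b::{banach, second_countable_topology}"
  assumes s: "\<And>i. approx (s i)" and lim: "\<And>x. x \<in> space (Rn n) \<Longrightarrow> (\<lambda>i. s i x) \<longlonglongrightarrow> f x"
    and bound: "\<And>i x. x \<in> space (Rn n) \<Longrightarrow> norm (s i x) \<le> w x" and w: "integrable (Rn n) w" and f: "f \<in> borel_measurable (Rn n)"
  shows "approx f"
proof -
  have sm: "s i \<in> borel_measurable (Rn n)" for i using s[of i] by (auto simp: approx_def)
  have wf: "norm (f x) \<le> w x" if "x \<in> space (Rn n)" for x
    by (rule LIMSEQ_le_const2[OF tendsto_norm[OF lim[OF that]]]) (use bound that in auto)
  have fi: "integrable (Rn n) f"
  proof (rule Bochner_Integration.integrable_bound[OF w f])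
    show "AE x in Rn n. norm (f x) \<le> norm (w x)"
      by (rule AE_I2) (use wf in \<open>force intro: order.trans\<close>)
  qed
  have "(\<lambda>i. \<integral>x. norm (f x - s i x) \<partial>Rn n) \<longlonglongrightarrow> (\<integral>x. 0 \<partial>Rn n)"
  proof (rule integral_dominated_convergence)
    show "integrable (Rn n) (\<lambda>x. 2 * w x)" using w by simp
    show "AE x in Rn n. (\<lambda>i. norm (f x - s i x)) \<longlonglongrightarrow> 0"
    proof (rule AE_I2)
      fix x assume "x \<in> space (Rn n)"
      from tendsto_norm[OF tendsto_diff[OF tendsto_const[of "f x"] lim[OF this]]]
      show "(\<lambda>i. norm (f x - s i x)) \<longlonglongrightarrow> 0" by simp
    qed
    show "AE x in Rn n. norm (norm (f x - s i x)) \<le> 2 * w x" for i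
    proof (rule AE_I2)
      fix x assume x: "x \<in> space (Rn n)"
      show "norm (norm (f x - s i x)) \<le> 2 * w x"
        using norm_triangle_ineq4[of "f x" "s i x"] wf[OF x] bound[OF x, of i] by simp
    qed
  qed (use f sm in measurable)
  then have L: "(\<lambda>i. \<integral>x. norm (f x - s i x) \<partial>Rn n) \<longlonglongrightarrow> 0" by simp
  show ?thesis
  proof (rule approx_L1_lim[OF fi])
    fix e :: real assume "e > 0"
    with L have "\<forall>\<^sub>F i in sequentially. (\<integral>x. norm (f x - s i x) \<partial>Rn n) < e" by (rule order_tendstoD(2))
    then obtain i where "(\<integral>x. norm (f x - s i x) \<partial>Rn n) < e" by (auto simp: eventually_sequentially)
    then show "\<exists>h. approx h \<and> (\<integral>x. norm (f x - h x) \<partial>Rn n) < e" using s by blast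
  qed
qed

lemma approx_sum: "finite I \<Longrightarrow> (\<And>i. i \<in> I \<Longrightarrow> approx (f i)) \<Longrightarrow> approx (\<lambda>x. \<Sum>i\<in>I. f i x)"
proof (induction I rule: finite_induct)
  case empty
  have "nice n (\<lambda>x. 0 :: 'b)" by (auto simp: nice_def locconst_def intro!: AE_I2 exI[of _ "1::real"])
  then show ?case by (simp add: approx_nice)
qed (auto intro: approx_add)

text \<open>A Dynkin class argument. Intersecting with a fixed box X keeps complements integrable:
  the indicator of X - A is that of X minus that of A \<inter> X.\<close>

lemma approx_indicator_box:
  fixes k :: nat
  assumes A: "A \<in> sets (Rn n)"
  defines "X \<equiv> Pi\<^sub>E {..<n} (\<lambda>i. {- real k<..real k})"
  shows "approx (indicator (A \<inter> X) :: _ \<Rightarrow> real)"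
proof -
  let ?G = "range (\<lambda>(a, b). Pi\<^sub>E {..<n} (\<lambda>i. {a i<..b i :: real}))"
  have X: "approx (indicator X :: _ \<Rightarrow> real)" "X \<in> sets (Rn n)"
    unfolding X_def by (rule approx_nice[OF nice_box]) (rule PiE_sets_Rn, simp)
  have wX: "integrable (Rn n) (indicator X :: _ \<Rightarrow> real)" using X by (simp add: approx_def)
  have inter: "Pi\<^sub>E {..<n} (\<lambda>i. {a i<..b i}) \<inter> Pi\<^sub>E {..<n} (\<lambda>i. {c i<..d i}) = Pi\<^sub>E {..<n} (\<lambda>i. {max (a i) (c i)<..min (b i) (d i)})"
    for a b c d :: "nat \<Rightarrow> real" by (auto simp: PiE_def Pi_def)
  have G: "Int_stable ?G" "?G \<subseteq> Pow (space (Rn n))"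
    by (force simp: Int_stable_def inter) (auto simp: space_Rn PiE_def)
  have "A \<in> sigma_sets (space (Rn n)) ?G" using A sets_Rn_boxes by metis
  from G this show ?thesis
  proof (induction rule: sigma_sets_induct_disjoint)
    case (basic A)
    then obtain a b where "A = Pi\<^sub>E {..<n} (\<lambda>i. {a i<..b i})" by auto
    then show ?case unfolding X_def by (simp add: inter) (rule approx_nice[OF nice_box])
  next
    case empty
    show ?case using approx_sum[of "{}"] by simp
  next
    case (compl A)
    have "(indicator ((space (Rn n) - A) \<inter> X) :: _ \<Rightarrow> real) = (\<lambda>x. indicator X x + indicator (A \<inter> X) x *\<^sub>R (-1))"
      using sets.sets_into_space[OF X(2)] by (auto simp: indicator_def fun_eq_iff)
    then show ?case using approx_add[OF X(1) approx_scaleR[OF compl(2), of "-1::real"]] by simp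
  next
    case (union A)
    have Am: "A i \<in> sets (Rn n)" for i using union(2) sets_Rn_boxes by blast
    show ?case
    proof (rule approx_lim[where s="\<lambda>N x. \<Sum>i<N. indicator (A i \<inter> X) x"])
      show "approx (\<lambda>x. \<Sum>i<N. indicator (A i \<inter> X) x :: real)" for N
        by (rule approx_sum) (use union(3) in auto)
      have eq: "(\<Sum>i<N. indicator (A i \<inter> X) x :: real) = indicator ((\<Union>i<N. A i) \<inter> X) x" for N x
      proof -
        have "disjoint_family_on (\<lambda>i. A i \<inter> X) {..<N}" using union(1) by (auto simp: disjoint_family_on_def)
        then show ?thesis by (subst indicator_UN_disjoint[symmetric]) auto
      qed
      show "(\<lambda>N. \<Sum>i<N. indicator (A i \<inter> X) x :: real) \<longlonglongrightarrow> indicator ((\<Union>i. A i) \<inter> X) x" for x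
      proof (cases "x \<in> (\<Union>i. A i) \<inter> X")
        case True
        then obtain j where "x \<in> A j" by auto
        then show ?thesis unfolding eq
          by (intro tendsto_eventually eventually_sequentiallyI[of "Suc j"]) (use True in \<open>auto simp: indicator_def\<close>)
      next
        case False
        then show ?thesis unfolding eq by (intro tendsto_eventually always_eventually) (auto simp: indicator_def)
      qed
      show "norm (\<Sum>i<N. indicator (A i \<inter> X) x :: real) \<le> indicator X x" for N x
        unfolding eq by (auto simp: indicator_def)
    qed (use wX Am X in auto)
  qed
qed

lemma approx_integrable:
  fixes f :: "_ \<Rightarrow> 'b::{banach, second_countable_topology}"
  assumes "integrable (Rn n) f" shows "approx f"
  using assms
proof (induction rule: integrable_induct)
  case (base A c)
  have "approx (indicator A :: _ \<Rightarrow> real)"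
  proof (rule approx_lim)
    let ?X = "\<lambda>k::nat. Pi\<^sub>E {..<n} (\<lambda>i. {- real k<..real k})"
    show "approx (indicator (A \<inter> ?X k) :: _ \<Rightarrow> real)" for k by (rule approx_indicator_box[OF base(1)])
    show "(\<lambda>k. indicator (A \<inter> ?X k) x :: real) \<longlonglongrightarrow> indicator A x" if x: "x \<in> space (Rn n)" for x
    proof -
      obtain k0 :: nat where k0: "(\<Sum>i<n. \<bar>x i\<bar>) < k0" using reals_Archimedean2 by blast
      have "x \<in> ?X k" if "k \<ge> k0" for k
      proof -
        have "\<bar>x i\<bar> < k" if "i < n" for i
        proof -
          have "\<bar>x i\<bar> \<le> (\<Sum>i<n. \<bar>x i\<bar>)" using that by (intro member_le_sum) auto
          then show ?thesis using k0 \<open>k \<ge> k0\<close> by linarith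
        qed
        then show ?thesis using x by (auto simp: space_Rn PiE_def Pi_def abs_less_iff less_imp_le minus_less_iff)
      qed
      then show ?thesis by (intro tendsto_eventually eventually_sequentiallyI[of k0]) (auto simp: indicator_def)
    qed
    show "norm (indicator (A \<inter> ?X k) x :: real) \<le> indicator A x" for k x by (auto simp: indicator_def)
  qed (use base in auto)
  then show ?case by (rule approx_scaleR)
next
  case (add f g)
  then show ?case by (intro approx_add)
next
  case (lim f s)
  show ?case
    by (rule approx_lim[where s=s and w="\<lambda>x. 2 * norm (f x)"]) (use lim in auto)
qed

lemma nice_dense:
  fixes f :: "_ \<Rightarrow> 'b::{banach, second_countable_topology}"
  assumes "integrable (Rn n) f" "e > 0"
  obtains \<phi> where "nice n \<phi>" "(\<integral>x. norm (f x - \<phi> x) \<partial>Rn n) < e"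
  using approx_integrable[OF assms(1)] assms(2) unfolding approx_def by blast

end

subsection \<open>Dyadic cubes\<close>

text \<open>Only the generations k \<ge> 0, of side L / 2^k, are used; each application chooses L so
  large that no cube of generation 0 is exceptional.\<close>

definition dyadic_index :: "nat \<Rightarrow> real \<Rightarrow> nat \<Rightarrow> (nat \<Rightarrow> real) \<Rightarrow> nat \<Rightarrow> int" where
  "dyadic_index n L k x = (\<lambda>i\<in>{..<n}. \<lfloor>x i * 2 ^ k / L\<rfloor>)"

definition dcube :: "nat \<Rightarrow> real \<Rightarrow> nat \<Rightarrow> (nat \<Rightarrow> real) \<Rightarrow> (nat \<Rightarrow> real) set" where
  "dcube n L k x = {y \<in> space (Rn n). dyadic_index n L k y = dyadic_index n L k x}"

lemma dcube_eq:
  assumes "L > 0"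
  shows "dcube n L k x = Pi\<^sub>E {..<n} (\<lambda>i. {\<lfloor>x i * 2 ^ k / L\<rfloor> * (L / 2 ^ k)..<\<lfloor>x i * 2 ^ k / L\<rfloor> * (L / 2 ^ k) + L / 2 ^ k})"
proof -
  have "\<lfloor>s * 2 ^ k / L\<rfloor> = z \<longleftrightarrow> s \<in> {z * (L / 2 ^ k)..<z * (L / 2 ^ k) + L / 2 ^ k}" for s :: real and z :: int
    using assms by (simp add: floor_eq_iff field_simps)
  then show ?thesis
    by (force simp: dcube_def dyadic_index_def space_Rn PiE_def Pi_def fun_eq_iff restrict_def)
qed

lemma dcube_refl: "x \<in> space (Rn n) \<Longrightarrow> x \<in> dcube n L k x"
  by (simp add: dcube_def)

lemma dcube_sets [measurable]: "L > 0 \<Longrightarrow> dcube n L k x \<in> sets (Rn n)"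
  unfolding dcube_eq by (rule PiE_sets_Rn) auto

lemma emeasure_dcube: "L > 0 \<Longrightarrow> emeasure (Rn n) (dcube n L k x) = ennreal ((L / 2 ^ k) ^ n)"
  unfolding dcube_eq by (rule emeasure_Rn_cube(1)) simp

text \<open>floor(s) = floor(2 s) div 2, so equal indices at one generation force equal indices at
  the preceding one.\<close>

lemma dcube_nested:
  assumes "y \<in> dcube n L k x" "j \<le> k"
  shows "dcube n L j y = dcube n L j x"
proof -
  have step: "dyadic_index n L j y = dyadic_index n L j x" if "dyadic_index n L (Suc j) y = dyadic_index n L (Suc j) x" for j
  proof
    fix i
    have *: "\<lfloor>s * 2 ^ j / L\<rfloor> = \<lfloor>s * 2 ^ Suc j / L\<rfloor> div 2" for s :: real
      using floor_divide_real_eq_div[of 2 "s * 2 ^ Suc j / L"] by (simp add: field_simps)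
    show "dyadic_index n L j y i = dyadic_index n L j x i"
      using fun_cong[OF that, of i] by (auto simp: dyadic_index_def restrict_def * simp del: power_Suc split: if_splits)
  qed
  have "dyadic_index n L j y = dyadic_index n L j x"
    using assms(2)
  proof (induction rule: inc_induct)
    case base
    show ?case using assms(1) by (simp add: dcube_def)
  qed (rule step)
  then show ?thesis by (simp add: dcube_def)
qed

lemma cube_diam:
  assumes "y \<in> Pi\<^sub>E {..<n} (\<lambda>i. {c i..<c i + len})" "z \<in> Pi\<^sub>E {..<n} (\<lambda>i. {c i..<c i + len :: real})"
  shows "vnorm n (vsub n y z) \<le> n * len" "vnorm n (vsub n y c) \<le> n * len"
proof -
  have "\<bar>y i - z i\<bar> \<le> len" "\<bar>y i - c i\<bar> \<le> len" if "i < n" for i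
    using PiE_mem[OF assms(1), of i] PiE_mem[OF assms(2), of i] that by (auto simp: abs_if)
  then have "(\<Sum>i<n. \<bar>vsub n y z i\<bar>) \<le> (\<Sum>i<n. len)" "(\<Sum>i<n. \<bar>vsub n y c i\<bar>) \<le> (\<Sum>i<n. len)"
    by (intro sum_mono; simp add: vsub_def)+
  then show "vnorm n (vsub n y z) \<le> n * len" "vnorm n (vsub n y c) \<le> n * len"
    using vnorm_le_sum[of n "vsub n y z"] vnorm_le_sum[of n "vsub n y c"] by auto
qed

lemma dcube_diam:
  assumes "L > 0" "y \<in> dcube n L k x" "x \<in> space (Rn n)"
  shows "vnorm n (vsub n x y) \<le> n * (L / 2 ^ k)"
  using assms(2) dcube_refl[OF assms(3), of L k] unfolding dcube_eq[OF assms(1)] by (intro cube_diam(1))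

context singular_kernel begin

text \<open>The Calderon--Zygmund stopping rule. A cube is bad if the mean of u over it exceeds t.
  Generation 0 is never bad by the size of L, so a first bad cube has a parent that is not bad,
  which limits its mean to 2^n t. First bad cubes are equal or disjoint.\<close>

lemma dyadic_stopping:
  fixes u :: "(nat \<Rightarrow> real) \<Rightarrow> real"
  assumes u: "integrable (Rn n) u" "\<And>x. u x \<ge> 0" and t: "t > 0" and L: "L > 0"
    and tL: "(\<integral>x. u x \<partial>Rn n) \<le> t * L ^ n"
  obtains Q :: "nat \<Rightarrow> (nat \<Rightarrow> real) set" and c :: "nat \<Rightarrow> nat \<Rightarrow> real" and len :: "nat \<Rightarrow> real"
  where "\<And>j. Q j = Pi\<^sub>E {..<n} (\<lambda>i. {c j i..<c j i + len j})" "\<And>j. len j \<ge> 0" "\<And>j. c j \<in> space (Rn n)" "disjoint_family Q"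
    "\<And>j. t * len j ^ n \<le> (\<integral>x. u x * indicator (Q j) x \<partial>Rn n)"
    "\<And>j. (\<integral>x. u x * indicator (Q j) x \<partial>Rn n) \<le> 2 ^ n * t * len j ^ n"
    "\<And>x k. x \<in> space (Rn n) \<Longrightarrow> x \<notin> (\<Union>j. Q j) \<Longrightarrow> (\<integral>y. u y * indicator (dcube n L k x) y \<partial>Rn n) \<le> t * (L / 2 ^ k) ^ n"
proof -
  define I where "I k x = (\<integral>y. u y * indicator (dcube n L k x) y \<partial>Rn n)" for k x
  define bad where "bad k x \<longleftrightarrow> t * (L / 2 ^ k) ^ n < I k x" for k x
  have Iint: "integrable (Rn n) (\<lambda>y. u y * indicator X y)" if "X \<in> sets (Rn n)" for X
    using integrable_real_mult_indicator[OF that u(1)] by (simp add: mult.commute)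
  have I_mono: "I k x \<le> I j x" if "j \<le> k" "x \<in> space (Rn n)" for j k x
    unfolding I_def
  proof (rule integral_mono)
    show "u y * indicator (dcube n L k x) y \<le> u y * indicator (dcube n L j x) y" for y
      using dcube_nested[OF _ that(1), of y n L x] dcube_refl[of y n L j] u(2)[of y]
      by (auto simp: indicator_def dcube_def)
  qed (use Iint L in auto)
  have nb0: "\<not> bad 0 x" for x
  proof -
    have "I 0 x \<le> (\<integral>x. u x \<partial>Rn n)"
      unfolding I_def by (rule integral_mono) (use Iint L u in \<open>auto simp: indicator_def\<close>)
    then show ?thesis using tL by (simp add: bad_def)
  qed
  define U where "U = {x \<in> space (Rn n). \<exists>k. bad k x}"
  define kk where "kk x = (LEAST k. bad k x)" for x
  \<comment> \<open>A first bad cube is encoded by its generation and its index. The possible codes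
    form a countable set, and \<open>to_nat_on\<close> turns them into the labels j of the cubes Q
    j.\<close>
  define key where "key x = (kk x, dyadic_index n L (kk x) x)" for x
  define Kset where "Kset = (UNIV :: nat set) \<times> (Pi\<^sub>E {..<n} (\<lambda>_. UNIV :: int set))"
  have cK: "countable Kset" unfolding Kset_def by (intro countable_SIGMA countable_PiE) auto
  have keyK: "key x \<in> Kset" for x by (auto simp: key_def Kset_def dyadic_index_def)
  define Q where "Q j = {x \<in> U. to_nat_on Kset (key x) = j}" for j
  have cell: "{y \<in> U. key y = key x} = dcube n L (kk x) x" if x: "x \<in> U" for x
  proof (intro equalityI subsetI)
    fix y assume "y \<in> {y \<in> U. key y = key x}"
    then show "y \<in> dcube n L (kk x) x" by (auto simp: key_def dcube_def U_def)
  next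
    fix y assume y: "y \<in> dcube n L (kk x) x"
    have bx: "bad (kk x) x" unfolding kk_def using x by (auto simp: U_def intro: LeastI_ex)
    \<comment> \<open>Up to generation kk x the cubes around x and y coincide, so both points stop
      at the same generation.\<close>
    have same: "bad k y \<longleftrightarrow> bad k x" if "k \<le> kk x" for k
      using dcube_nested[OF y that] by (simp add: bad_def I_def)
    have "kk y = kk x"
      unfolding kk_def[of y]
    proof (rule Least_equality)
      show "bad (kk x) y" using same bx by simp
      fix k assume k: "bad k y"
      show "kk x \<le> k"
      proof (rule ccontr)
        assume "\<not> kk x \<le> k"
        then have "bad k x" using same[of k] k by simp
        then have "kk x \<le> k" unfolding kk_def by (rule Least_le)
        with \<open>\<not> kk x \<le> k\<close> show False by simp
      qed
    qed
    moreover have "y \<in> U" using same[of "kk x"] bx y by (auto simp: U_def dcube_def)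
    ultimately show "y \<in> {y \<in> U. key y = key x}" using y by (simp add: key_def dcube_def)
  qed
  have QU: "(\<Union>j. Q j) = U" by (auto simp: Q_def)
  have ex: "\<exists>c len. Q j = Pi\<^sub>E {..<n} (\<lambda>i. {c i..<c i + len}) \<and> len \<ge> 0 \<and> c \<in> space (Rn n) \<and> t * len ^ n \<le> (\<integral>x. u x * indicator (Q j) x \<partial>Rn n) \<and>
     (\<integral>x. u x * indicator (Q j) x \<partial>Rn n) \<le> 2 ^ n * t * len ^ n" for j
  proof (cases "Q j = {}")
    case True
    \<comment> \<open>A label that is not attained receives a cube of side 0, which is empty because
      n \<ge> 1.\<close>
    let ?c = "\<lambda>i\<in>{..<n}. 0 :: real"
    have "y \<notin> Pi\<^sub>E {..<n} (\<lambda>i. {?c i..<?c i + 0})" for y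
    proof
      assume "y \<in> Pi\<^sub>E {..<n} (\<lambda>i. {?c i..<?c i + 0})"
      from PiE_mem[OF this, of 0] n show False by simp
    qed
    then have "Q j = Pi\<^sub>E {..<n} (\<lambda>i. {?c i..<?c i + 0})" unfolding True by blast
    moreover have "?c \<in> space (Rn n)" by (simp add: space_Rn)
    moreover have "(\<integral>x. u x * indicator (Q j) x \<partial>Rn n) = 0" by (simp add: True)
    moreover have "(0::real) ^ n = 0" using n by (simp add: power_0_left)
    ultimately show ?thesis
      by (intro exI[of _ ?c] exI[of _ "0::real"] conjI) (assumption | simp only: mult_zero_right order_refl)+
  next
    case False
    then obtain x where x: "x \<in> Q j" by auto
    then have xU: "x \<in> U" and xj: "to_nat_on Kset (key x) = j" by (auto simp: Q_def)
    have "Q j = {y \<in> U. key y = key x}"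
      unfolding Q_def using inj_on_to_nat_on[OF cK] keyK xj by (auto simp: inj_on_def)
    then have Qj: "Q j = dcube n L (kk x) x" by (simp add: cell[OF xU])
    have xs: "x \<in> space (Rn n)" using xU by (simp add: U_def)
    have bx: "bad (kk x) x" unfolding kk_def using xU by (auto simp: U_def intro: LeastI_ex)
    then obtain k' where k': "kk x = Suc k'" using nb0 by (cases "kk x") auto
    have nb: "\<not> bad k' x" unfolding kk_def using k' not_less_Least[of k' "\<lambda>k. bad k x"] by (simp add: kk_def)
    have "I (kk x) x \<le> I k' x" using k' xs by (intro I_mono) auto
    also have "\<dots> \<le> t * (L / 2 ^ k') ^ n" using nb by (simp add: bad_def)
    also have "(L / 2 ^ k') ^ n = 2 ^ n * (L / 2 ^ kk x) ^ n"
      unfolding k' by (simp add: power_mult_distrib[symmetric])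
    finally have 2: "I (kk x) x \<le> 2 ^ n * t * (L / 2 ^ kk x) ^ n" by (simp add: mult_ac)
    have 1: "t * (L / 2 ^ kk x) ^ n \<le> I (kk x) x" using bx by (simp add: bad_def)
    let ?c = "\<lambda>i\<in>{..<n}. \<lfloor>x i * 2 ^ kk x / L\<rfloor> * (L / 2 ^ kk x)"
    have "Q j = Pi\<^sub>E {..<n} (\<lambda>i. {?c i..<?c i + L / 2 ^ kk x})"
      unfolding Qj dcube_eq[OF L] by (rule PiE_cong) auto
    then show ?thesis using 1 2 L unfolding I_def Qj[symmetric]
      by (intro exI[of _ ?c] exI[of _ "L / 2 ^ kk x"]) (auto simp: space_Rn)
  qed
  define P where "P j c len \<longleftrightarrow> Q j = Pi\<^sub>E {..<n} (\<lambda>i. {c i..<c i + len}) \<and> len \<ge> 0 \<and> c \<in> space (Rn n) \<and> t * len ^ n \<le> (\<integral>x. u x * indicator (Q j) x \<partial>Rn n) \<and>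
     (\<integral>x. u x * indicator (Q j) x \<partial>Rn n) \<le> 2 ^ n * t * len ^ n" for j c and len :: real
  have "\<exists>c len. P j c len" for j using ex[of j] by (simp only: P_def)
  then obtain c len where c: "\<And>j. P j (c j) (len j)" by metis
  show ?thesis
  proof (rule that[of Q c len])
    show "disjoint_family Q" by (auto simp: disjoint_family_on_def Q_def)
    show "(\<integral>y. u y * indicator (dcube n L k x) y \<partial>Rn n) \<le> t * (L / 2 ^ k) ^ n"
      if "x \<in> space (Rn n)" "x \<notin> (\<Union>j. Q j)" for x k
      using that unfolding QU by (auto simp: U_def bad_def I_def not_less)
  qed (use c[unfolded P_def] in blast)+
qed

text \<open>Each cube has volume at most 1/t times its own share of the integral of u, and the
  shares add up by disjointness.\<close>

lemma stopping_volume: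
  fixes u :: "(nat \<Rightarrow> real) \<Rightarrow> real"
  assumes u: "integrable (Rn n) u" "\<And>x. u x \<ge> 0" and t: "t > 0"
    and Q: "\<And>j. Q j = Pi\<^sub>E {..<n} (\<lambda>i. {c j i..<c j i + len j})" "\<And>j. len j \<ge> 0" "disjoint_family Q"
    "\<And>j. t * len j ^ n \<le> (\<integral>x. u x * indicator (Q j) x \<partial>Rn n)"
  shows "\<And>j. Q j \<in> sets (Rn n)" "\<And>j. emeasure (Rn n) (Q j) = ennreal (len j ^ n)"
    "(\<Sum>j. ennreal (len j ^ n)) \<le> ennreal ((\<integral>x. u x \<partial>Rn n) / t)"
    "emeasure (Rn n) (\<Union>j. Q j) = (\<Sum>j. ennreal (len j ^ n))"
proof -
  show Qs[measurable]: "Q j \<in> sets (Rn n)" for j unfolding Q(1) by (rule PiE_sets_Rn) simp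
  show Qe: "emeasure (Rn n) (Q j) = ennreal (len j ^ n)" for j unfolding Q(1) by (rule emeasure_Rn_cube(1)[OF Q(2)])
  have um[measurable]: "u \<in> borel_measurable (Rn n)" using u by auto
  have "emeasure (Rn n) (\<Union>j. Q j) = (\<Sum>j. emeasure (Rn n) (Q j))"
    by (rule suminf_emeasure[symmetric]) (use Qs Q(3) in auto)
  then show "emeasure (Rn n) (\<Union>j. Q j) = (\<Sum>j. ennreal (len j ^ n))" by (simp add: Qe)
  have "ennreal t * (\<Sum>j. ennreal (len j ^ n)) = (\<Sum>j. ennreal (t * len j ^ n))"
    using t Q(2) by (subst ennreal_suminf_cmult[symmetric]) (simp add: ennreal_mult)
  also have "\<dots> \<le> (\<Sum>j. \<integral>\<^sup>+x. ennreal (u x) * indicator (Q j) x \<partial>Rn n)"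
  proof (rule suminf_le)
    fix j
    have "ennreal (t * len j ^ n) \<le> ennreal (\<integral>x. u x * indicator (Q j) x \<partial>Rn n)" by (rule ennreal_leI[OF Q(4)])
    also have "\<dots> = (\<integral>\<^sup>+x. ennreal (u x * indicator (Q j) x) \<partial>Rn n)"
      by (rule nn_integral_eq_integral[symmetric])
         (use u integrable_real_mult_indicator[OF Qs u(1)] in \<open>auto simp: mult.commute\<close>)
    also have "\<dots> = (\<integral>\<^sup>+x. ennreal (u x) * indicator (Q j) x \<partial>Rn n)"
      by (rule nn_integral_cong) (auto simp: indicator_def)
    finally show "ennreal (t * len j ^ n) \<le> (\<integral>\<^sup>+x. ennreal (u x) * indicator (Q j) x \<partial>Rn n)" .
  qed auto
  also have "\<dots> = (\<integral>\<^sup>+x. (\<Sum>j. ennreal (u x) * indicator (Q j) x) \<partial>Rn n)"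
    by (rule nn_integral_suminf[symmetric]) auto
  also have "\<dots> \<le> (\<integral>\<^sup>+x. ennreal (u x) \<partial>Rn n)"
  proof (rule nn_integral_mono)
    fix x
    have "(\<Sum>j. ennreal (u x) * indicator (Q j) x) = ennreal (u x) * indicator (\<Union>j. Q j) x"
      unfolding ennreal_suminf_cmult by (subst suminf_indicator[OF Q(3)]) simp
    then show "(\<Sum>j. ennreal (u x) * indicator (Q j) x) \<le> ennreal (u x)" by (simp add: indicator_def)
  qed
  also have "\<dots> = ennreal (\<integral>x. u x \<partial>Rn n)" by (rule nn_integral_eq_integral) (use u in auto)
  finally have "ennreal (1 / t) * (ennreal t * (\<Sum>j. ennreal (len j ^ n))) \<le> ennreal (1 / t) * ennreal (\<integral>x. u x \<partial>Rn n)"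
    by (rule mult_left_mono) simp
  then show "(\<Sum>j. ennreal (len j ^ n)) \<le> ennreal ((\<integral>x. u x \<partial>Rn n) / t)"
    using t u by (simp add: mult.assoc[symmetric] ennreal_mult[symmetric])
qed

text \<open>The weak type (1,1) bound, with constant 1, for the maximal function over the dyadic
  cubes of generation k \<ge> 0.\<close>

lemma dyadic_maximal:
  fixes u :: "(nat \<Rightarrow> real) \<Rightarrow> real"
  assumes u: "integrable (Rn n) u" "\<And>x. u x \<ge> 0" and t: "t > 0" and L: "L > 0"
    and tL: "(\<integral>x. u x \<partial>Rn n) \<le> t * L ^ n"
  obtains V where "V \<in> sets (Rn n)" "emeasure (Rn n) V \<le> ennreal ((\<integral>x. u x \<partial>Rn n) / t)"
    "\<And>x k. x \<in> space (Rn n) \<Longrightarrow> x \<notin> V \<Longrightarrow> (\<integral>y. u y * indicator (dcube n L k x) y \<partial>Rn n) \<le> t * (L / 2 ^ k) ^ n"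
proof -
  show ?thesis
  proof (rule dyadic_stopping[OF u t L tL])
    fix Q :: "nat \<Rightarrow> (nat \<Rightarrow> real) set" and c len
    assume Q: "\<And>j. Q j = Pi\<^sub>E {..<n} (\<lambda>i. {c j i..<c j i + len j})" "\<And>j. len j \<ge> 0" "disjoint_family Q"
      "\<And>j. t * len j ^ n \<le> (\<integral>x. u x * indicator (Q j) x \<partial>Rn n)"
      and le: "\<And>x k. x \<in> space (Rn n) \<Longrightarrow> x \<notin> (\<Union>j. Q j) \<Longrightarrow> (\<integral>y. u y * indicator (dcube n L k x) y \<partial>Rn n) \<le> t * (L / 2 ^ k) ^ n"
    note v = stopping_volume[OF u t Q]
    show ?thesis by (rule that[of "\<Union>j. Q j"]) (use v le in auto)
  qed
qed

text \<open>Takes the place of Lebesgue's differentiation theorem. With \<phi> of class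
  \<open>nice\<close> close to u, a small cube around x on which \<phi> is constant gives \<phi> x
  \<le> t + \<tau>, unless the dyadic maximal function of |u - \<phi>| exceeds \<tau> at x; and u x
  \<le> \<phi> x + \<tau> outside a small set.\<close>

lemma dyadic_differentiation:
  fixes u :: "(nat \<Rightarrow> real) \<Rightarrow> real"
  assumes u: "integrable (Rn n) u" and L: "L > 0" and U: "U \<in> sets (Rn n)"
    and le: "\<And>x k. x \<in> space (Rn n) \<Longrightarrow> x \<notin> U \<Longrightarrow> (\<integral>y. u y * indicator (dcube n L k x) y \<partial>Rn n) \<le> t * (L / 2 ^ k) ^ n"
  shows "AE x in Rn n. x \<notin> U \<longrightarrow> u x \<le> t"
proof -
  have [measurable]: "u \<in> borel_measurable (Rn n)" using u by auto
  define S where "S \<tau> = {x \<in> space (Rn n). x \<notin> U \<and> t + 2 * \<tau> < u x}" for \<tau>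
  have Sm[measurable]: "S \<tau> \<in> sets (Rn n)" for \<tau> unfolding S_def using U by measurable
  have zero: "S \<tau> \<in> null_sets (Rn n)" if \<tau>: "\<tau> > 0" for \<tau>
  proof -
    have small: "emeasure (Rn n) (S \<tau>) \<le> ennreal e" if e: "e > 0" for e
    proof -
      \<comment> \<open>The first bound makes the exceptional set smaller than e, the second meets
        the requirement of \<open>dyadic_maximal\<close> on generation 0.\<close>
      define \<delta> where "\<delta> = min (e * \<tau> / 2) (\<tau> * L ^ n)"
      have \<delta>: "\<delta> > 0" "\<delta> \<le> e * \<tau> / 2" "\<delta> \<le> \<tau> * L ^ n" using e \<tau> L by (auto simp: \<delta>_def)
      obtain \<phi> :: "_ \<Rightarrow> real" where \<phi>: "nice n \<phi>" "(\<integral>x. norm (u x - \<phi> x) \<partial>Rn n) < \<delta>"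
        by (rule nice_dense[OF u \<delta>(1)])
      let ?w = "\<lambda>x. \<bar>u x - \<phi> x\<bar>"
      note pi = nice_integrable[OF \<phi>(1)]
      have [measurable]: "\<phi> \<in> borel_measurable (Rn n)" using pi by auto
      have w: "integrable (Rn n) ?w" using u pi by auto
      have wl: "(\<integral>x. ?w x \<partial>Rn n) < \<delta>" using \<phi>(2) by simp
      have w0: "0 \<le> ?w x" for x by simp
      have wL: "(\<integral>x. ?w x \<partial>Rn n) \<le> \<tau> * L ^ n" using wl \<delta>(3) by linarith
      obtain V where V: "V \<in> sets (Rn n)" "emeasure (Rn n) V \<le> ennreal ((\<integral>x. ?w x \<partial>Rn n) / \<tau>)"
        "\<And>x k. x \<in> space (Rn n) \<Longrightarrow> x \<notin> V \<Longrightarrow> (\<integral>y. ?w y * indicator (dcube n L k x) y \<partial>Rn n) \<le> \<tau> * (L / 2 ^ k) ^ n"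
        using dyadic_maximal[OF w w0 \<tau> L wL] by blast
      let ?H = "{x \<in> space (Rn n). \<tau> < ?w x}"
      have H: "?H \<in> sets (Rn n)" "emeasure (Rn n) ?H \<le> ennreal ((\<integral>x. ?w x \<partial>Rn n) / \<tau>)"
        using emeasure_Markov[OF w _ \<tau>] by auto
      have ae: "AE x in Rn n. x \<in> S \<tau> \<longrightarrow> x \<in> V \<union> ?H"
      proof -
        have "AE x in Rn n. locconst n \<phi> x" using \<phi>(1) by (simp add: nice_def)
        then show ?thesis using AE_space
        proof eventually_elim
          case (elim x)
          have main: "u x \<le> t + 2 * \<tau>" if nU: "x \<notin> U" and nV: "x \<notin> V" and nH: "\<not> \<tau> < ?w x"
          proof -
            obtain r where r: "r > 0" "\<And>y. y \<in> space (Rn n) \<Longrightarrow> vnorm n (vsub n x y) < r \<Longrightarrow> \<phi> y = \<phi> x"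
              using elim(1) unfolding locconst_def by blast
            obtain k :: nat where k: "n * L / r < 2 ^ k" using real_arch_pow[of 2 "n * L / r"] by auto
            let ?Q = "dcube n L k x" and ?v = "(L / 2 ^ k) ^ n"
            have Qs[measurable]: "?Q \<in> sets (Rn n)" using L by simp
            have iQ: "integrable (Rn n) (\<lambda>y. h y * indicator ?Q y)" if "integrable (Rn n) h" for h :: "_ \<Rightarrow> real"
              using integrable_real_mult_indicator[OF Qs that] by (simp add: mult.commute)
            have eq: "\<phi> y * indicator ?Q y = \<phi> x * indicator ?Q y" for y
            proof (cases "y \<in> ?Q")
              case True
              have "vnorm n (vsub n x y) \<le> n * (L / 2 ^ k)" by (rule dcube_diam[OF L True elim(2)])
              also have "\<dots> < r" using k r L by (simp add: field_simps)
              finally show ?thesis using r(2)[of y] True by (auto simp: dcube_def)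
            qed simp
            have "(\<integral>y. \<phi> y * indicator ?Q y \<partial>Rn n) = (\<integral>y. \<phi> x * indicator ?Q y \<partial>Rn n)"
              by (rule Bochner_Integration.integral_cong[OF refl], rule eq)
            also have "\<dots> = \<phi> x * measure (Rn n) ?Q"
              by (simp add: Int_absorb2[OF sets.sets_into_space[OF Qs]])
            finally have "(\<integral>y. \<phi> y * indicator ?Q y \<partial>Rn n) = \<phi> x * measure (Rn n) ?Q" .
            moreover have "measure (Rn n) ?Q = ?v" using emeasure_dcube[OF L, of n k x] L by (simp add: measure_def)
            ultimately have "\<phi> x * ?v = (\<integral>y. \<phi> y * indicator ?Q y \<partial>Rn n)" by simp
            also have "\<dots> \<le> (\<integral>y. u y * indicator ?Q y + ?w y * indicator ?Q y \<partial>Rn n)"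
              by (rule integral_mono) (use iQ u pi w in \<open>auto simp: indicator_def abs_if\<close>)
            also have "\<dots> = (\<integral>y. u y * indicator ?Q y \<partial>Rn n) + (\<integral>y. ?w y * indicator ?Q y \<partial>Rn n)"
              by (rule Bochner_Integration.integral_add) (use iQ u w in auto)
            also have "\<dots> \<le> t * ?v + \<tau> * ?v" by (intro add_mono le V(3) elim nU nV)
            finally have "\<phi> x * ?v \<le> (t + \<tau>) * ?v" by (simp add: distrib_right)
            then have "\<phi> x \<le> t + \<tau>" using L by (auto simp: mult_le_cancel_right)
            with nH show ?thesis by auto
          qed
          show ?case
          proof
            assume "x \<in> S \<tau>"
            then have "x \<notin> U" "\<not> u x \<le> t + 2 * \<tau>" by (auto simp: S_def)
            show "x \<in> V \<union> ?H"
            proof (rule ccontr)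
              assume "x \<notin> V \<union> ?H"
              then have "x \<notin> V" "\<not> \<tau> < ?w x" using elim(2) by simp_all
              from main[OF \<open>x \<notin> U\<close> this] \<open>\<not> u x \<le> t + 2 * \<tau>\<close> show False by simp
            qed
          qed
        qed
      qed
      have "emeasure (Rn n) (S \<tau>) \<le> emeasure (Rn n) (V \<union> ?H)"
        by (rule emeasure_mono_AE[OF ae]) (use V H in auto)
      also have "\<dots> \<le> ennreal ((\<integral>x. ?w x \<partial>Rn n) / \<tau>) + ennreal ((\<integral>x. ?w x \<partial>Rn n) / \<tau>)"
        by (rule order.trans[OF emeasure_subadditive[OF V(1) H(1)] add_mono[OF V(2) H(2)]])
      also have "\<dots> = ennreal (2 * ((\<integral>x. ?w x \<partial>Rn n) / \<tau>))"
        using \<tau> by (subst ennreal_plus[symmetric]) auto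
      also have "\<dots> \<le> ennreal e"
        using wl \<delta>(2) \<tau> by (intro ennreal_leI) (simp add: field_simps)
      finally show ?thesis .
    qed
    have "emeasure (Rn n) (S \<tau>) \<le> 0" by (rule ennreal_le_epsilon) (use small in auto)
    then show ?thesis by (auto simp: null_sets_def)
  qed
  have "(\<Union>k::nat. S (1 / Suc k)) \<in> null_sets (Rn n)" by (rule null_sets_UN) (use zero in auto)
  from AE_not_in[OF this] show ?thesis using AE_space
  proof eventually_elim
    case (elim x)
    show ?case
    proof (rule impI, rule field_le_epsilon)
      fix e :: real assume nU: "x \<notin> U" and e: "e > 0"
      obtain k :: nat where k: "1 / Suc k < e / 2" using e nat_approx_posE[of "e / 2"] by auto
      have "u x \<le> t + 2 * (1 / Suc k)" using elim nU by (auto simp: S_def not_less)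
      with k show "u x \<le> t + e" by simp
    qed
  qed
qed

end

subsection \<open>The maximal truncated operator\<close>

text \<open>Finitely many cells are handled by the triangle inequality, and dominated convergence
  exhausts the rest. In this way the cancellation inside each of infinitely many cells can be used
  for a single integral.\<close>

lemma norm_integral_cells_le:
  fixes F :: "'a \<Rightarrow> 'b::{banach, second_countable_topology}" and G :: "'a \<Rightarrow> ennreal"
  assumes F: "integrable M F" "\<And>x. x \<in> space M \<Longrightarrow> x \<notin> (\<Union>j. Q j) \<Longrightarrow> F x = 0"
    and Q: "\<And>j::nat. Q j \<in> sets M" "disjoint_family Q" and G: "G \<in> borel_measurable M"
    and le: "\<And>j. ennreal (norm (\<integral>x. indicator (Q j) x *\<^sub>R F x \<partial>M)) \<le> (\<integral>\<^sup>+x. G x * indicator (Q j) x \<partial>M)"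
  shows "ennreal (norm (\<integral>x. F x \<partial>M)) \<le> (\<integral>\<^sup>+x. G x \<partial>M)"
proof -
  have [measurable]: "F \<in> borel_measurable M" "G \<in> borel_measurable M" "\<And>j. Q j \<in> sets M" using F G Q by auto
  have iQ: "integrable M (\<lambda>x. indicator X x *\<^sub>R F x)" if "X \<in> sets M" for X
    by (rule integrable_mult_indicator[OF that F(1)])
  have eq: "(\<Sum>j<N. indicator (Q j) x :: 'c::{real_normed_algebra_1,comm_semiring_1}) = indicator (\<Union>j<N. Q j) x" for N x
    by (rule indicator_UN_disjoint[symmetric]) (use Q(2) in \<open>auto simp: disjoint_family_on_def\<close>)
  have partial: "ennreal (norm (\<integral>x. indicator (\<Union>j<N. Q j) x *\<^sub>R F x \<partial>M)) \<le> (\<integral>\<^sup>+x. G x \<partial>M)" for N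
  proof -
    have "(\<integral>x. indicator (\<Union>j<N. Q j) x *\<^sub>R F x \<partial>M) = (\<integral>x. (\<Sum>j<N. indicator (Q j) x *\<^sub>R F x) \<partial>M)"
      by (simp only: eq[symmetric] scaleR_sum_left)
    also have "\<dots> = (\<Sum>j<N. \<integral>x. indicator (Q j) x *\<^sub>R F x \<partial>M)"
      by (rule Bochner_Integration.integral_sum) (use iQ Q in auto)
    finally have "ennreal (norm (\<integral>x. indicator (\<Union>j<N. Q j) x *\<^sub>R F x \<partial>M)) \<le> ennreal (\<Sum>j<N. norm (\<integral>x. indicator (Q j) x *\<^sub>R F x \<partial>M))"
      by (simp add: ennreal_leI norm_sum)
    also have "\<dots> = (\<Sum>j<N. ennreal (norm (\<integral>x. indicator (Q j) x *\<^sub>R F x \<partial>M)))" by (rule sum_ennreal[symmetric]) simp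
    also have "\<dots> \<le> (\<Sum>j<N. \<integral>\<^sup>+x. G x * indicator (Q j) x \<partial>M)" by (intro sum_mono le)
    also have "\<dots> = (\<integral>\<^sup>+x. (\<Sum>j<N. G x * indicator (Q j) x) \<partial>M)" by (rule nn_integral_sum[symmetric]) auto
    also have "\<dots> \<le> (\<integral>\<^sup>+x. G x \<partial>M)"
    proof (rule nn_integral_mono)
      fix x
      have "(\<Sum>j<N. indicator (Q j) x :: ennreal) = indicator (\<Union>j<N. Q j) x"
        by (rule indicator_UN_disjoint[symmetric]) (use Q(2) in \<open>auto simp: disjoint_family_on_def\<close>)
      then have "(\<Sum>j<N. G x * indicator (Q j) x) = G x * indicator (\<Union>j<N. Q j) x"
        by (simp add: sum_distrib_left[symmetric])
      then show "(\<Sum>j<N. G x * indicator (Q j) x) \<le> G x" by (simp add: indicator_def)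
    qed
    finally show ?thesis .
  qed
  have "(\<lambda>N. \<integral>x. indicator (\<Union>j<N. Q j) x *\<^sub>R F x \<partial>M) \<longlonglongrightarrow> (\<integral>x. F x \<partial>M)"
  proof (rule integral_dominated_convergence[where w="\<lambda>x. norm (F x)"])
    show "AE x in M. (\<lambda>N. indicator (\<Union>j<N. Q j) x *\<^sub>R F x) \<longlonglongrightarrow> F x"
    proof (rule AE_I2)
      fix x assume x: "x \<in> space M"
      show "(\<lambda>N. indicator (\<Union>j<N. Q j) x *\<^sub>R F x) \<longlonglongrightarrow> F x"
      proof (cases "x \<in> (\<Union>j. Q j)")
        case True
        then obtain j where "x \<in> Q j" by auto
        then show ?thesis
          by (intro tendsto_eventually eventually_sequentiallyI[of "Suc j"]) (auto simp: indicator_def)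
      qed (use F(2)[OF x] in simp)
    qed
  qed (use F(1) in \<open>auto simp: indicator_def\<close>)
  then have "(\<lambda>N. ennreal (norm (\<integral>x. indicator (\<Union>j<N. Q j) x *\<^sub>R F x \<partial>M))) \<longlonglongrightarrow> ennreal (norm (\<integral>x. F x \<partial>M))"
    by (intro tendsto_ennrealI tendsto_norm)
  then show ?thesis by (rule LIMSEQ_le_const2) (use partial in auto)
qed

context singular_kernel begin

text \<open>If |TM M g| exceeds 4 s, one of its four parts exceeds s. The constant is 3/2 * 3/2 =
  9/4 \<le> 3.\<close>

lemma TM_weak_complex:
  fixes g :: "(nat \<Rightarrow> real) \<Rightarrow> complex"
  assumes D: "dirac_weak \<sigma>" and g: "integrable (Rn n) g" "\<And>y. cmod (g y) \<le> t"
    and M: "M > 0" and s: "s > 0" "s \<ge> 440 * t * W"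
  shows "emeasure (Rn n) {x \<in> space (Rn n). 4 * s < cmod (TM M g x)} \<le> ennreal (3 * \<sigma> * (\<integral>y. cmod (g y) \<partial>Rn n) / s)"
proof -
  have \<sigma>: "\<sigma> \<ge> 0" using D by (simp add: dirac_weak_def)
  have [measurable]: "g \<in> borel_measurable (Rn n)" using g by auto
  define a where "a j = (\<integral>y. cpart j (g y) \<partial>Rn n)" for j
  define G where "G = (\<integral>y. cmod (g y) \<partial>Rn n)"
  note ci = cpart_integral_sum_le[OF g(1)]
  let ?E = "\<lambda>j. {x \<in> space (Rn n). s < cmod (TM M (\<lambda>y. of_real (cpart j (g y))) x)}"
  have E: "emeasure (Rn n) (?E j) \<le> ennreal (3 / 2 * \<sigma> * a j / s)" for j
    unfolding a_def by (rule TM_weak_bounded[OF D ci(1) _ _ M s]) (auto intro: order.trans[OF cpart_le g(2)])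
  have Em: "?E j \<in> sets (Rn n)" for j by measurable
  have "emeasure (Rn n) {x \<in> space (Rn n). 4 * s < cmod (TM M g x)} \<le> emeasure (Rn n) (\<Union>j<4. ?E j)"
  proof (rule emeasure_mono)
    show "{x \<in> space (Rn n). 4 * s < cmod (TM M g x)} \<subseteq> (\<Union>j<4. ?E j)"
    proof
      fix x assume x: "x \<in> {x \<in> space (Rn n). 4 * s < cmod (TM M g x)}"
      then have [measurable]: "x \<in> space (Rn n)" by simp
      have "TM M g x = (\<Sum>j<4. \<i> ^ j * TM M (\<lambda>y. of_real (cpart j (g y))) x)"
        unfolding TM_def by (rule cpart_integral(2)[OF integrable_KM_mult]) (use M g in auto)
      then have 1: "cmod (TM M g x) \<le> (\<Sum>j<4. cmod (TM M (\<lambda>y. of_real (cpart j (g y))) x))"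
        by (simp only: norm_cpart_sum_le)
      show "x \<in> (\<Union>j<4. ?E j)"
      proof (rule ccontr)
        assume "x \<notin> (\<Union>j<4. ?E j)"
        then have "cmod (TM M (\<lambda>y. of_real (cpart j (g y))) x) \<le> s" if "j < 4" for j using x that by force
        then have "(\<Sum>j<4. cmod (TM M (\<lambda>y. of_real (cpart j (g y))) x)) \<le> (\<Sum>j<(4::nat). s)" by (intro sum_mono) auto
        with 1 x show False by simp
      qed
    qed
    show "(\<Union>j<4. ?E j) \<in> sets (Rn n)" using Em by (intro sets.finite_UN) auto
  qed
  also have "\<dots> \<le> ennreal (3 / 2 * \<sigma> / s * (\<Sum>j<4. a j))"
    by (rule emeasure_UN4_le) (use Em E s \<sigma> in \<open>auto simp: a_def\<close>)
  also have "\<dots> \<le> ennreal (3 * \<sigma> * G / s)"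
  proof (rule ennreal_leI)
    have "3 / 2 * \<sigma> / s * (\<Sum>j<4. a j) \<le> 3 / 2 * \<sigma> / s * (3 / 2 * G)"
      by (rule mult_left_mono) (use ci(2) s \<sigma> in \<open>auto simp: a_def G_def\<close>)
    also have "\<dots> = 9 / 4 * (\<sigma> * G / s)" by simp
    also have "\<dots> \<le> 3 * (\<sigma> * G / s)" by (rule mult_right_mono) (use s \<sigma> in \<open>auto simp: G_def\<close>)
    finally show "3 / 2 * \<sigma> / s * (\<Sum>j<4. a j) \<le> 3 * \<sigma> * G / s" by simp
  qed
  finally show ?thesis by (simp add: G_def)
qed

definition trunc :: "real \<Rightarrow> (nat \<Rightarrow> real) \<Rightarrow> (nat \<Rightarrow> real) \<Rightarrow> complex" where
  "trunc \<epsilon> x y = (if \<epsilon> \<le> vnorm n (vsub n x y) then K (vsub n x y) else 0)"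

lemma trunc_measurable [measurable (raw)]:
  assumes [measurable]: "f \<in> measurable N (Rn n)" "g \<in> measurable N (Rn n)"
  shows "(\<lambda>z. trunc \<epsilon> (f z) (g z)) \<in> borel_measurable N"
  unfolding trunc_def by measurable

lemma TR_trunc: "TR \<epsilon> f x = (\<integral>y. trunc \<epsilon> x y * f y \<partial>Rn n)"
  unfolding TR_def trunc_def by (rule Bochner_Integration.integral_cong) (auto simp: indicator_def)

lemma integrable_trunc_mono:
  assumes int: "integrable (Rn n) (\<lambda>y. trunc \<epsilon> x y * f y)" and e: "\<epsilon> \<le> \<delta>"
    and [measurable]: "x \<in> space (Rn n)" "f \<in> borel_measurable (Rn n)"
  shows "integrable (Rn n) (\<lambda>y. trunc \<delta> x y * f y)"
  by (rule Bochner_Integration.integrable_bound[OF int]) (use e in \<open>auto simp: trunc_def\<close>)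

text \<open>The point is uniformity in y. The distances |x - y| reached by |x| < \<rho> form a shell
  of length at most 3 \<rho> and inner radius at least e if |y| \<le> 2 \<rho>; for larger |y| the
  length is at most twice the inner radius.\<close>

lemma nn_integral_K_ball_le:
  assumes \<rho>: "\<rho> \<ge> 1" and e: "0 < e" "e \<le> 1" and y[measurable]: "y \<in> space (Rn n)"
  shows "(\<integral>\<^sup>+x. indicator {..<\<rho>} (vnorm n x) * ennreal (cmod (trunc e x y)) \<partial>Rn n) \<le> ennreal (W * (3 * \<rho> / e + 2))"
proof -
  define a where "a = max e (vnorm n y - \<rho>)"
  define b where "b = vnorm n y + \<rho>"
  have "e \<le> vnorm n y + \<rho>" using \<rho> e vnorm_nonneg[of n y] by linarith
  then have ab: "0 < a" "a \<le> b" using \<rho> e by (auto simp: a_def b_def)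
  have "(\<integral>\<^sup>+x. indicator {..<\<rho>} (vnorm n x) * ennreal (cmod (trunc e x y)) \<partial>Rn n)
    \<le> (\<integral>\<^sup>+x. ennreal (cmod (K (vsub n x y))) * indicator {a..b} (vnorm n (vsub n x y)) \<partial>Rn n)"
  proof (rule nn_integral_mono)
    fix x
    have "vnorm n (vsub n x y) \<le> vnorm n x + vnorm n y" by (rule vnorm_vsub_le)
    moreover have "vnorm n y \<le> vnorm n (vsub n x y) + vnorm n x"
      using vnorm_le_vsub[of n y x] by (simp add: vnorm_vsub_commute)
    ultimately show "indicator {..<\<rho>} (vnorm n x) * ennreal (cmod (trunc e x y)) \<le> ennreal (cmod (K (vsub n x y))) * indicator {a..b} (vnorm n (vsub n x y))"
      by (auto simp: indicator_def trunc_def a_def b_def)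
  qed
  also have "\<dots> = (\<integral>\<^sup>+w. ennreal (cmod (K w)) * indicator {a..b} (vnorm n w) \<partial>Rn n)"
    by (rule nn_integral_vsub_right[where F="\<lambda>w. ennreal (cmod (K w)) * indicator {a..b} (vnorm n w)"]) measurable
  also have "\<dots> \<le> ennreal (W * ((b - a) / a))" by (rule nn_integral_K_annulus[OF ab])
  also have "\<dots> \<le> ennreal (W * (3 * \<rho> / e + 2))"
  proof (intro ennreal_leI mult_left_mono W_nonneg)
    show "(b - a) / a \<le> 3 * \<rho> / e + 2"
    proof (cases "vnorm n y \<le> 2 * \<rho>")
      case True
      have "(b - a) / a \<le> 3 * \<rho> / e"
        by (rule frac_le) (use True \<rho> e ab in \<open>auto simp: a_def b_def\<close>)
      then show ?thesis by simp
    next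
      case False
      have "a \<ge> vnorm n y - \<rho>" by (simp add: a_def)
      then have "(b - a) \<le> 2 * a" using False \<rho> by (simp add: b_def)
      then have "(b - a) / a \<le> 2" using ab by (simp add: field_simps)
      moreover have "3 * \<rho> / e \<ge> 0" using \<rho> e by simp
      ultimately show ?thesis by linarith
    qed
  qed
  finally show ?thesis .
qed

text \<open>\<Omega> may be unbounded, so even away from the singularity the product of the kernel
  with an integrable h need not be integrable for every x. Tonelli over x in a ball gives
  integrability almost everywhere.\<close>

lemma AE_integrable_trunc:
  assumes h: "integrable (Rn n) h"
  shows "AE x in Rn n. \<forall>\<epsilon>>0. integrable (Rn n) (\<lambda>y. trunc \<epsilon> x y * h y)"
proof -
  interpret P: pair_sigma_finite "Rn n" "Rn n" ..
  have [measurable]: "h \<in> borel_measurable (Rn n)" using h by auto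
  \<comment> \<open>Countably many pairs of truncation 1/(k+1) and radius k+1 suffice, as
    integrability at one truncation distance passes to all larger ones.\<close>
  have "AE x in Rn n. vnorm n x < real k + 1 \<longrightarrow> (\<integral>\<^sup>+y. ennreal (cmod (trunc (1 / (real k + 1)) x y * h y)) \<partial>Rn n) < \<infinity>" for k :: nat
  proof -
    let ?e = "1 / (real k + 1)" and ?\<rho> = "real k + 1"
    let ?f = "\<lambda>x. indicator {..<?\<rho>} (vnorm n x) * (\<integral>\<^sup>+y. ennreal (cmod (trunc ?e x y * h y)) \<partial>Rn n)"
    have "(\<integral>\<^sup>+x. ?f x \<partial>Rn n) = (\<integral>\<^sup>+x. \<integral>\<^sup>+y. indicator {..<?\<rho>} (vnorm n x) * ennreal (cmod (trunc ?e x y)) * ennreal (cmod (h y)) \<partial>Rn n \<partial>Rn n)"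
    proof (rule nn_integral_cong)
      fix x assume [measurable]: "x \<in> space (Rn n)"
      show "?f x = (\<integral>\<^sup>+y. indicator {..<?\<rho>} (vnorm n x) * ennreal (cmod (trunc ?e x y)) * ennreal (cmod (h y)) \<partial>Rn n)"
        by (subst nn_integral_cmult[symmetric]) (auto simp: norm_mult ennreal_mult mult.assoc)
    qed
    also have "\<dots> = (\<integral>\<^sup>+y. \<integral>\<^sup>+x. indicator {..<?\<rho>} (vnorm n x) * ennreal (cmod (trunc ?e x y)) * ennreal (cmod (h y)) \<partial>Rn n \<partial>Rn n)"
      by (rule P.Fubini'[symmetric]) measurable
    also have "\<dots> \<le> (\<integral>\<^sup>+y. ennreal (W * (3 * ?\<rho> / ?e + 2)) * ennreal (cmod (h y)) \<partial>Rn n)"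
    proof (rule nn_integral_mono)
      fix y assume y[measurable]: "y \<in> space (Rn n)"
      have "(\<integral>\<^sup>+x. indicator {..<?\<rho>} (vnorm n x) * ennreal (cmod (trunc ?e x y)) * ennreal (cmod (h y)) \<partial>Rn n)
         = (\<integral>\<^sup>+x. indicator {..<?\<rho>} (vnorm n x) * ennreal (cmod (trunc ?e x y)) \<partial>Rn n) * ennreal (cmod (h y))"
        by (rule nn_integral_multc) measurable
      also have "\<dots> \<le> ennreal (W * (3 * ?\<rho> / ?e + 2)) * ennreal (cmod (h y))"
        by (intro mult_right_mono nn_integral_K_ball_le) (simp_all add: y)
      finally show "(\<integral>\<^sup>+x. indicator {..<?\<rho>} (vnorm n x) * ennreal (cmod (trunc ?e x y)) * ennreal (cmod (h y)) \<partial>Rn n) \<le> ennreal (W * (3 * ?\<rho> / ?e + 2)) * ennreal (cmod (h y))" .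
    qed
    also have "\<dots> = ennreal (W * (3 * ?\<rho> / ?e + 2)) * (\<integral>\<^sup>+y. ennreal (cmod (h y)) \<partial>Rn n)"
      by (rule nn_integral_cmult) measurable
    also have "\<dots> < \<infinity>" using h by (simp add: integrable_iff_bounded ennreal_mult_less_top)
    finally have "AE x in Rn n. ?f x \<noteq> \<infinity>" by (intro nn_integral_PInf_AE) auto
    then show ?thesis by eventually_elim (auto simp: less_top indicator_def split: if_splits)
  qed
  then have "AE x in Rn n. \<forall>k::nat. vnorm n x < real k + 1 \<longrightarrow> (\<integral>\<^sup>+y. ennreal (cmod (trunc (1 / (real k + 1)) x y * h y)) \<partial>Rn n) < \<infinity>"
    by (simp add: AE_all_countable)
  then show ?thesis using AE_space
  proof eventually_elim
    case (elim x)
    have xm[measurable]: "x \<in> space (Rn n)" by (rule elim)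
    show ?case
    proof (intro allI impI)
      fix \<epsilon> :: real assume e: "\<epsilon> > 0"
      obtain k :: nat where k: "max (vnorm n x) (1 / \<epsilon>) < k" using reals_Archimedean2 by blast
      have "1 / \<epsilon> \<le> real k + 1" "vnorm n x < real k + 1" using k by auto
      then have ke: "1 / (real k + 1) \<le> \<epsilon>" using e by (simp add: field_simps)
      have "integrable (Rn n) (\<lambda>y. trunc (1 / (real k + 1)) x y * h y)"
      proof (rule integrableI_bounded)
        show "(\<integral>\<^sup>+y. ennreal (norm (trunc (1 / (real k + 1)) x y * h y)) \<partial>Rn n) < \<infinity>"
          using elim(1) \<open>vnorm n x < real k + 1\<close> by blast
      qed measurable
      then show "integrable (Rn n) (\<lambda>y. trunc \<epsilon> x y * h y)"
        by (rule integrable_trunc_mono[OF _ ke]) measurable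
    qed
  qed
qed

end

subsection \<open>The Calderon--Zygmund decomposition\<close>

context singular_kernel begin

text \<open>The summands come, in this order, from the volume of the enlarged cubes, the integrated
  Hormander estimate, the annulus of cut cells, and the threshold t itself.\<close>

definition "cz_const = (8 * real n ^ 2) ^ n + 2 ^ (n + 2) * HC * W + 2 ^ (n + 2) * W + 1"

lemma cz_const_pos: "cz_const > 0"
  unfolding cz_const_def using HC_pos W_nonneg by (intro add_nonneg_pos add_nonneg_nonneg) auto

lemma kernel_diff_translate:
  assumes c: "c \<in> space (Rn n)" and y: "y \<in> space (Rn n)" and e: "e > 0" "vnorm n (vsub n y c) \<le> e / (2 * n)"
  shows "(\<integral>\<^sup>+x. ennreal (cmod (K (vsub n x y) - K (vsub n x c))) * indicator {e..} (vnorm n (vsub n x c)) \<partial>Rn n) \<le> ennreal (HC * W)"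
proof -
  have [measurable]: "c \<in> space (Rn n)" "y \<in> space (Rn n)" by fact+
  let ?F = "\<lambda>w. ennreal (cmod (K (vsub n w (vsub n y c)) - K w)) * indicator {e..} (vnorm n w)"
  have "(\<integral>\<^sup>+x. ennreal (cmod (K (vsub n x y) - K (vsub n x c))) * indicator {e..} (vnorm n (vsub n x c)) \<partial>Rn n)
     = (\<integral>\<^sup>+x. ?F (vsub n x c) \<partial>Rn n)"
  proof (rule nn_integral_cong)
    fix x
    have "vsub n (vsub n x c) (vsub n y c) = vsub n x y" by (auto simp: vsub_def)
    then show "ennreal (cmod (K (vsub n x y) - K (vsub n x c))) * indicator {e..} (vnorm n (vsub n x c)) = ?F (vsub n x c)" by simp
  qed
  also have "\<dots> = (\<integral>\<^sup>+w. ?F w \<partial>Rn n)" by (rule nn_integral_vsub_right) measurable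
  also have "\<dots> \<le> ennreal (HC * W)" by (rule hormander) (use e in auto)
  finally show ?thesis .
qed

text \<open>The first term is the cancellation of \<open>b\<close> over \<open>Q\<close>. The second accounts for cells cut by the sphere of radius
  \<open>\<epsilon>\<close> around \<open>x\<close>: being small compared with their distance to \<open>x\<close>, they lie in the annulus between
  \<open>\<epsilon>/2\<close> and \<open>3\<epsilon>/2\<close>, on which the size condition alone suffices.\<close>

lemma cz_cell_estimate:
  fixes h :: "(nat \<Rightarrow> real) \<Rightarrow> complex" and len :: real
  assumes h: "integrable (Rn n) h" and t: "t > 0" and Q: "Q = Pi\<^sub>E {..<n} (\<lambda>i. {c i..<c i + len})" and len: "len > 0"
    and c: "c \<in> space (Rn n)"
    and up: "(\<integral>x. cmod (h x) * indicator Q x \<partial>Rn n) \<le> 2 ^ n * t * len ^ n"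
    and b: "\<And>y. y \<in> Q \<Longrightarrow> b y = h y - (\<integral>y. indicator Q y *\<^sub>R h y \<partial>Rn n) / of_real (len ^ n)"
    and bi: "integrable (Rn n) b" and x: "x \<in> space (Rn n)" and far: "4 * real n ^ 2 * len \<le> vnorm n (vsub n x c)"
    and int: "integrable (Rn n) (\<lambda>y. trunc \<epsilon> x y * b y)" and e: "\<epsilon> > 0"
  shows "ennreal (cmod (\<integral>y. indicator Q y *\<^sub>R (trunc \<epsilon> x y * b y) \<partial>Rn n))
    \<le> (\<integral>\<^sup>+y. (ennreal (cmod (K (vsub n x y) - K (vsub n x c))) * ennreal (cmod (b y) + 2 ^ (n + 1) * t)
        + ennreal (2 ^ (n + 1) * t) * (ennreal (cmod (K (vsub n x y))) * indicator {\<epsilon> / 2..3 / 2 * \<epsilon>} (vnorm n (vsub n x y)))) * indicator Q y \<partial>Rn n)"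
    (is "_ \<le> (\<integral>\<^sup>+y. (?D y * ?B y + ?T * ?R y) * indicator Q y \<partial>_)")
proof -
  have hm[measurable]: "h \<in> borel_measurable (Rn n)" and bm[measurable]: "b \<in> borel_measurable (Rn n)" using h bi by auto
  have [measurable]: "x \<in> space (Rn n)" "c \<in> space (Rn n)" by fact+
  have Qm[measurable]: "Q \<in> sets (Rn n)" unfolding Q by (rule PiE_sets_Rn) simp
  have Qe: "emeasure (Rn n) Q = ennreal (len ^ n)" unfolding Q by (rule emeasure_Rn_cube(1)) (use len in simp)
  have Qme: "measure (Rn n) Q = len ^ n" using Qe len by (simp add: measure_def)
  have Qs: "Q \<subseteq> space (Rn n)" by (rule sets.sets_into_space[OF Qm])
  have bQ: "integrable (Rn n) (\<lambda>y. indicator Q y *\<^sub>R b y)" by (rule integrable_mult_indicator[OF Qm bi])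
  have hQ: "integrable (Rn n) (\<lambda>y. indicator Q y *\<^sub>R h y)" by (rule integrable_mult_indicator[OF Qm h])
  have cQ: "integrable (Rn n) (\<lambda>y. indicator Q y *\<^sub>R a)" for a :: complex
    using Qe by (intro integrable_indicator) auto
  define av where "av = (\<integral>y. indicator Q y *\<^sub>R h y \<partial>Rn n) / of_real (len ^ n)"
  have avl: "av * of_real (len ^ n) = (\<integral>y. indicator Q y *\<^sub>R h y \<partial>Rn n)" using len by (simp add: av_def)
  have b_eq: "indicator Q y *\<^sub>R b y = indicator Q y *\<^sub>R h y - indicator Q y *\<^sub>R av" for y
    by (auto simp: indicator_def b av_def)
  have int_av: "(\<integral>y. indicator Q y *\<^sub>R a \<partial>Rn n) = of_real (len ^ n) * a" for a :: complex
    using Qe by (simp add: Qme Int_absorb2[OF Qs] scaleR_conv_of_real)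
  have b0: "(\<integral>y. indicator Q y *\<^sub>R b y \<partial>Rn n) = 0"
    unfolding b_eq using hQ cQ avl by (simp add: int_av mult.commute)
  have habs: "(\<integral>y. cmod (indicator Q y *\<^sub>R h y) \<partial>Rn n) \<le> 2 ^ n * t * len ^ n"
    using up by (simp add: mult.commute abs_mult)
  have babs: "(\<integral>\<^sup>+y. ennreal (cmod (b y)) * indicator Q y \<partial>Rn n) \<le> ?T * ennreal (len ^ n)"
  proof -
    have avb: "cmod av * len ^ n \<le> 2 ^ n * t * len ^ n"
    proof -
      have "cmod av * len ^ n = cmod (av * of_real (len ^ n))" using len by (simp add: norm_mult norm_power)
      also have "\<dots> \<le> (\<integral>y. cmod (indicator Q y *\<^sub>R h y) \<partial>Rn n)" unfolding avl by (rule integral_norm_bound)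
      finally show ?thesis using habs by simp
    qed
    have "(\<integral>\<^sup>+y. ennreal (cmod (b y)) * indicator Q y \<partial>Rn n) = (\<integral>\<^sup>+y. ennreal (cmod (indicator Q y *\<^sub>R b y)) \<partial>Rn n)"
      by (rule nn_integral_cong) (auto simp: indicator_def)
    also have "\<dots> = ennreal (\<integral>y. cmod (indicator Q y *\<^sub>R b y) \<partial>Rn n)"
      by (rule nn_integral_eq_integral[OF integrable_norm[OF bQ]]) simp
    also have "(\<integral>y. cmod (indicator Q y *\<^sub>R b y) \<partial>Rn n) \<le> (\<integral>y. cmod (indicator Q y *\<^sub>R h y) + cmod (indicator Q y *\<^sub>R av) \<partial>Rn n)"
      using integrable_norm[OF bQ] unfolding b_eq
      by (rule integral_mono) (use hQ cQ in \<open>auto intro!: norm_triangle_ineq4 simp del: norm_scaleR\<close>)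
    also have "\<dots> = (\<integral>y. cmod (indicator Q y *\<^sub>R h y) \<partial>Rn n) + (\<integral>y. cmod (indicator Q y *\<^sub>R av) \<partial>Rn n)"
      by (rule Bochner_Integration.integral_add[OF integrable_norm[OF hQ] integrable_norm[OF cQ]])
    also have "(\<integral>y. cmod (indicator Q y *\<^sub>R av) \<partial>Rn n) = len ^ n * cmod av"
      using Qe by (simp add: Qme Int_absorb2[OF Qs])
    finally have "(\<integral>\<^sup>+y. ennreal (cmod (b y)) * indicator Q y \<partial>Rn n) \<le> ennreal ((\<integral>y. cmod (indicator Q y *\<^sub>R h y) \<partial>Rn n) + len ^ n * cmod av)"
      by (simp add: ennreal_leI)
    also have "\<dots> \<le> ennreal (2 ^ (n + 1) * t * len ^ n)"
      by (rule ennreal_leI) (use habs avb in \<open>simp add: mult.commute\<close>)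
    finally show ?thesis using t len by (simp add: ennreal_mult)
  qed
  \<comment> \<open>Nothing bounds |b| pointwise, but K(x - c) is constant in y, so the mass of |b|
    may be spread evenly over Q at height 2^(n+1) t.\<close>
  have TQ: "ennreal (cmod (K (vsub n x c))) * (\<integral>\<^sup>+y. ennreal (cmod (b y)) * indicator Q y \<partial>Rn n)
     \<le> (\<integral>\<^sup>+y. ?T * ennreal (cmod (K (vsub n x c))) * indicator Q y \<partial>Rn n)"
  proof -
    have "ennreal (cmod (K (vsub n x c))) * (\<integral>\<^sup>+y. ennreal (cmod (b y)) * indicator Q y \<partial>Rn n)
      \<le> ennreal (cmod (K (vsub n x c))) * (?T * ennreal (len ^ n))" by (rule mult_left_mono[OF babs]) simp
    also have "\<dots> = (\<integral>\<^sup>+y. ?T * ennreal (cmod (K (vsub n x c))) * indicator Q y \<partial>Rn n)"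
      by (subst nn_integral_cmult_indicator) (auto simp: Qe mult_ac)
    finally show ?thesis .
  qed
  consider (out) "\<And>y. y \<in> Q \<Longrightarrow> \<epsilon> \<le> vnorm n (vsub n x y)" | (ins) "\<And>y. y \<in> Q \<Longrightarrow> vnorm n (vsub n x y) < \<epsilon>"
    | (cross) y1 y2 where "y1 \<in> Q" "y2 \<in> Q" "\<epsilon> \<le> vnorm n (vsub n x y1)" "vnorm n (vsub n x y2) < \<epsilon>"
    by (meson not_le)
  then show ?thesis
  proof cases
    case out
    have eq: "indicator Q y *\<^sub>R (trunc \<epsilon> x y * b y) = indicator Q y *\<^sub>R ((K (vsub n x y) - K (vsub n x c)) * b y) + K (vsub n x c) * (indicator Q y *\<^sub>R b y)" for y
      using out[of y] by (auto simp: indicator_def trunc_def algebra_simps)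
    have i1: "integrable (Rn n) (\<lambda>y. indicator Q y *\<^sub>R (trunc \<epsilon> x y * b y))" by (rule integrable_mult_indicator[OF Qm int])
    have i2: "integrable (Rn n) (\<lambda>y. K (vsub n x c) * (indicator Q y *\<^sub>R b y))"
      by (rule integrable_mult_right[OF bQ])
    have i3: "integrable (Rn n) (\<lambda>y. indicator Q y *\<^sub>R ((K (vsub n x y) - K (vsub n x c)) * b y))"
      using Bochner_Integration.integrable_diff[OF i1 i2] unfolding eq by simp
    have "(\<integral>y. indicator Q y *\<^sub>R (trunc \<epsilon> x y * b y) \<partial>Rn n) = (\<integral>y. indicator Q y *\<^sub>R ((K (vsub n x y) - K (vsub n x c)) * b y) \<partial>Rn n)"
      unfolding eq Bochner_Integration.integral_add[OF i3 i2]
      by (simp only: integral_mult_right_zero b0 mult_zero_right add_0_right)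
    then have "ennreal (cmod (\<integral>y. indicator Q y *\<^sub>R (trunc \<epsilon> x y * b y) \<partial>Rn n)) \<le> (\<integral>\<^sup>+y. ennreal (cmod (indicator Q y *\<^sub>R ((K (vsub n x y) - K (vsub n x c)) * b y))) \<partial>Rn n)"
      using integral_norm_bound_ennreal[OF i3] by simp
    also have "\<dots> \<le> (\<integral>\<^sup>+y. (?D y * ?B y + ?T * ?R y) * indicator Q y \<partial>Rn n)"
    proof (rule nn_integral_mono)
      fix y
      have "ennreal (cmod ((K (vsub n x y) - K (vsub n x c)) * b y)) \<le> ?D y * ?B y"
        using t by (simp only: norm_mult ennreal_mult[symmetric] norm_ge_zero) (auto intro!: ennreal_leI mult_left_mono simp: ennreal_mult[symmetric] simp del: ennreal_plus)
      then show "ennreal (cmod (indicator Q y *\<^sub>R ((K (vsub n x y) - K (vsub n x c)) * b y))) \<le> (?D y * ?B y + ?T * ?R y) * indicator Q y"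
        by (auto simp: indicator_def intro: add_increasing2)
    qed
    finally show ?thesis .
  next
    case ins
    have z: "indicator Q y *\<^sub>R (trunc \<epsilon> x y * b y) = 0" for y
      using ins[of y] by (auto simp: indicator_def trunc_def)
    show ?thesis by (simp only: z) simp
  next
    case (cross y1 y2)
    have n1: "real n \<ge> 1" using n by simp
    have sq: "real n \<le> real n ^ 2" using n1 by (simp add: power2_eq_square)
    have nl: "n * len \<le> real n ^ 2 * len" using sq len by (intro mult_right_mono) auto
    \<comment> \<open>The corner c has distance at least 4 n^2 len from x, while y2 in the same cube
      is closer than \<epsilon>; hence the diameter bound n len is at most \<epsilon>/2.\<close>
    have "vnorm n (vsub n x c) \<le> vnorm n (vsub n x y2) + vnorm n (vsub n y2 c)" by (rule vnorm_vsub_triangle)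
    also have "vnorm n (vsub n y2 c) \<le> n * len" using cube_diam(2) cross(2) Q by blast
    finally have "4 * real n ^ 2 * len < \<epsilon> + n * len" using far cross(4) by linarith
    then have small: "n * len \<le> \<epsilon> / 2" using nl e by linarith
    have near: "\<epsilon> / 2 \<le> vnorm n (vsub n x y)" "vnorm n (vsub n x y) \<le> 3 / 2 * \<epsilon>" if y: "y \<in> Q" for y
    proof -
      have "vnorm n (vsub n x y1) \<le> vnorm n (vsub n x y) + vnorm n (vsub n y y1)" by (rule vnorm_vsub_triangle)
      moreover have "vnorm n (vsub n y y1) \<le> n * len" using cube_diam(1) y cross(1) Q by blast
      ultimately show "\<epsilon> / 2 \<le> vnorm n (vsub n x y)" using small cross(3) by linarith
      have "vnorm n (vsub n x y) \<le> vnorm n (vsub n x y2) + vnorm n (vsub n y2 y)" by (rule vnorm_vsub_triangle)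
      moreover have "vnorm n (vsub n y2 y) \<le> n * len" using cube_diam(1) y cross(2) Q by blast
      ultimately show "vnorm n (vsub n x y) \<le> 3 / 2 * \<epsilon>" using small cross(4) by linarith
    qed
    have i1: "integrable (Rn n) (\<lambda>y. indicator Q y *\<^sub>R (trunc \<epsilon> x y * b y))" by (rule integrable_mult_indicator[OF Qm int])
    \<comment> \<open>K(x - y) is exchanged for K(x - c) so that the mass can be spread, and
      exchanged back afterwards; each exchange costs one kernel difference.\<close>
    have tri: "ennreal (cmod a) \<le> ennreal (cmod (a - d)) + ennreal (cmod d)" for a d :: complex
      using norm_triangle_ineq[of "a - d" d] by (simp add: ennreal_plus[symmetric] ennreal_leI del: ennreal_plus)
    have tri': "ennreal (cmod d) \<le> ennreal (cmod (a - d)) + ennreal (cmod a)" for a d :: complex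
      using norm_triangle_ineq4[of a "a - d"] by (simp add: ennreal_plus[symmetric] ennreal_leI add.commute del: ennreal_plus)
    have "ennreal (cmod (\<integral>y. indicator Q y *\<^sub>R (trunc \<epsilon> x y * b y) \<partial>Rn n)) \<le> (\<integral>\<^sup>+y. ennreal (cmod (indicator Q y *\<^sub>R (trunc \<epsilon> x y * b y))) \<partial>Rn n)"
      by (rule integral_norm_bound_ennreal[OF i1])
    also have "\<dots> \<le> (\<integral>\<^sup>+y. ?D y * ennreal (cmod (b y)) * indicator Q y + ennreal (cmod (K (vsub n x c))) * (ennreal (cmod (b y)) * indicator Q y) \<partial>Rn n)"
    proof (rule nn_integral_mono)
      fix y
      have "ennreal (cmod (trunc \<epsilon> x y * b y)) \<le> ennreal (cmod (K (vsub n x y))) * ennreal (cmod (b y))"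
        by (auto simp: trunc_def norm_mult ennreal_mult)
      also have "\<dots> \<le> (?D y + ennreal (cmod (K (vsub n x c)))) * ennreal (cmod (b y))"
        by (rule mult_right_mono[OF tri]) simp
      finally show "ennreal (cmod (indicator Q y *\<^sub>R (trunc \<epsilon> x y * b y))) \<le> ?D y * ennreal (cmod (b y)) * indicator Q y + ennreal (cmod (K (vsub n x c))) * (ennreal (cmod (b y)) * indicator Q y)"
        by (auto simp: indicator_def distrib_right)
    qed
    also have "\<dots> = (\<integral>\<^sup>+y. ?D y * ennreal (cmod (b y)) * indicator Q y \<partial>Rn n) + ennreal (cmod (K (vsub n x c))) * (\<integral>\<^sup>+y. ennreal (cmod (b y)) * indicator Q y \<partial>Rn n)"
      by (subst nn_integral_add) (auto simp: nn_integral_cmult)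
    also have "\<dots> \<le> (\<integral>\<^sup>+y. ?D y * ennreal (cmod (b y)) * indicator Q y \<partial>Rn n) + (\<integral>\<^sup>+y. ?T * ennreal (cmod (K (vsub n x c))) * indicator Q y \<partial>Rn n)"
      by (rule add_left_mono[OF TQ])
    also have "\<dots> = (\<integral>\<^sup>+y. ?D y * ennreal (cmod (b y)) * indicator Q y + ?T * ennreal (cmod (K (vsub n x c))) * indicator Q y \<partial>Rn n)"
      by (rule nn_integral_add[symmetric]) auto
    also have "\<dots> \<le> (\<integral>\<^sup>+y. (?D y * ?B y + ?T * ?R y) * indicator Q y \<partial>Rn n)"
    proof (rule nn_integral_mono)
      fix y
      show "?D y * ennreal (cmod (b y)) * indicator Q y + ?T * ennreal (cmod (K (vsub n x c))) * indicator Q y \<le> (?D y * ?B y + ?T * ?R y) * indicator Q y"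
      proof (cases "y \<in> Q")
        case True
        have R: "?R y = ennreal (cmod (K (vsub n x y)))" using near[OF True] by (simp add: indicator_def)
        have B: "?B y = ennreal (cmod (b y)) + ?T" using t by (simp add: ennreal_plus)
        have "?T * ennreal (cmod (K (vsub n x c))) \<le> ?T * (?D y + ennreal (cmod (K (vsub n x y))))"
          by (rule mult_left_mono[OF tri']) simp
        then have "?D y * ennreal (cmod (b y)) + ?T * ennreal (cmod (K (vsub n x c))) \<le> ?D y * ennreal (cmod (b y)) + ?T * (?D y + ennreal (cmod (K (vsub n x y))))"
          by (rule add_left_mono)
        also have "\<dots> = ?D y * ?B y + ?T * ?R y" unfolding R B by (simp add: distrib_left mult.commute add.assoc)
        finally show ?thesis using True by simp
      qed simp
    qed
    finally show ?thesis .
  qed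
qed

text \<open>The good part g is the average of h on each stopping cube and h elsewhere, where |h|
  \<le> t almost everywhere. Off the enlarged cubes V the truncations of h - g are bounded by a
  Hormander integral D and an annulus term. D does not depend on \<epsilon>, so the one exceptional
  set where D > t serves all truncations at once.\<close>

lemma cz_decomposition:
  fixes h :: "(nat \<Rightarrow> real) \<Rightarrow> complex"
  assumes h: "integrable (Rn n) h" and t: "t > 0"
  shows "\<exists>g E. integrable (Rn n) g \<and> (\<forall>y. cmod (g y) \<le> 2 ^ n * t) \<and>
    (\<integral>y. cmod (g y) \<partial>Rn n) \<le> (2 ^ n + 1) * (\<integral>y. cmod (h y) \<partial>Rn n) \<and>
    E \<in> sets (Rn n) \<and> emeasure (Rn n) E \<le> ennreal (cz_const * (\<integral>y. cmod (h y) \<partial>Rn n) / t) \<and>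
    (AE x in Rn n. x \<notin> E \<longrightarrow> (\<forall>\<epsilon>>0. cmod (TR \<epsilon> (\<lambda>y. h y - g y) x) \<le> cz_const * t))"
proof -
  define m where "m = (\<integral>y. cmod (h y) \<partial>Rn n)"
  have m0: "m \<ge> 0" by (simp add: m_def)
  \<comment> \<open>L \<ge> 1 gives L \<le> L^n, hence m \<le> t L \<le> t L^n, as the stopping
    argument requires.\<close>
  define L where "L = m / t + 1"
  have L: "L > 0" using m0 t by (simp add: L_def add_nonneg_pos)
  have hm[measurable]: "h \<in> borel_measurable (Rn n)" using h by auto
  have u: "integrable (Rn n) (\<lambda>x. cmod (h x))" using h by simp
  have mL: "(\<integral>x. cmod (h x) \<partial>Rn n) \<le> t * L ^ n"
  proof -
    have "L \<le> L ^ n" using n m0 t by (intro self_le_power) (auto simp: L_def)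
    moreover have "m \<le> t * L" using t by (simp add: L_def distrib_left)
    ultimately have "m \<le> t * L ^ n" using t by (meson mult_left_mono less_imp_le order.trans)
    then show ?thesis by (simp add: m_def)
  qed
  show ?thesis
  proof (rule dyadic_stopping[OF u _ t L mL])
    fix Q :: "nat \<Rightarrow> (nat \<Rightarrow> real) set" and c :: "nat \<Rightarrow> nat \<Rightarrow> real" and len :: "nat \<Rightarrow> real"
    assume Q: "\<And>j. Q j = Pi\<^sub>E {..<n} (\<lambda>i. {c j i..<c j i + len j})" "\<And>j. len j \<ge> 0" "disjoint_family Q"
        "\<And>j. t * len j ^ n \<le> (\<integral>x. cmod (h x) * indicator (Q j) x \<partial>Rn n)"
      and cs: "\<And>j. c j \<in> space (Rn n)"
      and up: "\<And>j. (\<integral>x. cmod (h x) * indicator (Q j) x \<partial>Rn n) \<le> 2 ^ n * t * len j ^ n"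
      and stop: "\<And>x k. x \<in> space (Rn n) \<Longrightarrow> x \<notin> (\<Union>j. Q j) \<Longrightarrow> (\<integral>y. cmod (h y) * indicator (dcube n L k x) y \<partial>Rn n) \<le> t * (L / 2 ^ k) ^ n"
    note vol = stopping_volume[OF u norm_ge_zero t Q]
    define U where "U = (\<Union>j. Q j)"
    have Qm[measurable]: "Q j \<in> sets (Rn n)" for j by (rule vol(1))
    have Um[measurable]: "U \<in> sets (Rn n)" unfolding U_def by measurable
    have Ue: "emeasure (Rn n) U \<le> ennreal (m / t)" using vol(3,4) by (simp add: U_def m_def)
    have Ufin: "emeasure (Rn n) U < \<infinity>" by (rule le_less_trans[OF Ue]) simp
    have len_pos: "len j > 0" if "y \<in> Q j" for j y
    proof -
      have "y 0 \<in> {c j 0..<c j 0 + len j}" by (rule PiE_mem[OF that[unfolded Q(1)]]) (use n in simp)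
      then show ?thesis by simp
    qed
    \<comment> \<open>The label of the cube containing y. Its measurability makes c (J y) measurable
      in y, so that the kernel differences of all cells form one integrand for Tonelli.\<close>
    define J where "J y = (LEAST j. y \<in> Q j)" for y
    have J: "J y = j" if "y \<in> Q j" for y j
    proof -
      have *: "k = j" if "y \<in> Q k" for k
        using that \<open>y \<in> Q j\<close> Q(3) unfolding disjoint_family_on_def by blast
      show ?thesis unfolding J_def
      proof (rule Least_equality)
        show "y \<in> Q j" by fact
        show "j \<le> k" if "y \<in> Q k" for k using *[OF that] by simp
      qed
    qed
    have Jm[measurable]: "J \<in> measurable (Rn n) (count_space UNIV)"
    proof -
      have "{y \<in> space (Rn n). y \<in> Q j} = Q j" for j using sets.sets_into_space[OF vol(1)] by blast
      then have "Measurable.pred (Rn n) (\<lambda>y. y \<in> Q j)" for j by (simp add: pred_def vol(1))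
      then show ?thesis unfolding J_def[abs_def] by (rule measurable_Least)
    qed
    define av where "av j = (\<integral>y. indicator (Q j) y *\<^sub>R h y \<partial>Rn n) / of_real (len j ^ n)" for j
    have av_le: "cmod (av j) \<le> 2 ^ n * t" for j
    proof (cases "len j = 0")
      case True
      then show ?thesis using n t by (simp add: av_def power_0_left)
    next
      case False
      then have l: "len j ^ n > 0" using Q(2)[of j] by simp
      have "cmod (\<integral>y. indicator (Q j) y *\<^sub>R h y \<partial>Rn n) \<le> (\<integral>y. cmod (indicator (Q j) y *\<^sub>R h y) \<partial>Rn n)" by (rule integral_norm_bound)
      also have "\<dots> \<le> 2 ^ n * t * len j ^ n" using up[of j] by (simp add: mult.commute abs_mult)
      finally show ?thesis using l Q(2)[of j] by (simp add: av_def norm_divide norm_power divide_le_eq)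
    qed
    \<comment> \<open>The last branch is taken only on a null set and makes the bound on g hold
      everywhere.\<close>
    define g where "g y = (if y \<in> U then av (J y) else if cmod (h y) \<le> t then h y else 0)" for y
    define b where "b y = (if y \<in> U then h y - av (J y) else 0)" for y
    have avm[measurable]: "(\<lambda>y. av (J y)) \<in> borel_measurable (Rn n)"
      by (rule measurable_compose[OF Jm]) simp
    have cm[measurable]: "(\<lambda>y. c (J y)) \<in> measurable (Rn n) (Rn n)"
      by (rule measurable_compose[OF Jm]) (use cs in simp)
    have gm[measurable]: "g \<in> borel_measurable (Rn n)" unfolding g_def by measurable
    have bm[measurable]: "b \<in> borel_measurable (Rn n)" unfolding b_def by measurable
    have g_le: "cmod (g y) \<le> 2 ^ n * t" for y
    proof -
      have "1 * t \<le> 2 ^ n * t" using t by (intro mult_right_mono) auto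
      then have "max (cmod (av (J y))) t \<le> 2 ^ n * t" using av_le[of "J y"] by simp
      moreover have "cmod (g y) \<le> max (cmod (av (J y))) t" using t by (auto simp: g_def)
      ultimately show ?thesis by (rule order.trans[rotated])
    qed
    have iU: "integrable (Rn n) (\<lambda>y. 2 ^ n * t * indicator U y :: real)" using Ufin by simp
    have bound1: "cmod (g y) \<le> cmod (h y) + 2 ^ n * t * indicator U y" for y
      using av_le[of "J y"] t by (auto simp: g_def indicator_def intro: add_increasing)
    have bound2: "cmod (b y) \<le> cmod (h y) + 2 ^ n * t * indicator U y" for y
      using norm_triangle_ineq4[of "h y" "av (J y)"] av_le[of "J y"] t by (auto simp: b_def indicator_def)
    have ihU: "integrable (Rn n) (\<lambda>y. cmod (h y) + 2 ^ n * t * indicator U y)" using u iU by simp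
    have gi: "integrable (Rn n) g" by (rule Bochner_Integration.integrable_bound[OF ihU gm]) (use bound1 t in auto)
    have bi: "integrable (Rn n) b" by (rule Bochner_Integration.integrable_bound[OF ihU bm]) (use bound2 t in auto)
    have Umeas: "measure (Rn n) U \<le> m / t" using Ue m0 t by (simp add: measure_def enn2real_leI)
    have ihU_le: "(\<integral>y. cmod (h y) + 2 ^ n * t * indicator U y \<partial>Rn n) \<le> (2 ^ n + 1) * m"
    proof -
      have "(\<integral>y. cmod (h y) + 2 ^ n * t * indicator U y \<partial>Rn n) = m + 2 ^ n * t * measure (Rn n) U"
        using u iU by (simp add: m_def Int_absorb2[OF sets.sets_into_space[OF Um]])
      also have "\<dots> \<le> m + 2 ^ n * t * (m / t)" using Umeas t by (intro add_left_mono mult_left_mono) auto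
      finally show ?thesis using t by (simp add: distrib_right)
    qed
    have g1: "(\<integral>y. cmod (g y) \<partial>Rn n) \<le> (2 ^ n + 1) * m"
      by (rule order.trans[OF integral_mono ihU_le]) (use gi ihU bound1 in auto)
    have b1: "(\<integral>y. cmod (b y) \<partial>Rn n) \<le> (2 ^ n + 1) * m"
      by (rule order.trans[OF integral_mono ihU_le]) (use bi ihU bound2 in auto)
    have hgb: "AE y in Rn n. h y - g y = b y"
    proof -
      have "AE y in Rn n. y \<notin> U \<longrightarrow> cmod (h y) \<le> t"
        unfolding U_def by (rule dyadic_differentiation[OF u L _ stop]) (use Um U_def in auto)
      then show ?thesis by eventually_elim (auto simp: g_def b_def)
    qed
    \<comment> \<open>The radius 4 n^2 len serves two purposes: Hormander's condition for
      displacements up to n len, and the smallness of cells that are cut by a sphere.\<close>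
    define V where "V = (\<Union>j. {x \<in> space (Rn n). vnorm n (vsub n (c j) x) \<le> 4 * real n ^ 2 * len j})"
    have Vm: "{x \<in> space (Rn n). vnorm n (vsub n (c j) x) \<le> 4 * real n ^ 2 * len j} \<in> sets (Rn n)" for j
    proof -
      have [measurable]: "c j \<in> space (Rn n)" by (rule cs)
      show ?thesis by measurable
    qed
    have V: "V \<in> sets (Rn n)" unfolding V_def by (rule sets.countable_UN) (use Vm in blast)
    have Ve: "emeasure (Rn n) V \<le> ennreal ((8 * real n ^ 2) ^ n * m / t)"
    proof -
      have "emeasure (Rn n) V \<le> (\<Sum>j. emeasure (Rn n) {x \<in> space (Rn n). vnorm n (vsub n (c j) x) \<le> 4 * real n ^ 2 * len j})"
        unfolding V_def by (rule emeasure_subadditive_countably) (use Vm in auto)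
      also have "\<dots> \<le> (\<Sum>j. ennreal ((8 * real n ^ 2) ^ n) * ennreal (len j ^ n))"
      proof (rule suminf_le)
        fix j
        have "emeasure (Rn n) {x \<in> space (Rn n). vnorm n (vsub n (c j) x) \<le> 4 * real n ^ 2 * len j} \<le> ennreal ((2 * (4 * real n ^ 2 * len j)) ^ n)"
          using emeasure_Rn_ball_le[of "4 * real n ^ 2 * len j" n "c j"] Q(2)[of j] by simp
        also have "2 * (4 * real n ^ 2 * len j) = (8 * real n ^ 2) * len j" by simp
        also have "((8 * real n ^ 2) * len j) ^ n = (8 * real n ^ 2) ^ n * len j ^ n" by (rule power_mult_distrib)
        finally show "emeasure (Rn n) {x \<in> space (Rn n). vnorm n (vsub n (c j) x) \<le> 4 * real n ^ 2 * len j} \<le> ennreal ((8 * real n ^ 2) ^ n) * ennreal (len j ^ n)"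
          using Q(2)[of j] by (simp add: ennreal_mult)
      qed auto
      also have "\<dots> = ennreal ((8 * real n ^ 2) ^ n) * (\<Sum>j. ennreal (len j ^ n))" by (rule ennreal_suminf_cmult)
      also have "\<dots> \<le> ennreal ((8 * real n ^ 2) ^ n) * ennreal (m / t)"
        by (rule mult_left_mono) (use vol(3) in \<open>auto simp: m_def\<close>)
      finally show ?thesis using m0 t by (simp add: ennreal_mult[symmetric])
    qed
    let ?B = "\<lambda>y. ennreal (cmod (b y) + 2 ^ (n + 1) * t)"
    let ?k = "\<lambda>x y. ennreal (cmod (K (vsub n x y) - K (vsub n x (c (J y)))))"
    define D where "D x = (\<integral>\<^sup>+y. ?k x y * ?B y * indicator U y \<partial>Rn n)" for x
    interpret P: pair_sigma_finite "Rn n" "Rn n" ..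
    have Dm[measurable]: "D \<in> borel_measurable (Rn n)" unfolding D_def by measurable
    have D_int: "(\<integral>\<^sup>+x. D x * indicator (- V) x \<partial>Rn n) \<le> ennreal (2 ^ (n + 2) * HC * W * m)"
    proof -
      have Vc[measurable]: "Measurable.pred (Rn n) (\<lambda>x. x \<notin> V)" using V by measurable
      have "(\<integral>\<^sup>+x. D x * indicator (- V) x \<partial>Rn n) = (\<integral>\<^sup>+x. \<integral>\<^sup>+y. ?k x y * ?B y * indicator U y * (if x \<notin> V then 1 else 0) \<partial>Rn n \<partial>Rn n)"
        unfolding D_def
      proof (rule nn_integral_cong)
        fix x assume [measurable]: "x \<in> space (Rn n)"
        have "(\<integral>\<^sup>+y. ?k x y * ?B y * indicator U y \<partial>Rn n) * indicator (- V) x = (\<integral>\<^sup>+y. ?k x y * ?B y * indicator U y \<partial>Rn n) * (if x \<notin> V then 1 else 0)"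
          by (simp add: indicator_def)
        also have "\<dots> = (\<integral>\<^sup>+y. ?k x y * ?B y * indicator U y * (if x \<notin> V then 1 else 0) \<partial>Rn n)"
          by (rule nn_integral_multc[symmetric]) measurable
        finally show "(\<integral>\<^sup>+y. ?k x y * ?B y * indicator U y \<partial>Rn n) * indicator (- V) x = (\<integral>\<^sup>+y. ?k x y * ?B y * indicator U y * (if x \<notin> V then 1 else 0) \<partial>Rn n)" .
      qed
      also have "\<dots> = (\<integral>\<^sup>+y. \<integral>\<^sup>+x. ?k x y * ?B y * indicator U y * (if x \<notin> V then 1 else 0) \<partial>Rn n \<partial>Rn n)"
        by (rule P.Fubini'[symmetric]) measurable
      also have "\<dots> \<le> (\<integral>\<^sup>+y. ennreal (HC * W) * (?B y * indicator U y) \<partial>Rn n)"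
      proof (rule nn_integral_mono)
        fix y assume y[measurable]: "y \<in> space (Rn n)"
        show "(\<integral>\<^sup>+x. ?k x y * ?B y * indicator U y * (if x \<notin> V then 1 else 0) \<partial>Rn n) \<le> ennreal (HC * W) * (?B y * indicator U y)"
        proof (cases "y \<in> U")
          case True
          then obtain j where yj: "y \<in> Q j" by (auto simp: U_def)
          note l = len_pos[OF yj]
          have [measurable]: "c j \<in> space (Rn n)" by (rule cs)
          let ?e = "4 * real n ^ 2 * len j"
          have e: "?e > 0" using l n by simp
          have "vnorm n (vsub n y (c j)) \<le> n * len j" using cube_diam(2) yj Q(1) by blast
          also have "n * len j \<le> ?e / (2 * n)" using n l by (simp add: power2_eq_square)
          finally have near: "vnorm n (vsub n y (c j)) \<le> ?e / (2 * n)" .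
          have "(\<integral>\<^sup>+x. ?k x y * ?B y * indicator U y * (if x \<notin> V then 1 else 0) \<partial>Rn n)
            \<le> (\<integral>\<^sup>+x. (ennreal (cmod (K (vsub n x y) - K (vsub n x (c j)))) * indicator {?e..} (vnorm n (vsub n x (c j)))) * ?B y \<partial>Rn n)"
          proof (rule nn_integral_mono)
            fix x assume x: "x \<in> space (Rn n)"
            have "vnorm n (vsub n x (c j)) \<ge> ?e" if "x \<notin> V"
            proof -
              have "\<not> vnorm n (vsub n (c j) x) \<le> ?e" using that x by (auto simp: V_def)
              then show ?thesis by (simp add: vnorm_vsub_commute[of n x])
            qed
            then show "?k x y * ?B y * indicator U y * (if x \<notin> V then 1 else 0) \<le> (ennreal (cmod (K (vsub n x y) - K (vsub n x (c j)))) * indicator {?e..} (vnorm n (vsub n x (c j)))) * ?B y"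
              using True J[OF yj] by (auto simp: indicator_def)
          qed
          also have "\<dots> = (\<integral>\<^sup>+x. ennreal (cmod (K (vsub n x y) - K (vsub n x (c j)))) * indicator {?e..} (vnorm n (vsub n x (c j))) \<partial>Rn n) * ?B y"
            by (rule nn_integral_multc) measurable
          also have "\<dots> \<le> ennreal (HC * W) * ?B y"
            by (rule mult_right_mono[OF kernel_diff_translate[OF cs y e near]]) simp
          finally show ?thesis using True by simp
        qed simp
      qed
      also have "\<dots> = ennreal (HC * W) * (\<integral>\<^sup>+y. ?B y * indicator U y \<partial>Rn n)" by (rule nn_integral_cmult) measurable
      also have "(\<integral>\<^sup>+y. ?B y * indicator U y \<partial>Rn n) \<le> ennreal (2 ^ (n + 2) * m)"
      proof -
        have "(\<integral>\<^sup>+y. ?B y * indicator U y \<partial>Rn n) \<le> (\<integral>\<^sup>+y. ennreal (cmod (b y) + 2 ^ (n + 1) * t * indicator U y) \<partial>Rn n)"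
          by (rule nn_integral_mono) (auto simp: indicator_def)
        also have "\<dots> = ennreal (\<integral>y. cmod (b y) + 2 ^ (n + 1) * t * indicator U y \<partial>Rn n)"
          by (rule nn_integral_eq_integral) (use bi Ufin t in auto)
        also have "(\<integral>y. cmod (b y) + 2 ^ (n + 1) * t * indicator U y \<partial>Rn n) = (\<integral>y. cmod (b y) \<partial>Rn n) + 2 ^ (n + 1) * t * measure (Rn n) U"
          using bi Ufin by (simp add: Int_absorb2[OF sets.sets_into_space[OF Um]])
        also have "\<dots> \<le> (2 ^ n + 1) * m + 2 ^ (n + 1) * t * (m / t)"
          using Umeas t by (intro add_mono mult_left_mono b1) auto
        also have "\<dots> = (3 * 2 ^ n + 1) * m" using t by (simp add: algebra_simps)
        also have "\<dots> \<le> (2 ^ (n + 2)) * m" using m0 by (intro mult_right_mono) auto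
        finally show ?thesis by (simp add: ennreal_leI)
      qed
      finally have "(\<integral>\<^sup>+x. D x * indicator (- V) x \<partial>Rn n) \<le> ennreal (HC * W) * ennreal (2 ^ (n + 2) * m)"
        by (simp add: mult_left_mono)
      also have "\<dots> = ennreal (2 ^ (n + 2) * HC * W * m)"
        using HC_pos W_nonneg m0 by (simp add: ennreal_mult[symmetric] mult_ac)
      finally show ?thesis .
    qed
    define H where "H = {x \<in> space (Rn n). x \<notin> V \<and> ennreal t < D x}"
    have Hm: "H \<in> sets (Rn n)" unfolding H_def using V by measurable
    have He: "emeasure (Rn n) H \<le> ennreal (2 ^ (n + 2) * HC * W * m / t)"
    proof -
      have "ennreal t * emeasure (Rn n) H = (\<integral>\<^sup>+x. ennreal t * indicator H x \<partial>Rn n)"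
        by (rule nn_integral_cmult_indicator[symmetric, OF Hm])
      also have "\<dots> \<le> (\<integral>\<^sup>+x. D x * indicator (- V) x \<partial>Rn n)"
        by (rule nn_integral_mono) (auto simp: H_def indicator_def)
      also note D_int
      finally have "ennreal (1 / t) * (ennreal t * emeasure (Rn n) H) \<le> ennreal (1 / t) * ennreal (2 ^ (n + 2) * HC * W * m)"
        by (rule mult_left_mono) simp
      then show ?thesis using t HC_pos W_nonneg m0 by (simp add: mult.assoc[symmetric] ennreal_mult[symmetric])
    qed
    have "AE x in Rn n. \<forall>\<epsilon>>0. integrable (Rn n) (\<lambda>y. trunc \<epsilon> x y * b y)" by (rule AE_integrable_trunc[OF bi])
    then have main: "AE x in Rn n. x \<notin> V \<union> H \<longrightarrow> (\<forall>\<epsilon>>0. cmod (TR \<epsilon> (\<lambda>y. h y - g y) x) \<le> cz_const * t)"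
      using AE_space
    proof eventually_elim
      case (elim x)
      show ?case
      proof (intro impI allI)
        fix \<epsilon> :: real assume nVH: "x \<notin> V \<union> H" and e: "\<epsilon> > 0"
        have x[measurable]: "x \<in> space (Rn n)" by (rule elim)
        have ib: "integrable (Rn n) (\<lambda>y. trunc \<epsilon> x y * b y)" using elim e by blast
        have "TR \<epsilon> (\<lambda>y. h y - g y) x = TR \<epsilon> b x"
          unfolding TR_trunc by (rule integral_cong_AE) (use hgb in \<open>auto elim!: eventually_mono\<close>)
        moreover have "ennreal (cmod (TR \<epsilon> b x)) \<le> ennreal (cz_const * t)"
        proof -
          let ?T = "ennreal (2 ^ (n + 1) * t)"
          let ?R = "\<lambda>y. ennreal (cmod (K (vsub n x y))) * indicator {\<epsilon> / 2..3 / 2 * \<epsilon>} (vnorm n (vsub n x y))"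
          let ?G = "\<lambda>y. ?k x y * ?B y * indicator U y + ?T * ?R y"
          have "ennreal (cmod (TR \<epsilon> b x)) \<le> (\<integral>\<^sup>+y. ?G y \<partial>Rn n)"
            unfolding TR_trunc
          proof (rule norm_integral_cells_le[OF ib _ Qm Q(3)])
            show "trunc \<epsilon> x y * b y = 0" if "y \<notin> (\<Union>j. Q j)" for y using that by (simp add: b_def U_def)
            show "?G \<in> borel_measurable (Rn n)" by measurable
            fix j
            show "ennreal (cmod (\<integral>y. indicator (Q j) y *\<^sub>R (trunc \<epsilon> x y * b y) \<partial>Rn n)) \<le> (\<integral>\<^sup>+y. ?G y * indicator (Q j) y \<partial>Rn n)"
            proof (cases "Q j = {}")
              case False
              then have l: "len j > 0" using len_pos by blast
              have far: "4 * real n ^ 2 * len j \<le> vnorm n (vsub n x (c j))"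
              proof -
                have "\<not> vnorm n (vsub n (c j) x) \<le> 4 * real n ^ 2 * len j" using nVH x by (auto simp: V_def)
                then show ?thesis by (simp add: vnorm_vsub_commute[of n x])
              qed
              have bav: "b y = h y - (\<integral>y. indicator (Q j) y *\<^sub>R h y \<partial>Rn n) / of_real (len j ^ n)" if "y \<in> Q j" for y
                using that J[OF that] by (auto simp: b_def U_def av_def)
              have "ennreal (cmod (\<integral>y. indicator (Q j) y *\<^sub>R (trunc \<epsilon> x y * b y) \<partial>Rn n))
                \<le> (\<integral>\<^sup>+y. (ennreal (cmod (K (vsub n x y) - K (vsub n x (c j)))) * ?B y + ?T * ?R y) * indicator (Q j) y \<partial>Rn n)"
                by (rule cz_cell_estimate[OF h t Q(1) l cs up bav bi x far ib e])
              also have "\<dots> = (\<integral>\<^sup>+y. ?G y * indicator (Q j) y \<partial>Rn n)"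
              proof (rule nn_integral_cong)
                fix y
                have "y \<in> U" "J y = j" if "y \<in> Q j" using that J[OF that] by (auto simp: U_def)
                then show "(ennreal (cmod (K (vsub n x y) - K (vsub n x (c j)))) * ?B y + ?T * ?R y) * indicator (Q j) y = ?G y * indicator (Q j) y"
                  by (auto simp: indicator_def)
              qed
              finally show ?thesis .
            qed simp
          qed
          also have "\<dots> = D x + ?T * (\<integral>\<^sup>+y. ?R y \<partial>Rn n)"
            unfolding D_def by (subst nn_integral_add) (auto simp: nn_integral_cmult)
          also have "(\<integral>\<^sup>+y. ?R y \<partial>Rn n) = (\<integral>\<^sup>+w. ennreal (cmod (K w)) * indicator {\<epsilon> / 2..3 / 2 * \<epsilon>} (vnorm n w) \<partial>Rn n)"
            by (rule nn_integral_vsub_left[where F="\<lambda>w. ennreal (cmod (K w)) * indicator {\<epsilon> / 2..3 / 2 * \<epsilon>} (vnorm n w)"]) measurable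
          also have "D x + ?T * \<dots> \<le> ennreal t + ?T * ennreal (W * ((3 / 2 * \<epsilon> - \<epsilon> / 2) / (\<epsilon> / 2)))"
          proof (intro add_mono mult_left_mono nn_integral_K_annulus)
            show "D x \<le> ennreal t" using nVH x by (auto simp: H_def not_less)
          qed (use e in auto)
          also have "(3 / 2 * \<epsilon> - \<epsilon> / 2) / (\<epsilon> / 2) = 2" using e by (simp add: field_simps)
          also have "ennreal t + ?T * ennreal (W * 2) = ennreal (t + 2 ^ (n + 1) * t * (W * 2))"
            using t W_nonneg by (simp add: ennreal_mult[symmetric] ennreal_plus[symmetric] del: ennreal_plus)
          also have "\<dots> \<le> ennreal (cz_const * t)"
          proof (rule ennreal_leI)
            have "t + 2 ^ (n + 1) * t * (W * 2) = (2 ^ (n + 2) * W + 1) * t" by (simp add: algebra_simps)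
            also have "\<dots> \<le> cz_const * t" unfolding cz_const_def
              using t HC_pos W_nonneg by (intro mult_right_mono) auto
            finally show "t + 2 ^ (n + 1) * t * (W * 2) \<le> cz_const * t" .
          qed
          finally show ?thesis .
        qed
        ultimately show "cmod (TR \<epsilon> (\<lambda>y. h y - g y) x) \<le> cz_const * t"
          using cz_const_pos t by (simp add: ennreal_le_iff)
      qed
    qed
    have VH: "emeasure (Rn n) (V \<union> H) \<le> ennreal (cz_const * m / t)"
    proof -
      have "emeasure (Rn n) (V \<union> H) \<le> ennreal ((8 * real n ^ 2) ^ n * m / t) + ennreal (2 ^ (n + 2) * HC * W * m / t)"
        by (rule order.trans[OF emeasure_subadditive[OF V Hm] add_mono[OF Ve He]])
      also have "\<dots> = ennreal ((8 * real n ^ 2) ^ n * m / t + 2 ^ (n + 2) * HC * W * m / t)"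
        using m0 t HC_pos W_nonneg by (intro ennreal_plus[symmetric]) auto
      also have "\<dots> \<le> ennreal (cz_const * m / t)"
      proof (rule ennreal_leI)
        have "(8 * real n ^ 2) ^ n * m / t + 2 ^ (n + 2) * HC * W * m / t = ((8 * real n ^ 2) ^ n + 2 ^ (n + 2) * HC * W) * (m / t)"
          by (simp only: distrib_right times_divide_eq_right add_divide_distrib)
        also have "\<dots> \<le> cz_const * (m / t)"
          unfolding cz_const_def using m0 t W_nonneg by (intro mult_right_mono) auto
        finally show "(8 * real n ^ 2) ^ n * m / t + 2 ^ (n + 2) * HC * W * m / t \<le> cz_const * m / t" by simp
      qed
      finally show ?thesis .
    qed
    show ?thesis
      using gi g_le g1 V Hm VH main unfolding m_def by (intro exI[of _ g] exI[of _ "V \<union> H"]) auto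
  qed simp
qed

end

subsection \<open>Cotlar's comparison and the maximal inequality\<close>

context singular_kernel begin

text \<open>For a bounded function the truncation at distance \<open>\<epsilon>\<close> around \<open>x\<close> is compared with \<open>TM M g z - TM M g\<^sub>1 z\<close>,
  where \<open>g\<^sub>1\<close> is \<open>g\<close> cut to the \<open>\<epsilon>\<close>-ball and \<open>z\<close> is a point of a dyadic cube around \<open>x\<close> at which both terms are small.\<close>

lemma cotlar_bounded:
  fixes g :: "(nat \<Rightarrow> real) \<Rightarrow> complex"
  assumes D: "dirac_weak \<sigma>" and g: "integrable (Rn n) g" "\<And>y. cmod (g y) \<le> t" and t: "t > 0"
  defines "c \<equiv> 440 * W + 12 * \<sigma> * (8 * real n ^ 2) ^ n + 1"
  shows "\<exists>E\<in>sets (Rn n). emeasure (Rn n) E \<le> ennreal (12 * \<sigma> * (\<integral>y. cmod (g y) \<partial>Rn n) / t) \<and>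
    (AE x in Rn n. x \<notin> E \<longrightarrow> (\<forall>\<^sub>F \<epsilon> in at_right 0. cmod (TR \<epsilon> g x) \<le> (8 * c + HC * W + 1) * t))"
proof -
  have \<sigma>: "\<sigma> \<ge> 0" using D by (simp add: dirac_weak_def)
  have n1: "real n \<ge> 1" using n by simp
  have c1: "c \<ge> 1" "c \<ge> 440 * W" "c \<ge> 12 * \<sigma> * (8 * real n ^ 2) ^ n" using \<sigma> W_nonneg by (auto simp: c_def)
  define s where "s = c * t"
  have s: "s > 0" "s \<ge> 440 * t * W" "s \<ge> t"
  proof -
    show "s > 0" using c1 t by (simp add: s_def)
    show "s \<ge> 440 * t * W" using mult_right_mono[OF c1(2), of t] t by (simp add: s_def mult_ac)
    show "s \<ge> t" using mult_right_mono[OF c1(1), of t] t by (simp add: s_def)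
  qed
  have gm[measurable]: "g \<in> borel_measurable (Rn n)" using g by auto
  define G where "G = (\<integral>y. cmod (g y) \<partial>Rn n)"
  have G0: "G \<ge> 0" by (simp add: G_def)
  define v where "v = 3 * \<sigma> * G / s"
  have v0: "v \<ge> 0" using \<sigma> G0 s by (simp add: v_def)
  \<comment> \<open>Every X k has measure at most v, so 4 v \<le> L^n limits its density in cubes of
    generation 0 to 1/4.\<close>
  define L where "L = 4 * v + 1"
  have L: "L > 0" "v \<le> 1 / 4 * L ^ n"
  proof -
    show "L > 0" using v0 by (simp add: L_def)
    have "L \<le> L ^ n" using n v0 by (intro self_le_power) (auto simp: L_def)
    then show "v \<le> 1 / 4 * L ^ n" by (simp add: L_def)
  qed
  define Mk where "Mk k = real k + 1" for k :: nat
  have Mk: "Mk k > 0" for k by (simp add: Mk_def)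
  have Mk_lim: "filterlim Mk at_top sequentially" unfolding Mk_def by real_asymp
  define X where "X k = {x \<in> space (Rn n). 4 * s < cmod (TM (Mk k) g x)}" for k
  have Xm[measurable]: "X k \<in> sets (Rn n)" for k unfolding X_def by measurable
  have Xe: "emeasure (Rn n) (X k) \<le> ennreal v" for k
    unfolding X_def v_def G_def by (rule TM_weak_complex[OF D g Mk s(1,2)])
  have Xfin: "emeasure (Rn n) (X k) < \<infinity>" for k by (rule le_less_trans[OF Xe]) simp
  have Xme: "measure (Rn n) (X k) \<le> v" for k using Xe v0 by (simp add: measure_def enn2real_leI)
  have exV: "\<exists>V. V \<in> sets (Rn n) \<and> emeasure (Rn n) V \<le> ennreal (4 * v) \<and>
      (\<forall>x\<in>space (Rn n). x \<notin> V \<longrightarrow> (\<forall>j. measure (Rn n) (X k \<inter> dcube n L j x) \<le> 1 / 4 * (L / 2 ^ j) ^ n))" for k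
  proof -
    have iX: "integrable (Rn n) (indicator (X k) :: _ \<Rightarrow> real)" using Xfin by (intro integrable_real_indicator) auto
    have X_int: "(\<integral>x. indicator (X k) x \<partial>Rn n) = measure (Rn n) (X k)"
      by (simp add: Int_absorb2[OF sets.sets_into_space[OF Xm]])
    have le: "(\<integral>x. indicator (X k) x \<partial>Rn n) \<le> 1 / 4 * L ^ n" unfolding X_int using Xme[of k] L(2) by linarith
    have pos: "0 \<le> (indicator (X k) x :: real)" for x by simp
    obtain V where V: "V \<in> sets (Rn n)" "emeasure (Rn n) V \<le> ennreal ((\<integral>x. indicator (X k) x \<partial>Rn n) / (1 / 4))"
        "\<And>x j. x \<in> space (Rn n) \<Longrightarrow> x \<notin> V \<Longrightarrow> (\<integral>y. indicator (X k) y * indicator (dcube n L j x) y \<partial>Rn n) \<le> 1 / 4 * (L / 2 ^ j) ^ n"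
      using dyadic_maximal[OF iX pos _ L(1) le] by auto
    have "(\<integral>y. indicator (X k) y * indicator (dcube n L j x) y \<partial>Rn n) = measure (Rn n) (X k \<inter> dcube n L j x)" for x j
      using L(1) by (subst indicator_inter_arith[symmetric]) (simp add: Int_absorb2 sets.sets_into_space)
    then have "measure (Rn n) (X k \<inter> dcube n L j x) \<le> 1 / 4 * (L / 2 ^ j) ^ n" if "x \<in> space (Rn n)" "x \<notin> V" for x j
      using V(3)[OF that, of j] by simp
    moreover have "emeasure (Rn n) V \<le> ennreal (4 * v)"
      by (rule order.trans[OF V(2)]) (use Xme[of k] in \<open>simp add: X_int ennreal_leI\<close>)
    ultimately show ?thesis using V(1) by (intro exI[of _ V] conjI ballI impI allI)
  qed
  define PV where "PV k V \<longleftrightarrow> V \<in> sets (Rn n) \<and> emeasure (Rn n) V \<le> ennreal (4 * v) \<and>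
      (\<forall>x\<in>space (Rn n). x \<notin> V \<longrightarrow> (\<forall>j. measure (Rn n) (X k \<inter> dcube n L j x) \<le> 1 / 4 * (L / 2 ^ j) ^ n))" for k V
  obtain V where V: "\<And>k. PV k (V k)" using exV unfolding PV_def[symmetric] by metis
  have Vm: "V k \<in> sets (Rn n)" and Ve: "emeasure (Rn n) (V k) \<le> ennreal (4 * v)" for k using V[of k] by (auto simp: PV_def)
  have Vd: "measure (Rn n) (X k \<inter> dcube n L j x) \<le> 1 / 4 * (L / 2 ^ j) ^ n" if "x \<in> space (Rn n)" "x \<notin> V k" for x j k
    using V[of k] that by (auto simp: PV_def)
  \<comment> \<open>Outside this lim inf set there are arbitrarily large k with x not in V k, and
    the estimates below are uniform in k.\<close>
  define E where "E = (\<Union>j. \<Inter>k\<in>{j..}. V k)"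
  have Em: "E \<in> sets (Rn n)" unfolding E_def using Vm by (intro sets.countable_UN sets.countable_INT) auto
  have Ee: "emeasure (Rn n) E \<le> ennreal (12 * \<sigma> * G / t)"
  proof -
    have "emeasure (Rn n) E = (SUP j. emeasure (Rn n) (\<Inter>k\<in>{j..}. V k))"
      unfolding E_def using Vm by (intro SUP_emeasure_incseq[symmetric]) (auto simp: incseq_def)
    also have "\<dots> \<le> ennreal (4 * v)"
    proof (rule SUP_least)
      fix j show "emeasure (Rn n) (\<Inter>k\<in>{j..}. V k) \<le> ennreal (4 * v)"
        by (rule order.trans[OF emeasure_mono Ve[of j]]) (use Vm in auto)
    qed
    also have "\<dots> \<le> ennreal (12 * \<sigma> * G / t)"
    proof (rule ennreal_leI)
      have "12 * \<sigma> * G / s \<le> 12 * \<sigma> * G / t" using s t \<sigma> G0 by (intro divide_left_mono) auto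
      then show "4 * v \<le> 12 * \<sigma> * G / t" by (simp add: v_def)
    qed
    finally show ?thesis .
  qed
  note int_ae = AE_integrable_trunc[OF g(1)]
  have main: "cmod (TR \<epsilon> g x) \<le> (8 * c + HC * W + 1) * t"
    if x[measurable]: "x \<in> space (Rn n)" and xE: "x \<notin> E" and ix: "\<forall>\<epsilon>>0. integrable (Rn n) (\<lambda>y. trunc \<epsilon> x y * g y)"
      and e: "0 < \<epsilon>" "\<epsilon> < 2 * real n ^ 2 * L" for x \<epsilon>
  proof -
    have n2: "real n ^ 2 > 0" using n1 by simp
    \<comment> \<open>The first generation of side at most \<epsilon>/(2 n^2): distances within the
      cube are then at most \<epsilon>/(2n), as \<open>hormander\<close> demands, and minimality
      keeps the side at least \<epsilon>/(4 n^2), comparable to the \<epsilon>-ball. The bound on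
      \<epsilon> excludes generation 0, so a previous generation exists.\<close>
    define j where "j = (LEAST j. L / 2 ^ j \<le> \<epsilon> / (2 * real n ^ 2))"
    have "\<exists>j. L / 2 ^ j \<le> \<epsilon> / (2 * real n ^ 2)"
    proof -
      obtain j :: nat where "L * (2 * real n ^ 2) / \<epsilon> < 2 ^ j" using real_arch_pow[of 2 "L * (2 * real n ^ 2) / \<epsilon>"] by auto
      then have "L / 2 ^ j \<le> \<epsilon> / (2 * real n ^ 2)" using e n2 by (simp add: field_simps)
      then show ?thesis by blast
    qed
    then have j1: "L / 2 ^ j \<le> \<epsilon> / (2 * real n ^ 2)" unfolding j_def by (rule LeastI_ex)
    have "j \<noteq> 0"
    proof
      assume "j = 0"
      with j1 have "L \<le> \<epsilon> / (2 * real n ^ 2)" by simp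
      then have "2 * real n ^ 2 * L \<le> \<epsilon>" using n2 by (simp add: field_simps)
      with e show False by simp
    qed
    then obtain i where ji: "j = Suc i" by (cases j) auto
    have "\<not> L / 2 ^ i \<le> \<epsilon> / (2 * real n ^ 2)" using not_less_Least[of i "\<lambda>j. L / 2 ^ j \<le> \<epsilon> / (2 * real n ^ 2)"] ji by (simp add: j_def)
    define len where "len = L / 2 ^ j"
    have len: "len > 0" "len \<le> \<epsilon> / (2 * real n ^ 2)" using L j1 by (auto simp: len_def)
    have "L / 2 ^ i = 2 * len" by (simp add: len_def ji)
    with \<open>\<not> L / 2 ^ i \<le> \<epsilon> / (2 * real n ^ 2)\<close> have len2: "\<epsilon> \<le> 4 * real n ^ 2 * len" using n2 by (simp add: field_simps)
    have nlen: "n * len \<le> \<epsilon> / (2 * n)"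
    proof -
      have "n * len \<le> n * (\<epsilon> / (2 * real n ^ 2))" using len by (intro mult_left_mono) auto
      also have "\<dots> = \<epsilon> / (2 * n)" using n1 by (simp add: power2_eq_square)
      finally show ?thesis .
    qed
    have half: "\<epsilon> / (2 * n) \<le> \<epsilon> / 2" using n1 e by (intro divide_left_mono) auto
    let ?Q = "dcube n L j x"
    have Qm[measurable]: "?Q \<in> sets (Rn n)" using L by simp
    have Qs: "?Q \<subseteq> space (Rn n)" by (rule sets.sets_into_space[OF Qm])
    have Qe: "emeasure (Rn n) ?Q = ennreal (len ^ n)" unfolding len_def by (rule emeasure_dcube[OF L(1)])
    have Qd: "vnorm n (vsub n x z) \<le> \<epsilon> / (2 * n)" if "z \<in> ?Q" for z
      using dcube_diam[OF L(1) that x] nlen by (simp add: len_def)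
    define g1 where "g1 y = (if vnorm n (vsub n x y) < \<epsilon> then g y else 0)" for y
    have g1m[measurable]: "g1 \<in> borel_measurable (Rn n)" unfolding g1_def by measurable
    have g1i: "integrable (Rn n) g1" by (rule Bochner_Integration.integrable_bound[OF g(1)]) (auto simp: g1_def)
    have g1b: "cmod (g1 y) \<le> t" for y using g(2)[of y] t by (simp add: g1_def)
    have g1n: "(\<integral>y. cmod (g1 y) \<partial>Rn n) \<le> t * ((8 * real n ^ 2) ^ n * len ^ n)"
    proof -
      let ?b = "{y \<in> space (Rn n). vnorm n (vsub n x y) \<le> \<epsilon>}"
      have "ennreal (\<integral>y. cmod (g1 y) \<partial>Rn n) = (\<integral>\<^sup>+y. ennreal (cmod (g1 y)) \<partial>Rn n)"
        by (rule nn_integral_eq_integral[symmetric]) (use g1i in auto)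
      also have "\<dots> \<le> (\<integral>\<^sup>+y. ennreal t * indicator ?b y \<partial>Rn n)"
        by (rule nn_integral_mono) (use g(2) in \<open>auto simp: g1_def indicator_def intro: ennreal_leI\<close>)
      also have "\<dots> = ennreal t * emeasure (Rn n) ?b" by (rule nn_integral_cmult_indicator) measurable
      also have "\<dots> \<le> ennreal t * ennreal ((2 * \<epsilon>) ^ n)" by (rule mult_left_mono[OF emeasure_Rn_ball_le]) (use e in auto)
      also have "\<dots> \<le> ennreal t * ennreal ((8 * real n ^ 2 * len) ^ n)"
      proof (intro mult_left_mono ennreal_leI power_mono)
        show "2 * \<epsilon> \<le> 8 * real n ^ 2 * len" using len2 by linarith
      qed (use e in auto)
      also have "\<dots> = ennreal (t * ((8 * real n ^ 2) ^ n * len ^ n))"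
        using t len by (simp add: ennreal_mult[symmetric] power_mult_distrib)
      finally show ?thesis using t len by (subst (asm) ennreal_le_iff) auto
    qed
    \<comment> \<open>The cost, at z, of truncating the kernel by size in the integral over |x - y|
      \<ge> \<epsilon>. It tends to 0 as k grows, for almost every z in the cube.\<close>
    define err where "err k z = (\<integral>\<^sup>+y. ennreal (cmod ((K (vsub n z y) - KM (Mk k) (vsub n z y)) * (if \<epsilon> \<le> vnorm n (vsub n x y) then g y else 0))) \<partial>Rn n)" for k z
    have errm[measurable]: "err k \<in> borel_measurable (Rn n)" for k unfolding err_def by measurable
    have err_lim: "(\<lambda>k. err k z) \<longlonglongrightarrow> 0" if z: "z \<in> ?Q" and iz: "\<forall>\<epsilon>>0. integrable (Rn n) (\<lambda>y. trunc \<epsilon> z y * g y)" for z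
    proof -
      have [measurable]: "z \<in> space (Rn n)" using z Qs by auto
      let ?w = "\<lambda>y. ennreal (cmod (trunc (\<epsilon> / 2) z y * g y))"
      have "(\<lambda>k. err k z) \<longlonglongrightarrow> (\<integral>\<^sup>+y. 0 \<partial>Rn n)"
        unfolding err_def
      proof (rule nn_integral_dominated_convergence[where w="?w"])
        show "(\<integral>\<^sup>+y. ?w y \<partial>Rn n) < \<infinity>" using iz e by (auto simp: integrable_iff_bounded)
        show "AE y in Rn n. ennreal (cmod ((K (vsub n z y) - KM (Mk k) (vsub n z y)) * (if \<epsilon> \<le> vnorm n (vsub n x y) then g y else 0))) \<le> ?w y" for k
        proof (rule AE_I2)
          fix y
          have "vnorm n (vsub n x y) \<le> vnorm n (vsub n x z) + vnorm n (vsub n z y)" by (rule vnorm_vsub_triangle)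
          then have "\<epsilon> / 2 \<le> vnorm n (vsub n z y)" if "\<epsilon> \<le> vnorm n (vsub n x y)" using that Qd[OF z] half by linarith
          moreover have "cmod (K (vsub n z y) - KM (Mk k) (vsub n z y)) \<le> cmod (K (vsub n z y))" by (simp add: KM_def)
          ultimately show "ennreal (cmod ((K (vsub n z y) - KM (Mk k) (vsub n z y)) * (if \<epsilon> \<le> vnorm n (vsub n x y) then g y else 0))) \<le> ?w y"
            by (intro ennreal_leI) (auto simp: trunc_def norm_mult intro!: mult_right_mono)
        qed
        show "AE y in Rn n. (\<lambda>k. ennreal (cmod ((K (vsub n z y) - KM (Mk k) (vsub n z y)) * (if \<epsilon> \<le> vnorm n (vsub n x y) then g y else 0)))) \<longlonglongrightarrow> 0"
        proof (rule AE_I2)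
          fix y
          have "(\<lambda>k. KM (Mk k) (vsub n z y)) \<longlonglongrightarrow> K (vsub n z y)" by (rule filterlim_compose[OF KM_tendsto Mk_lim])
          from tendsto_norm[OF tendsto_mult[OF tendsto_diff[OF tendsto_const[of "K (vsub n z y)"] this] tendsto_const[of "if \<epsilon> \<le> vnorm n (vsub n x y) then g y else 0"]]]
          have "(\<lambda>k. cmod ((K (vsub n z y) - KM (Mk k) (vsub n z y)) * (if \<epsilon> \<le> vnorm n (vsub n x y) then g y else 0))) \<longlonglongrightarrow> 0" by simp
          from tendsto_ennrealI[OF this] show "(\<lambda>k. ennreal (cmod ((K (vsub n z y) - KM (Mk k) (vsub n z y)) * (if \<epsilon> \<le> vnorm n (vsub n x y) then g y else 0)))) \<longlonglongrightarrow> 0" by simp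
        qed
      qed measurable
      then show ?thesis by simp
    qed
    define F where "F k = {z \<in> space (Rn n). z \<in> ?Q \<and> ennreal t < err k z}" for k
    have Fm[measurable]: "F k \<in> sets (Rn n)" for k unfolding F_def by measurable
    have "(\<lambda>k. \<integral>\<^sup>+z. indicator (F k) z \<partial>Rn n) \<longlonglongrightarrow> (\<integral>\<^sup>+z. 0 \<partial>Rn n)"
    proof (rule nn_integral_dominated_convergence[where w="indicator ?Q"])
      show "(\<integral>\<^sup>+z. indicator ?Q z \<partial>Rn n) < \<infinity>" by (simp add: Qe)
      show "AE z in Rn n. indicator (F k) z \<le> (indicator ?Q z :: ennreal)" for k by (rule AE_I2) (auto simp: F_def indicator_def)
      show "AE z in Rn n. (\<lambda>k. indicator (F k) z :: ennreal) \<longlonglongrightarrow> 0"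
        using int_ae
      proof eventually_elim
        case (elim z)
        show ?case
        proof (cases "z \<in> ?Q")
          case True
          have "\<forall>\<^sub>F k in sequentially. err k z < ennreal t" by (rule order_tendstoD(2)[OF err_lim[OF True elim]]) (use t in simp)
          then have "\<forall>\<^sub>F k in sequentially. indicator (F k) z = (0 :: ennreal)"
            by eventually_elim (auto simp: F_def indicator_def)
          then show ?thesis by (rule tendsto_eventually)
        qed (simp add: F_def)
      qed
    qed measurable
    then have "(\<lambda>k. emeasure (Rn n) (F k)) \<longlonglongrightarrow> 0" by simp
    then have "\<forall>\<^sub>F k in sequentially. emeasure (Rn n) (F k) < ennreal (1 / 4 * len ^ n)"
      by (rule order_tendstoD(2)) (use len in simp)
    then obtain k0 where k0: "\<And>k. k \<ge> k0 \<Longrightarrow> emeasure (Rn n) (F k) < ennreal (1 / 4 * len ^ n)" by (auto simp: eventually_sequentially)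
    obtain k where k: "k \<ge> k0" "x \<notin> V k" using xE by (auto simp: E_def)
    define Y where "Y = {z \<in> space (Rn n). 4 * s < cmod (TM (Mk k) g1 z)}"
    have Ym[measurable]: "Y \<in> sets (Rn n)" unfolding Y_def by measurable
    have Ye: "emeasure (Rn n) Y \<le> ennreal (1 / 4 * len ^ n)"
    proof -
      have "emeasure (Rn n) Y \<le> ennreal (3 * \<sigma> * (\<integral>y. cmod (g1 y) \<partial>Rn n) / s)"
        unfolding Y_def by (rule TM_weak_complex[OF D g1i g1b Mk s(1,2)])
      also have "\<dots> \<le> ennreal (1 / 4 * len ^ n)"
      proof (rule ennreal_leI)
        have "3 * \<sigma> * (\<integral>y. cmod (g1 y) \<partial>Rn n) \<le> 3 * \<sigma> * (t * ((8 * real n ^ 2) ^ n * len ^ n))"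
          using g1n \<sigma> by (intro mult_left_mono) auto
        also have "\<dots> = (12 * \<sigma> * (8 * real n ^ 2) ^ n) * (t * len ^ n / 4)" by simp
        also have "\<dots> \<le> c * (t * len ^ n / 4)" using c1(3) t len by (intro mult_right_mono) auto
        also have "\<dots> = 1 / 4 * len ^ n * s" by (simp add: s_def)
        finally show "3 * \<sigma> * (\<integral>y. cmod (g1 y) \<partial>Rn n) / s \<le> 1 / 4 * len ^ n" using s by (simp add: divide_le_eq)
      qed
      finally show ?thesis .
    qed
    have Xq: "emeasure (Rn n) (X k \<inter> ?Q) \<le> ennreal (1 / 4 * len ^ n)"
    proof -
      have "emeasure (Rn n) (X k \<inter> ?Q) \<noteq> \<infinity>"
        using emeasure_mono[of "X k \<inter> ?Q" "X k" "Rn n"] Xfin[of k] Xm[of k] by (auto simp: top_unique)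
      then have "emeasure (Rn n) (X k \<inter> ?Q) = ennreal (measure (Rn n) (X k \<inter> ?Q))" by (intro emeasure_eq_ennreal_measure) simp
      then show ?thesis using Vd[OF x k(2), of j] by (simp add: len_def ennreal_leI)
    qed
    \<comment> \<open>Three exceptional sets, each of at most a quarter of the cube's measure,
      cannot cover it.\<close>
    have "\<not> ?Q \<subseteq> (X k \<inter> ?Q) \<union> (Y \<union> F k)"
    proof
      assume "?Q \<subseteq> (X k \<inter> ?Q) \<union> (Y \<union> F k)"
      then have "ennreal (len ^ n) \<le> emeasure (Rn n) ((X k \<inter> ?Q) \<union> (Y \<union> F k))"
        unfolding Qe[symmetric] by (rule emeasure_mono) measurable
      also have "\<dots> \<le> emeasure (Rn n) (X k \<inter> ?Q) + emeasure (Rn n) (Y \<union> F k)"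
        by (rule emeasure_subadditive) measurable
      also have "\<dots> \<le> emeasure (Rn n) (X k \<inter> ?Q) + (emeasure (Rn n) Y + emeasure (Rn n) (F k))"
        by (intro add_left_mono emeasure_subadditive) measurable
      also have "\<dots> \<le> ennreal (1 / 4 * len ^ n) + (ennreal (1 / 4 * len ^ n) + ennreal (1 / 4 * len ^ n))"
        by (intro add_mono Xq Ye less_imp_le[OF k0[OF k(1)]])
      also have "\<dots> = ennreal (3 / 4 * len ^ n)"
        using len by (simp add: ennreal_plus[symmetric] del: ennreal_plus)
      finally have "len ^ n \<le> 3 / 4 * len ^ n" using len by (subst (asm) ennreal_le_iff) auto
      then show False using zero_less_power[OF len(1), of n] by linarith
    qed
    then obtain z where z: "z \<in> ?Q" "z \<notin> X k" "z \<notin> Y" "z \<notin> F k" by blast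
    have zs[measurable]: "z \<in> space (Rn n)" using z Qs by auto
    have z1: "cmod (TM (Mk k) g z) \<le> 4 * s" "cmod (TM (Mk k) g1 z) \<le> 4 * s" "err k z \<le> ennreal t"
      using z zs by (auto simp: X_def Y_def F_def not_less)
    let ?g2 = "\<lambda>y. if \<epsilon> \<le> vnorm n (vsub n x y) then g y else 0"
    have i1: "integrable (Rn n) (\<lambda>y. trunc \<epsilon> x y * g y)" using ix e by blast
    have M0: "Mk k \<ge> 0" using Mk[of k] by simp
    note i2 = integrable_KM_mult[OF M0 g(1), of z] and i3 = integrable_KM_mult[OF M0 g1i, of z]
    have diff: "TR \<epsilon> g x - (TM (Mk k) g z - TM (Mk k) g1 z) = (\<integral>y. trunc \<epsilon> x y * g y - (KM (Mk k) (vsub n z y) * g y - KM (Mk k) (vsub n z y) * g1 y) \<partial>Rn n)"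
      unfolding TR_trunc TM_def using i1 i2 i3 by simp
    have "ennreal (cmod (TR \<epsilon> g x - (TM (Mk k) g z - TM (Mk k) g1 z)))
      \<le> (\<integral>\<^sup>+y. ennreal (cmod (trunc \<epsilon> x y * g y - (KM (Mk k) (vsub n z y) * g y - KM (Mk k) (vsub n z y) * g1 y))) \<partial>Rn n)"
      unfolding diff by (rule integral_norm_bound_ennreal) (use i1 i2 i3 in auto)
    also have "\<dots> \<le> (\<integral>\<^sup>+y. ennreal t * (ennreal (cmod (K (vsub n z y) - K (vsub n x y))) * indicator {\<epsilon>..} (vnorm n (vsub n x y)))
       + ennreal (cmod ((K (vsub n z y) - KM (Mk k) (vsub n z y)) * ?g2 y)) \<partial>Rn n)"
    proof (rule nn_integral_mono)
      fix y
      show "ennreal (cmod (trunc \<epsilon> x y * g y - (KM (Mk k) (vsub n z y) * g y - KM (Mk k) (vsub n z y) * g1 y)))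
        \<le> ennreal t * (ennreal (cmod (K (vsub n z y) - K (vsub n x y))) * indicator {\<epsilon>..} (vnorm n (vsub n x y)))
          + ennreal (cmod ((K (vsub n z y) - KM (Mk k) (vsub n z y)) * ?g2 y))"
      proof (cases "\<epsilon> \<le> vnorm n (vsub n x y)")
        case True
        have "trunc \<epsilon> x y * g y - (KM (Mk k) (vsub n z y) * g y - KM (Mk k) (vsub n z y) * g1 y)
          = (K (vsub n z y) - KM (Mk k) (vsub n z y)) * g y - (K (vsub n z y) - K (vsub n x y)) * g y"
          using True by (simp add: trunc_def g1_def algebra_simps)
        then have "cmod (trunc \<epsilon> x y * g y - (KM (Mk k) (vsub n z y) * g y - KM (Mk k) (vsub n z y) * g1 y))
          \<le> cmod ((K (vsub n z y) - KM (Mk k) (vsub n z y)) * g y) + cmod ((K (vsub n z y) - K (vsub n x y)) * g y)"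
          by (simp only: norm_triangle_ineq4)
        also have "cmod ((K (vsub n z y) - K (vsub n x y)) * g y) \<le> t * cmod (K (vsub n z y) - K (vsub n x y))"
          using g(2)[of y] by (simp add: norm_mult mult.commute[of t] mult_left_mono)
        finally have "ennreal (cmod (trunc \<epsilon> x y * g y - (KM (Mk k) (vsub n z y) * g y - KM (Mk k) (vsub n z y) * g1 y)))
          \<le> ennreal (t * cmod (K (vsub n z y) - K (vsub n x y)) + cmod ((K (vsub n z y) - KM (Mk k) (vsub n z y)) * g y))"
          by (simp add: ennreal_leI add.commute)
        also have "\<dots> = ennreal t * ennreal (cmod (K (vsub n z y) - K (vsub n x y))) + ennreal (cmod ((K (vsub n z y) - KM (Mk k) (vsub n z y)) * g y))"
          using t by (simp add: ennreal_plus ennreal_mult)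
        finally show ?thesis using True by simp
      qed (simp add: trunc_def g1_def)
    qed
    also have "\<dots> = ennreal t * (\<integral>\<^sup>+y. ennreal (cmod (K (vsub n z y) - K (vsub n x y))) * indicator {\<epsilon>..} (vnorm n (vsub n x y)) \<partial>Rn n) + err k z"
      unfolding err_def by (subst nn_integral_add) (auto simp: nn_integral_cmult)
    also have "(\<integral>\<^sup>+y. ennreal (cmod (K (vsub n z y) - K (vsub n x y))) * indicator {\<epsilon>..} (vnorm n (vsub n x y)) \<partial>Rn n) \<le> ennreal (HC * W)"
    proof -
      let ?H = "\<lambda>w. ennreal (cmod (K (vsub n w (vsub n x z)) - K w)) * indicator {\<epsilon>..} (vnorm n w)"
      have "(\<integral>\<^sup>+y. ennreal (cmod (K (vsub n z y) - K (vsub n x y))) * indicator {\<epsilon>..} (vnorm n (vsub n x y)) \<partial>Rn n) = (\<integral>\<^sup>+y. ?H (vsub n x y) \<partial>Rn n)"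
      proof (rule nn_integral_cong)
        fix y
        have "vsub n (vsub n x y) (vsub n x z) = vsub n z y" by (auto simp: vsub_def)
        then show "ennreal (cmod (K (vsub n z y) - K (vsub n x y))) * indicator {\<epsilon>..} (vnorm n (vsub n x y)) = ?H (vsub n x y)" by simp
      qed
      also have "\<dots> = (\<integral>\<^sup>+w. ?H w \<partial>Rn n)" by (rule nn_integral_vsub_left) measurable
      also have "\<dots> \<le> ennreal (HC * W)" by (rule hormander) (use e Qd[OF z(1)] in auto)
      finally show ?thesis .
    qed
    finally have "ennreal (cmod (TR \<epsilon> g x - (TM (Mk k) g z - TM (Mk k) g1 z))) \<le> ennreal t * ennreal (HC * W) + ennreal t"
      using z1(3) by (meson add_mono mult_left_mono order.trans order_refl zero_le)
    also have "\<dots> = ennreal ((HC * W + 1) * t)"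
      using t HC_pos W_nonneg by (simp add: ennreal_mult[symmetric] ennreal_plus[symmetric] algebra_simps del: ennreal_plus)
    finally have d: "cmod (TR \<epsilon> g x - (TM (Mk k) g z - TM (Mk k) g1 z)) \<le> (HC * W + 1) * t"
      using t HC_pos W_nonneg by (subst (asm) ennreal_le_iff) auto
    have "cmod (TR \<epsilon> g x) \<le> cmod (TM (Mk k) g z - TM (Mk k) g1 z) + cmod (TR \<epsilon> g x - (TM (Mk k) g z - TM (Mk k) g1 z))"
      by (metis norm_triangle_sub)
    also have "\<dots> \<le> (4 * s + 4 * s) + (HC * W + 1) * t"
      using norm_triangle_ineq4[of "TM (Mk k) g z" "TM (Mk k) g1 z"] z1 d by linarith
    also have "\<dots> = (8 * c + HC * W + 1) * t" by (simp add: s_def algebra_simps)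
    finally show ?thesis .
  qed
  have "AE x in Rn n. x \<notin> E \<longrightarrow> (\<forall>\<^sub>F \<epsilon> in at_right 0. cmod (TR \<epsilon> g x) \<le> (8 * c + HC * W + 1) * t)"
    using int_ae AE_space
  proof eventually_elim
    case (elim x)
    have pos: "0 < 2 * real n ^ 2 * L" using n1 L by simp
    show ?case
    proof
      assume xE: "x \<notin> E"
      show "\<forall>\<^sub>F \<epsilon> in at_right 0. cmod (TR \<epsilon> g x) \<le> (8 * c + HC * W + 1) * t"
        using eventually_at_right_real[OF pos] by eventually_elim (use main[OF elim(2) xE elim(1)] in auto)
    qed
  qed
  with Em Ee show ?thesis by (auto simp: G_def)
qed

text \<open>Only small \<epsilon> are controlled, which is what governs the oscillation at 0. The
  good part is treated by \<open>cotlar_bounded\<close> at height 2^n t; its norm is at most 2 * 2^n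
  times that of h, so the powers of 2 cancel in the measure estimate.\<close>

lemma maximal_weak:
  assumes D: "dirac_weak \<sigma>"
  shows "\<exists>A>0. \<forall>h t. integrable (Rn n) h \<longrightarrow> t > 0 \<longrightarrow> (\<exists>E\<in>sets (Rn n). emeasure (Rn n) E \<le> ennreal (A * (\<integral>y. cmod (h y) \<partial>Rn n) / t) \<and>
    (AE x in Rn n. x \<notin> E \<longrightarrow> (\<forall>\<^sub>F \<epsilon> in at_right 0. cmod (TR \<epsilon> h x) \<le> A * t)))"
proof -
  have \<sigma>: "\<sigma> \<ge> 0" using D by (simp add: dirac_weak_def)
  define c where "c = 440 * W + 12 * \<sigma> * (8 * real n ^ 2) ^ n + 1"
  have c: "c > 0" using \<sigma> W_nonneg by (simp add: c_def add_nonneg_pos)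
  define a where "a = (8 * c + HC * W + 1) * 2 ^ n"
  have a: "a > 0" using c HC_pos W_nonneg by (simp add: a_def add_pos_nonneg)
  define A where "A = cz_const + 24 * \<sigma> + a"
  have A: "A > 0" using cz_const_pos \<sigma> a by (simp add: A_def add_pos_nonneg)
  have "\<exists>E\<in>sets (Rn n). emeasure (Rn n) E \<le> ennreal (A * (\<integral>y. cmod (h y) \<partial>Rn n) / t) \<and>
    (AE x in Rn n. x \<notin> E \<longrightarrow> (\<forall>\<^sub>F \<epsilon> in at_right 0. cmod (TR \<epsilon> h x) \<le> A * t))"
    if h: "integrable (Rn n) h" and t: "t > 0" for h t
  proof -
    define m where "m = (\<integral>y. cmod (h y) \<partial>Rn n)"
    have m0: "m \<ge> 0" by (simp add: m_def)
    obtain g E1 where g: "integrable (Rn n) g" "\<And>y. cmod (g y) \<le> 2 ^ n * t" "(\<integral>y. cmod (g y) \<partial>Rn n) \<le> (2 ^ n + 1) * m"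
      and E1: "E1 \<in> sets (Rn n)" "emeasure (Rn n) E1 \<le> ennreal (cz_const * m / t)"
      "AE x in Rn n. x \<notin> E1 \<longrightarrow> (\<forall>\<epsilon>>0. cmod (TR \<epsilon> (\<lambda>y. h y - g y) x) \<le> cz_const * t)"
      using cz_decomposition[OF h t] unfolding m_def by blast
    have t2: "2 ^ n * t > 0" using t by simp
    obtain E2 where E2: "E2 \<in> sets (Rn n)" "emeasure (Rn n) E2 \<le> ennreal (12 * \<sigma> * (\<integral>y. cmod (g y) \<partial>Rn n) / (2 ^ n * t))"
      "AE x in Rn n. x \<notin> E2 \<longrightarrow> (\<forall>\<^sub>F \<epsilon> in at_right 0. cmod (TR \<epsilon> g x) \<le> (8 * c + HC * W + 1) * (2 ^ n * t))"
      using cotlar_bounded[OF D g(1,2) t2] unfolding c_def by blast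
    have "emeasure (Rn n) E2 \<le> ennreal (24 * \<sigma> * m / t)"
    proof (rule order.trans[OF E2(2)], rule ennreal_leI)
      have "(2 ^ n + 1) * m \<le> (2 * 2 ^ n) * m" using m0 by (intro mult_right_mono) auto
      with g(3) have "(\<integral>y. cmod (g y) \<partial>Rn n) \<le> 2 * 2 ^ n * m" by linarith
      then have "12 * \<sigma> * (\<integral>y. cmod (g y) \<partial>Rn n) \<le> 12 * \<sigma> * (2 * 2 ^ n * m)" using \<sigma> by (intro mult_left_mono) auto
      then have "12 * \<sigma> * (\<integral>y. cmod (g y) \<partial>Rn n) / (2 ^ n * t) \<le> 12 * \<sigma> * (2 * 2 ^ n * m) / (2 ^ n * t)"
        using t2 by (intro divide_right_mono) auto
      also have "\<dots> = 24 * \<sigma> * m / t" by simp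
      finally show "12 * \<sigma> * (\<integral>y. cmod (g y) \<partial>Rn n) / (2 ^ n * t) \<le> 24 * \<sigma> * m / t" .
    qed
    then have "emeasure (Rn n) (E1 \<union> E2) \<le> ennreal (cz_const * m / t) + ennreal (24 * \<sigma> * m / t)"
      using order.trans[OF emeasure_subadditive[OF E1(1) E2(1)] add_mono[OF E1(2)]] by blast
    also have "\<dots> = ennreal (cz_const * m / t + 24 * \<sigma> * m / t)"
      using cz_const_pos \<sigma> m0 t by (intro ennreal_plus[symmetric]) auto
    also have "\<dots> \<le> ennreal (A * m / t)"
    proof (rule ennreal_leI)
      have "cz_const * m / t + 24 * \<sigma> * m / t = (cz_const + 24 * \<sigma>) * (m / t)"
        by (simp only: distrib_right times_divide_eq_right add_divide_distrib)
      also have "\<dots> \<le> A * (m / t)" using a m0 t by (intro mult_right_mono) (auto simp: A_def)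
      finally show "cz_const * m / t + 24 * \<sigma> * m / t \<le> A * m / t" by simp
    qed
    finally have le: "emeasure (Rn n) (E1 \<union> E2) \<le> ennreal (A * m / t)" .
    have "AE x in Rn n. x \<notin> E1 \<union> E2 \<longrightarrow> (\<forall>\<^sub>F \<epsilon> in at_right 0. cmod (TR \<epsilon> h x) \<le> A * t)"
      using E1(3) E2(3) AE_integrable_trunc[OF h] AE_integrable_trunc[OF g(1)]
    proof eventually_elim
      case (elim x)
      show ?case
      proof
        assume nE: "x \<notin> E1 \<union> E2"
        then have "\<forall>\<^sub>F \<epsilon> in at_right 0. cmod (TR \<epsilon> g x) \<le> (8 * c + HC * W + 1) * (2 ^ n * t)" using elim(2) by simp
        then show "\<forall>\<^sub>F \<epsilon> in at_right 0. cmod (TR \<epsilon> h x) \<le> A * t"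
          using eventually_at_right_less[of "0::real"]
        proof eventually_elim
          case (elim \<epsilon>)
          have i: "integrable (Rn n) (\<lambda>y. trunc \<epsilon> x y * h y)" "integrable (Rn n) (\<lambda>y. trunc \<epsilon> x y * g y)"
            using elim(2) \<open>\<forall>\<epsilon>>0. integrable (Rn n) (\<lambda>y. trunc \<epsilon> x y * h y)\<close> \<open>\<forall>\<epsilon>>0. integrable (Rn n) (\<lambda>y. trunc \<epsilon> x y * g y)\<close> by auto
          have "TR \<epsilon> h x = TR \<epsilon> (\<lambda>y. h y - g y) x + TR \<epsilon> g x"
            unfolding TR_trunc using i by (simp add: right_diff_distrib)
          then have "cmod (TR \<epsilon> h x) \<le> cmod (TR \<epsilon> (\<lambda>y. h y - g y) x) + cmod (TR \<epsilon> g x)" by (simp only: norm_triangle_ineq)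
          also have "\<dots> \<le> cz_const * t + (8 * c + HC * W + 1) * (2 ^ n * t)"
            using nE elim \<open>x \<notin> E1 \<longrightarrow> (\<forall>\<epsilon>>0. cmod (TR \<epsilon> (\<lambda>y. h y - g y) x) \<le> cz_const * t)\<close> by (intro add_mono) auto
          also have "\<dots> = (cz_const + a) * t" by (simp add: a_def algebra_simps)
          also have "\<dots> \<le> A * t" using \<sigma> t by (intro mult_right_mono) (auto simp: A_def)
          finally show ?case .
        qed
      qed
    qed
    with le E1(1) E2(1) show ?thesis unfolding m_def by blast
  qed
  with A show ?thesis by blast
qed

end

subsection \<open>Principal values of integrable functions\<close>

text \<open>Intersecting the exceptional sets for e = 1/(k+1) leaves a null set.\<close>

lemma AE_small_exception:
  assumes "\<And>e. e > 0 \<Longrightarrow> \<exists>E\<in>sets M. emeasure M E \<le> ennreal e \<and> (AE x in M. x \<notin> E \<longrightarrow> P x)"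
  shows "AE x in M. P x"
proof -
  have "\<forall>k::nat. \<exists>E. E \<in> sets M \<and> emeasure M E \<le> ennreal (1 / Suc k) \<and> (AE x in M. x \<notin> E \<longrightarrow> P x)"
    using assms by (metis of_nat_0_less_iff zero_less_Suc zero_less_divide_1_iff)
  then obtain E where E: "\<And>k::nat. E k \<in> sets M" "\<And>k. emeasure M (E k) \<le> ennreal (1 / Suc k)" "\<And>k. AE x in M. x \<notin> E k \<longrightarrow> P x"
    by metis
  have I: "(\<Inter>k. E k) \<in> sets M" using E(1) by (intro sets.countable_INT) auto
  have le: "emeasure M (\<Inter>k. E k) \<le> ennreal (1 / Suc k)" for k
    by (rule order.trans[OF emeasure_mono E(2)[of k]]) (use E(1) in auto)
  have "emeasure M (\<Inter>k. E k) \<le> 0"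
  proof (rule ennreal_le_epsilon)
    fix e :: real assume e: "0 < e"
    obtain k :: nat where k: "1 / Suc k < e" using nat_approx_posE[OF e] by auto
    show "emeasure M (\<Inter>k. E k) \<le> 0 + ennreal e"
      using order.trans[OF le[of k] ennreal_leI[OF less_imp_le[OF k]]] by simp
  qed
  with I have "(\<Inter>k. E k) \<in> null_sets M" by (simp add: null_sets_def)
  from AE_not_in[OF this] have "AE x in M. x \<notin> (\<Inter>k. E k)" .
  moreover have "AE x in M. \<forall>k. x \<notin> E k \<longrightarrow> P x" by (subst AE_all_countable) (use E(3) in blast)
  ultimately show ?thesis by eventually_elim auto
qed

lemma Cauchy_at_right_convergent:
  fixes F :: "real \<Rightarrow> 'b::complete_space"
  assumes "\<And>e. e > 0 \<Longrightarrow> \<exists>d>0. \<forall>a b. 0 < a \<longrightarrow> a < d \<longrightarrow> 0 < b \<longrightarrow> b < d \<longrightarrow> dist (F a) (F b) \<le> e"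
  shows "\<exists>l. (F \<longlongrightarrow> l) (at_right 0)"
proof -
  define u where "u k = F (1 / Suc k)" for k :: nat
  have small: "\<exists>N. \<forall>k\<ge>N. 1 / Suc k < d" if d: "d > 0" for d :: real
  proof -
    obtain N :: nat where N: "1 / Suc N < d" using nat_approx_posE[OF d] by auto
    have "1 / real (Suc k) \<le> 1 / Suc N" if "k \<ge> N" for k using that by (intro divide_left_mono) auto
    with N show ?thesis by (meson le_less_trans)
  qed
  have "Cauchy u"
  proof (rule metric_CauchyI)
    fix e :: real assume e: "e > 0"
    obtain d where d: "d > 0" "\<And>a b. 0 < a \<Longrightarrow> a < d \<Longrightarrow> 0 < b \<Longrightarrow> b < d \<Longrightarrow> dist (F a) (F b) \<le> e / 2"
      using assms[of "e / 2"] e by auto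
    obtain N where N: "\<And>k. k \<ge> N \<Longrightarrow> 1 / Suc k < d" using small[OF d(1)] by blast
    have "dist (u i) (u j) < e" if "i \<ge> N" "j \<ge> N" for i j
    proof -
      have "dist (u i) (u j) \<le> e / 2" unfolding u_def by (intro d(2) N that) auto
      with e show ?thesis by simp
    qed
    then show "\<exists>N. \<forall>i\<ge>N. \<forall>j\<ge>N. dist (u i) (u j) < e" by blast
  qed
  then obtain l where l: "u \<longlonglongrightarrow> l" using Cauchy_convergent convergent_def by blast
  have "(F \<longlongrightarrow> l) (at_right 0)"
  proof (rule tendstoI)
    fix e :: real assume e: "e > 0"
    obtain d where d: "d > 0" "\<And>a b. 0 < a \<Longrightarrow> a < d \<Longrightarrow> 0 < b \<Longrightarrow> b < d \<Longrightarrow> dist (F a) (F b) \<le> e / 2"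
      using assms[of "e / 2"] e by auto
    obtain N where N: "\<And>k. k \<ge> N \<Longrightarrow> 1 / Suc k < d" using small[OF d(1)] by blast
    obtain N' where N': "\<And>k. k \<ge> N' \<Longrightarrow> dist (u k) l < e / 2" using metric_LIMSEQ_D[OF l, of "e / 2"] e by auto
    let ?k = "max N N'"
    show "\<forall>\<^sub>F x in at_right 0. dist (F x) l < e"
      using eventually_at_right_real[OF d(1)]
    proof eventually_elim
      case (elim x)
      have "dist (F x) (u ?k) \<le> e / 2" unfolding u_def by (rule d(2)) (use elim N[of ?k] in auto)
      with N'[of ?k] show ?case using dist_triangle[of "F x" l "u ?k"] by simp
    qed
  qed
  then show ?thesis ..
qed

context singular_kernel begin

lemma TR_diff:
  assumes "integrable (Rn n) (\<lambda>y. trunc \<epsilon> x y * f y)" "integrable (Rn n) (\<lambda>y. trunc \<epsilon> x y * \<phi> y)"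
  shows "TR \<epsilon> f x = TR \<epsilon> \<phi> x + TR \<epsilon> (\<lambda>y. f y - \<phi> y) x"
  unfolding TR_trunc using assms by (simp add: right_diff_distrib)

lemma AE_TR_nice:
  assumes "nice n \<phi>"
  shows "AE x in Rn n. (\<exists>r>0. \<forall>\<epsilon>. 0 < \<epsilon> \<longrightarrow> \<epsilon> \<le> r \<longrightarrow> TR \<epsilon> \<phi> x = sio n \<Omega> \<phi> x)"
proof -
  have "AE x in Rn n. locconst n \<phi> x" using assms by (simp add: nice_def)
  then show ?thesis using AE_space
  proof eventually_elim
    case (elim x)
    obtain B r R where g: "good_at \<phi> x B r R" by (rule good_atE[OF assms elim])
    then have "r > 0" by (simp add: good_at_def)
    moreover have "TR \<epsilon> \<phi> x = sio n \<Omega> \<phi> x" if "0 < \<epsilon>" "\<epsilon> \<le> r" for \<epsilon>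
      using good_at_TR[OF g that] good_at_tendsto(2)[OF g] by simp
    ultimately show ?case by blast
  qed
qed

text \<open>For \<phi> of class \<open>nice\<close> the truncations are eventually constant, so the
  oscillation of those of f is at most twice the bound A t for f - \<phi>. With t = e / (2 A) this
  is e, off a set whose measure is proportional to the L^1 distance of f and \<phi>.\<close>

lemma pv_exists:
  assumes D: "dirac_weak \<sigma>" and f: "integrable (Rn n) f"
  shows "AE x in Rn n. ((\<lambda>\<epsilon>. TR \<epsilon> f x) \<longlongrightarrow> sio n \<Omega> f x) (at_right 0)"
proof -
  obtain A where A: "A > 0" "\<And>h t. integrable (Rn n) h \<Longrightarrow> t > 0 \<Longrightarrow> \<exists>E\<in>sets (Rn n). emeasure (Rn n) E \<le> ennreal (A * (\<integral>y. cmod (h y) \<partial>Rn n) / t) \<and>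
    (AE x in Rn n. x \<notin> E \<longrightarrow> (\<forall>\<^sub>F \<epsilon> in at_right 0. cmod (TR \<epsilon> h x) \<le> A * t))"
    using maximal_weak[OF D] by blast
  let ?P = "\<lambda>e x. \<exists>d>0. \<forall>a b. 0 < a \<longrightarrow> a < d \<longrightarrow> 0 < b \<longrightarrow> b < d \<longrightarrow> dist (TR a f x) (TR b f x) \<le> e"
  have osc: "AE x in Rn n. ?P e x" if e: "e > 0" for e
  proof (rule AE_small_exception)
    fix \<eta> :: real assume \<eta>: "\<eta> > 0"
    define t where "t = e / (2 * A)"
    have t: "t > 0" using e A(1) by (simp add: t_def)
    have \<delta>: "\<eta> * t / A > 0" using \<eta> t A(1) by simp
    obtain \<phi> :: "_ \<Rightarrow> complex" where \<phi>: "nice n \<phi>" "(\<integral>x. cmod (f x - \<phi> x) \<partial>Rn n) < \<eta> * t / A"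
      by (rule nice_dense[OF f \<delta>])
    note pi = nice_integrable[OF \<phi>(1)]
    have hi: "integrable (Rn n) (\<lambda>y. f y - \<phi> y)" using f pi by simp
    obtain E where E: "E \<in> sets (Rn n)" "emeasure (Rn n) E \<le> ennreal (A * (\<integral>y. cmod (f y - \<phi> y) \<partial>Rn n) / t)"
      "AE x in Rn n. x \<notin> E \<longrightarrow> (\<forall>\<^sub>F \<epsilon> in at_right 0. cmod (TR \<epsilon> (\<lambda>y. f y - \<phi> y) x) \<le> A * t)"
      using A(2)[OF hi t] by blast
    have "A * (\<integral>y. cmod (f y - \<phi> y) \<partial>Rn n) / t \<le> \<eta>"
      using \<phi>(2) A(1) t by (simp add: field_simps less_imp_le)
    then have Ee: "emeasure (Rn n) E \<le> ennreal \<eta>" using E(2) by (meson ennreal_leI order.trans)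
    have "AE x in Rn n. x \<notin> E \<longrightarrow> ?P e x"
      using E(3) AE_TR_nice[OF \<phi>(1)] AE_integrable_trunc[OF f] AE_integrable_trunc[OF pi]
    proof eventually_elim
      case (elim x)
      show ?case
      proof
        assume "x \<notin> E"
        then have "\<forall>\<^sub>F \<epsilon> in at_right 0. cmod (TR \<epsilon> (\<lambda>y. f y - \<phi> y) x) \<le> A * t" using elim(1) by simp
        then obtain d where d: "d > 0" "\<And>\<epsilon>. 0 < \<epsilon> \<Longrightarrow> \<epsilon> < d \<Longrightarrow> cmod (TR \<epsilon> (\<lambda>y. f y - \<phi> y) x) \<le> A * t"
          by (auto simp: eventually_at_right_field)
        obtain r where r: "r > 0" "\<And>\<epsilon>. 0 < \<epsilon> \<Longrightarrow> \<epsilon> \<le> r \<Longrightarrow> TR \<epsilon> \<phi> x = sio n \<Omega> \<phi> x" using elim(2) by blast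
        have At: "A * t = e / 2" using A(1) by (simp add: t_def)
        have "dist (TR \<epsilon> f x) (sio n \<Omega> \<phi> x) \<le> e / 2" if "0 < \<epsilon>" "\<epsilon> < min d r" for \<epsilon>
        proof -
          have "TR \<epsilon> f x = sio n \<Omega> \<phi> x + TR \<epsilon> (\<lambda>y. f y - \<phi> y) x"
            using TR_diff[of \<epsilon> x f \<phi>] elim(3,4) r(2)[of \<epsilon>] that by simp
          then show ?thesis using d(2)[of \<epsilon>] that At by (simp add: dist_norm)
        qed note * = this
        have "dist (TR a f x) (TR b f x) \<le> e" if "0 < a" "a < min d r" "0 < b" "b < min d r" for a b
          using *[OF that(1,2)] *[OF that(3,4)] dist_triangle2[of "TR a f x" "TR b f x" "sio n \<Omega> \<phi> x"] by simp
        then show "?P e x" using d(1) r(1) by (intro exI[of _ "min d r"]) auto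
      qed
    qed
    with E(1) Ee show "\<exists>E\<in>sets (Rn n). emeasure (Rn n) E \<le> ennreal \<eta> \<and> (AE x in Rn n. x \<notin> E \<longrightarrow> ?P e x)" by blast
  qed
  have "AE x in Rn n. \<forall>k::nat. ?P (1 / Suc k) x"
    by (subst AE_all_countable) (use osc in simp)
  then show ?thesis
  proof eventually_elim
    case (elim x)
    have "?P e x" if e: "e > 0" for e
    proof -
      obtain k :: nat where k: "1 / Suc k < e" using nat_approx_posE[OF e] by auto
      obtain d where d: "d > 0" "\<And>a b. 0 < a \<Longrightarrow> a < d \<Longrightarrow> 0 < b \<Longrightarrow> b < d \<Longrightarrow> dist (TR a f x) (TR b f x) \<le> 1 / Suc k"
        using elim by blast
      show ?thesis
      proof (intro exI[of _ d] conjI allI impI)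
        fix a b assume "0 < a" "a < d" "0 < b" "b < d"
        from d(2)[OF this] k show "dist (TR a f x) (TR b f x) \<le> e" by linarith
      qed (rule d)
    qed
    then obtain l where l: "((\<lambda>\<epsilon>. TR \<epsilon> f x) \<longlongrightarrow> l) (at_right 0)"
      using Cauchy_at_right_convergent[of "\<lambda>\<epsilon>. TR \<epsilon> f x"] by blast
    with sio_eq[OF l] show ?case by simp
  qed
qed

text \<open>Settles the case of norm zero, in which no configuration can be rescaled to a total mass
  of 16 times the norm.\<close>

lemma sio_eq_0:
  assumes f: "integrable (Rn n) f" and "(\<integral>y. cmod (f y) \<partial>Rn n) = 0"
  shows "sio n \<Omega> f x = 0"
proof -
  have "AE y in Rn n. cmod (f y) = 0"
    using integral_nonneg_eq_0_iff_AE[OF integrable_norm[OF f]] assms(2) by simp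
  then have z: "AE y in Rn n. f y = 0" by simp
  have "TR \<epsilon> f x = 0" for \<epsilon>
    unfolding TR_def by (rule integral_eq_zero_AE) (use z in \<open>auto elim!: eventually_mono\<close>)
  then have "((\<lambda>\<epsilon>. TR \<epsilon> f x) \<longlongrightarrow> 0) (at_right 0)" by simp
  then show ?thesis by (rule sio_eq)
qed

text \<open>The level is split as 9/10 for \<phi> and 1/10 for f - \<phi>. The maximal constant A
  depends on n, but it multiplies the norm of f - \<phi>, which is chosen after A.\<close>

lemma sio_weak:
  assumes D: "dirac_weak \<sigma>" and f: "integrable (Rn n) f" and lam: "lam > 0"
  shows "outer_leb n {x \<in> space (Rn n). cmod (sio n \<Omega> f x) > lam} \<le> ennreal ((32 * \<sigma> + 7400 * W + 4) * (\<integral>y. cmod (f y) \<partial>Rn n) / lam)"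
proof -
  have \<sigma>: "\<sigma> \<ge> 0" using D by (simp add: dirac_weak_def)
  define F where "F = (\<integral>y. cmod (f y) \<partial>Rn n)"
  have F0: "F \<ge> 0" by (simp add: F_def)
  show ?thesis
  proof (cases "F = 0")
    case True
    then have "{x \<in> space (Rn n). cmod (sio n \<Omega> f x) > lam} = {}" using sio_eq_0[OF f] lam by (simp add: F_def)
    then have "outer_leb n {x \<in> space (Rn n). cmod (sio n \<Omega> f x) > lam} = 0"
      by (simp only: outer_leb_eq[OF sets.empty_sets] emeasure_empty)
    then show ?thesis by simp
  next
    case False
    then have F: "F > 0" using F0 by simp
    obtain A where A: "A > 0" "\<And>h t. integrable (Rn n) h \<Longrightarrow> t > 0 \<Longrightarrow> \<exists>E\<in>sets (Rn n). emeasure (Rn n) E \<le> ennreal (A * (\<integral>y. cmod (h y) \<partial>Rn n) / t) \<and>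
      (AE x in Rn n. x \<notin> E \<longrightarrow> (\<forall>\<^sub>F \<epsilon> in at_right 0. cmod (TR \<epsilon> h x) \<le> A * t))"
      using maximal_weak[OF D] by blast
    define p where "p = 27 * \<sigma> + 6600 * W + 3"
    have p: "p > 0" using \<sigma> W_nonneg by (simp add: p_def add_nonneg_pos)
    define t where "t = lam / (10 * A)"
    have t: "t > 0" using lam A by (simp add: t_def)
    \<comment> \<open>Collects the coefficients of \<delta> in the final estimate, up to the factor
      1/lam: 10/9 p from the norm of \<phi>, and 10 A^2 from A / t. The choice of \<delta> makes q
      \<delta> = F / 2.\<close>
    define q where "q = p * 10 / 9 + 10 * A * A"
    have q: "q > 0" using p A by (simp add: q_def add_pos_pos)
    define \<delta> where "\<delta> = F / (2 * q)"
    have \<delta>: "\<delta> > 0" using F q by (simp add: \<delta>_def)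
    obtain \<phi> :: "_ \<Rightarrow> complex" where \<phi>: "nice n \<phi>" "(\<integral>x. cmod (f x - \<phi> x) \<partial>Rn n) < \<delta>"
      by (rule nice_dense[OF f \<delta>])
    note pi = nice_integrable[OF \<phi>(1)]
    have hi: "integrable (Rn n) (\<lambda>y. f y - \<phi> y)" using f pi by simp
    have \<phi>n: "(\<integral>y. cmod (\<phi> y) \<partial>Rn n) \<le> F + \<delta>"
    proof -
      have "(\<integral>y. cmod (\<phi> y) \<partial>Rn n) \<le> (\<integral>y. cmod (f y) + cmod (f y - \<phi> y) \<partial>Rn n)"
      proof (rule integral_mono)
        show "cmod (\<phi> y) \<le> cmod (f y) + cmod (f y - \<phi> y)" for y
          using norm_triangle_ineq4[of "f y" "f y - \<phi> y"] by simp
      qed (use f pi in auto)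
      also have "\<dots> = F + (\<integral>y. cmod (f y - \<phi> y) \<partial>Rn n)" using f hi by (simp add: F_def)
      finally show ?thesis using \<phi>(2) by simp
    qed
    obtain E1 where E1: "E1 \<in> sets (Rn n)" "emeasure (Rn n) E1 \<le> ennreal (A * (\<integral>y. cmod (f y - \<phi> y) \<partial>Rn n) / t)"
      "AE x in Rn n. x \<notin> E1 \<longrightarrow> (\<forall>\<^sub>F \<epsilon> in at_right 0. cmod (TR \<epsilon> (\<lambda>y. f y - \<phi> y) x) \<le> A * t)"
      using A(2)[OF hi t] by blast
    have lam9: "9 / 10 * lam > 0" using lam by simp
    obtain E2 where E2: "E2 \<in> sets (Rn n)" "emeasure (Rn n) E2 \<le> ennreal (p * (\<integral>y. cmod (\<phi> y) \<partial>Rn n) / (9 / 10 * lam))"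
      "AE x in Rn n. x \<notin> E2 \<longrightarrow> cmod (sio n \<Omega> \<phi> x) \<le> 9 / 10 * lam"
      using sio_weak_nice[OF D \<phi>(1) lam9] unfolding p_def by blast
    have "AE x in Rn n. x \<notin> E1 \<union> E2 \<longrightarrow> cmod (sio n \<Omega> f x) \<le> lam"
      using E1(3) E2(3) AE_TR_nice[OF \<phi>(1)] AE_integrable_trunc[OF f] AE_integrable_trunc[OF pi] pv_exists[OF D f]
    proof eventually_elim
      case (elim x)
      show ?case
      proof
        assume nE: "x \<notin> E1 \<union> E2"
        then have ev: "\<forall>\<^sub>F \<epsilon> in at_right 0. cmod (TR \<epsilon> (\<lambda>y. f y - \<phi> y) x) \<le> A * t" using elim(1) by simp
        obtain r where r: "r > 0" "\<And>\<epsilon>. 0 < \<epsilon> \<Longrightarrow> \<epsilon> \<le> r \<Longrightarrow> TR \<epsilon> \<phi> x = sio n \<Omega> \<phi> x" using elim(3) by blast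
        have At: "A * t = lam / 10" using A(1) by (simp add: t_def)
        have "\<forall>\<^sub>F \<epsilon> in at_right 0. cmod (TR \<epsilon> f x) \<le> lam"
          using ev eventually_at_right_real[OF r(1)]
        proof eventually_elim
          case (elim \<epsilon>)
          have "TR \<epsilon> f x = sio n \<Omega> \<phi> x + TR \<epsilon> (\<lambda>y. f y - \<phi> y) x"
            using TR_diff[of \<epsilon> x f \<phi>] \<open>\<forall>\<epsilon>>0. integrable (Rn n) (\<lambda>y. trunc \<epsilon> x y * f y)\<close> \<open>\<forall>\<epsilon>>0. integrable (Rn n) (\<lambda>y. trunc \<epsilon> x y * \<phi> y)\<close> r(2)[of \<epsilon>] elim(2) by simp
          then have "cmod (TR \<epsilon> f x) \<le> cmod (sio n \<Omega> \<phi> x) + cmod (TR \<epsilon> (\<lambda>y. f y - \<phi> y) x)" by (simp only: norm_triangle_ineq)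
          also have "\<dots> \<le> 9 / 10 * lam + lam / 10"
            using elim(1) nE \<open>x \<notin> E2 \<longrightarrow> cmod (sio n \<Omega> \<phi> x) \<le> 9 / 10 * lam\<close> unfolding At by (intro add_mono) auto
          finally show ?case by simp
        qed
        then show "cmod (sio n \<Omega> f x) \<le> lam"
          by (intro tendsto_upperbound[OF tendsto_norm[OF elim(6)]]) auto
      qed
    qed
    then obtain N where N: "{x \<in> space (Rn n). \<not> (x \<notin> E1 \<union> E2 \<longrightarrow> cmod (sio n \<Omega> f x) \<le> lam)} \<subseteq> N" "emeasure (Rn n) N = 0" "N \<in> sets (Rn n)"
      by (rule AE_E)
    have E12: "E1 \<union> E2 \<in> sets (Rn n)" using E1 E2 by auto
    have "outer_leb n {x \<in> space (Rn n). cmod (sio n \<Omega> f x) > lam} \<le> emeasure (Rn n) ((E1 \<union> E2) \<union> N)"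
      by (rule outer_leb_le) (use N E12 in \<open>auto simp: not_le\<close>)
    also have "\<dots> \<le> emeasure (Rn n) (E1 \<union> E2) + emeasure (Rn n) N" by (rule emeasure_subadditive[OF E12 N(3)])
    also have "\<dots> \<le> ennreal (A * (\<integral>y. cmod (f y - \<phi> y) \<partial>Rn n) / t) + ennreal (p * (\<integral>y. cmod (\<phi> y) \<partial>Rn n) / (9 / 10 * lam))"
      unfolding N(2) using order.trans[OF emeasure_subadditive[OF E1(1) E2(1)] add_mono[OF E1(2) E2(2)]] by simp
    also have "\<dots> = ennreal (A * (\<integral>y. cmod (f y - \<phi> y) \<partial>Rn n) / t + p * (\<integral>y. cmod (\<phi> y) \<partial>Rn n) / (9 / 10 * lam))"
      using A(1) t p lam by (intro ennreal_plus[symmetric]) auto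
    also have "\<dots> \<le> ennreal ((32 * \<sigma> + 7400 * W + 4) * F / lam)"
    proof (rule ennreal_leI)
      have 1: "A * (\<integral>y. cmod (f y - \<phi> y) \<partial>Rn n) / t \<le> A * \<delta> / t"
        using \<phi>(2) A(1) t by (intro divide_right_mono mult_left_mono) auto
      have 2: "p * (\<integral>y. cmod (\<phi> y) \<partial>Rn n) / (9 / 10 * lam) \<le> p * (F + \<delta>) / (9 / 10 * lam)"
        using \<phi>n p lam by (intro divide_right_mono mult_left_mono) auto
      have "A * \<delta> / t + p * (F + \<delta>) / (9 / 10 * lam) = (p * 10 / 9 * F + q * \<delta>) / lam"
        using A(1) lam by (simp add: t_def q_def field_simps)
      also have "q * \<delta> = F / 2" using q by (simp add: \<delta>_def)
      also have "(p * 10 / 9 * F + F / 2) / lam \<le> (32 * \<sigma> + 7400 * W + 4) * F / lam"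
      proof (rule divide_right_mono)
        have "p * 10 / 9 * F + F / 2 = (p * 10 / 9 + 1 / 2) * F" by (simp add: distrib_right)
        also have "\<dots> \<le> (32 * \<sigma> + 7400 * W + 4) * F"
        proof (rule mult_right_mono)
          \<comment> \<open>The constants 32, 7400 and 4 round up 30, 22000/3 and 23/6.\<close>
          have "p * 10 / 9 + 1 / 2 = 30 * \<sigma> + 22000 / 3 * W + 23 / 6" by (simp add: p_def field_simps)
          also have "\<dots> \<le> 32 * \<sigma> + 7400 * W + 4"
            by (intro add_mono mult_right_mono \<sigma> W_nonneg) auto
          finally show "p * 10 / 9 + 1 / 2 \<le> 32 * \<sigma> + 7400 * W + 4" .
        qed (use F in simp)
        finally show "p * 10 / 9 * F + F / 2 \<le> (32 * \<sigma> + 7400 * W + 4) * F" .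
      qed (use lam in simp)
      finally show "A * (\<integral>y. cmod (f y - \<phi> y) \<partial>Rn n) / t + p * (\<integral>y. cmod (\<phi> y) \<partial>Rn n) / (9 / 10 * lam) \<le> (32 * \<sigma> + 7400 * W + 4) * F / lam"
        using 1 2 by linarith
    qed
    finally show ?thesis by (simp add: F_def)
  qed
qed

end

theorem theorem4p1:
  fixes C :: real
  assumes "C > 0"
  shows "\<exists>C4 C5. C4 > 0 \<and> C5 > 0 \<and>
    (\<forall>n::nat. \<forall>\<Omega>. \<forall>f :: (nat \<Rightarrow> real) \<Rightarrow> complex. \<forall>lam::real.
       n \<ge> 1 \<longrightarrow> admissible_Omega C n \<Omega> \<longrightarrow> integrable (Rn n) f \<longrightarrow> lam > 0 \<longrightarrow>
       outer_leb n {x \<in> space (Rn n). cmod (sio n \<Omega> f x) > lam}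
         \<le> ennreal ((C4 + C5 * (\<integral>\<theta>. cmod (\<Omega> \<theta>) \<partial>sphere_measure n)) * (1 / lam)
                     * (\<integral>y. cmod (f y) \<partial>Rn n))
           + 2 * (SUP \<nu> \<in> {\<nu> :: (real \<times> (nat \<Rightarrow> real)) list.
                     (\<forall>(a, c) \<in> set \<nu>. a > 0 \<and> c \<in> space (Rn n)) \<and>
                     (\<Sum>(a, c)\<leftarrow>\<nu>. a) \<le> 16 * (\<integral>y. cmod (f y) \<partial>Rn n)}.
                  outer_leb n {x \<in> space (Rn n). cmod (sio_dirac n \<Omega> \<nu> x) > lam}))"
proof (rule exI[of _ "4::real"], rule exI[of _ "7400::real"], intro conjI allI impI)
  fix n :: nat and \<Omega> :: "(nat \<Rightarrow> real) \<Rightarrow> complex" and f :: "(nat \<Rightarrow> real) \<Rightarrow> complex" and lam :: real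
  assume n: "n \<ge> 1" and adm: "admissible_Omega C n \<Omega>" and f: "integrable (Rn n) f" and lam: "lam > 0"
  interpret singular_kernel n \<Omega> C by standard (use n adm assms in auto)
  define F where "F = (\<integral>y. cmod (f y) \<partial>Rn n)"
  have F0: "F \<ge> 0" by (simp add: F_def)
  let ?S = "SUP \<nu> \<in> {\<nu> :: (real \<times> (nat \<Rightarrow> real)) list.
                     (\<forall>(a, c) \<in> set \<nu>. a > 0 \<and> c \<in> space (Rn n)) \<and> (\<Sum>(a, c)\<leftarrow>\<nu>. a) \<le> 16 * F}.
                  outer_leb n {x \<in> space (Rn n). cmod (sio_dirac n \<Omega> \<nu> x) > lam}"
  let ?L = "outer_leb n {x \<in> space (Rn n). cmod (sio n \<Omega> f x) > lam}"
  have "?L \<le> ennreal ((4 + 7400 * W) * (1 / lam) * F) + 2 * ?S"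
  proof (cases "F = 0")
    case True
    then have "{x \<in> space (Rn n). cmod (sio n \<Omega> f x) > lam} = {}" using sio_eq_0[OF f] lam by (simp add: F_def)
    then have "?L = 0" by (simp only: outer_leb_eq[OF sets.empty_sets] emeasure_empty)
    then show ?thesis by simp
  next
    case False
    then have F: "F > 0" using F0 by simp
    show ?thesis
    proof (cases ?S)
      \<comment> \<open>A finite supremum r yields the weak type constant \<sigma> = r lam / (16 F),
        and 32 \<sigma> F / lam = 2 r is the term with the supremum. An infinite supremum makes the
        right side infinite.\<close>
      case (real r)
      have m0: "16 * F > 0" using F by simp
      have D: "dirac_weak (r * lam / (16 * F))"
        by (rule dirac_weakI[OF m0 lam real(1)]) (use real(2) in simp)
      have "?L \<le> ennreal ((32 * (r * lam / (16 * F)) + 7400 * W + 4) * F / lam)"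
        using sio_weak[OF D f lam] by (simp add: F_def)
      also have "(32 * (r * lam / (16 * F)) + 7400 * W + 4) * F / lam = (4 + 7400 * W) * (1 / lam) * F + 2 * r"
        using F lam by (simp add: field_simps)
      also have "ennreal \<dots> = ennreal ((4 + 7400 * W) * (1 / lam) * F) + 2 * ennreal r"
        using F lam W_nonneg real(1) by (subst ennreal_plus) (auto simp: ennreal_mult)
      finally show ?thesis using real(2) by simp
    next
      case top
      show ?thesis unfolding top by (simp add: ennreal_mult_top)
    qed
  qed
  then show "?L \<le> ennreal ((4 + 7400 * (\<integral>\<theta>. cmod (\<Omega> \<theta>) \<partial>sphere_measure n)) * (1 / lam) * (\<integral>y. cmod (f y) \<partial>Rn n))
           + 2 * (SUP \<nu> \<in> {\<nu> :: (real \<times> (nat \<Rightarrow> real)) list.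
                     (\<forall>(a, c) \<in> set \<nu>. a > 0 \<and> c \<in> space (Rn n)) \<and>
                     (\<Sum>(a, c)\<leftarrow>\<nu>. a) \<le> 16 * (\<integral>y. cmod (f y) \<partial>Rn n)}.
                  outer_leb n {x \<in> space (Rn n). cmod (sio_dirac n \<Omega> \<nu> x) > lam})"
    unfolding W_def F_def .
qed simp_all

end
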